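(* Let $A$ be a complex affine Poisson algebra. If the Poisson bracket of $A$ is algebraic, then $A$ satisfies the Poisson Dixmier-Moeglin equivalence.
   Context: A complex affine Poisson algebra is a finitely generated commutative $\mathbb{C}$-algebra $A$ with a bilinear map $\{-,-\}:A\times A\to A$ that is both a Lie bracket and a biderivation. An ideal $I$ is a Poisson ideal if $\{I,A\}\subseteq I$. The Poisson core of an ideal $J$ is the largest Poisson ideal contained in $J$. A Poisson primitive ideal is the Poisson core of a maximal ideal of $A$. A Poisson prime ideal is a prime ideal that is also a Poisson ideal; ${\rm P.spec}\,A$ denotes the set of Poisson prime ideals with the subspace topology from ${\rm spec}\,A$ (Zariski topology). The Poisson center of a Poisson algebra $B$ is $Z_P(B)=\{a\in B : \{a,b\}=0\ \forall b\in B\}$. For a Poisson prime ideal $P$, the bracket of $A$ induces one on $A/P$ and extends uniquely to ${\rm Frac}(A/P)$; $P$ is Poisson rational if $Z_P({\rm Frac}(A/P))=\mathbb{C}$. A subset of a topological space is locally closed if it is the intersection of an open and a closed subset; a Poisson prime ideal $P$ is locally closed if $\{P\}$ is locally closed in ${\rm P.spec}\,A$. $A$ satisfies the Poisson Dixmier-Moeglin equivalence if the following three sets of Poisson prime ideals coincide: the locally closed Poisson prime ideals, the Poisson primitive ideals, and the Poisson rational ideals. Let $\mathscr{A}={\rm max}\,A$ be the maximal spectrum. Symplectic leaves: if $\mathscr{A}$ is smooth, they are the leaves of the symplectic foliation of the complex analytic Poisson manifold $\mathscr{A}$, i.e. the leaf of $\mathfrak{m}$ is the set of points that can be reached from $\mathfrak{m}$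 by a finite concatenation of flows of Hamiltonian vector fields. In general (Brown-Gordon), put $\mathscr{A}_0=\mathscr{A}$ (with reduced structure) and let $\mathscr{A}_{i+1}$ be the singular locus of $\mathscr{A}_i$, a closed Poisson subvariety; each $\mathscr{A}_i\setminus\mathscr{A}_{i+1}$ is a smooth complex Poisson manifold, and the symplectic leaves of $\mathscr{A}$ are the symplectic leaves of these manifolds. The Poisson bracket of $A$ is algebraic if each symplectic leaf is a locally closed subvariety of $\mathscr{A}$ (in the Zariski topology). *)

theory Defs
  imports
    "HOL-Analysis.Function_Topology"
    "HOL-Analysis.Derivative"
    "HOL-Library.Extended_Nat"
    "HOL-Algebra.Module"
    "HOL-Algebra.QuotRing"
    "HOL-Algebra.Ideal_Product"
    "HOL-Algebra.Generated_Rings"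
    "HOL-Algebra.Embedded_Algebras"
    "HOL-Algebra.Algebraic_Closure_Type"
begin

section \<open>Complex affine Poisson algebras\<close>

abbreviation complex_field :: "complex ring" where
  "complex_field \<equiv> ring_of_type_algebra"

abbreviation scalar :: "(complex, 'a) module \<Rightarrow> complex \<Rightarrow> 'a" where
  "scalar A c \<equiv> c \<odot>\<^bsub>A\<^esub> \<one>\<^bsub>A\<^esub>"

locale complex_poisson_algebra =
  Module.algebra "complex_field" A for A :: "(complex, 'a) module" +
  fixes br :: "'a \<Rightarrow> 'a \<Rightarrow> 'a"
  assumes br_closed:
      "\<lbrakk>a \<in> carrier A; b \<in> carrier A\<rbrakk> \<Longrightarrow> br a b \<in> carrier A"
    and br_add_left:
      "\<lbrakk>a \<in> carrier A; b \<in> carrier A; c \<in> carrier A\<rbrakk>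
        \<Longrightarrow> br (a \<oplus>\<^bsub>A\<^esub> b) c = br a c \<oplus>\<^bsub>A\<^esub> br b c"
    and br_add_right:
      "\<lbrakk>a \<in> carrier A; b \<in> carrier A; c \<in> carrier A\<rbrakk>
        \<Longrightarrow> br a (b \<oplus>\<^bsub>A\<^esub> c) = br a b \<oplus>\<^bsub>A\<^esub> br a c"
    and br_smult_left:
      "\<lbrakk>a \<in> carrier A; b \<in> carrier A\<rbrakk> \<Longrightarrow> br (k \<odot>\<^bsub>A\<^esub> a) b = k \<odot>\<^bsub>A\<^esub> br a b"
    and br_smult_right:
      "\<lbrakk>a \<in> carrier A; b \<in> carrier A\<rbrakk> \<Longrightarrow> br a (k \<odot>\<^bsub>A\<^esub> b) = k \<odot>\<^bsub>A\<^esub> br a b"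
    and br_alternating:
      "a \<in> carrier A \<Longrightarrow> br a a = \<zero>\<^bsub>A\<^esub>"
    and br_jacobi:
      "\<lbrakk>a \<in> carrier A; b \<in> carrier A; c \<in> carrier A\<rbrakk>
        \<Longrightarrow> br a (br b c) \<oplus>\<^bsub>A\<^esub> br b (br c a) \<oplus>\<^bsub>A\<^esub> br c (br a b) = \<zero>\<^bsub>A\<^esub>"
    and br_derivation_left:
      "\<lbrakk>a \<in> carrier A; b \<in> carrier A; c \<in> carrier A\<rbrakk>
        \<Longrightarrow> br (a \<otimes>\<^bsub>A\<^esub> b) c = a \<otimes>\<^bsub>A\<^esub> br b c \<oplus>\<^bsub>A\<^esub> br a c \<otimes>\<^bsub>A\<^esub> b"
    and br_derivation_right:
      "\<lbrakk>a \<in> carrier A; b \<in> carrier A; c \<in> carrier A\<rbrakk>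
        \<Longrightarrow> br a (b \<otimes>\<^bsub>A\<^esub> c) = b \<otimes>\<^bsub>A\<^esub> br a c \<oplus>\<^bsub>A\<^esub> br a b \<otimes>\<^bsub>A\<^esub> c"

text \<open>The subalgebra generated by \<open>S\<close> is the subring generated by \<open>S\<close> and the scalars.\<close>

definition finitely_generated_algebra :: "(complex, 'a) module \<Rightarrow> bool" where
  "finitely_generated_algebra A \<longleftrightarrow>
    (\<exists>S. finite S \<and> S \<subseteq> carrier A \<and> generate_ring A (S \<union> range (scalar A)) = carrier A)"

locale complex_affine_poisson_algebra = complex_poisson_algebra +
  assumes finitely_generated: "finitely_generated_algebra A"


section \<open>Poisson ideals and the Poisson spectrum\<close>

definition poisson_ideal :: "(complex, 'a) module \<Rightarrow> ('a \<Rightarrow> 'a \<Rightarrow> 'a) \<Rightarrow> 'a set \<Rightarrow> bool" where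
  "poisson_ideal A br I \<longleftrightarrow> ideal I A \<and> (\<forall>x\<in>I. \<forall>a\<in>carrier A. br x a \<in> I)"

definition is_poisson_core ::
  "(complex, 'a) module \<Rightarrow> ('a \<Rightarrow> 'a \<Rightarrow> 'a) \<Rightarrow> 'a set \<Rightarrow> 'a set \<Rightarrow> bool" where
  "is_poisson_core A br J P \<longleftrightarrow>
    poisson_ideal A br P \<and> P \<subseteq> J \<and> (\<forall>K. poisson_ideal A br K \<and> K \<subseteq> J \<longrightarrow> K \<subseteq> P)"

definition poisson_primitive ::
  "(complex, 'a) module \<Rightarrow> ('a \<Rightarrow> 'a \<Rightarrow> 'a) \<Rightarrow> 'a set \<Rightarrow> bool" where
  "poisson_primitive A br P \<longleftrightarrow> (\<exists>m. maximalideal m A \<and> is_poisson_core A br m P)"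

definition prime_spectrum :: "('a, 'm) ring_scheme \<Rightarrow> 'a set set" where
  "prime_spectrum R = {P. primeideal P R}"

definition max_spectrum :: "('a, 'm) ring_scheme \<Rightarrow> 'a set set" where
  "max_spectrum R = {m. maximalideal m R}"

definition zariski_topology :: "('a, 'm) ring_scheme \<Rightarrow> 'a set topology" where
  "zariski_topology R =
    topology (\<lambda>U. \<exists>S\<subseteq>carrier R. U = {P \<in> prime_spectrum R. \<not> S \<subseteq> P})"

lemma istopology_zariski:
  fixes R :: "('a, 'm) ring_scheme"
  shows "istopology (\<lambda>U. \<exists>S\<subseteq>carrier R. U = {P \<in> prime_spectrum R. \<not> S \<subseteq> P})"
  unfolding istopology_def
proof (intro conjI allI impI)
  fix U V
  assume "\<exists>S\<subseteq>carrier R. U = {P \<in> prime_spectrum R. \<not> S \<subseteq> P}"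
    and "\<exists>S\<subseteq>carrier R. V = {P \<in> prime_spectrum R. \<not> S \<subseteq> P}"
  then obtain S T where S: "S \<subseteq> carrier R" "U = {P \<in> prime_spectrum R. \<not> S \<subseteq> P}"
    and T: "T \<subseteq> carrier R" "V = {P \<in> prime_spectrum R. \<not> T \<subseteq> P}"
    by blast
  define W where "W = {s \<otimes>\<^bsub>R\<^esub> t | s t. s \<in> S \<and> t \<in> T}"
  have key: "\<not> W \<subseteq> P \<longleftrightarrow> \<not> S \<subseteq> P \<and> \<not> T \<subseteq> P" if "P \<in> prime_spectrum R" for P
  proof -
    interpret primeideal P R
      using that by (simp add: prime_spectrum_def)
    show ?thesis
      unfolding W_def using S(1) T(1) I_prime I_l_closed I_r_closed
      by (auto simp: subset_iff) blast+
  qed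
  show "\<exists>W\<subseteq>carrier R. U \<inter> V = {P \<in> prime_spectrum R. \<not> W \<subseteq> P}"
  proof (cases "prime_spectrum R = {}")
    case True
    then show ?thesis using S by auto
  next
    case False
    then obtain Q where "primeideal Q R"
      by (auto simp: prime_spectrum_def)
    then interpret primeideal Q R .
    have "W \<subseteq> carrier R"
      unfolding W_def using S(1) T(1) by auto
    moreover have "U \<inter> V = {P \<in> prime_spectrum R. \<not> W \<subseteq> P}"
      unfolding S(2) T(2) using key by blast
    ultimately show ?thesis by blast
  qed
next
  fix \<K>
  assume "\<forall>U\<in>\<K>. \<exists>S\<subseteq>carrier R. U = {P \<in> prime_spectrum R. \<not> S \<subseteq> P}"
  then obtain f where f: "\<And>U. U \<in> \<K> \<Longrightarrow> f U \<subseteq> carrier R"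
      "\<And>U. U \<in> \<K> \<Longrightarrow> U = {P \<in> prime_spectrum R. \<not> f U \<subseteq> P}"
    by metis
  have "\<Union>\<K> = {P \<in> prime_spectrum R. \<not> (\<Union>U\<in>\<K>. f U) \<subseteq> P}"
  proof (rule Set.set_eqI)
    fix P
    have "P \<in> \<Union>\<K> \<longleftrightarrow> (\<exists>U\<in>\<K>. P \<in> prime_spectrum R \<and> \<not> f U \<subseteq> P)"
      using f(2) by blast
    then show "P \<in> \<Union>\<K> \<longleftrightarrow> P \<in> {P \<in> prime_spectrum R. \<not> (\<Union>U\<in>\<K>. f U) \<subseteq> P}"
      by blast
  qed
  moreover have "(\<Union>U\<in>\<K>. f U) \<subseteq> carrier R"
    using f(1) by blast
  ultimately show "\<exists>S\<subseteq>carrier R. \<Union>\<K> = {P \<in> prime_spectrum R. \<not> S \<subseteq> P}"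
    by blast
qed

lemma openin_zariski:
  "openin (zariski_topology R) U \<longleftrightarrow> (\<exists>S\<subseteq>carrier R. U = {P \<in> prime_spectrum R. \<not> S \<subseteq> P})"
  unfolding zariski_topology_def by (simp add: topology_inverse'[OF istopology_zariski])

definition poisson_spectrum ::
  "(complex, 'a) module \<Rightarrow> ('a \<Rightarrow> 'a \<Rightarrow> 'a) \<Rightarrow> 'a set set" where
  "poisson_spectrum A br = {P \<in> prime_spectrum A. poisson_ideal A br P}"

definition locally_closedin :: "'b topology \<Rightarrow> 'b set \<Rightarrow> bool" where
  "locally_closedin T S \<longleftrightarrow> (\<exists>U V. openin T U \<and> closedin T V \<and> S = U \<inter> V)"

definition poisson_locally_closed ::
  "(complex, 'a) module \<Rightarrow> ('a \<Rightarrow> 'a \<Rightarrow> 'a) \<Rightarrow> 'a set \<Rightarrow> bool" where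
  "poisson_locally_closed A br P \<longleftrightarrow>
    P \<in> poisson_spectrum A br \<and>
    locally_closedin (subtopology (zariski_topology A) (poisson_spectrum A br)) {P}"


section \<open>Poisson rational ideals\<close>

definition fraction_rel :: "('a, 'm) ring_scheme \<Rightarrow> (('a \<times> 'a) \<times> ('a \<times> 'a)) set" where
  "fraction_rel R = {((a, s), (b, t)).
      a \<in> carrier R \<and> b \<in> carrier R \<and>
      s \<in> carrier R - {\<zero>\<^bsub>R\<^esub>} \<and> t \<in> carrier R - {\<zero>\<^bsub>R\<^esub>} \<and> a \<otimes>\<^bsub>R\<^esub> t = b \<otimes>\<^bsub>R\<^esub> s}"

definition fraction :: "('a, 'm) ring_scheme \<Rightarrow> 'a \<Rightarrow> 'a \<Rightarrow> ('a \<times> 'a) set" where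
  "fraction R a s = fraction_rel R `` {(a, s)}"

text \<open>
  Operations on fractions are unions over all pairs of representatives, as in
  \<^const>\<open>rcoset_mult\<close>; all members of such a union agree when \<open>R\<close> is a domain.
\<close>

definition fraction_field :: "('a, 'm) ring_scheme \<Rightarrow> ('a \<times> 'a) set ring" where
  "fraction_field R = \<lparr>
     carrier = (carrier R \<times> (carrier R - {\<zero>\<^bsub>R\<^esub>})) // fraction_rel R,
     monoid.mult = (\<lambda>u v. \<Union>(a, s)\<in>u. \<Union>(b, t)\<in>v. fraction R (a \<otimes>\<^bsub>R\<^esub> b) (s \<otimes>\<^bsub>R\<^esub> t)),
     one = fraction R \<one>\<^bsub>R\<^esub> \<one>\<^bsub>R\<^esub>,
     ring.zero = fraction R \<zero>\<^bsub>R\<^esub> \<one>\<^bsub>R\<^esub>,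
     add = (\<lambda>u v. \<Union>(a, s)\<in>u. \<Union>(b, t)\<in>v.
              fraction R (a \<otimes>\<^bsub>R\<^esub> t \<oplus>\<^bsub>R\<^esub> b \<otimes>\<^bsub>R\<^esub> s) (s \<otimes>\<^bsub>R\<^esub> t)) \<rparr>"

text \<open>
  The extension of a bracket from \<open>R\<close> to its fraction field is forced by the quotient rule in
  both arguments:
  \<open>{a/s, b/t} = (s t {a,b} - s b {a,t} - a t {s,b} + a b {s,t}) / (s\<^sup>2 t\<^sup>2)\<close>.
\<close>

definition fraction_bracket ::
  "('a, 'm) ring_scheme \<Rightarrow> ('a \<Rightarrow> 'a \<Rightarrow> 'a) \<Rightarrow> ('a \<times> 'a) set \<Rightarrow> ('a \<times> 'a) set \<Rightarrow> ('a \<times> 'a) set"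
where
  "fraction_bracket R br u v = (\<Union>(a, s)\<in>u. \<Union>(b, t)\<in>v.
     fraction R
       (s \<otimes>\<^bsub>R\<^esub> t \<otimes>\<^bsub>R\<^esub> br a b \<ominus>\<^bsub>R\<^esub> s \<otimes>\<^bsub>R\<^esub> b \<otimes>\<^bsub>R\<^esub> br a t
          \<ominus>\<^bsub>R\<^esub> a \<otimes>\<^bsub>R\<^esub> t \<otimes>\<^bsub>R\<^esub> br s b \<oplus>\<^bsub>R\<^esub> a \<otimes>\<^bsub>R\<^esub> b \<otimes>\<^bsub>R\<^esub> br s t)
       (s \<otimes>\<^bsub>R\<^esub> s \<otimes>\<^bsub>R\<^esub> (t \<otimes>\<^bsub>R\<^esub> t)))"

definition quotient_bracket ::
  "('a, 'm) ring_scheme \<Rightarrow> ('a \<Rightarrow> 'a \<Rightarrow> 'a) \<Rightarrow> 'a set \<Rightarrow> 'a set \<Rightarrow> 'a set \<Rightarrow> 'a set" where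
  "quotient_bracket R br I u v = (\<Union>a\<in>u. \<Union>b\<in>v. I +>\<^bsub>R\<^esub> br a b)"

definition poisson_center :: "('a, 'm) ring_scheme \<Rightarrow> ('a \<Rightarrow> 'a \<Rightarrow> 'a) \<Rightarrow> 'a set" where
  "poisson_center B br = {a \<in> carrier B. \<forall>b\<in>carrier B. br a b = \<zero>\<^bsub>B\<^esub>}"

definition poisson_rational ::
  "(complex, 'a) module \<Rightarrow> ('a \<Rightarrow> 'a \<Rightarrow> 'a) \<Rightarrow> 'a set \<Rightarrow> bool" where
  "poisson_rational A br P \<longleftrightarrow>
    P \<in> poisson_spectrum A br \<and>
    poisson_center (fraction_field (A Quot P))
        (fraction_bracket (A Quot P) (quotient_bracket A br P)) =
      range (\<lambda>c. fraction (A Quot P) (P +>\<^bsub>A\<^esub> scalar A c) \<one>\<^bsub>A Quot P\<^esub>)"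

definition poisson_dixmier_moeglin ::
  "(complex, 'a) module \<Rightarrow> ('a \<Rightarrow> 'a \<Rightarrow> 'a) \<Rightarrow> bool" where
  "poisson_dixmier_moeglin A br \<longleftrightarrow>
    {P. poisson_locally_closed A br P} = {P. poisson_primitive A br P} \<and>
    {P. poisson_primitive A br P} = {P. poisson_rational A br P}"


section \<open>Stratification of the maximal spectrum by singular loci\<close>

text \<open>
  A closed subvariety \<open>V\<close> of \<open>max A\<close> carries its reduced structure, so its coordinate ring is
  \<open>A / I\<close> with \<open>I = \<Inter>V\<close>.
\<close>

text \<open>
  The Zariski cotangent space of \<open>V\<close> at \<open>m\<close> is \<open>m / (m\<^sup>2 + I)\<close>.  It is viewed as a subspace of the
  ring \<open>A / (m\<^sup>2 + I)\<close> over the image of the scalars, so that \<^const>\<open>ring.dimension\<close> applies.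
\<close>

definition cotangent_dimension :: "(complex, 'a) module \<Rightarrow> 'a set set \<Rightarrow> 'a set \<Rightarrow> nat \<Rightarrow> bool" where
  "cotangent_dimension A V m d \<longleftrightarrow>
    (let J = (m \<cdot>\<^bsub>A\<^esub> m) <+>\<^bsub>A\<^esub> \<Inter>V
     in ring.dimension (A Quot J) d (range (\<lambda>c. J +>\<^bsub>A\<^esub> scalar A c)) ((\<lambda>x. J +>\<^bsub>A\<^esub> x) ` m))"

text \<open>
  The Krull dimension of the local ring of \<open>V\<close> at \<open>m\<close>: the supremum of the lengths of chains of
  prime ideals of \<open>A\<close> that contain \<open>\<Inter>V\<close> and end in \<open>m\<close>.
\<close>

definition local_dimension :: "(complex, 'a) module \<Rightarrow> 'a set set \<Rightarrow> 'a set \<Rightarrow> enat" where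
  "local_dimension A V m = Sup {enat n | n.
     \<exists>P :: nat \<Rightarrow> 'a set. (\<forall>i\<le>n. primeideal (P i) A \<and> \<Inter>V \<subseteq> P i) \<and>
       (\<forall>i<n. P i \<subset> P (Suc i)) \<and> P n = m}"

definition regular_point :: "(complex, 'a) module \<Rightarrow> 'a set set \<Rightarrow> 'a set \<Rightarrow> bool" where
  "regular_point A V m \<longleftrightarrow> (\<exists>d. cotangent_dimension A V m d \<and> local_dimension A V m = enat d)"

definition singular_locus :: "(complex, 'a) module \<Rightarrow> 'a set set \<Rightarrow> 'a set set" where
  "singular_locus A V = {m \<in> V. \<not> regular_point A V m}"

primrec iterated_singular_locus :: "(complex, 'a) module \<Rightarrow> nat \<Rightarrow> 'a set set" where
  "iterated_singular_locus A 0 = max_spectrum A"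
| "iterated_singular_locus A (Suc i) = singular_locus A (iterated_singular_locus A i)"

definition smooth_stratum :: "(complex, 'a) module \<Rightarrow> nat \<Rightarrow> 'a set set" where
  "smooth_stratum A i = iterated_singular_locus A i - iterated_singular_locus A (Suc i)"


section \<open>Symplectic leaves\<close>

text \<open>The value \<open>a(m)\<close>: the image of \<open>a\<close> under \<open>A / m \<cong> \<complex>\<close> (Nullstellensatz).\<close>

definition point_value :: "(complex, 'a) module \<Rightarrow> 'a set \<Rightarrow> 'a \<Rightarrow> complex" where
  "point_value A m a = (THE c. a \<ominus>\<^bsub>A\<^esub> scalar A c \<in> m)"

text \<open>
  Points of \<open>\<complex>\<^sup>n\<close> are functions \<^typ>\<open>nat \<Rightarrow> complex\<close> of which only the coordinates below \<open>n\<close>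
  matter; the remaining coordinates of \<open>coordinates A n x m\<close> are 0.
\<close>

definition coordinates ::
  "(complex, 'a) module \<Rightarrow> nat \<Rightarrow> (nat \<Rightarrow> 'a) \<Rightarrow> 'a set \<Rightarrow> nat \<Rightarrow> complex" where
  "coordinates A n x m = (\<lambda>i. if i < n then point_value A m (x i) else 0)"

text \<open>
  Holomorphic in the first \<open>n\<close> variables: continuous (product topology) and holomorphic in each
  of these variables separately.
\<close>

definition holomorphic_in_variables ::
  "nat \<Rightarrow> (nat \<Rightarrow> complex) set \<Rightarrow> ((nat \<Rightarrow> complex) \<Rightarrow> complex) \<Rightarrow> bool" where
  "holomorphic_in_variables n U F \<longleftrightarrow>
    open U \<and> continuous_on U F \<and>
    (\<forall>z\<in>U. \<forall>i<n. (\<lambda>w. F (z(i := w))) field_differentiable at (z i))"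

definition partial_deriv ::
  "nat \<Rightarrow> ((nat \<Rightarrow> complex) \<Rightarrow> complex) \<Rightarrow> (nat \<Rightarrow> complex) \<Rightarrow> complex" where
  "partial_deriv i F z = deriv (\<lambda>w. F (z(i := w))) (z i)"

text \<open>
  On a smooth stratum, the holomorphic functions are locally the functions \<open>f = F(x\<^sub>0, \<dots>, x\<^sub>n\<^sub>-\<^sub>1)\<close>
  with \<open>x\<^sub>i \<in> A\<close> and \<open>F\<close> holomorphic.  By the chain rule the Hamiltonian vector field of \<open>f\<close> acts on
  \<open>g \<in> A\<close> by \<open>{f, g} = \<Sum>\<^sub>i (\<partial>F/\<partial>z\<^sub>i)(x) {x\<^sub>i, g}\<close>.
\<close>

definition hamiltonian_vector_field ::
  "(complex, 'a) module \<Rightarrow> ('a \<Rightarrow> 'a \<Rightarrow> 'a) \<Rightarrow> nat \<Rightarrow> (nat \<Rightarrow> 'a) \<Rightarrow>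
   ((nat \<Rightarrow> complex) \<Rightarrow> complex) \<Rightarrow> 'a set \<Rightarrow> 'a \<Rightarrow> complex" where
  "hamiltonian_vector_field A br n x F m g =
    (\<Sum>i<n. partial_deriv i F (coordinates A n x m) * point_value A m (br (x i) g))"

text \<open>
  \<open>q\<close> is reached from \<open>p\<close> by the flow inside \<open>S\<close>, for time \<open>T\<close>, of the Hamiltonian vector field of
  \<open>F(x\<^sub>0, \<dots>, x\<^sub>n\<^sub>-\<^sub>1)\<close>.  A curve in \<open>S\<close> is an integral curve iff the derivative of each \<open>g \<in> A\<close>
  along it is the one prescribed by the vector field.  Time is real; since \<open>F\<close> may be replaced
  by a complex multiple, this covers complex times.
\<close>

definition hamiltonian_flow_step ::
  "(complex, 'a) module \<Rightarrow> ('a \<Rightarrow> 'a \<Rightarrow> 'a) \<Rightarrow> 'a set set \<Rightarrow> 'a set \<Rightarrow> 'a set \<Rightarrow> bool" where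
  "hamiltonian_flow_step A br S p q \<longleftrightarrow>
    (\<exists>n x U F T \<gamma>.
      (\<forall>i<n. x i \<in> carrier A) \<and> holomorphic_in_variables n U F \<and>
      0 \<le> T \<and> \<gamma> 0 = p \<and> \<gamma> T = q \<and>
      (\<forall>t\<in>{0..T::real}. \<gamma> t \<in> S \<and> coordinates A n x (\<gamma> t) \<in> U \<and>
        (\<forall>g\<in>carrier A. ((\<lambda>s. point_value A (\<gamma> s) g)
           has_vector_derivative hamiltonian_vector_field A br n x F (\<gamma> t) g)
           (at t within {0..T}))))"

definition leaf_in ::
  "(complex, 'a) module \<Rightarrow> ('a \<Rightarrow> 'a \<Rightarrow> 'a) \<Rightarrow> 'a set set \<Rightarrow> 'a set \<Rightarrow> 'a set set" where
  "leaf_in A br S m = {q. (hamiltonian_flow_step A br S)\<^sup>*\<^sup>* m q}"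

definition symplectic_leaves ::
  "(complex, 'a) module \<Rightarrow> ('a \<Rightarrow> 'a \<Rightarrow> 'a) \<Rightarrow> 'a set set set" where
  "symplectic_leaves A br =
    {leaf_in A br (smooth_stratum A i) m | i m. m \<in> smooth_stratum A i}"

definition algebraic_poisson_bracket ::
  "(complex, 'a) module \<Rightarrow> ('a \<Rightarrow> 'a \<Rightarrow> 'a) \<Rightarrow> bool" where
  "algebraic_poisson_bracket A br \<longleftrightarrow>
    (\<forall>L\<in>symplectic_leaves A br.
      locally_closedin (subtopology (zariski_topology A) (max_spectrum A)) L)"

end

(*
  Everything is pulled back along a surjection from a free commutative algebra R over the complex
  numbers. Poisson ideals of A become the ideals of R that contain the relations and are stable
  under a set D of derivations lifting the maps {a, -}, and the Poisson core of a maximal ideal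
  becomes the core with respect to D, which is prime.

  Locally closed implies primitive by the Nullstellensatz. For primitive against rational, one shows
  that the fraction field of R / p has only scalar D-constants iff p is the core of a maximal ideal:
  if there are no new constants, each finite set of monomials independent modulo p has a generalised
  Wronskian W outside p lying in every strictly larger stable ideal that contains a nontrivial
  combination of these monomials; there are countably many such W, and since the complex numbers are
  uncountable some point of p avoids all of them.

  For primitive implies locally closed, take the core p of a point m and the symplectic leaf L of m.
  Values of generators of a Poisson ideal along a Hamiltonian flow solve a linear differential
  equation, so a Poisson ideal lies in m iff it lies in every point of L. The ideal of functions that
  vanish on L is Poisson, because flows of polynomial Hamiltonians exist (exponential series) and stay in
  the stratum: the embedding dimension is transported by the flow, and the local dimension is the
  largest transcendence degree of a prime between the ideal and the point, where the prime can be
  taken stable. Hence p is the vanishing ideal of L, and a function that cuts L out of its closure and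
  does not vanish at m lies in every Poisson prime strictly containing p.
*)
theory Submission
  imports Defs "HOL-Complex_Analysis.Cauchy_Integral_Formula"
begin

section \<open>Ideals, derivations and linear algebra modulo a prime\<close>

text \<open>In the free algebra \<open>falg\<close> any values on the variables define a derivation,
  which gives the freedom needed for dual derivations and for lifting the bracket. The price is that
  the lifted maps obey the laws of the bracket only modulo the relations. Statements about residue
  fields are kept in \<open>falg\<close> by clearing denominators: a fraction is a pair whose
  denominator lies outside the prime. The main obstacle is that the strata are cut out by an
  algebraic condition, the dimension of a cotangent space against the length of prime chains, but
  have to be invariant under analytic flows. A flow turns polynomial functions into analytic ones,
  so a prime inside one point cannot be transported to another point. Stable ideals need no
  transport, because the flow does not change which of them a point contains; this is why the local
  dimension is rewritten with stable primes. Leaves use arbitrary holomorphic Hamiltonians, whereas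
  flows are constructed only for elements of \<open>A\<close>. The differential equation treats
  every curve that is given; the constructed curves suffice to show that an invariant set has a
  stable vanishing ideal.\<close>

definition is_ideal :: "'r::comm_ring_1 set \<Rightarrow> bool" where
  "is_ideal I \<longleftrightarrow> 0 \<in> I \<and> (\<forall>a\<in>I. \<forall>b\<in>I. a + b \<in> I) \<and> (\<forall>a\<in>I. \<forall>r. r * a \<in> I)"

definition is_prime :: "'r::comm_ring_1 set \<Rightarrow> bool" where
  "is_prime p \<longleftrightarrow> is_ideal p \<and> 1 \<notin> p \<and> (\<forall>a b. a * b \<in> p \<longrightarrow> a \<in> p \<or> b \<in> p)"

lemma is_ideal_0: "is_ideal I \<Longrightarrow> 0 \<in> I"
  and is_ideal_add: "is_ideal I \<Longrightarrow> a \<in> I \<Longrightarrow> b \<in> I \<Longrightarrow> a + b \<in> I"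
  and is_ideal_mult: "is_ideal I \<Longrightarrow> a \<in> I \<Longrightarrow> r * a \<in> I"
  by (auto simp: is_ideal_def)

lemma is_ideal_mult2: "is_ideal I \<Longrightarrow> a \<in> I \<Longrightarrow> a * r \<in> I"
  using is_ideal_mult[of I a r] by (simp add: mult.commute)

lemma is_ideal_uminus: "is_ideal I \<Longrightarrow> a \<in> I \<Longrightarrow> - a \<in> I"
  using is_ideal_mult[of I a "-1"] by simp

lemma is_ideal_diff: "is_ideal I \<Longrightarrow> a \<in> I \<Longrightarrow> b \<in> I \<Longrightarrow> a - b \<in> I"
  using is_ideal_add[of I a "-b"] is_ideal_uminus[of I b] by simp

lemma is_ideal_sum: "is_ideal I \<Longrightarrow> (\<And>i. i \<in> S \<Longrightarrow> f i \<in> I) \<Longrightarrow> sum f S \<in> I"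
  by (induction S rule: infinite_finite_induct) (auto intro: is_ideal_0 is_ideal_add)

lemma is_ideal_cong: "is_ideal I \<Longrightarrow> a - b \<in> I \<Longrightarrow> a \<in> I \<longleftrightarrow> b \<in> I"
  using is_ideal_diff[of I a "a - b"] is_ideal_add[of I "a - b" b] by auto

lemma is_ideal_add_iff: "is_ideal I \<Longrightarrow> b \<in> I \<Longrightarrow> a + b \<in> I \<longleftrightarrow> a \<in> I"
  by (rule is_ideal_cong) auto

lemma prime_ideal: "is_prime p \<Longrightarrow> is_ideal p"
  and prime_one: "is_prime p \<Longrightarrow> 1 \<notin> p"
  and prime_mult: "is_prime p \<Longrightarrow> a * b \<in> p \<Longrightarrow> a \<in> p \<or> b \<in> p"
  by (auto simp: is_prime_def)

lemma prime_mult_iff: "is_prime p \<Longrightarrow> a * b \<in> p \<longleftrightarrow> a \<in> p \<or> b \<in> p"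
  by (meson is_ideal_mult is_ideal_mult2 prime_ideal prime_mult)

lemma prime_power: "is_prime p \<Longrightarrow> a ^ k \<in> p \<Longrightarrow> a \<in> p"
  by (induction k) (auto simp: prime_mult_iff prime_one)

lemma prime_prod: "finite S \<Longrightarrow> is_prime p \<Longrightarrow> prod f S \<in> p \<Longrightarrow> \<exists>i\<in>S. f i \<in> p"
  by (induction S rule: finite_induct) (auto simp: prime_mult_iff prime_one)

section \<open>Linear systems and elimination modulo a prime\<close>

text \<open>Gaussian elimination without division: modulo a prime the ring is a domain, and each
  step multiplies by the pivot instead of dividing by it. \<open>T\<close> indexes the equations and
  \<open>S\<close> the unknowns.\<close>

lemma homogeneous_system_mod_prime:
  fixes a :: "'i \<Rightarrow> 'j \<Rightarrow> 'r::comm_ring_1"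
  assumes p: "is_prime p" and T: "finite T" and S: "finite S" "card T < card S"
  shows "\<exists>c. (\<exists>i\<in>S. c i \<notin> p) \<and> (\<forall>j\<in>T. (\<Sum>i\<in>S. c i * a i j) \<in> p)"
  using T S
proof (induction T arbitrary: S a rule: finite_induct)
  case empty
  then have "S \<noteq> {}" by auto
  then show ?case using prime_one[OF p] by (intro exI[of _ "\<lambda>_. 1"]) auto
next
  case (insert t T)
  note I = prime_ideal[OF p]
  show ?case
  proof (cases "\<forall>i\<in>S. a i t \<in> p")
    case True
    obtain c where c: "\<exists>i\<in>S. c i \<notin> p" "\<forall>j\<in>T. (\<Sum>i\<in>S. c i * a i j) \<in> p"
      using insert.IH[of S a] insert.prems insert.hyps by auto
    have "(\<Sum>i\<in>S. c i * a i t) \<in> p" using True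
      by (intro is_ideal_sum[OF I] is_ideal_mult[OF I]) auto
    then show ?thesis using c by auto
  next
    case False
    then obtain k where k: "k \<in> S" "a k t \<notin> p" by auto
    define S' where "S' = S - {k}"
    have S': "finite S'" "card T < card S'" "k \<notin> S'" "S = insert k S'"
      using insert.prems insert.hyps k by (auto simp: S'_def)
    obtain c' where c': "\<exists>i\<in>S'. c' i \<notin> p"
        "\<forall>j\<in>T. (\<Sum>i\<in>S'. c' i * (a k t * a i j - a i t * a k j)) \<in> p"
      using insert.IH[OF S'(1,2), of "\<lambda>i j. a k t * a i j - a i t * a k j"] by auto
    \<comment> \<open>Equation \<open>t\<close> determines the unknown at \<open>k\<close>; scaling
      the other unknowns by the pivot \<open>a k t\<close> keeps it in the ring.\<close>
    define c where "c i = (if i = k then - (\<Sum>i\<in>S'. c' i * a i t) else c' i * a k t)" for i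
    have eq: "(\<Sum>i\<in>S. c i * a i j) = (\<Sum>i\<in>S'. c' i * (a k t * a i j - a i t * a k j))" for j
    proof -
      have "(\<Sum>i\<in>S. c i * a i j) = c k * a k j + (\<Sum>i\<in>S'. c i * a i j)"
        using S' by simp
      also have "(\<Sum>i\<in>S'. c i * a i j) = (\<Sum>i\<in>S'. c' i * a k t * a i j)"
        using S'(3) by (intro sum.cong) (auto simp: c_def)
      finally show ?thesis
        by (simp add: c_def sum_distrib_left sum_distrib_right sum_subtractf algebra_simps)
    qed
    have "(\<Sum>i\<in>S. c i * a i j) \<in> p" if "j \<in> insert t T" for j
      using that c'(2) I by (auto simp: eq is_ideal_0 algebra_simps)
    moreover have "\<exists>i\<in>S. c i \<notin> p"
    proof -
      obtain i where i: "i \<in> S'" "c' i \<notin> p" using c'(1) by auto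
      then have "c i \<notin> p" using k(2) S'(3) p by (auto simp: c_def prime_mult_iff)
      then show ?thesis using i S' by auto
    qed
    ultimately show ?thesis by blast
  qed
qed

text \<open>Closure is asked for only modulo \<open>I\<close> because the rows used later are
  gradients of elements of an ideal, and the product rule leaves terms in that ideal.\<close>

definition rows_closed :: "'r::comm_ring_1 set \<Rightarrow> 'i set \<Rightarrow> ('i \<Rightarrow> 'r) set \<Rightarrow> bool" where
  "rows_closed I S M \<longleftrightarrow> M \<noteq> {} \<and>
    (\<forall>f\<in>M. \<forall>g\<in>M. \<forall>r s. \<exists>h\<in>M. \<forall>i\<in>S. h i - (r * f i + s * g i) \<in> I)"

lemma rows_closed_comb:
  assumes M: "rows_closed I S M" and I: "is_ideal I" and T: "finite T"
    and f: "f \<in> M" and g: "\<And>j. j \<in> T \<Longrightarrow> g j \<in> M"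
  shows "\<exists>h\<in>M. \<forall>i\<in>S. h i - (r * f i - (\<Sum>j\<in>T. s j * g j i)) \<in> I"
  using T g
proof (induction T rule: finite_induct)
  case empty
  obtain h where "h \<in> M" "\<forall>i\<in>S. h i - (r * f i + 0 * f i) \<in> I"
    using M f unfolding rows_closed_def by blast
  then show ?case by auto
next
  case (insert t T)
  then obtain h where h: "h \<in> M" "\<forall>i\<in>S. h i - (r * f i - (\<Sum>j\<in>T. s j * g j i)) \<in> I"
    by auto
  obtain h' where h': "h' \<in> M" "\<forall>i\<in>S. h' i - (1 * h i + (- s t) * g t i) \<in> I"
    using M h(1) insert.prems[of t] unfolding rows_closed_def by blast
  have "h' i - (r * f i - (\<Sum>j\<in>insert t T. s j * g j i)) \<in> I" if "i \<in> S" for i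
  proof -
    have "(h' i - (1 * h i + (- s t) * g t i)) + (h i - (r * f i - (\<Sum>j\<in>T. s j * g j i))) \<in> I"
      using h(2) h'(2) that by (intro is_ideal_add[OF I]) auto
    then show ?thesis using insert.hyps by (simp add: algebra_simps)
  qed
  then show ?case using h'(1) by blast
qed

text \<open>With \<open>P = I\<close> this is Gaussian elimination over the fraction field of the quotient
  by \<open>I\<close>; with \<open>P\<close> maximal it is elimination over a local ring, which plays the role of
  Nakayama's lemma.\<close>

lemma elimination:
  assumes I: "is_ideal I" and P: "is_prime P" and IP: "I \<subseteq> P"
    and S: "finite S" and M: "rows_closed I S M"
  shows "\<exists>F u piv. F \<subseteq> S \<and> u \<notin> P \<and>
    (\<forall>j\<in>S - F. piv j \<in> M \<and> piv j j - u \<in> I \<and> (\<forall>i\<in>S - F - {j}. piv j i \<in> I)) \<and>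
    (\<forall>f\<in>M. (\<forall>i\<in>S - F. f i \<in> P) \<longrightarrow> (\<forall>k\<in>F. f k \<in> P))"
proof -
  define Q where "Q F u piv \<longleftrightarrow> F \<subseteq> S \<and> u \<notin> P \<and>
    (\<forall>j\<in>S - F. piv j \<in> M \<and> piv j j - u \<in> I \<and> (\<forall>i\<in>S - F - {j}. piv j i \<in> I))" for F u piv
  have "\<exists>n F u piv. Q F u piv \<and> card F = n"
    using prime_one[OF P] by (intro exI[of _ "card S"] exI[of _ S] exI[of _ 1]) (auto simp: Q_def)
  \<comment> \<open>A partial elimination with the fewest columns \<open>F\<close> left over is
    final: a row contradicting the last clause would supply one more pivot.\<close>
  then obtain n where n: "\<exists>F u piv. Q F u piv \<and> card F = n"
      "\<And>m. m < n \<Longrightarrow> \<not> (\<exists>F u piv. Q F u piv \<and> card F = m)"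
    using exists_least_iff[of "\<lambda>n. \<exists>F u piv. Q F u piv \<and> card F = n"] by auto
  obtain F u piv where Q: "Q F u piv" "card F = n" using n(1) by auto
  have FS: "F \<subseteq> S" "finite F" using Q(1) S by (auto simp: Q_def intro: finite_subset)
  note PI = prime_ideal[OF P]
  have "f k \<in> P" if f: "f \<in> M" and fP: "\<forall>i\<in>S - F. f i \<in> P" and k: "k \<in> F" for f k
  proof (rule ccontr)
    assume fk: "f k \<notin> P"
    have piv: "piv j \<in> M" "piv j j - u \<in> I" "\<And>i. i \<in> S - F - {j} \<Longrightarrow> piv j i \<in> I"
      if "j \<in> S - F" for j using Q(1) that by (auto simp: Q_def)
    have u: "u \<notin> P" using Q(1) by (auto simp: Q_def)
    obtain h where h: "h \<in> M" "\<forall>i\<in>S. h i - (u * f i - (\<Sum>j\<in>S - F. f j * piv j i)) \<in> I"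
      using rows_closed_comb[OF M I, of "S - F" f piv u f] S f piv(1) by auto
    have hI: "h i \<in> I" if i: "i \<in> S - F" for i
    proof -
      have "(\<Sum>j\<in>S - F. f j * piv j i) = f i * piv i i + (\<Sum>j\<in>S - F - {i}. f j * piv j i)"
        using S i by (subst sum.remove[of _ i]) auto
      moreover have s: "(\<Sum>j\<in>S - F - {i}. f j * piv j i) \<in> I"
        using piv(3) i by (intro is_ideal_sum[OF I] is_ideal_mult[OF I]) auto
      moreover have s': "f i * (piv i i - u) \<in> I" using piv(2)[OF i] by (rule is_ideal_mult[OF I])
      moreover have s'': "h i - (u * f i - (\<Sum>j\<in>S - F. f j * piv j i)) \<in> I" using h(2) i by auto
      moreover have "(h i - (u * f i - (\<Sum>j\<in>S - F. f j * piv j i))) - f i * (piv i i - u)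
          - (\<Sum>j\<in>S - F - {i}. f j * piv j i) \<in> I"
        by (rule is_ideal_diff[OF I is_ideal_diff[OF I s'' s'] s])
      ultimately show ?thesis by (simp add: algebra_simps)
    qed
    have hk: "h k \<notin> P"
    proof
      assume a: "h k \<in> P"
      have s: "h k - (u * f k - (\<Sum>j\<in>S - F. f j * piv j k)) \<in> P" using h(2) k FS IP by auto
      have s': "(\<Sum>j\<in>S - F. f j * piv j k) \<in> P"
        using fP by (intro is_ideal_sum[OF PI] is_ideal_mult2[OF PI]) auto
      have "h k - (h k - (u * f k - (\<Sum>j\<in>S - F. f j * piv j k)))
          + (\<Sum>j\<in>S - F. f j * piv j k) \<in> P"
        by (rule is_ideal_add[OF PI is_ideal_diff[OF PI a s] s'])
      then have "u * f k \<in> P" by simp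
      with u fk P show False by (auto simp: prime_mult_iff)
    qed
    have "\<exists>g. g \<in> M \<and> (\<forall>i\<in>S. g i - (h k * piv j i - piv j k * h i) \<in> I)" if j: "j \<in> S - F" for j
    proof -
      obtain g where "g \<in> M" "\<forall>i\<in>S. g i - (h k * piv j i + (- piv j k) * h i) \<in> I"
        using M h(1) piv(1)[OF j] unfolding rows_closed_def by blast
      then show ?thesis by auto
    qed
    then obtain g where g: "\<And>j. j \<in> S - F \<Longrightarrow> g j \<in> M"
        "\<And>j i. j \<in> S - F \<Longrightarrow> i \<in> S \<Longrightarrow> g j i - (h k * piv j i - piv j k * h i) \<in> I"
      by metis
    \<comment> \<open>Scaling the old rows by \<open>h k\<close> and the new row by \<open>u\<close>
      gives all pivots the common value \<open>u * h k\<close>.\<close>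
    obtain h' where h': "h' \<in> M" "\<forall>i\<in>S. h' i - (u * h i + 0 * h i) \<in> I"
      using M h(1) unfolding rows_closed_def by blast
    define piv' where "piv' j = (if j = k then h' else g j)" for j
    have kS: "k \<in> S" using k FS by auto
    have "Q (F - {k}) (u * h k) piv'" unfolding Q_def
    proof (intro conjI ballI)
      show "F - {k} \<subseteq> S" using FS by auto
      show "u * h k \<notin> P" using u hk P by (auto simp: prime_mult_iff)
      fix j assume j: "j \<in> S - (F - {k})"
      show "piv' j \<in> M" using j g h' by (auto simp: piv'_def)
      show "piv' j j - u * h k \<in> I"
      proof (cases "j = k")
        case True
        then show ?thesis using h'(2) kS by (auto simp: piv'_def)
      next
        case False
        with j have jF: "j \<in> S - F" by auto
        have s: "g j j - (h k * piv j j - piv j k * h j) \<in> I" using g(2) jF by auto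
        have "(g j j - (h k * piv j j - piv j k * h j)) + h k * (piv j j - u)
          - piv j k * h j \<in> I"
          by (rule is_ideal_diff[OF I is_ideal_add[OF I s is_ideal_mult[OF I piv(2)[OF jF]]]
                is_ideal_mult[OF I hI[OF jF]]])
        then show ?thesis using False by (simp add: piv'_def algebra_simps)
      qed
      fix i assume i: "i \<in> S - (F - {k}) - {j}"
      show "piv' j i \<in> I"
      proof (cases "j = k")
        case True
        with i have iF: "i \<in> S - F" by auto
        have "h' i - u * h i \<in> I" using h'(2) iF by auto
        moreover have "u * h i \<in> I" using hI[OF iF] by (rule is_ideal_mult[OF I])
        ultimately show ?thesis using True I is_ideal_cong by (auto simp: piv'_def)
      next
        case False
        with j have jF: "j \<in> S - F" by auto
        have gi: "g j i - (h k * piv j i - piv j k * h i) \<in> I" using g(2) jF i by auto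
        show ?thesis
        proof (cases "i = k")
          case True
          then show ?thesis using gi False by (simp add: piv'_def mult.commute)
        next
          case ik: False
          then have iF: "i \<in> S - F - {j}" using i by auto
          have "h k * piv j i - piv j k * h i \<in> I"
            using piv(3)[OF jF iF] hI iF
            by (intro is_ideal_diff[OF I] is_ideal_mult[OF I]) auto
          then show ?thesis using gi False I is_ideal_cong by (auto simp: piv'_def)
        qed
      qed
    qed
    moreover have "card (F - {k}) < n" using Q(2) k FS by (metis card_Diff1_less)
    ultimately show False using n(2) by blast
  qed
  with Q(1)[unfolded Q_def] show ?thesis
    by (intro exI[of _ F] exI[of _ u] exI[of _ piv] conjI) simp_all
qed

section \<open>Derivations and differential cores\<close>

definition is_derivation :: "('r::comm_ring_1 \<Rightarrow> 'r) \<Rightarrow> bool" where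
  "is_derivation d \<longleftrightarrow> (\<forall>a b. d (a + b) = d a + d b) \<and> (\<forall>a b. d (a * b) = a * d b + d a * b)"

definition stable :: "('r \<Rightarrow> 'r) set \<Rightarrow> 'r set \<Rightarrow> bool" where
  "stable D I \<longleftrightarrow> (\<forall>d\<in>D. \<forall>x\<in>I. d x \<in> I)"

lemma derivation_add: "is_derivation d \<Longrightarrow> d (a + b) = d a + d b"
  and derivation_mult: "is_derivation d \<Longrightarrow> d (a * b) = a * d b + d a * b"
  by (auto simp: is_derivation_def)

lemma derivation_0: "is_derivation d \<Longrightarrow> d 0 = 0"
  using derivation_add[of d 0 0] by simp

lemma derivation_minus: "is_derivation d \<Longrightarrow> d (- a) = - d a"
  using derivation_add[of d a "-a"] derivation_0[of d] by (simp add: eq_neg_iff_add_eq_0 add.commute)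

lemma derivation_diff: "is_derivation d \<Longrightarrow> d (a - b) = d a - d b"
  using derivation_add[of d a "-b"] derivation_minus[of d b] by simp

lemma derivation_sum: "is_derivation d \<Longrightarrow> d (sum f S) = (\<Sum>i\<in>S. d (f i))"
  by (induction S rule: infinite_finite_induct) (auto simp: derivation_0 derivation_add)

lemma derivation_1: "is_derivation d \<Longrightarrow> d 1 = 0"
  using derivation_mult[of d 1 1] by simp

lemma derivation_power:
  "is_derivation d \<Longrightarrow> d (a ^ k) = of_nat k * a ^ (k - 1) * d a"
proof (induction k)
  case (Suc k)
  then show ?case by (cases k) (auto simp: derivation_mult algebra_simps)
qed (simp add: derivation_1)

lemma derivation_of_nat: "is_derivation d \<Longrightarrow> d (of_nat n) = 0"
  by (induction n) (auto simp: derivation_0 derivation_add derivation_1)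

lemma derivation_funpow_add: "is_derivation d \<Longrightarrow> (d ^^ n) (a + b) = (d ^^ n) a + (d ^^ n) b"
  by (induction n) (auto simp: derivation_add)

lemma derivation_leibniz:
  fixes d :: "'r::comm_ring_1 \<Rightarrow> 'r"
  assumes d: "is_derivation d"
  shows "(d ^^ n) (a * b) = (\<Sum>i\<le>n. of_nat (n choose i) * ((d ^^ i) a * (d ^^ (n - i)) b))"
proof (induction n)
  case (Suc n)
  let ?t = "\<lambda>n i. of_nat (n choose i) * ((d ^^ i) a * (d ^^ (Suc n - i)) b) :: 'r"
  let ?s = "\<lambda>n i. of_nat (n choose i) * ((d ^^ Suc i) a * (d ^^ (n - i)) b) :: 'r"
  have "d (of_nat (n choose i) * ((d ^^ i) a * (d ^^ (n - i)) b)) = ?t n i + ?s n i" if "i \<le> n" for i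
    using that by (simp add: derivation_mult[OF d] derivation_of_nat[OF d] Suc_diff_le algebra_simps)
  then have "(d ^^ Suc n) (a * b) = (\<Sum>i\<le>n. ?t n i + ?s n i)"
    by (simp add: Suc derivation_sum[OF d])
  also have "\<dots> = (\<Sum>i\<le>n. ?t n i) + (\<Sum>i\<le>n. ?s n i)" by (simp add: sum.distrib)
  also have "(\<Sum>i\<le>n. ?t n i) = (\<Sum>i\<le>Suc n. ?t n i)" by (simp add: binomial_eq_0)
  also have "(\<Sum>i\<le>Suc n. ?t n i) = ?t n 0 + (\<Sum>i\<le>n. ?t n (Suc i))" by (rule sum.atMost_Suc_shift)
  finally have "(d ^^ Suc n) (a * b) = ?t n 0 + (\<Sum>i\<le>n. ?t n (Suc i) + ?s n i)"
    by (simp add: sum.distrib add.assoc)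
  also have "(\<Sum>i\<le>n. ?t n (Suc i) + ?s n i) =
      (\<Sum>i\<le>n. of_nat (Suc n choose Suc i) * ((d ^^ Suc i) a * (d ^^ (Suc n - Suc i)) b))"
    by (intro sum.cong) (auto simp: algebra_simps)
  finally show ?case by (subst sum.atMost_Suc_shift) simp
qed simp

text \<open>If \<open>a\<close> and \<open>b\<close> are outside, take the least \<open>k\<close>
  and \<open>l\<close> for which \<open>(d ^^ k) a\<close> and \<open>(d ^^ l) b\<close> leave
  \<open>q\<close>. In the Leibniz expansion of \<open>(d ^^ (k + l)) (a * b)\<close> every other
  term lies in \<open>q\<close>, and the binomial coefficient of the remaining one is nonzero modulo
  \<open>q\<close>.\<close>

lemma derivation_funpow_stable_prime:
  fixes d :: "'r::comm_ring_1 \<Rightarrow> 'r"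
  assumes d: "is_derivation d" and q: "is_prime q" and char: "\<And>n. n > 0 \<Longrightarrow> of_nat n \<notin> q"
  shows "is_prime {x. \<forall>k. (d ^^ k) x \<in> q}"
proof -
  note I = prime_ideal[OF q]
  have z: "(d ^^ k) 0 = 0" for k by (induction k) (auto simp: derivation_0[OF d])
  have ideal: "is_ideal {x. \<forall>k. (d ^^ k) x \<in> q}"
    unfolding is_ideal_def using I
    by (auto simp: z derivation_funpow_add[OF d] derivation_leibniz[OF d] is_ideal_0 is_ideal_add
        intro!: is_ideal_sum[OF I] is_ideal_mult[OF I])
  have "(\<forall>k. (d ^^ k) a \<in> q) \<or> (\<forall>k. (d ^^ k) b \<in> q)" if ab: "\<forall>k. (d ^^ k) (a * b) \<in> q" for a b
  proof (rule ccontr)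
    assume "\<not> ?thesis"
    then obtain k l where k: "(d ^^ k) a \<notin> q" "\<And>i. i < k \<Longrightarrow> (d ^^ i) a \<in> q"
      and l: "(d ^^ l) b \<notin> q" "\<And>i. i < l \<Longrightarrow> (d ^^ i) b \<in> q"
      using exists_least_iff[of "\<lambda>k. (d ^^ k) a \<notin> q"] exists_least_iff[of "\<lambda>k. (d ^^ k) b \<notin> q"]
      by auto
    let ?t = "\<lambda>i. of_nat ((k + l) choose i) * ((d ^^ i) a * (d ^^ (k + l - i)) b) :: 'r"
    have "(d ^^ (k + l)) (a * b) = ?t k + (\<Sum>i\<in>{..k + l} - {k}. ?t i)"
      unfolding derivation_leibniz[OF d]
      by (subst sum.remove[of "{..k + l}" k]) auto
    moreover have "(\<Sum>i\<in>{..k + l} - {k}. ?t i) \<in> q"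
    proof (rule is_ideal_sum[OF I])
      fix i assume i: "i \<in> {..k + l} - {k}"
      show "?t i \<in> q"
      proof (cases "i < k")
        case True
        then show ?thesis using k(2) by (intro is_ideal_mult[OF I] is_ideal_mult2[OF I]) auto
      next
        case False
        then have "k + l - i < l" using i by auto
        then show ?thesis using l(2) I by (intro is_ideal_mult[OF I]) auto
      qed
    qed
    ultimately have "?t k \<in> q"
      using ab[rule_format, of "k + l"] is_ideal_add_iff[OF I] by simp
    then show False using k(1) l(1) char[of "(k + l) choose k"] q by (auto simp: prime_mult_iff)
  qed
  moreover have "\<not> (\<forall>k. (d ^^ k) 1 \<in> q)" using prime_one[OF q] by (metis funpow_0)
  ultimately show ?thesis using ideal unfolding is_prime_def by auto
qed

text \<open>The elements all of whose iterated derivatives lie in \<open>P\<close>; a word in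
  \<open>D\<close> is a list applied from its head. By \<open>core_stable\<close> and
  \<open>core_greatest\<close> this is the largest stable subset of \<open>P\<close>.\<close>

definition core :: "('r::comm_ring_1 \<Rightarrow> 'r) set \<Rightarrow> 'r set \<Rightarrow> 'r set" where
  "core D P = {x. \<forall>ds. set ds \<subseteq> D \<longrightarrow> fold (\<lambda>d. d) ds x \<in> P}"

lemma core_subset: "core D P \<subseteq> P"
proof
  fix x assume "x \<in> core D P"
  then show "x \<in> P" unfolding core_def mem_Collect_eq by (elim allE[of _ "[]"]) simp
qed

lemma core_antimono: "D \<subseteq> D' \<Longrightarrow> core D' P \<subseteq> core D P"
  by (auto simp: core_def)

lemma core_empty: "core {} P = P"
  by (auto simp: core_def)

lemma core_stable: "stable D (core D P)"
  unfolding stable_def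
proof (intro ballI)
  fix d x assume d: "d \<in> D" and x: "x \<in> core D P"
  have "fold (\<lambda>d. d) ds (d x) \<in> P" if "set ds \<subseteq> D" for ds
  proof -
    have "fold (\<lambda>d. d) (d # ds) x \<in> P" using x[unfolded core_def mem_Collect_eq, rule_format, of "d # ds"] d that by simp
    then show ?thesis by simp
  qed
  then show "d x \<in> core D P" by (auto simp: core_def)
qed

lemma core_greatest:
  assumes "stable D K" "K \<subseteq> P"
  shows "K \<subseteq> core D P"
proof
  fix x assume x: "x \<in> K"
  have "fold (\<lambda>d. d) ds x \<in> K" if "set ds \<subseteq> D" for ds
    using that x assms(1)
    by (induction ds arbitrary: x) (auto simp: stable_def)
  then show "x \<in> core D P" using assms(2) by (auto simp: core_def)
qed

text \<open>For closure under multiplication the induction on the word runs over all multipliers and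
  all elements of the core at once, since the product rule replaces \<open>r * x\<close> by
  \<open>r * d x\<close> and \<open>d r * x\<close>.\<close>

lemma core_ideal:
  assumes D: "\<And>d. d \<in> D \<Longrightarrow> is_derivation d" and P: "is_ideal P"
  shows "is_ideal (core D P)"
proof -
  have add: "fold (\<lambda>d. d) ds (x + y) = fold (\<lambda>d. d) ds x + fold (\<lambda>d. d) ds y"
    if "set ds \<subseteq> D" for ds x y
    using that by (induction ds arbitrary: x y) (auto simp: derivation_add[OF D])
  have z: "fold (\<lambda>d. d) ds 0 = 0" if "set ds \<subseteq> D" for ds
    using that by (induction ds) (auto simp: derivation_0[OF D])
  have "fold (\<lambda>d. d) ds (r * x) \<in> P" if "set ds \<subseteq> D" "x \<in> core D P" for ds r x
    using that
  proof (induction ds arbitrary: r x)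
    case Nil
    then show ?case using core_subset[of D P] P by (auto intro: is_ideal_mult)
  next
    case (Cons d ds)
    then have d: "d \<in> D" "set ds \<subseteq> D" by auto
    have "d x \<in> core D P" using core_stable[of D P] d Cons.prems by (auto simp: stable_def)
    then have "fold (\<lambda>d. d) ds (r * d x) \<in> P" "fold (\<lambda>d. d) ds (d r * x) \<in> P"
      using Cons d by auto
    then show ?case using d P by (simp add: derivation_mult[OF D] add is_ideal_add[OF P])
  qed
  then show ?thesis unfolding is_ideal_def using P
    by (auto simp: core_def z add is_ideal_0 is_ideal_add)
qed

text \<open>A minimal prime among those between the core and \<open>P\<close> is stable, hence is the core.\<close>

lemma core_prime:
  fixes D :: "('r::comm_ring_1 \<Rightarrow> 'r) set"
  assumes D: "\<And>d. d \<in> D \<Longrightarrow> is_derivation d" and P: "is_prime P"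
    and char: "\<And>n. n > 0 \<Longrightarrow> of_nat n \<notin> P"
  shows "is_prime (core D P)"
proof -
  \<comment> \<open>Complements turn the search for a minimal prime into one for a maximal
    element.\<close>
  define A where "A = uminus ` {q. is_prime q \<and> core D P \<subseteq> q \<and> q \<subseteq> P}"
  have "\<exists>M\<in>A. \<forall>Z\<in>A. M \<subseteq> Z \<longrightarrow> Z = M"
  proof (rule subset_Zorn_nonempty)
    show "A \<noteq> {}" using P core_subset by (auto simp: A_def)
    fix C assume C: "C \<noteq> {}" "subset.chain A C"
    define q where "q = \<Inter>(uminus ` C)"
    have pr: "is_prime (- Z)" "core D P \<subseteq> - Z" "- Z \<subseteq> P" if "Z \<in> C" for Z
    proof -
      have "Z \<in> A" using C(2) that by (auto simp: subset.chain_def)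
      then show "is_prime (- Z)" "core D P \<subseteq> - Z" "- Z \<subseteq> P" by (auto simp: A_def)
    qed
    have "is_ideal q"
      unfolding is_ideal_def q_def using pr(1)[THEN prime_ideal] by (auto simp: is_ideal_def)
    moreover have "1 \<notin> q" using C(1) pr(1)[THEN prime_one] by (auto simp: q_def)
    moreover have "a \<in> q \<or> b \<in> q" if ab: "a * b \<in> q" for a b
    proof (rule ccontr)
      assume "\<not> ?thesis"
      then obtain Z Y where Z: "Z \<in> C" "a \<notin> - Z" and Y: "Y \<in> C" "b \<notin> - Y" by (auto simp: q_def)
      have "Z \<subseteq> Y \<or> Y \<subseteq> Z" using C(2) Z Y by (auto simp: subset.chain_def)
      then obtain W where "W \<in> C" "a \<notin> - W" "b \<notin> - W" using Z Y by auto
      moreover have "a * b \<in> - W" using ab \<open>W \<in> C\<close> by (auto simp: q_def)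
      ultimately show False using pr(1) prime_mult by blast
    qed
    ultimately have "is_prime q" by (auto simp: is_prime_def)
    moreover have "core D P \<subseteq> q" "q \<subseteq> P" using pr C(1) by (fastforce simp: q_def)+
    moreover have "\<Union>C = - q" by (auto simp: q_def)
    ultimately show "\<Union>C \<in> A" unfolding A_def by blast
  qed
  then obtain q where q: "is_prime q" "core D P \<subseteq> q" "q \<subseteq> P"
      "\<And>q'. is_prime q' \<Longrightarrow> core D P \<subseteq> q' \<Longrightarrow> q' \<subseteq> q \<Longrightarrow> q' = q"
  proof -
    assume *: "\<And>q. is_prime q \<Longrightarrow> core D P \<subseteq> q \<Longrightarrow> q \<subseteq> P \<Longrightarrow>
      (\<And>q'. is_prime q' \<Longrightarrow> core D P \<subseteq> q' \<Longrightarrow> q' \<subseteq> q \<Longrightarrow> q' = q) \<Longrightarrow> thesis"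
    obtain q where q: "is_prime q" "core D P \<subseteq> q" "q \<subseteq> P"
      and max: "\<forall>Z\<in>A. - q \<subseteq> Z \<longrightarrow> Z = - q"
      using \<open>\<exists>M\<in>A. _\<close> by (auto simp: A_def)
    show thesis
    proof (rule *[OF q])
      fix q' assume "is_prime q'" "core D P \<subseteq> q'" "q' \<subseteq> q"
      then have "- q' \<in> A" "- q \<subseteq> - q'" using q(3) by (auto simp: A_def)
      then show "q' = q" using max by blast
    qed
  qed
  have "stable D q" unfolding stable_def
  proof (intro ballI)
    fix d x assume d: "d \<in> D" and x: "x \<in> q"
    \<comment> \<open>The elements whose iterated \<open>d\<close>-derivatives stay in
      \<open>q\<close> form a prime between the core and \<open>q\<close>, so minimality makes it
      equal to \<open>q\<close>.\<close>
    let ?q = "{x. \<forall>k. (d ^^ k) x \<in> q}"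
    have "is_prime ?q"
      using derivation_funpow_stable_prime[OF D[OF d] q(1)] char q(3) by blast
    moreover have "core D P \<subseteq> ?q"
    proof
      fix y assume y: "y \<in> core D P"
      have "(d ^^ k) y \<in> core D P" for k
        using core_stable[of D P] d y by (induction k) (auto simp: stable_def)
      then show "y \<in> ?q" using q(2) by auto
    qed
    moreover have "?q \<subseteq> q" by (metis (mono_tags, lifting) funpow_0 mem_Collect_eq subsetI)
    ultimately have "?q = q" using q(4) by blast
    then have "(d ^^ 1) x \<in> q" using x by blast
    then show "d x \<in> q" by simp
  qed
  then have "q \<subseteq> core D P" using core_greatest q(3) by blast
  then show ?thesis using q by auto
qed

section \<open>The free commutative complex algebra on countably many variables\<close>

datatype fexpr = FCst complex | FVar nat | FAdd fexpr fexpr | FMul fexpr fexpr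

text \<open>The congruence generated by the laws of commutative rings and the arithmetic of the
  constants. A map out of the algebra can thus be defined by recursion on terms and checked rule by
  rule; this is done for derivations and for the evaluation in \<open>A\<close>.\<close>

inductive feq :: "fexpr \<Rightarrow> fexpr \<Rightarrow> bool" where
  feq_refl: "feq a a"
| feq_sym: "feq a b \<Longrightarrow> feq b a"
| feq_trans: "feq a b \<Longrightarrow> feq b c \<Longrightarrow> feq a c"
| feq_add: "feq a a' \<Longrightarrow> feq b b' \<Longrightarrow> feq (FAdd a b) (FAdd a' b')"
| feq_mul: "feq a a' \<Longrightarrow> feq b b' \<Longrightarrow> feq (FMul a b) (FMul a' b')"
| feq_add_assoc: "feq (FAdd (FAdd a b) c) (FAdd a (FAdd b c))"
| feq_add_comm: "feq (FAdd a b) (FAdd b a)"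
| feq_add_0: "feq (FAdd (FCst 0) a) a"
| feq_add_neg: "feq (FAdd (FMul (FCst (-1)) a) a) (FCst 0)"
| feq_mul_assoc: "feq (FMul (FMul a b) c) (FMul a (FMul b c))"
| feq_mul_comm: "feq (FMul a b) (FMul b a)"
| feq_mul_1: "feq (FMul (FCst 1) a) a"
| feq_distrib: "feq (FMul (FAdd a b) c) (FAdd (FMul a c) (FMul b c))"
| feq_cst_add: "feq (FAdd (FCst c) (FCst d)) (FCst (c + d))"
| feq_cst_mul: "feq (FMul (FCst c) (FCst d)) (FCst (c * d))"

quotient_type falg = fexpr / feq
  by (intro equivpI reflpI sympI transpI) (auto intro: feq_refl feq_sym feq_trans)

instantiation falg :: comm_ring_1
begin

lift_definition zero_falg :: falg is "FCst 0" .
lift_definition one_falg :: falg is "FCst 1" .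
lift_definition plus_falg :: "falg \<Rightarrow> falg \<Rightarrow> falg" is FAdd by (rule feq_add)
lift_definition times_falg :: "falg \<Rightarrow> falg \<Rightarrow> falg" is FMul by (rule feq_mul)
lift_definition uminus_falg :: "falg \<Rightarrow> falg" is "FMul (FCst (-1))"
  by (intro feq_mul feq_refl)
definition minus_falg :: "falg \<Rightarrow> falg \<Rightarrow> falg" where "minus_falg a b = a + - b"

instance
proof
  fix a b c :: falg
  show "a + b + c = a + (b + c)" by transfer (rule feq_add_assoc)
  show "a + b = b + a" by transfer (rule feq_add_comm)
  show "0 + a = a" by transfer (rule feq_add_0)
  show "- a + a = 0" by transfer (rule feq_add_neg)
  show "a - b = a + - b" by (rule minus_falg_def)
  show "a * b * c = a * (b * c)" by transfer (rule feq_mul_assoc)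
  show "a * b = b * a" by transfer (rule feq_mul_comm)
  show "1 * a = a" by transfer (rule feq_mul_1)
  show "(a + b) * c = a * c + b * c" by transfer (rule feq_distrib)
  \<comment> \<open>Evaluation at the origin respects the congruence and separates 0 from 1.\<close>
  define ev where "ev = rec_fexpr (\<lambda>c. c) (\<lambda>_. 0) (\<lambda>_ _ x y. x + y) (\<lambda>_ _ x y. x * y :: complex)"
  have "feq x y \<Longrightarrow> ev x = ev y" for x y
    by (induction rule: feq.induct) (auto simp: ev_def algebra_simps)
  then have "\<not> feq (FCst 0) (FCst 1)" by (fastforce simp: ev_def)
  then show "(0::falg) \<noteq> 1" by transfer
qed

end

lift_definition cst :: "complex \<Rightarrow> falg" is FCst .
lift_definition var :: "nat \<Rightarrow> falg" is FVar .

lemma cst_add: "cst (c + d) = cst c + cst d"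
  by transfer (rule feq_sym[OF feq_cst_add])

lemma cst_mult: "cst (c * d) = cst c * cst d"
  by transfer (rule feq_sym[OF feq_cst_mul])

lemma cst_0 [simp]: "cst 0 = 0"
  by transfer (rule feq_refl)

lemma cst_1 [simp]: "cst 1 = 1"
  by transfer (rule feq_refl)

lemma cst_uminus: "cst (- c) = - cst c"
  using cst_add[of c "-c"] by (simp add: eq_neg_iff_add_eq_0 add.commute)

lemma cst_diff: "cst (c - d) = cst c - cst d"
  using cst_add[of c "-d"] by (simp add: cst_uminus)

lemma cst_sum: "cst (sum f S) = (\<Sum>i\<in>S. cst (f i))"
  by (induction S rule: infinite_finite_induct) (auto simp: cst_add)

lemma cst_of_nat: "cst (of_nat n) = of_nat n"
  by (induction n) (auto simp: cst_add)

lemma cst_inverse: "c \<noteq> 0 \<Longrightarrow> cst (inverse c) * cst c = 1"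
  using cst_mult[of "inverse c" c] by simp

lemma falg_cases: obtains e where "x = abs_falg e"
  by (metis Quotient3_abs_rep Quotient3_falg)

lemma falg_induct [case_names cst var add mult]:
  assumes "\<And>c. P (cst c)" "\<And>i. P (var i)" "\<And>a b. P a \<Longrightarrow> P b \<Longrightarrow> P (a + b)"
    "\<And>a b. P a \<Longrightarrow> P b \<Longrightarrow> P (a * b)"
  shows "P x"
proof (cases x rule: falg_cases)
  case (1 e)
  have "P (abs_falg e)"
  proof (induction e)
    case (FAdd a b)
    then show ?case using assms(3) by (simp add: plus_falg.abs_eq[symmetric])
  next
    case (FMul a b)
    then show ?case using assms(4) by (simp add: times_falg.abs_eq[symmetric])
  qed (use assms in \<open>auto simp: cst.abs_eq[symmetric] var.abs_eq[symmetric]\<close>)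
  then show ?thesis using 1 by simp
qed

text \<open>The values already lie in the quotient, because the product rule multiplies a derivative
  by the class of the other factor.\<close>

primrec fder :: "(nat \<Rightarrow> falg) \<Rightarrow> fexpr \<Rightarrow> falg" where
  "fder v (FCst c) = 0"
| "fder v (FVar i) = v i"
| "fder v (FAdd a b) = fder v a + fder v b"
| "fder v (FMul a b) = abs_falg a * fder v b + fder v a * abs_falg b"

lemma feq_abs: "feq a b \<Longrightarrow> abs_falg a = abs_falg b"
  by (simp add: falg.abs_eq_iff)

lift_definition der :: "(nat \<Rightarrow> falg) \<Rightarrow> falg \<Rightarrow> falg" is fder
proof -
  fix v a b assume "feq a b"
  then show "fder v a = fder v b"
    by (induction rule: feq.induct)
      (auto simp: feq_abs plus_falg.abs_eq[symmetric] times_falg.abs_eq[symmetric]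
        cst.abs_eq[symmetric] algebra_simps cst_uminus)
qed

lemma der_cst [simp]: "der v (cst c) = 0"
  by transfer simp

lemma der_var [simp]: "der v (var i) = v i"
  by transfer simp

lemma der_derivation: "is_derivation (der v)"
  unfolding is_derivation_def
proof (intro conjI allI)
  fix a b
  show "der v (a + b) = der v a + der v b" by (transfer fixing: v) simp
  obtain e f where "a = abs_falg e" "b = abs_falg f" by (metis falg_cases)
  then show "der v (a * b) = a * der v b + der v a * b"
    by (simp add: times_falg.abs_eq der.abs_eq)
qed

lemma derivation_cst_mult:
  "is_derivation d \<Longrightarrow> d (cst c) = 0 \<Longrightarrow> d (cst c * x) = cst c * d x"
  by (simp add: derivation_mult)

lemma prime_cst: "is_prime p \<Longrightarrow> cst c \<in> p \<longleftrightarrow> c = 0"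
  using prime_one[of p] cst_inverse[of c] is_ideal_0[OF prime_ideal[of p]]
    is_ideal_mult[OF prime_ideal[of p], of "cst c" "cst (inverse c)"] by (cases "c = 0") auto

lemma prime_of_nat: "is_prime p \<Longrightarrow> n > 0 \<Longrightarrow> (of_nat n :: falg) \<notin> p"
  using prime_cst[of p "of_nat n"] by (simp add: cst_of_nat)

lemmas falg_core_prime = core_prime[where 'r = falg, OF _ _ prime_of_nat]

section \<open>Complex points as algebra homomorphisms\<close>

definition is_point :: "(falg \<Rightarrow> complex) \<Rightarrow> bool" where
  "is_point f \<longleftrightarrow> (\<forall>a b. f (a + b) = f a + f b) \<and> (\<forall>a b. f (a * b) = f a * f b) \<and> (\<forall>c. f (cst c) = c)"

definition point_ideal :: "(falg \<Rightarrow> complex) \<Rightarrow> falg set" where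
  "point_ideal f = {x. f x = 0}"

lemma point_add: "is_point f \<Longrightarrow> f (a + b) = f a + f b"
  and point_mult: "is_point f \<Longrightarrow> f (a * b) = f a * f b"
  and point_cst: "is_point f \<Longrightarrow> f (cst c) = c"
  by (auto simp: is_point_def)

lemma point_0: "is_point f \<Longrightarrow> f 0 = 0"
  and point_1: "is_point f \<Longrightarrow> f 1 = 1"
  using point_cst[of f 0] point_cst[of f 1] by simp_all

lemma point_uminus: "is_point f \<Longrightarrow> f (- a) = - f a"
  using point_add[of f a "-a"] point_0[of f] by (simp add: eq_neg_iff_add_eq_0 add.commute)

lemma point_diff: "is_point f \<Longrightarrow> f (a - b) = f a - f b"
  using point_add[of f a "-b"] by (simp add: point_uminus)

lemma point_sum: "is_point f \<Longrightarrow> f (sum g S) = (\<Sum>i\<in>S. f (g i))"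
  by (induction S rule: infinite_finite_induct) (auto simp: point_0 point_add)

lemma point_power: "is_point f \<Longrightarrow> f (a ^ k) = f a ^ k"
  by (induction k) (auto simp: point_1 point_mult)

lemmas point_simps = point_add point_mult point_cst point_0 point_1 point_uminus point_diff
  point_sum point_power

lemma point_ideal_prime: "is_point f \<Longrightarrow> is_prime (point_ideal f)"
  by (auto simp: is_prime_def is_ideal_def point_ideal_def point_simps)

lemma point_eqI: "is_point f \<Longrightarrow> is_point g \<Longrightarrow> point_ideal f \<subseteq> point_ideal g \<Longrightarrow> f = g"
proof
  fix x assume f: "is_point f" and g: "is_point g" and k: "point_ideal f \<subseteq> point_ideal g"
  have "x - cst (f x) \<in> point_ideal f" using f by (simp add: point_ideal_def point_simps)
  then have "x - cst (f x) \<in> point_ideal g" using k by auto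
  then show "f x = g x" using g by (simp add: point_ideal_def point_simps)
qed

section \<open>Linear independence over the complex numbers modulo an ideal\<close>

definition lin :: "(falg \<Rightarrow> complex) \<Rightarrow> falg set \<Rightarrow> falg" where
  "lin c E = (\<Sum>e\<in>E. cst (c e) * e)"

definition indep :: "falg set \<Rightarrow> falg set \<Rightarrow> bool" where
  "indep p E \<longleftrightarrow> finite E \<and> (\<forall>c. lin c E \<in> p \<longrightarrow> (\<forall>e\<in>E. c e = 0))"

definition spans :: "falg set \<Rightarrow> falg set \<Rightarrow> falg set" where
  "spans p T = {x. \<exists>c. x - lin c T \<in> p}"

lemma homogeneous_system_complex:
  fixes a :: "'i \<Rightarrow> 'j \<Rightarrow> complex"
  assumes "finite T" "finite S" "card T < card S"
  shows "\<exists>c. (\<exists>i\<in>S. c i \<noteq> 0) \<and> (\<forall>j\<in>T. (\<Sum>i\<in>S. c i * a i j) = 0)"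
  using homogeneous_system_mod_prime[of "{0::complex}" T S a] assms
  by (auto simp: is_prime_def is_ideal_def)

text \<open>The Steinitz bound: the coefficients over \<open>T\<close> of more than
  \<open>card T\<close> elements admit a nonzero solution of a homogeneous system, which is a linear
  dependence.\<close>

lemma indep_card_le:
  assumes p: "is_ideal p" and E: "indep p E" and T: "finite T" "E \<subseteq> spans p T"
  shows "card E \<le> card T"
proof (rule ccontr)
  assume "\<not> ?thesis"
  obtain a where a: "\<And>e. e \<in> E \<Longrightarrow> e - lin (a e) T \<in> p"
    using T(2) unfolding spans_def subset_iff mem_Collect_eq by metis
  obtain c where c: "\<exists>e\<in>E. c e \<noteq> 0" "\<forall>t\<in>T. (\<Sum>e\<in>E. c e * a e t) = 0"
    using homogeneous_system_complex[of T E a] E T(1) \<open>\<not> _\<close> by (auto simp: indep_def)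
  have "lin c E = (\<Sum>e\<in>E. cst (c e) * (e - lin (a e) T)) + (\<Sum>e\<in>E. cst (c e) * lin (a e) T)"
    by (simp add: lin_def sum.distrib[symmetric] algebra_simps)
  also have "(\<Sum>e\<in>E. cst (c e) * lin (a e) T) = (\<Sum>t\<in>T. cst (\<Sum>e\<in>E. c e * a e t) * t)"
    unfolding lin_def sum_distrib_left cst_sum sum_distrib_right
    by (subst sum.swap) (simp add: cst_mult mult.assoc)
  also have "\<dots> = 0" using c(2) by simp
  finally have "lin c E \<in> p"
    using a by (auto intro!: is_ideal_sum[OF p] is_ideal_mult[OF p])
  then show False using E c(1) by (auto simp: indep_def)
qed

lemma lin_insert: "finite E \<Longrightarrow> x \<notin> E \<Longrightarrow> lin c (insert x E) = cst (c x) * x + lin c E"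
  by (simp add: lin_def)

lemma lin_cong: "(\<And>e. e \<in> E \<Longrightarrow> c e = d e) \<Longrightarrow> lin c E = lin d E"
  by (simp add: lin_def)

lemma lin_scale: "lin (\<lambda>e. k * c e) E = cst k * lin c E"
  by (simp add: lin_def sum_distrib_left cst_mult mult.assoc)

lemma lin_add: "lin (\<lambda>e. c e + d e) E = lin c E + lin d E"
  by (simp add: lin_def sum.distrib cst_add algebra_simps)

lemma lin_uminus: "lin (\<lambda>e. - c e) E = - lin c E"
  by (simp add: lin_def cst_uminus sum_negf)

lemma spans_self:
  assumes "is_ideal p" "finite E" "x \<in> E"
  shows "x \<in> spans p E"
proof -
  let ?c = "\<lambda>e. if e = x then 1 else 0"
  have "lin ?c E = (\<Sum>e\<in>E. if e = x then x else 0)"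
    unfolding lin_def by (intro sum.cong) auto
  also have "\<dots> = x" using assms by simp
  finally have "x - lin ?c E \<in> p" using is_ideal_0[OF assms(1)] by simp
  then show ?thesis unfolding spans_def mem_Collect_eq by (rule exI[of _ ?c])
qed

lemma indep_insert:
  assumes p: "is_ideal p" and E: "indep p E" and x: "x \<notin> spans p E"
  shows "indep p (insert x E)"
proof -
  have fin: "finite E" using E by (simp add: indep_def)
  have "x \<notin> E" using spans_self[OF p fin] x by auto
  have "\<forall>e\<in>insert x E. c e = 0" if c: "lin c (insert x E) \<in> p" for c
  proof -
    have eq: "cst (c x) * x + lin c E \<in> p" using c lin_insert[OF fin \<open>x \<notin> E\<close>] by simp
    have "c x = 0"
    proof (rule ccontr)
      assume n: "c x \<noteq> 0"
      have "cst (inverse (c x)) * (cst (c x) * x + lin c E) \<in> p" using eq by (rule is_ideal_mult[OF p])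
      then have "x - lin (\<lambda>e. - (inverse (c x) * c e)) E \<in> p"
        unfolding lin_uminus lin_scale distrib_left mult.assoc[symmetric] cst_inverse[OF n] by simp
      then show False using x by (auto simp: spans_def)
    qed
    then show ?thesis using eq E by (auto simp: indep_def)
  qed
  then show ?thesis using fin by (auto simp: indep_def)
qed

lemma indep_empty: "indep p {}"
  by (simp add: indep_def)

lemma exists_indep_spanning:
  assumes p: "is_ideal p" and T: "finite T"
  shows "\<exists>E\<subseteq>T. indep p E \<and> T \<subseteq> spans p E"
  using T
proof (induction T rule: finite_induct)
  case empty
  then show ?case using indep_empty by auto
next
  case (insert x T)
  then obtain E where E: "E \<subseteq> T" "indep p E" "T \<subseteq> spans p E" by auto
  show ?case
  proof (cases "x \<in> spans p E")
    case True
    then show ?thesis using E by (intro exI[of _ E]) auto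
  next
    case False
    have fin: "finite E" using E by (simp add: indep_def)
    have "spans p E \<subseteq> spans p (insert x E)"
    proof
      fix y assume "y \<in> spans p E"
      then obtain c where c: "y - lin c E \<in> p" by (auto simp: spans_def)
      have "x \<notin> E" using False spans_self[OF p fin] by auto
      then have "lin (c(x := 0)) (insert x E) = lin c E"
        using fin by (simp add: lin_insert) (rule lin_cong, auto)
      then show "y \<in> spans p (insert x E)" using c by (auto simp: spans_def intro: exI[of _ "c(x := 0)"])
    qed
    then show ?thesis using E indep_insert[OF p E(2) False] spans_self[OF p, of "insert x E" x] fin
      by (intro exI[of _ "insert x E"]) auto
  qed
qed

section \<open>Monomials and the Nullstellensatz\<close>

text \<open>The enumeration runs over lists of variable indices, so a monomial occurs once for each
  ordering of its factors. What matters is that countably many elements span.\<close>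

definition monomial :: "nat \<Rightarrow> falg" where
  "monomial k = prod_list (map var (from_nat k :: nat list))"

lemma falg_monomial_expansion: "\<exists>N c. x = (\<Sum>i<N. cst (c i) * monomial i)"
proof -
  define Q where "Q x \<longleftrightarrow> (\<exists>N c. x = (\<Sum>i<N. cst (c i) * monomial i))" for x
  have add: "Q (x + y)" if Q: "Q x" "Q y" for x y
  proof -
    obtain N c M d where c: "x = (\<Sum>i<N. cst (c i) * monomial i)" "y = (\<Sum>i<M. cst (d i) * monomial i)"
      using Q by (auto simp: Q_def)
    let ?K = "max N M"
    have "x = (\<Sum>i<?K. cst (if i < N then c i else 0) * monomial i)"
      unfolding c(1) by (intro sum.mono_neutral_cong_left) auto
    moreover have "y = (\<Sum>i<?K. cst (if i < M then d i else 0) * monomial i)"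
      unfolding c(2) by (intro sum.mono_neutral_cong_left) auto
    ultimately have "x + y = (\<Sum>i<?K. cst ((if i < N then c i else 0) + (if i < M then d i else 0)) * monomial i)"
      by (simp only: sum.distrib[symmetric] cst_add distrib_right)
    then show ?thesis unfolding Q_def by (intro exI)
  qed
  have single: "Q (cst c * monomial k)" for c k
  proof -
    have "(\<Sum>i<Suc k. cst (if i = k then c else 0) * monomial i) = (\<Sum>i<Suc k. if i = k then cst c * monomial k else 0)"
      by (intro sum.cong) auto
    then show ?thesis unfolding Q_def by (intro exI[of _ "Suc k"] exI[of _ "\<lambda>i. if i = k then c else 0"]) simp
  qed
  have Q0: "Q 0" using single[of 0 0] by simp
  have Qsum: "Q (sum f S)" if "\<And>i. i \<in> S \<Longrightarrow> Q (f i)" for f :: "nat \<Rightarrow> falg" and S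
    using that by (induction S rule: infinite_finite_induct) (auto simp: Q0 add)
  \<comment> \<open>Stated as closure under multiplication by \<open>x\<close>, the claim composes
    in the product case; applied to 1 it gives the expansion.\<close>
  have "\<forall>y. Q y \<longrightarrow> Q (x * y)" for x
  proof (induction x rule: falg_induct)
    case (cst c)
    show ?case
    proof (intro allI impI)
      fix y assume "Q y"
      then obtain N d where "y = (\<Sum>i<N. cst (d i) * monomial i)" by (auto simp: Q_def)
      then have "cst c * y = (\<Sum>i<N. cst (c * d i) * monomial i)"
        by (simp add: sum_distrib_left cst_mult mult.assoc)
      then show "Q (cst c * y)" by (auto simp: Q_def)
    qed
  next
    case (var j)
    show ?case
    proof (intro allI impI)
      fix y assume "Q y"
      then obtain N d where "y = (\<Sum>i<N. cst (d i) * monomial i)" by (auto simp: Q_def)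
      then have "var j * y = (\<Sum>i<N. cst (d i) * monomial (to_nat (j # from_nat i)))"
        by (simp add: sum_distrib_left monomial_def mult_ac)
      then show "Q (var j * y)" using Qsum single by simp
    qed
  qed (auto simp: distrib_right add mult.assoc)
  moreover have "Q 1" using single[of 1 "to_nat ([] :: nat list)"] by (simp add: monomial_def)
  ultimately have "Q (x * 1)" by blast
  then show ?thesis by (simp add: Q_def)
qed

lemma map_poly_cst_mult: "map_poly cst (p * q) = map_poly cst p * map_poly cst q"
proof (induction p)
  case (pCons a p)
  have "map_poly cst (x + y) = map_poly cst x + map_poly cst y" for x y
    by (intro poly_eqI) (simp add: coeff_map_poly cst_add)
  moreover have "map_poly cst (smult a x) = smult (cst a) (map_poly cst x)" for x
    by (intro poly_eqI) (simp add: coeff_map_poly cst_mult)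
  ultimately show ?case using pCons by (simp add: map_poly_pCons)
qed simp

text \<open>Over the complex numbers \<open>F\<close> splits into linear factors, and a prime that
  contains their product at \<open>x\<close> contains one of them. The roots are removed one at a
  time.\<close>

lemma prime_poly_root:
  assumes q: "is_prime q" and "F \<noteq> 0" and "poly (map_poly cst F) x \<in> q"
  shows "\<exists>c. x - cst c \<in> q"
  using assms(2,3)
proof (induction "degree F" arbitrary: F)
  case 0
  obtain a where a: "F = [:a:]" using degree_eq_zeroE[OF 0(1)[symmetric]] by auto
  then show ?case using 0(2,3) q by (simp add: map_poly_pCons prime_cst)
next
  case (Suc n)
  have nc: "\<not> constant (poly F)" using Suc.hyps(2) by (simp add: constant_degree)
  obtain c where "poly F c = 0" 
    using Fundamental_Theorem_Algebra.fundamental_theorem_of_algebra[OF nc] by (rule exE)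
  then have "[:- c, 1:] dvd F" by (simp add: poly_eq_0_iff_dvd)
  then obtain G where G: "F = [:- c, 1:] * G" by (rule dvdE)
  have "G \<noteq> 0" using Suc.prems(1) G by auto
  have "degree F = Suc (degree G)"
    unfolding G using \<open>G \<noteq> 0\<close> by (subst degree_mult_eq) auto
  then have "degree G = n" using Suc.hyps(2) by simp
  have "poly (map_poly cst F) x = (x - cst c) * poly (map_poly cst G) x"
    unfolding G map_poly_cst_mult
    by (simp add: map_poly_pCons cst_uminus del: mult_pCons_left)
  then have "(x - cst c) \<in> q \<or> poly (map_poly cst G) x \<in> q"
    using Suc.prems(2) q by (simp add: prime_mult_iff)
  then show ?case using Suc.hyps(1)[of G] \<open>G \<noteq> 0\<close> \<open>degree G = n\<close> by auto
qed

text \<open>A strong form of the Nullstellensatz. If \<open>q\<close> is maximal among the ideals that miss the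
  multiplicative set generated by \<open>W\<close>, then the localisation of the quotient is a field of
  countable dimension; if \<open>x\<close> were not a scalar there, the elements \<open>1 / (x - c)\<close> would be
  uncountably many, hence linearly dependent.\<close>

lemma point_avoiding_countable:
  assumes p: "is_prime p" and W: "countable W" "W \<inter> p = {}"
  shows "\<exists>f. is_point f \<and> p \<subseteq> point_ideal f \<and> (\<forall>w\<in>W. f w \<noteq> 0)"
proof -
  define S where "S = prod_list ` lists W"
  have Sc: "countable S" using W(1) by (auto simp: S_def)
  have S1: "1 \<in> S" unfolding S_def by (intro image_eqI[of _ _ "[]"]) auto
  have Sm: "s * t \<in> S" if st: "s \<in> S" "t \<in> S" for s t
  proof -
    obtain l m where "s = prod_list l" "t = prod_list m" "l \<in> lists W" "m \<in> lists W"
      using st by (auto simp: S_def)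
    then show ?thesis unfolding S_def by (intro image_eqI[of _ _ "l @ m"]) auto
  qed
  have SW: "W \<subseteq> S"
  proof
    fix w assume "w \<in> W"
    then show "w \<in> S" unfolding S_def by (intro image_eqI[of _ _ "[w]"]) auto
  qed
  have "prod_list l \<notin> p" if "l \<in> lists W" for l
    using that by (induction l) (use p W(2) in \<open>auto simp: prime_one prime_mult_iff\<close>)
  then have Sp: "S \<inter> p = {}" by (auto simp: S_def)
  define A where "A = {q. is_ideal q \<and> p \<subseteq> q \<and> S \<inter> q = {}}"
  have "\<exists>q\<in>A. \<forall>q'\<in>A. q \<subseteq> q' \<longrightarrow> q' = q"
  proof (rule subset_Zorn_nonempty)
    show "A \<noteq> {}" using p Sp by (auto simp: A_def prime_ideal)
    fix C assume C: "C \<noteq> {}" "subset.chain A C"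
    have CA: "C \<subseteq> A" using C(2) by (auto simp: subset.chain_def)
    have "is_ideal (\<Union>C)"
      unfolding is_ideal_def
    proof (intro conjI ballI allI)
      show "0 \<in> \<Union>C" using C(1) CA by (fastforce simp: A_def is_ideal_0)
    next
      fix a b assume "a \<in> \<Union>C" "b \<in> \<Union>C"
      then obtain I1 I2 where I: "I1 \<in> C" "I2 \<in> C" "a \<in> I1" "b \<in> I2" by auto
      then have "I1 \<subseteq> I2 \<or> I2 \<subseteq> I1" using C(2) by (auto simp: subset.chain_def)
      then obtain I3 where "I3 \<in> C" "a \<in> I3" "b \<in> I3" using I by auto
      moreover have "is_ideal I3" using CA \<open>I3 \<in> C\<close> by (auto simp: A_def)
      ultimately show "a + b \<in> \<Union>C" by (blast intro: is_ideal_add)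
    next
      fix a r assume "a \<in> \<Union>C"
      then obtain I3 where "I3 \<in> C" "a \<in> I3" by auto
      moreover have "is_ideal I3" using CA \<open>I3 \<in> C\<close> by (auto simp: A_def)
      ultimately show "r * a \<in> \<Union>C" by (blast intro: is_ideal_mult)
    qed
    then show "\<Union>C \<in> A" using C(1) CA by (auto simp: A_def)
  qed
  then obtain q where q: "is_ideal q" "p \<subseteq> q" "S \<inter> q = {}"
    and qmax: "\<And>q'. is_ideal q' \<Longrightarrow> q \<subseteq> q' \<Longrightarrow> S \<inter> q' = {} \<Longrightarrow> q' = q"
    by (auto simp: A_def)
  \<comment> \<open>By maximality the ideal generated by \<open>q\<close> and \<open>x\<close> meets
    \<open>S\<close>: modulo \<open>q\<close>, each element outside \<open>q\<close> divides an
    element of \<open>S\<close>.\<close>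
  have meet: "\<exists>s\<in>S. \<exists>a. s - a * x \<in> q" if x: "x \<notin> q" for x
  proof (rule ccontr)
    assume n: "\<not> ?thesis"
    define q' where "q' = {y. \<exists>a. y - a * x \<in> q}"
    have "is_ideal q'" unfolding is_ideal_def q'_def mem_Collect_eq
    proof (intro conjI ballI allI)
      show "\<exists>a. 0 - a * x \<in> q" using is_ideal_0[OF q(1)] by (intro exI[of _ 0]) simp
      fix y z assume "y \<in> {y. \<exists>a. y - a * x \<in> q}"
      then obtain a where a: "y - a * x \<in> q" by auto
      {
        assume "z \<in> {y. \<exists>a. y - a * x \<in> q}"
        then obtain b where b: "z - b * x \<in> q" by auto
        show "\<exists>a. y + z - a * x \<in> q"
          using is_ideal_add[OF q(1) a b] by (intro exI[of _ "a + b"]) (simp add: algebra_simps)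
      }
      show "\<exists>b. r * y - b * x \<in> q" for r
        using is_ideal_mult[OF q(1) a, of r] by (intro exI[of _ "r * a"]) (simp add: algebra_simps)
    qed
    moreover have "q \<subseteq> q'"
    proof
      fix y assume "y \<in> q"
      then show "y \<in> q'" unfolding q'_def by (auto intro: exI[of _ 0])
    qed
    moreover have "S \<inter> q' = {}" using n by (auto simp: q'_def)
    ultimately have "q' = q" by (rule qmax)
    moreover have "x \<in> q'" unfolding q'_def using is_ideal_0[OF q(1)] by (auto intro: exI[of _ 1])
    ultimately show False using x by simp
  qed
  have qp: "is_prime q" unfolding is_prime_def
  proof (intro conjI allI impI)
    show "is_ideal q" by fact
    show "1 \<notin> q" using S1 q(3) by auto
    fix a b assume ab: "a * b \<in> q"
    show "a \<in> q \<or> b \<in> q"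
    proof (rule ccontr)
      assume "\<not> ?thesis"
      then obtain s a' t b' where s: "s \<in> S" "s - a' * a \<in> q" and t: "t \<in> S" "t - b' * b \<in> q"
        using meet[of a] meet[of b] by blast
      have "(s - a' * a) * t + a' * a * (t - b' * b) + a' * b' * (a * b) \<in> q"
        by (intro is_ideal_add[OF q(1)] is_ideal_mult[OF q(1)] is_ideal_mult2[OF q(1)] s t ab)
      then have "s * t \<in> q" by (simp add: algebra_simps)
      then show False using Sm[OF s(1) t(1)] q(3) by auto
    qed
  qed
  have ex: "\<exists>c. x - cst c \<in> q" for x
  proof (rule ccontr)
    assume n: "\<nexists>c. x - cst c \<in> q"
    have "\<forall>c. \<exists>s a. s \<in> S \<and> s - a * (x - cst c) \<in> q" using n meet by blast
    then obtain s a where s: "\<And>c. s c \<in> S" "\<And>c. s c - a c * (x - cst c) \<in> q" by metis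
    have "\<forall>c. \<exists>N d. a c = (\<Sum>i<N. cst (d i) * monomial i)" using falg_monomial_expansion by blast
    then obtain N d where N: "\<And>c. a c = (\<Sum>i<N c. cst (d c i) * monomial i)" by metis
    \<comment> \<open>Each scalar \<open>c\<close> comes with a denominator in the countable set
      \<open>S\<close> and a length of the expansion of its numerator. Uncountably many scalars
      force infinitely many to share both, and \<open>k + 1\<close> numerators spanned by the same
      \<open>k\<close> monomials are dependent.\<close>
    define Fib where "Fib = (\<lambda>(t, k). {c. s c = t \<and> N c = k})"
    have "\<exists>tk\<in>S \<times> UNIV. infinite (Fib tk)"
    proof (rule ccontr)
      assume "\<not> ?thesis"
      then have "countable (\<Union>tk\<in>S \<times> UNIV. Fib tk)"
        using Sc by (intro countable_UN countable_SIGMA) (auto intro: countable_finite)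
      moreover have "(\<Union>tk\<in>S \<times> UNIV. Fib tk) = UNIV" using s(1) by (auto simp: Fib_def)
      ultimately have "countable (UNIV :: complex set)" by simp
      then have "countable (range complex_of_real)" by (rule countable_subset[rotated]) simp
      then have "countable (UNIV :: real set)"
        using countable_image_inj_on[of complex_of_real UNIV] by (simp add: inj_on_def)
      then show False using uncountable_UNIV_real by simp
    qed
    then obtain t k where tk: "t \<in> S" "infinite (Fib (t, k))" by auto
    obtain L where L: "finite L" "card L = Suc k" "L \<subseteq> Fib (t, k)"
      using infinite_arbitrarily_large[OF tk(2)] by blast
    obtain e where e: "\<exists>c\<in>L. e c \<noteq> 0" "\<forall>i\<in>{..<k}. (\<Sum>c\<in>L. e c * d c i) = 0"
      using homogeneous_system_complex[of "{..<k}" L d] L by auto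
    have "(\<Sum>c\<in>L. cst (e c) * a c) = (\<Sum>c\<in>L. cst (e c) * (\<Sum>i<k. cst (d c i) * monomial i))"
      using L(3) by (intro sum.cong) (auto simp: N Fib_def)
    also have "\<dots> = (\<Sum>i<k. cst (\<Sum>c\<in>L. e c * d c i) * monomial i)"
      unfolding sum_distrib_left cst_sum sum_distrib_right
      by (subst sum.swap) (simp add: cst_mult mult.assoc)
    also have "\<dots> = 0" using e(2) by simp
    finally have ea: "(\<Sum>c\<in>L. cst (e c) * a c) = 0" .
    \<comment> \<open>The numerator of the sum of the fractions \<open>e c / (X - c)\<close>. At a
      \<open>c\<close> in \<open>L\<close> with \<open>e c\<close> nonzero only one summand
      survives, so \<open>F\<close> is not the zero polynomial.\<close>
    define F where "F = (\<Sum>c\<in>L. smult (e c) (\<Prod>b\<in>L - {c}. [:- b, 1:]))"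
    have pm: "poly (map_poly cst (\<Prod>b\<in>L'. [:- b, 1:])) x = (\<Prod>b\<in>L'. x - cst b)" if "finite L'" for L'
      using that by (induction L' rule: finite_induct)
        (simp_all add: map_poly_cst_mult map_poly_pCons cst_uminus del: mult_pCons_left)
    have madd: "map_poly cst (sum f L') = (\<Sum>c\<in>L'. map_poly cst (f c))" for f and L' :: "complex set"
      by (intro poly_eqI) (simp add: coeff_map_poly coeff_sum cst_sum)
    have msm: "map_poly cst (smult c f) = smult (cst c) (map_poly cst f)" for c f
      by (intro poly_eqI) (simp add: coeff_map_poly cst_mult)
    have Fx: "poly (map_poly cst F) x = (\<Sum>c\<in>L. cst (e c) * (\<Prod>b\<in>L - {c}. x - cst b))"
      unfolding F_def madd poly_sum msm using L(1) by (simp add: pm)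
    have "t * poly (map_poly cst F) x
        = (\<Sum>c\<in>L. cst (e c) * (\<Prod>b\<in>L - {c}. x - cst b) * (t - a c * (x - cst c)))
          + (\<Sum>c\<in>L. cst (e c) * a c * ((x - cst c) * (\<Prod>b\<in>L - {c}. x - cst b)))"
      unfolding Fx by (simp add: sum_distrib_left sum.distrib[symmetric] algebra_simps)
    also have "(\<Sum>c\<in>L. cst (e c) * a c * ((x - cst c) * (\<Prod>b\<in>L - {c}. x - cst b)))
        = (\<Sum>c\<in>L. cst (e c) * a c * (\<Prod>b\<in>L. x - cst b))"
      using L(1) by (intro sum.cong refl) (simp add: prod.remove)
    also have "\<dots> = 0" using ea by (simp add: sum_distrib_right[symmetric])
    finally have "t * poly (map_poly cst F) x
      = (\<Sum>c\<in>L. cst (e c) * (\<Prod>b\<in>L - {c}. x - cst b) * (t - a c * (x - cst c)))" by simp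
    also have "\<dots> \<in> q"
    proof (intro is_ideal_sum[OF q(1)] is_ideal_mult[OF q(1)])
      fix c assume "c \<in> L"
      then have "s c = t" using L(3) by (auto simp: Fib_def)
      then show "t - a c * (x - cst c) \<in> q" using s(2)[of c] by simp
    qed
    finally have "poly (map_poly cst F) x \<in> q" using tk(1) q(3) qp by (auto simp: prime_mult_iff)
    moreover have "F \<noteq> 0"
    proof -
      obtain c where c: "c \<in> L" "e c \<noteq> 0" using e(1) by auto
      have "poly F c = (\<Sum>b\<in>L. e b * (\<Prod>b'\<in>L - {b}. c - b'))"
        by (simp add: F_def poly_sum poly_prod)
      also have "\<dots> = (\<Sum>b\<in>L. if b = c then e c * (\<Prod>b'\<in>L - {c}. c - b') else 0)"
        using L(1) c(1) by (intro sum.cong) auto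
      also have "\<dots> = e c * (\<Prod>b'\<in>L - {c}. c - b')" using L(1) c(1) by simp
      also have "\<dots> \<noteq> 0" using L(1) c(2) by auto
      finally show ?thesis by auto
    qed
    ultimately show False using prime_poly_root[OF qp] n by blast
  qed
  define f where "f x = (SOME c. x - cst c \<in> q)" for x
  have fq: "x - cst (f x) \<in> q" for x unfolding f_def using ex by (rule someI_ex)
  have fI: "f x = c" if "x - cst c \<in> q" for x c
  proof -
    have "(x - cst c) - (x - cst (f x)) \<in> q" by (rule is_ideal_diff[OF q(1) that fq])
    then have "cst (f x - c) \<in> q" by (simp add: cst_diff)
    then show ?thesis using prime_cst[OF qp] by simp
  qed
  have "is_point f" unfolding is_point_def
  proof (intro conjI allI)
    fix a b c
    show "f (a + b) = f a + f b"
      using is_ideal_add[OF q(1) fq[of a] fq[of b]] by (intro fI) (simp add: cst_add algebra_simps)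
    have "(a - cst (f a)) * b + cst (f a) * (b - cst (f b)) \<in> q"
      by (intro is_ideal_add[OF q(1)] is_ideal_mult[OF q(1)] is_ideal_mult2[OF q(1)] fq)
    then show "f (a * b) = f a * f b" by (intro fI) (simp add: cst_mult algebra_simps)
    show "f (cst c) = c" by (intro fI) (simp add: is_ideal_0[OF q(1)])
  qed
  moreover have ker: "x \<in> q \<longleftrightarrow> f x = 0" for x
    using fI[of x 0] fq[of x] by auto
  then have "p \<subseteq> point_ideal f" using q(2) by (auto simp: point_ideal_def)
  moreover have "\<forall>w\<in>W. f w \<noteq> 0" using SW q(3) ker by auto
  ultimately show ?thesis by blast
qed

lemma nullstellensatz:
  assumes "is_prime p" "x \<notin> p"
  shows "\<exists>f. is_point f \<and> p \<subseteq> point_ideal f \<and> f x \<noteq> 0"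
  using point_avoiding_countable[of p "{x}"] assms by auto

section \<open>Finitely many variables: Noetherianity, rank and growth\<close>

inductive_set subalg :: "nat \<Rightarrow> falg set" for j where
  subalg_cst: "cst c \<in> subalg j"
| subalg_var: "i < j \<Longrightarrow> var i \<in> subalg j"
| subalg_add: "x \<in> subalg j \<Longrightarrow> y \<in> subalg j \<Longrightarrow> x + y \<in> subalg j"
| subalg_mult: "x \<in> subalg j \<Longrightarrow> y \<in> subalg j \<Longrightarrow> x * y \<in> subalg j"

lemma subalg_0: "0 \<in> subalg j" and subalg_1: "1 \<in> subalg j"
  using subalg_cst[of 0 j] subalg_cst[of 1 j] by simp_all

lemma subalg_uminus: "x \<in> subalg j \<Longrightarrow> - x \<in> subalg j"
  using subalg_mult[OF subalg_cst[of "-1"]] by (simp add: cst_uminus)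

lemma subalg_diff: "x \<in> subalg j \<Longrightarrow> y \<in> subalg j \<Longrightarrow> x - y \<in> subalg j"
  using subalg_add[of x j "-y"] subalg_uminus[of y j] by simp

lemma subalg_power: "x \<in> subalg j \<Longrightarrow> x ^ k \<in> subalg j"
  by (induction k) (auto intro: subalg_1 subalg_mult)

lemma subalg_Suc: "x \<in> subalg j \<Longrightarrow> x \<in> subalg (Suc j)"
  by (induction rule: subalg.induct) (auto intro: subalg.intros)

text \<open>An element may have several such expressions, so a leading coefficient belongs to an
  expression and not to the element.\<close>

definition poly_less :: "falg set \<Rightarrow> falg \<Rightarrow> nat \<Rightarrow> falg set" where
  "poly_less S y m = {x. \<exists>b. (\<forall>i. b i \<in> S) \<and> x = (\<Sum>i<m. b i * y ^ i)}"

lemma poly_less_I: "(\<And>i. b i \<in> S) \<Longrightarrow> x = (\<Sum>i<m. b i * y ^ i) \<Longrightarrow> x \<in> poly_less S y m"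
  by (auto simp: poly_less_def)

lemma poly_less_zero: "poly_less (subalg j) y 0 = {0}"
  by (auto simp: poly_less_def intro: subalg_0)

lemma poly_less_0: "0 \<in> poly_less (subalg j) y m"
  by (rule poly_less_I[of "\<lambda>_. 0"]) (auto intro: subalg_0)

lemma poly_less_add:
  "x \<in> poly_less (subalg j) y m \<Longrightarrow> z \<in> poly_less (subalg j) y m \<Longrightarrow> x + z \<in> poly_less (subalg j) y m"
proof -
  assume "x \<in> poly_less (subalg j) y m" "z \<in> poly_less (subalg j) y m"
  then obtain b d where b: "\<And>i. b i \<in> subalg j" "x = (\<Sum>i<m. b i * y ^ i)"
    and d: "\<And>i. d i \<in> subalg j" "z = (\<Sum>i<m. d i * y ^ i)" by (auto simp: poly_less_def)
  show ?thesis
    by (rule poly_less_I[of "\<lambda>i. b i + d i"]) (auto simp: b d sum.distrib algebra_simps intro: subalg_add)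
qed

lemma poly_less_mult:
  "s \<in> subalg j \<Longrightarrow> x \<in> poly_less (subalg j) y m \<Longrightarrow> s * x \<in> poly_less (subalg j) y m"
proof -
  assume s: "s \<in> subalg j" and "x \<in> poly_less (subalg j) y m"
  then obtain b where b: "\<And>i. b i \<in> subalg j" "x = (\<Sum>i<m. b i * y ^ i)" by (auto simp: poly_less_def)
  show ?thesis
    by (rule poly_less_I[of "\<lambda>i. s * b i"]) (auto simp: b s sum_distrib_left mult.assoc intro: subalg_mult)
qed

lemma poly_less_Suc:
  "x \<in> poly_less (subalg j) y (Suc m) \<longleftrightarrow>
    (\<exists>a\<in>subalg j. x - a * y ^ m \<in> poly_less (subalg j) y m)"
proof
  assume "x \<in> poly_less (subalg j) y (Suc m)"
  then obtain b where b: "\<And>i. b i \<in> subalg j" "x = (\<Sum>i<Suc m. b i * y ^ i)" by (auto simp: poly_less_def)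
  have "x - b m * y ^ m \<in> poly_less (subalg j) y m"
    by (rule poly_less_I[of b]) (auto simp: b)
  then show "\<exists>a\<in>subalg j. x - a * y ^ m \<in> poly_less (subalg j) y m" using b(1) by blast
next
  assume "\<exists>a\<in>subalg j. x - a * y ^ m \<in> poly_less (subalg j) y m"
  then obtain a b where a: "a \<in> subalg j" and b: "\<And>i. b i \<in> subalg j" "x - a * y ^ m = (\<Sum>i<m. b i * y ^ i)"
    by (auto simp: poly_less_def)
  have "(\<Sum>i<m. (b(m := a)) i * y ^ i) = (\<Sum>i<m. b i * y ^ i)" by (intro sum.cong) auto
  then have "x = (\<Sum>i<Suc m. (b(m := a)) i * y ^ i)" using b(2) by (simp add: algebra_simps)
  then show "x \<in> poly_less (subalg j) y (Suc m)" using a b by (intro poly_less_I[of "b(m := a)"]) auto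
qed

lemma poly_less_mono: "x \<in> poly_less (subalg j) y m \<Longrightarrow> m \<le> m' \<Longrightarrow> x \<in> poly_less (subalg j) y m'"
proof (induction m')
  case (Suc m')
  show ?case
  proof (cases "m = Suc m'")
    case False
    then have "x \<in> poly_less (subalg j) y m'" using Suc by simp
    then show ?thesis unfolding poly_less_Suc by (intro bexI[of _ 0] subalg_0) simp
  qed (use Suc in simp)
qed simp

lemma poly_less_sum:
  "(\<And>i. i \<in> S \<Longrightarrow> f i \<in> poly_less (subalg j) y m) \<Longrightarrow> sum f S \<in> poly_less (subalg j) y m"
  by (induction S rule: infinite_finite_induct) (auto intro: poly_less_0 poly_less_add)

lemma poly_less_shift:
  "x \<in> poly_less (subalg j) y m \<Longrightarrow> y * x \<in> poly_less (subalg j) y (Suc m)"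
proof -
  assume "x \<in> poly_less (subalg j) y m"
  then obtain b where b: "\<And>i. b i \<in> subalg j" "x = (\<Sum>i<m. b i * y ^ i)" by (auto simp: poly_less_def)
  show ?thesis
  proof (rule poly_less_I[of "\<lambda>i. case i of 0 \<Rightarrow> 0 | Suc i \<Rightarrow> b i"])
    show "y * x = (\<Sum>i<Suc m. (case i of 0 \<Rightarrow> 0 | Suc i \<Rightarrow> b i) * y ^ i)"
      by (subst sum.lessThan_Suc_shift) (simp add: b sum_distrib_left mult_ac)
  qed (auto simp: b subalg_0 split: nat.split)
qed

lemma poly_less_shift_power:
  "x \<in> poly_less (subalg j) y m \<Longrightarrow> y ^ k * x \<in> poly_less (subalg j) y (m + k)"
  by (induction k) (auto simp: mult.assoc dest: poly_less_shift)

lemma poly_less_prod: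
  "x \<in> poly_less (subalg j) y m \<Longrightarrow> z \<in> poly_less (subalg j) y k \<Longrightarrow> x * z \<in> poly_less (subalg j) y (k + m)"
proof (induction m arbitrary: x)
  case 0
  then show ?case by (simp add: poly_less_zero poly_less_0)
next
  case (Suc m)
  then obtain a where a: "a \<in> subalg j" "x - a * y ^ m \<in> poly_less (subalg j) y m"
    by (auto simp: poly_less_Suc)
  have "(x - a * y ^ m) * z \<in> poly_less (subalg j) y (k + Suc m)"
    using Suc.IH[OF a(2) Suc.prems(2)] by (rule poly_less_mono) simp
  moreover have "a * (y ^ m * z) \<in> poly_less (subalg j) y (k + Suc m)"
    using poly_less_mult[OF a(1) poly_less_shift_power[OF Suc.prems(2)]] by (rule poly_less_mono) simp
  ultimately have "(x - a * y ^ m) * z + a * (y ^ m * z) \<in> poly_less (subalg j) y (k + Suc m)"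
    by (rule poly_less_add)
  then show ?case by (simp add: algebra_simps)
qed

lemma poly_less_const: "a \<in> subalg j \<Longrightarrow> a \<in> poly_less (subalg j) y (Suc 0)"
  by (simp add: poly_less_Suc poly_less_zero)

lemma subalg_Suc_poly: "x \<in> subalg (Suc j) \<Longrightarrow> \<exists>m. x \<in> poly_less (subalg j) (var j) m"
proof (induction rule: subalg.induct)
  case (subalg_cst c)
  then show ?case using poly_less_const[OF subalg.subalg_cst] by blast
next
  case (subalg_var i)
  show ?case
  proof (cases "i = j")
    case True
    have "var j * 1 \<in> poly_less (subalg j) (var j) (Suc (Suc 0))"
      by (intro poly_less_shift poly_less_const subalg_1)
    then show ?thesis using True by auto
  next
    case False
    then show ?thesis using subalg_var poly_less_const[OF subalg.subalg_var[of i j]] by auto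
  qed
next
  case (subalg_add x y)
  then obtain m k where "x \<in> poly_less (subalg j) (var j) m" "y \<in> poly_less (subalg j) (var j) k" by auto
  then have "x \<in> poly_less (subalg j) (var j) (max m k)" "y \<in> poly_less (subalg j) (var j) (max m k)"
    by (auto elim: poly_less_mono)
  then show ?case using poly_less_add by blast
next
  case (subalg_mult x y)
  then show ?case using poly_less_prod by blast
qed

definition ideal_of :: "falg set \<Rightarrow> falg set \<Rightarrow> bool" where
  "ideal_of S Q \<longleftrightarrow> Q \<subseteq> S \<and> 0 \<in> Q \<and> (\<forall>a\<in>Q. \<forall>b\<in>Q. a + b \<in> Q) \<and> (\<forall>a\<in>Q. \<forall>r\<in>S. r * a \<in> Q)"

lemma ideal_of_sum: "ideal_of S Q \<Longrightarrow> (\<And>i. i \<in> I \<Longrightarrow> f i \<in> Q) \<Longrightarrow> sum f I \<in> Q"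
  by (induction I rule: infinite_finite_induct) (auto simp: ideal_of_def)

definition generated :: "falg set \<Rightarrow> falg set \<Rightarrow> falg set" where
  "generated S G = {x. \<exists>c. (\<forall>g. c g \<in> S) \<and> x = (\<Sum>g\<in>G. c g * g)}"

lemma generated_add:
  "x \<in> generated (subalg j) G \<Longrightarrow> y \<in> generated (subalg j) G \<Longrightarrow> x + y \<in> generated (subalg j) G"
proof -
  assume "x \<in> generated (subalg j) G" "y \<in> generated (subalg j) G"
  then obtain c d where c: "\<And>g. c g \<in> subalg j" "x = (\<Sum>g\<in>G. c g * g)"
    and d: "\<And>g. d g \<in> subalg j" "y = (\<Sum>g\<in>G. d g * g)" by (auto simp: generated_def)
  have "x + y = (\<Sum>g\<in>G. (c g + d g) * g)" by (simp add: c d sum.distrib algebra_simps)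
  moreover have "\<forall>g. c g + d g \<in> subalg j" using c d by (auto intro: subalg_add)
  ultimately show ?thesis unfolding generated_def by (intro CollectI exI[of _ "\<lambda>g. c g + d g"] conjI)
qed

lemma generated_mult:
  "s \<in> subalg j \<Longrightarrow> x \<in> generated (subalg j) G \<Longrightarrow> s * x \<in> generated (subalg j) G"
proof -
  assume s: "s \<in> subalg j" and "x \<in> generated (subalg j) G"
  then obtain c where c: "\<And>g. c g \<in> subalg j" "x = (\<Sum>g\<in>G. c g * g)" by (auto simp: generated_def)
  have "s * x = (\<Sum>g\<in>G. (s * c g) * g)" by (simp add: c sum_distrib_left mult.assoc)
  moreover have "\<forall>g. s * c g \<in> subalg j" using c s by (auto intro: subalg_mult)
  ultimately show ?thesis unfolding generated_def by (intro CollectI exI[of _ "\<lambda>g. s * c g"] conjI)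
qed

lemma generated_0: "0 \<in> generated (subalg j) G"
  unfolding generated_def by (intro CollectI exI[of _ "\<lambda>_. 0"]) (auto intro: subalg_0)

lemma generated_self: "finite G \<Longrightarrow> g \<in> G \<Longrightarrow> g \<in> generated (subalg j) G"
proof -
  assume G: "finite G" "g \<in> G"
  have "(\<Sum>h\<in>G. (if h = g then 1 else 0) * h) = (\<Sum>h\<in>G. if h = g then g else 0)"
    by (intro sum.cong) auto
  also have "\<dots> = g" using G by simp
  finally show ?thesis
    unfolding generated_def by (intro CollectI exI[of _ "\<lambda>h. if h = g then 1 else 0"])
      (auto intro: subalg_0 subalg_1)
qed

lemma generated_sum: "(\<And>i. i \<in> S \<Longrightarrow> f i \<in> generated (subalg j) G) \<Longrightarrow> sum f S \<in> generated (subalg j) G"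
  by (induction S rule: infinite_finite_induct) (auto intro: generated_0 generated_add)

text \<open>Hilbert's argument, by induction on the number of variables: the ideals of leading
  coefficients increase with the degree and become stationary at some \<open>K\<close>, and lifts of
  generators for the degrees up to \<open>K\<close> generate the whole ideal. With no variables the
  ring is the field of constants.\<close>

lemma subalg_noetherian:
  "ideal_of (subalg j) Q \<Longrightarrow> \<exists>G\<subseteq>Q. finite G \<and> Q \<subseteq> generated (subalg j) G"
proof (induction j arbitrary: Q)
  case 0
  have c: "\<exists>c. x = cst c" if "x \<in> subalg 0" for x
    using that
  proof (induction rule: subalg.induct)
    case (subalg_add x y)
    then show ?case by (metis cst_add)
  next
    case (subalg_mult x y)
    then show ?case by (metis cst_mult)
  qed auto
  show ?case
  proof (cases "Q \<subseteq> {0}")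
    case True
    then show ?thesis using generated_0 by (intro exI[of _ "{}"]) auto
  next
    case False
    then obtain x where x: "x \<in> Q" "x \<noteq> 0" by auto
    then obtain c' where c': "x = cst c'" using c 0 by (auto simp: ideal_of_def)
    then have "c' \<noteq> 0" using x by auto
    have "y \<in> generated (subalg 0) {x}" if "y \<in> subalg 0" for y
    proof -
      have "y * cst (inverse c') * x \<in> generated (subalg 0) {x}"
        by (intro generated_mult generated_self subalg_mult that subalg_cst) auto
      then show ?thesis using cst_inverse[OF \<open>c' \<noteq> 0\<close>] c' by (simp add: mult.assoc)
    qed
    then show ?thesis using x 0 by (intro exI[of _ "{x}"]) (auto simp: ideal_of_def)
  qed
next
  case (Suc j)
  let ?S = "subalg j" and ?T = "subalg (Suc j)"
  let ?y = "var j"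
  have yT: "?y \<in> ?T" by (intro subalg_var) simp
  have ST: "?S \<subseteq> ?T" using subalg_Suc by auto
  note Qi = Suc.prems
  have Q: "Q \<subseteq> ?T" "0 \<in> Q" "\<And>a b. a \<in> Q \<Longrightarrow> b \<in> Q \<Longrightarrow> a + b \<in> Q"
      "\<And>a r. a \<in> Q \<Longrightarrow> r \<in> ?T \<Longrightarrow> r * a \<in> Q"
    using Suc.prems by (auto simp: ideal_of_def)
  \<comment> \<open>All coefficients of \<open>?y ^ k\<close> in expressions of degree at most
    \<open>k\<close> of elements of \<open>Q\<close>.\<close>
  define Lk where "Lk k = {a \<in> ?S. \<exists>x\<in>Q. x - a * ?y ^ k \<in> poly_less ?S ?y k}" for k
  have LkS: "a \<in> ?S" if "a \<in> Lk k" for a k using that by (simp add: Lk_def)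
  have add: "a + b \<in> Lk k" if ab: "a \<in> Lk k" "b \<in> Lk k" for a b k
  proof -
    obtain x z where "x \<in> Q" "x - a * ?y ^ k \<in> poly_less ?S ?y k"
      "z \<in> Q" "z - b * ?y ^ k \<in> poly_less ?S ?y k" using ab by (auto simp: Lk_def)
    then have "x + z \<in> Q" "(x - a * ?y ^ k) + (z - b * ?y ^ k) \<in> poly_less ?S ?y k"
      using Q(3) poly_less_add by auto
    moreover have "(x - a * ?y ^ k) + (z - b * ?y ^ k) = (x + z) - (a + b) * ?y ^ k"
      by (simp add: algebra_simps)
    ultimately show ?thesis using ab by (auto simp: Lk_def intro: subalg_add)
  qed
  have mult: "s * a \<in> Lk k" if sa: "s \<in> ?S" "a \<in> Lk k" for s a k
  proof -
    obtain x where "x \<in> Q" "x - a * ?y ^ k \<in> poly_less ?S ?y k" using sa by (auto simp: Lk_def)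
    then have "s * x \<in> Q" "s * (x - a * ?y ^ k) \<in> poly_less ?S ?y k"
      using Q(4) sa ST poly_less_mult by auto
    moreover have "s * (x - a * ?y ^ k) = s * x - s * a * ?y ^ k" by (simp add: algebra_simps)
    ultimately show ?thesis using sa by (auto simp: Lk_def intro: subalg_mult)
  qed
  have z: "0 \<in> Lk k" for k using Q(2) by (auto simp: Lk_def poly_less_0 intro!: subalg_0 bexI[of _ 0])
  have ideal: "ideal_of ?S (Lk k)" for k
    unfolding ideal_of_def using add mult z by (blast intro: subsetI dest: LkS)
  have mono1: "Lk k \<subseteq> Lk (Suc k)" for k
  proof
    fix a assume a: "a \<in> Lk k"
    then obtain x where "x \<in> Q" "x - a * ?y ^ k \<in> poly_less ?S ?y k" by (auto simp: Lk_def)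
    then have "?y * x \<in> Q" "?y * (x - a * ?y ^ k) \<in> poly_less ?S ?y (Suc k)"
      using Q(4) yT poly_less_shift by auto
    moreover have "?y * (x - a * ?y ^ k) = ?y * x - a * ?y ^ Suc k" by (simp add: algebra_simps)
    ultimately show "a \<in> Lk (Suc k)" using a by (auto simp: Lk_def)
  qed
  have mono: "Lk k \<subseteq> Lk l" if "k \<le> l" for k l
    by (rule lift_Suc_mono_le[of Lk, OF mono1 that])
  have "ideal_of ?S (\<Union>k. Lk k)"
    unfolding ideal_of_def
  proof (intro conjI ballI)
    fix a b assume "a \<in> (\<Union>k. Lk k)" "b \<in> (\<Union>k. Lk k)"
    then obtain k l where "a \<in> Lk k" "b \<in> Lk l" by auto
    then have "a \<in> Lk (max k l)" "b \<in> Lk (max k l)" using mono[of k "max k l"] mono[of l "max k l"] by auto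
    then show "a + b \<in> (\<Union>k. Lk k)" using add by blast
  qed (use z mult LkS in blast)+
  then obtain G where G: "G \<subseteq> (\<Union>k. Lk k)" "finite G" "(\<Union>k. Lk k) \<subseteq> generated ?S G"
    using Suc.IH by blast
  have "\<exists>K. G \<subseteq> Lk K" using G(2,1)
  proof (induction G rule: finite_induct)
    case (insert g G)
    then obtain K l where "G \<subseteq> Lk K" "g \<in> Lk l" by auto
    then have "insert g G \<subseteq> Lk (max K l)" using mono[of K "max K l"] mono[of l "max K l"] by auto
    then show ?case by blast
  qed auto
  then obtain K where K: "G \<subseteq> Lk K" by auto
  have LK: "Lk k \<subseteq> Lk K" for k
  proof
    fix a assume "a \<in> Lk k"
    then obtain c where c: "\<And>g. c g \<in> ?S" "a = (\<Sum>g\<in>G. c g * g)" using G(3) by (auto simp: generated_def)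
    have "(\<Sum>g\<in>G'. c g * g) \<in> Lk K" if "G' \<subseteq> G" for G'
      using finite_subset[OF that G(2)] that
      by (induction G' rule: finite_induct) (use K z add mult c(1) in auto)
    then show "a \<in> Lk K" using c by auto
  qed
  have "\<forall>k. \<exists>G\<subseteq>Lk k. finite G \<and> Lk k \<subseteq> generated ?S G" using Suc.IH ideal by blast
  then obtain Gk where Gk: "\<And>k. Gk k \<subseteq> Lk k" "\<And>k. finite (Gk k)" "\<And>k. Lk k \<subseteq> generated ?S (Gk k)"
    by metis
  have "\<forall>k. \<forall>g\<in>Gk k. \<exists>x. x \<in> Q \<and> x - g * ?y ^ k \<in> poly_less ?S ?y k"
    using Gk(1) by (force simp: Lk_def)
  then obtain lft where lft: "\<And>k g. g \<in> Gk k \<Longrightarrow> lft k g \<in> Q"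
      "\<And>k g. g \<in> Gk k \<Longrightarrow> lft k g - g * ?y ^ k \<in> poly_less ?S ?y k" by metis
  define H where "H = (\<Union>k\<le>K. lft k ` Gk k)"
  have H: "finite H" "H \<subseteq> Q" using Gk(2) lft(1) by (auto simp: H_def)
  have gen: "x \<in> generated ?T H" if "x \<in> Q" "x \<in> poly_less ?S ?y m" for x m
    using that
  proof (induction m arbitrary: x)
    case 0
    then show ?case by (simp add: poly_less_zero generated_0)
  next
    case (Suc m)
    then obtain a where a: "a \<in> ?S" "x - a * ?y ^ m \<in> poly_less ?S ?y m" by (auto simp: poly_less_Suc)
    \<comment> \<open>Above degree \<open>K\<close> there are no new leading coefficients, so lifts
      from level \<open>K\<close> are used and shifted by \<open>?y ^ (m - k)\<close>.\<close>
    define k where "k = min m K"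
    have "a \<in> Lk m" using a Suc.prems by (auto simp: Lk_def)
    then have "a \<in> Lk k" using LK[of m] by (auto simp: k_def min_def)
    then obtain c where c: "\<And>g. c g \<in> ?S" "a = (\<Sum>g\<in>Gk k. c g * g)"
      using Gk(3) by (auto simp: generated_def)
    \<comment> \<open>A combination of lifts with the same leading term as \<open>x\<close>;
      subtracting it lowers the degree within \<open>Q\<close>.\<close>
    define w where "w = (\<Sum>g\<in>Gk k. c g * (?y ^ (m - k) * lft k g))"
    have wQ: "w \<in> Q"
      unfolding w_def
    proof (rule ideal_of_sum[OF Qi])
      fix g assume g: "g \<in> Gk k"
      have "?y ^ (m - k) * lft k g \<in> Q" using lft(1)[OF g] subalg_power[OF yT] by (rule Q(4))
      then show "c g * (?y ^ (m - k) * lft k g) \<in> Q" by (rule Q(4)) (use c(1) ST in auto)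
    qed
    have km: "m - k + k = m" "k + (m - k) = m" by (auto simp: k_def)
    have "w - a * ?y ^ m = (\<Sum>g\<in>Gk k. c g * (?y ^ (m - k) * (lft k g - g * ?y ^ k)))"
    proof -
      have e: "?y ^ m = ?y ^ (m - k) * ?y ^ k" using km(1) by (simp add: power_add[symmetric])
      have "a * ?y ^ m = (\<Sum>g\<in>Gk k. c g * (?y ^ (m - k) * (g * ?y ^ k)))"
        unfolding c(2) sum_distrib_right e by (simp only: mult.assoc mult.left_commute)
      then show ?thesis by (simp add: w_def sum_subtractf[symmetric] right_diff_distrib)
    qed
    moreover have "\<dots> \<in> poly_less ?S ?y m"
    proof (rule poly_less_sum)
      fix g assume g: "g \<in> Gk k"
      show "c g * (?y ^ (m - k) * (lft k g - g * ?y ^ k)) \<in> poly_less ?S ?y m"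
        using poly_less_mult[OF c(1) poly_less_shift_power[OF lft(2)[OF g], of "m - k"]] km(2) by simp
    qed
    ultimately have wm: "w - a * ?y ^ m \<in> poly_less ?S ?y m" by simp
    have "(x - a * ?y ^ m) + (- 1) * (w - a * ?y ^ m) \<in> poly_less ?S ?y m"
      by (intro poly_less_add a poly_less_mult wm subalg_uminus subalg_1)
    then have "x - w \<in> poly_less ?S ?y m" by simp
    moreover have "x - w \<in> Q"
      using Q(3)[OF Suc.prems(1) Q(4)[OF wQ, of "-1"]] by (simp add: subalg_uminus subalg_1)
    ultimately have "x - w \<in> generated ?T H" by (intro Suc.IH)
    moreover have "w \<in> generated ?T H" unfolding w_def
    proof (intro generated_sum generated_mult)
      fix g assume g: "g \<in> Gk k"
      show "c g \<in> ?T" using c ST by auto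
      show "?y ^ (m - k) \<in> ?T" by (intro subalg_power yT)
      show "lft k g \<in> generated ?T H"
        using g by (intro generated_self H) (auto simp: H_def k_def)
    qed
    ultimately have "(x - w) + w \<in> generated ?T H" by (rule generated_add)
    then show ?case by simp
  qed
  have "Q \<subseteq> generated ?T H"
  proof
    fix x assume "x \<in> Q"
    moreover then obtain m where "x \<in> poly_less ?S ?y m" using subalg_Suc_poly Q(1) by blast
    ultimately show "x \<in> generated ?T H" by (rule gen)
  qed
  then show ?case using H by blast
qed

text \<open>Records that the quotient by \<open>J\<close> is generated by the first \<open>n\<close>
  variables, since \<open>falg\<close> itself has infinitely many.\<close>

definition vars_in :: "nat \<Rightarrow> falg set \<Rightarrow> bool" where
  "vars_in n J \<longleftrightarrow> (\<forall>i\<ge>n. var i \<in> J)"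

lemma vars_in_mono: "vars_in n J \<Longrightarrow> J \<subseteq> I \<Longrightarrow> vars_in n I"
  by (auto simp: vars_in_def)

text \<open>The variables from \<open>n\<close> on are replaced by 0. The claim on
  \<open>der v (x - s)\<close> is carried along because \<open>p\<close> is not assumed to be stable
  here: it later extends stability from elements of \<open>subalg n\<close> to all of
  \<open>p\<close>.\<close>

lemma subalg_mod:
  assumes p: "is_ideal p" and n: "vars_in n p" and v: "\<And>i. i \<ge> n \<Longrightarrow> v i \<in> p"
  shows "\<exists>s\<in>subalg n. x - s \<in> p \<and> der v (x - s) \<in> p"
proof (induction x rule: falg_induct)
  case (cst c)
  then show ?case using is_ideal_0[OF p]
    by (intro bexI[of _ "cst c"]) (auto intro: subalg_cst simp: derivation_0[OF der_derivation])
next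
  case (var i)
  show ?case
  proof (cases "i < n")
    case True
    then show ?thesis using is_ideal_0[OF p]
      by (intro bexI[of _ "var i"]) (auto intro: subalg_var simp: derivation_0[OF der_derivation])
  next
    case False
    then show ?thesis using n v by (intro bexI[of _ 0]) (auto simp: vars_in_def intro: subalg_0)
  qed
next
  case (add a b)
  then obtain s t where st: "s \<in> subalg n" "a - s \<in> p" "der v (a - s) \<in> p"
    "t \<in> subalg n" "b - t \<in> p" "der v (b - t) \<in> p" by auto
  have eq: "a + b - (s + t) = (a - s) + (b - t)" by simp
  show ?case
    by (rule bexI[of _ "s + t"], unfold eq derivation_add[OF der_derivation])
      (use st in \<open>auto intro: subalg_add is_ideal_add[OF p]\<close>)
next
  case (mult a b)
  then obtain s t where st: "s \<in> subalg n" "a - s \<in> p" "der v (a - s) \<in> p"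
    "t \<in> subalg n" "b - t \<in> p" "der v (b - t) \<in> p" by auto
  have eq: "a * b - s * t = a * (b - t) + t * (a - s)" by (simp add: algebra_simps)
  show ?case
    by (rule bexI[of _ "s * t"], unfold eq derivation_add[OF der_derivation] derivation_mult[OF der_derivation])
      (use st in \<open>auto intro!: subalg_mult is_ideal_add[OF p] is_ideal_mult[OF p] intro: is_ideal_mult2[OF p] is_ideal_mult[OF p]\<close>)
qed

lemma falg_noetherian:
  assumes J: "is_ideal J" "vars_in n J" and Q: "is_ideal Q" "J \<subseteq> Q"
  shows "\<exists>G\<subseteq>Q. finite G \<and> (\<forall>x\<in>Q. \<exists>c. x - (\<Sum>g\<in>G. c g * g) \<in> J)"
proof -
  have "ideal_of (subalg n) (Q \<inter> subalg n)"
    using Q(1) by (auto simp: ideal_of_def is_ideal_def intro: subalg_0 subalg_add subalg_mult)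
  then obtain G where G: "G \<subseteq> Q \<inter> subalg n" "finite G" "Q \<inter> subalg n \<subseteq> generated (subalg n) G"
    using subalg_noetherian by blast
  have "\<exists>c. x - (\<Sum>g\<in>G. c g * g) \<in> J" if x: "x \<in> Q" for x
  proof -
    obtain s where s: "s \<in> subalg n" "x - s \<in> J"
      using subalg_mod[OF J, of "\<lambda>_. 0" x] is_ideal_0[OF J(1)] by auto
    then have "x - (x - s) \<in> Q" using is_ideal_diff[OF Q(1) x, of "x - s"] Q(2) by blast
    then have "s \<in> generated (subalg n) G" using s G(3) by auto
    then show ?thesis using s(2) by (auto simp: generated_def)
  qed
  then show ?thesis using G by blast
qed

lemma ascending_ideals_stabilise:
  assumes J: "is_ideal J" "vars_in n J" and I: "\<And>k. is_ideal (I k)" "\<And>k. J \<subseteq> I k" "\<And>k. I k \<subseteq> I (Suc k)"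
  shows "\<exists>k. I (Suc k) = I k"
proof -
  have mono: "I k \<subseteq> I l" if "k \<le> l" for k l by (rule lift_Suc_mono_le[of I, OF I(3) that])
  have "is_ideal (\<Union>k. I k)"
    unfolding is_ideal_def
  proof (intro conjI ballI allI)
    show "0 \<in> (\<Union>k. I k)" using I(1) is_ideal_0 by auto
    fix a assume "a \<in> (\<Union>k. I k)"
    then obtain k where k: "a \<in> I k" by auto
    then show "r * a \<in> (\<Union>k. I k)" for r using is_ideal_mult[OF I(1)] by blast
    fix b assume "b \<in> (\<Union>k. I k)"
    then obtain l where l: "b \<in> I l" by auto
    have "a \<in> I (max k l)" "b \<in> I (max k l)" using k l mono[of k "max k l"] mono[of l "max k l"] by auto
    then show "a + b \<in> (\<Union>k. I k)" using is_ideal_add[OF I(1)] by blast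
  qed
  moreover have "J \<subseteq> (\<Union>k. I k)" using I(2) by auto
  ultimately obtain G where G: "G \<subseteq> (\<Union>k. I k)" "finite G" "\<forall>x\<in>\<Union>k. I k. \<exists>c. x - (\<Sum>g\<in>G. c g * g) \<in> J"
    using falg_noetherian[OF J] by metis
  have "\<exists>K. G \<subseteq> I K" using G(2,1)
  proof (induction G rule: finite_induct)
    case (insert g G)
    then obtain K l where "G \<subseteq> I K" "g \<in> I l" by auto
    then have "insert g G \<subseteq> I (max K l)" using mono[of K "max K l"] mono[of l "max K l"] by auto
    then show ?case by blast
  qed auto
  then obtain K where K: "G \<subseteq> I K" by auto
  have "I (Suc K) \<subseteq> I K"
  proof
    fix x assume "x \<in> I (Suc K)"
    then obtain c where c: "x - (\<Sum>g\<in>G. c g * g) \<in> J" using G(3) by blast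
    have "(\<Sum>g\<in>G. c g * g) \<in> I K" using K by (intro is_ideal_sum[OF I(1)] is_ideal_mult[OF I(1)]) auto
    then have "(x - (\<Sum>g\<in>G. c g * g)) + (\<Sum>g\<in>G. c g * g) \<in> I K"
      using c I(2) by (intro is_ideal_add[OF I(1)]) auto
    then show "x \<in> I K" by simp
  qed
  then show ?thesis using I(3) by blast
qed

lemma exists_maximal_ideal_in_family:
  assumes J: "is_ideal J" "vars_in n J" and F: "F \<noteq> {}" "\<And>I. I \<in> F \<Longrightarrow> is_ideal I \<and> J \<subseteq> I"
  shows "\<exists>I\<in>F. \<forall>I'\<in>F. I \<subseteq> I' \<longrightarrow> I' = I"
proof (rule ccontr)
  assume "\<not> ?thesis"
  then have "\<forall>I\<in>F. \<exists>I'. I' \<in> F \<and> I \<subset> I'" by blast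
  then obtain g where g: "\<And>I. I \<in> F \<Longrightarrow> g I \<in> F \<and> I \<subset> g I" by metis
  obtain I0 where "I0 \<in> F" using F by auto
  define I where "I k = (g ^^ k) I0" for k
  have IF: "I k \<in> F" for k using \<open>I0 \<in> F\<close> g by (induction k) (auto simp: I_def)
  then have "I k \<subset> I (Suc k)" for k using g[of "I k"] by (simp add: I_def)
  then show False using ascending_ideals_stabilise[OF J, of I] F(2) IF by blast
qed

section \<open>Transcendence bases and dual derivations\<close>

text \<open>For a prime \<open>p\<close> this says that \<open>var j\<close> is algebraic over the
  fraction field of the image of \<open>subalg j\<close>; the leading coefficient is kept nonzero
  modulo \<open>p\<close>.\<close>

definition alg_relation :: "falg set \<Rightarrow> nat \<Rightarrow> nat \<Rightarrow> (nat \<Rightarrow> falg) \<Rightarrow> bool" where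
  "alg_relation p j s a \<longleftrightarrow> s > 0 \<and> (\<forall>i. a i \<in> subalg j) \<and> a s \<notin> p \<and> (\<Sum>i\<le>s. a i * var j ^ i) \<in> p"

definition free_vars :: "nat \<Rightarrow> falg set \<Rightarrow> nat set" where
  "free_vars n p = {j. j < n \<and> \<not> (\<exists>s a. alg_relation p j s a)}"

text \<open>The variables \<open>var 0, \<dots>, var (n - 1)\<close> are adjoined one at a time; the free ones form a
  transcendence basis, so \<open>trdeg n p\<close> is the transcendence degree of the residue field of \<open>p\<close>.\<close>

definition trdeg :: "nat \<Rightarrow> falg set \<Rightarrow> nat" where
  "trdeg n p = card (free_vars n p)"

lemma finite_free_vars: "finite (free_vars n p)"
  by (simp add: free_vars_def)

lemma free_vars_less: "k \<in> free_vars n p \<Longrightarrow> k < n"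
  by (simp add: free_vars_def)

lemma trdeg_le: "trdeg n p \<le> n"
  unfolding trdeg_def using card_mono[of "{..<n}" "free_vars n p"] by (auto simp: free_vars_def)

text \<open>Below the degree of the shortest relation the powers of \<open>var j\<close> are
  independent over \<open>subalg j\<close> modulo \<open>p\<close>: a top coefficient outside
  \<open>p\<close> would itself give a relation.\<close>

lemma coefficients_in_prime:
  assumes p: "is_prime p" and no: "\<And>s a. alg_relation p j s a \<Longrightarrow> m < s"
    and b: "\<And>i. b i \<in> subalg j" "(\<Sum>i\<le>m. b i * var j ^ i) \<in> p"
  shows "i \<le> m \<Longrightarrow> b i \<in> p"
  using no b(2)
proof (induction m)
  case 0
  then show ?case by simp
next
  case (Suc m)
  have bm: "b (Suc m) \<in> p"
  proof (rule ccontr)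
    assume "b (Suc m) \<notin> p"
    then have "alg_relation p j (Suc m) b" using b(1) Suc.prems(3) by (simp add: alg_relation_def)
    then show False using Suc.prems(2) by blast
  qed
  have "(\<Sum>i\<le>Suc m. b i * var j ^ i) - b (Suc m) * var j ^ Suc m \<in> p"
    by (rule is_ideal_diff[OF prime_ideal[OF p] Suc.prems(3) is_ideal_mult2[OF prime_ideal[OF p] bm]])
  then have "(\<Sum>i\<le>m. b i * var j ^ i) \<in> p" by simp
  moreover have "\<And>s a. alg_relation p j s a \<Longrightarrow> m < s" using Suc.prems(2) Suc_lessD by blast
  ultimately show ?case using Suc.IH bm Suc.prems(1) by (cases "i = Suc m") auto
qed

lemma subalg_Suc_expansion:
  assumes "x \<in> subalg (Suc j)"
  obtains m b where "\<And>i. b i \<in> subalg j" "x = (\<Sum>i\<le>m. b i * var j ^ i)"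
proof -
  obtain m where "x \<in> poly_less (subalg j) (var j) m" using subalg_Suc_poly[OF assms] by auto
  then have "x \<in> poly_less (subalg j) (var j) (Suc m)" by (rule poly_less_mono) simp
  then show thesis using that by (auto simp: poly_less_def lessThan_Suc_atMost)
qed

lemma der_cong_subalg:
  assumes "x \<in> subalg j" "\<And>i. i < j \<Longrightarrow> v' i = u * v i"
  shows "der v' x = u * der v x"
  using assms(1)
proof (induction rule: subalg.induct)
  case (subalg_mult x y)
  then show ?case by (simp add: derivation_mult[OF der_derivation] algebra_simps)
qed (auto simp: derivation_add[OF der_derivation] assms(2) distrib_left)

lemma minimal_relation:
  assumes "alg_relation p j s0 a0"
  shows "\<exists>s a. alg_relation p j s a \<and> (\<forall>s' a'. alg_relation p j s' a' \<longrightarrow> s \<le> s')"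
proof -
  define s where "s = (LEAST s. \<exists>a. alg_relation p j s a)"
  have "\<exists>a. alg_relation p j s a" unfolding s_def using assms by (intro LeastI) auto
  moreover have "s \<le> s'" if "alg_relation p j s' a'" for s' a'
    unfolding s_def using that by (intro Least_le) auto
  ultimately show ?thesis by blast
qed

text \<open>The derivative has smaller degree than the shortest relation, so it could lie in
  \<open>p\<close> only with all its coefficients. The top one is \<open>s * a s\<close>, which is
  excluded in characteristic 0.\<close>

lemma minimal_relation_separable:
  assumes p: "is_prime p" and a: "alg_relation p j s a"
    and min: "\<And>s' a'. alg_relation p j s' a' \<Longrightarrow> s \<le> s'"
  shows "(\<Sum>i\<le>s. of_nat i * a i * var j ^ (i - 1)) \<notin> p"
proof
  assume in_p: "(\<Sum>i\<le>s. of_nat i * a i * var j ^ (i - 1)) \<in> p"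
  have s: "s > 0" "a s \<notin> p" and aS: "\<And>i. a i \<in> subalg j" using a by (auto simp: alg_relation_def)
  obtain t where t: "s = Suc t" using s by (cases s) auto
  have "(\<Sum>i\<le>s. of_nat i * a i * var j ^ (i - 1)) = (\<Sum>i\<le>t. of_nat (Suc i) * a (Suc i) * var j ^ i)"
    unfolding t by (subst sum.atMost_Suc_shift) simp
  moreover have S: "of_nat (Suc i) * a (Suc i) \<in> subalg j" for i
    unfolding cst_of_nat[symmetric] by (intro subalg_mult subalg_cst aS)
  moreover have "\<And>s' a'. alg_relation p j s' a' \<Longrightarrow> t < s'" using min t by fastforce
  ultimately have "of_nat (Suc t) * a (Suc t) \<in> p"
    using coefficients_in_prime[OF p, of j t "\<lambda>i. of_nat (Suc i) * a (Suc i)" t] in_p by simp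
  then show False using s t prime_of_nat[OF p, of "Suc t"] prime_mult_iff[OF p] by simp
qed

lemma der_poly:
  "der v (\<Sum>i\<le>m. b i * y ^ i) =
    (\<Sum>i\<le>m. der v (b i) * y ^ i) + (\<Sum>i\<le>m. of_nat i * b i * y ^ (i - 1)) * der v y"
proof -
  have "der v (b i * y ^ i) = der v (b i) * y ^ i + of_nat i * b i * y ^ (i - 1) * der v y" for i
    by (simp add: derivation_mult[OF der_derivation] derivation_power[OF der_derivation] mult_ac)
  then show ?thesis
    unfolding derivation_sum[OF der_derivation] by (simp only: sum.distrib sum_distrib_right)
qed

text \<open>A derivation that preserves the part of \<open>p\<close> in \<open>subalg j\<close> is
  extended by one variable. If \<open>var j\<close> is free, elements of \<open>p\<close> have all
  their coefficients in \<open>p\<close> and nothing changes; if it is algebraic, the relation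
  dictates the value at \<open>var j\<close>.\<close>

lemma free_var_derivation_step:
  assumes p: "is_prime p" and k: "k \<in> free_vars n p" and j: "j < n"
    and v: "\<And>x. x \<in> p \<Longrightarrow> x \<in> subalg j \<Longrightarrow> der v x \<in> p" "v k \<notin> p"
      "\<And>l. l \<in> free_vars n p \<Longrightarrow> l \<noteq> k \<Longrightarrow> v l = 0" "\<And>l. l \<ge> j \<Longrightarrow> l \<noteq> k \<Longrightarrow> v l = 0"
  shows "\<exists>v'. (\<forall>x\<in>p. x \<in> subalg (Suc j) \<longrightarrow> der v' x \<in> p) \<and> v' k \<notin> p \<and>
      (\<forall>l\<in>free_vars n p. l \<noteq> k \<longrightarrow> v' l = 0) \<and> (\<forall>l\<ge>Suc j. l \<noteq> k \<longrightarrow> v' l = 0)"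
proof (cases "j \<in> free_vars n p")
  case True
  then have no: "\<not> alg_relation p j s a" for s a by (auto simp: free_vars_def)
  note I = prime_ideal[OF p]
  have "der v x \<in> p" if x: "x \<in> p" "x \<in> subalg (Suc j)" for x
  proof -
    obtain b m where b: "\<And>i. b i \<in> subalg j" "x = (\<Sum>i\<le>m. b i * var j ^ i)"
      using subalg_Suc_expansion[OF x(2)] by metis
    have bp: "b i \<in> p" if "i \<le> m" for i
      using coefficients_in_prime[OF p, of j m b i] no b x that by auto
    show ?thesis unfolding b(2) der_poly
      using bp v(1) b(1)
      by (intro is_ideal_add[OF I] is_ideal_sum[OF I] is_ideal_mult2[OF I, of "sum _ _"]
          is_ideal_mult2[OF I is_ideal_mult[OF I]]) (auto intro: is_ideal_mult2[OF I])
  qed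
  then show ?thesis using v by (intro exI[of _ v]) auto
next
  case False
  note I = prime_ideal[OF p]
  obtain s0 a0 where "alg_relation p j s0 a0" using False j by (auto simp: free_vars_def)
  then obtain s a where a: "alg_relation p j s a" and min: "\<And>s' a'. alg_relation p j s' a' \<Longrightarrow> s \<le> s'"
    using minimal_relation by metis
  have s: "s > 0" "a s \<notin> p" and aS: "\<And>i. a i \<in> subalg j" and rel: "(\<Sum>i\<le>s. a i * var j ^ i) \<in> p"
    using a by (auto simp: alg_relation_def)
  define F where "F = (\<Sum>i\<le>s. a i * var j ^ i)"
  define u where "u = (\<Sum>i\<le>s. of_nat i * a i * var j ^ (i - 1))"
  have u: "u \<notin> p" unfolding u_def by (rule minimal_relation_separable[OF p a min])
  \<comment> \<open>Differentiating the relation \<open>F\<close> leaves only one possible value at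
    \<open>var j\<close>, with denominator \<open>u\<close>; the whole derivation is scaled by
    \<open>u\<close> to clear it.\<close>
  define v' where "v' = (\<lambda>i. u * v i)(j := - (\<Sum>i\<le>s. der v (a i) * var j ^ i))"
  have kj: "k \<noteq> j" using k False by auto
  have dS: "der v' x = u * der v x" if "x \<in> subalg j" for x
    using that by (rule der_cong_subalg) (simp add: v'_def)
  have dF: "der v' F = 0"
  proof -
    have "v' j = - (\<Sum>i\<le>s. der v (a i) * var j ^ i)" by (simp add: v'_def)
    then show ?thesis
      unfolding F_def der_poly u_def[symmetric] der_var
      by (simp add: dS[OF aS] sum_distrib_left mult.assoc)
  qed
  have key: "der v' x \<in> p" if x: "x \<in> p" "\<And>i. b i \<in> subalg j" "x = (\<Sum>i\<le>m. b i * var j ^ i)" for x m b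
    using x
  proof (induction m arbitrary: x b rule: less_induct)
    case (less m)
    show ?case
    proof (cases "m < s")
      case True
      then have bp: "b i \<in> p" if "i \<le> m" for i
        using coefficients_in_prime[OF p, of j m b i] min less.prems that by fastforce
      have "der v' (b i) \<in> p" if "i \<le> m" for i
        using bp[OF that] v(1) less.prems(2) by (simp add: dS is_ideal_mult[OF I])
      then show ?thesis unfolding less.prems(3) der_poly
        using bp
        by (intro is_ideal_add[OF I] is_ideal_sum[OF I] is_ideal_mult2[OF I, of "sum _ _"]
            is_ideal_mult2[OF I is_ideal_mult[OF I]]) (auto intro: is_ideal_mult2[OF I])
    next
      case False
      then obtain d where d: "m = s + d" using le_Suc_ex not_less by blast
      define c where "c = b m"
      \<comment> \<open>Pseudo-division by the relation: \<open>z\<close> has degree below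
        \<open>m\<close>. As \<open>der v' F = 0\<close> and \<open>a s\<close> is not in
        \<open>p\<close>, the claim for \<open>z\<close> gives the claim for
        \<open>x\<close>.\<close>
      define z where "z = a s * x - c * var j ^ d * F"
      define b' where "b' i = a s * b i - (if i < d then 0 else c * a (i - d))" for i
      have b'S: "b' i \<in> subalg j" for i
        unfolding b'_def c_def using less.prems(2) aS by (auto intro!: subalg_diff subalg_mult subalg_0)
      have "c * var j ^ d * F = (\<Sum>i\<le>m. (if i < d then 0 else c * a (i - d)) * var j ^ i)"
      proof -
        have "(\<Sum>i\<le>m. (if i < d then 0 else c * a (i - d)) * var j ^ i)
            = (\<Sum>i\<in>{d..m}. c * a (i - d) * var j ^ i)"
          by (rule sum.mono_neutral_cong_right) auto
        also have "\<dots> = (\<Sum>i\<in>{0..s}. c * a i * var j ^ (i + d))"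
          using sum.shift_bounds_cl_nat_ivl[of "\<lambda>i. c * a (i - d) * var j ^ i" 0 d s]
          by (simp add: d add.commute)
        finally show ?thesis
          by (simp add: F_def sum_distrib_left power_add atMost_atLeast0 mult_ac)
      qed
      then have zsum: "z = (\<Sum>i\<le>m. b' i * var j ^ i)"
        unfolding z_def b'_def less.prems(3)
        by (simp add: sum_distrib_left sum_subtractf left_diff_distrib mult.assoc)
      have "b' m = 0" using d s by (simp add: b'_def c_def)
      obtain m' where m': "m = Suc m'" using d s(1) by (metis add_is_0 gr0_implies_Suc neq0_conv)
      have z': "z = (\<Sum>i\<le>m'. b' i * var j ^ i)" using zsum \<open>b' m = 0\<close> m' by simp
      have Fp: "F \<in> p" using rel by (simp add: F_def)
      have "z \<in> p" unfolding z_def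
        by (intro is_ideal_diff[OF I] is_ideal_mult[OF I] less.prems(1) Fp)
      then have dz: "der v' z \<in> p" using less.IH[of m' z b'] m' b'S z' by simp
      have "der v' z = a s * der v' x + der v' (a s) * x - der v' (c * var j ^ d) * F"
        by (simp add: z_def derivation_diff[OF der_derivation] derivation_mult[OF der_derivation] dF)
      then have "a s * der v' x = der v' z - der v' (a s) * x + der v' (c * var j ^ d) * F" by simp
      also have "\<dots> \<in> p"
        by (intro is_ideal_add[OF I] is_ideal_diff[OF I] dz is_ideal_mult[OF I] less.prems(1) Fp)
      finally show ?thesis using s prime_mult_iff[OF p] by blast
    qed
  qed
  have "der v' x \<in> p" if x: "x \<in> p" "x \<in> subalg (Suc j)" for x
  proof -
    obtain b m where "\<And>i. b i \<in> subalg j" "x = (\<Sum>i\<le>m. b i * var j ^ i)"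
      using subalg_Suc_expansion[OF x(2)] by metis
    then show ?thesis using key x by blast
  qed
  moreover have "v' k \<notin> p" using u v(2) kj prime_mult_iff[OF p] by (simp add: v'_def)
  moreover have "\<forall>l\<in>free_vars n p. l \<noteq> k \<longrightarrow> v' l = 0" using v(3) False by (auto simp: v'_def)
  moreover have "\<forall>l\<ge>Suc j. l \<noteq> k \<longrightarrow> v' l = 0" using v(4) by (auto simp: v'_def)
  ultimately show ?thesis by blast
qed

text \<open>These derivations are dual to the transcendence basis of free variables, up to a factor
  outside \<open>p\<close>.\<close>

lemma free_var_derivation:
  assumes p: "is_prime p" and n: "vars_in n p" and k: "k \<in> free_vars n p"
  shows "\<exists>v. stable {der v} p \<and> v k \<notin> p \<and> (\<forall>l\<in>free_vars n p. l \<noteq> k \<longrightarrow> v l = 0) \<and> (\<forall>l\<ge>n. v l = 0)"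
proof -
  have kn: "k < n" using k by (rule free_vars_less)
  have "\<exists>v. (\<forall>x\<in>p. x \<in> subalg j \<longrightarrow> der v x \<in> p) \<and> v k \<notin> p \<and>
      (\<forall>l\<in>free_vars n p. l \<noteq> k \<longrightarrow> v l = 0) \<and> (\<forall>l\<ge>j. l \<noteq> k \<longrightarrow> v l = 0)" if "j \<le> n" for j
    using that
  proof (induction j)
    case 0
    \<comment> \<open>Derivations vanish on the constants, so at the start only the value at
      \<open>k\<close> has to be prescribed; algebraic variables are adjusted when they are
      adjoined.\<close>
    define v where "v = (\<lambda>i. if i = k then 1 else 0 :: falg)"
    have "der v x = 0" if "x \<in> subalg 0" for x
      using that by (induction rule: subalg.induct)
        (auto simp: derivation_add[OF der_derivation] derivation_mult[OF der_derivation])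
    then show ?case using prime_one[OF p] is_ideal_0[OF prime_ideal[OF p]]
      by (intro exI[of _ v]) (auto simp: v_def)
  next
    case (Suc j)
    then obtain v where "\<forall>x\<in>p. x \<in> subalg j \<longrightarrow> der v x \<in> p" "v k \<notin> p"
      "\<forall>l\<in>free_vars n p. l \<noteq> k \<longrightarrow> v l = 0" "\<forall>l\<ge>j. l \<noteq> k \<longrightarrow> v l = 0" by auto
    then show ?case using free_var_derivation_step[OF p k, of j v] Suc.prems by simp
  qed
  from this[of n] obtain v where v: "\<forall>x\<in>p. x \<in> subalg n \<longrightarrow> der v x \<in> p" "v k \<notin> p"
    "\<forall>l\<in>free_vars n p. l \<noteq> k \<longrightarrow> v l = 0" "\<forall>l\<ge>n. l \<noteq> k \<longrightarrow> v l = 0" by auto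
  have v0: "\<forall>l\<ge>n. v l = 0" using v(4) kn by auto
  have "der v x \<in> p" if x: "x \<in> p" for x
  proof -
    note I = prime_ideal[OF p]
    obtain s where s: "s \<in> subalg n" "x - s \<in> p" "der v (x - s) \<in> p"
      using subalg_mod[OF I n, of v x] v0 is_ideal_0[OF I] by auto
    have "x - (x - s) \<in> p" by (rule is_ideal_diff[OF I x s(2)])
    then have "der v s \<in> p" using v(1) s by simp
    then have "der v (x - s) + der v s \<in> p" by (rule is_ideal_add[OF I s(3)])
    then show ?thesis by (simp add: derivation_diff[OF der_derivation])
  qed
  then show ?thesis using v v0 by (intro exI[of _ v]) (auto simp: stable_def)
qed

section \<open>Degree, growth and lengths of prime chains\<close>

inductive deg_le :: "nat \<Rightarrow> falg \<Rightarrow> nat \<Rightarrow> bool" for j where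
  deg_le_cst: "deg_le j (cst c) N"
| deg_le_add: "deg_le j x N \<Longrightarrow> deg_le j y N \<Longrightarrow> deg_le j (x + y) N"
| deg_le_var: "i < j \<Longrightarrow> deg_le j x N \<Longrightarrow> deg_le j (var i * x) (Suc N)"

lemma deg_le_mono: "deg_le j x N \<Longrightarrow> N \<le> M \<Longrightarrow> deg_le j x M"
proof (induction arbitrary: M rule: deg_le.induct)
  case (deg_le_var i x N)
  then show ?case by (cases M) (auto intro: deg_le.deg_le_var)
qed (auto intro: deg_le.intros)

lemma deg_le_0: "deg_le j 0 N" and deg_le_1: "deg_le j 1 N"
  using deg_le_cst[of j 0 N] deg_le_cst[of j 1 N] by simp_all

lemma deg_le_sum: "(\<And>i. i \<in> S \<Longrightarrow> deg_le j (f i) N) \<Longrightarrow> deg_le j (sum f S) N"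
  by (induction S rule: infinite_finite_induct) (auto intro: deg_le_0 deg_le_add)

lemma deg_le_cst_mult: "deg_le j x N \<Longrightarrow> deg_le j (cst c * x) N"
proof (induction rule: deg_le.induct)
  case (deg_le_cst d N)
  then show ?case using deg_le.deg_le_cst[of j "c * d"] by (simp add: cst_mult)
next
  case (deg_le_var i x N)
  then show ?case using deg_le.deg_le_var[of i j "cst c * x" N] by (simp add: mult.left_commute)
qed (auto simp: distrib_left intro: deg_le.deg_le_add)

lemma deg_le_mult: "deg_le j x N \<Longrightarrow> deg_le j y M \<Longrightarrow> deg_le j (x * y) (N + M)"
proof (induction rule: deg_le.induct)
  case (deg_le_cst c N)
  then show ?case using deg_le_mono[OF deg_le_cst_mult, of j y M "N + M"] by simp
qed (auto simp: distrib_right mult.assoc intro: deg_le.intros)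

lemma deg_le_uminus: "deg_le j x N \<Longrightarrow> deg_le j (- x) N"
  using deg_le_cst_mult[of j x N "-1"] by (simp add: cst_uminus)

lemma deg_le_diff: "deg_le j x N \<Longrightarrow> deg_le j y N \<Longrightarrow> deg_le j (x - y) N"
  using deg_le_add[of j x N "- y"] deg_le_uminus by simp

lemma deg_le_power: "deg_le j x N \<Longrightarrow> deg_le j (x ^ k) (k * N)"
  by (induction k) (auto intro: deg_le_1 deg_le_mult)

lemma subalg_deg_le: "x \<in> subalg j \<Longrightarrow> \<exists>N. deg_le j x N"
proof (induction rule: subalg.induct)
  case (subalg_var i)
  then show ?case using deg_le_var[OF subalg_var deg_le_1] by auto
next
  case (subalg_add x y)
  then obtain N M where "deg_le j x N" "deg_le j y M" by auto
  then have "deg_le j x (max N M)" "deg_le j y (max N M)" by (auto elim: deg_le_mono)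
  then show ?case using deg_le_add by blast
qed (auto intro: deg_le_cst deg_le_mult)

lemma deg_le_Suc_expansion:
  "deg_le (Suc j) x N \<Longrightarrow> \<exists>b. (\<forall>i. deg_le j (b i) N) \<and> x = (\<Sum>i\<le>N. b i * var j ^ i)"
proof (induction rule: deg_le.induct)
  case (deg_le_cst c N)
  have "(\<Sum>i\<le>N. (if i = 0 then cst c else 0) * var j ^ i) = (\<Sum>i\<le>N. if i = 0 then cst c else 0)"
    by (intro sum.cong) auto
  then show ?case
    by (intro exI[of _ "\<lambda>i. if i = 0 then cst c else 0"]) (auto intro: deg_le.deg_le_cst deg_le_0)
next
  case (deg_le_add x N y)
  then obtain b d where b: "\<forall>i. deg_le j (b i) N" "x = (\<Sum>i\<le>N. b i * var j ^ i)"
    and d: "\<forall>i. deg_le j (d i) N" "y = (\<Sum>i\<le>N. d i * var j ^ i)" by auto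
  then show ?case
    by (intro exI[of _ "\<lambda>i. b i + d i"]) (auto simp: sum.distrib distrib_right intro: deg_le.deg_le_add)
next
  case (deg_le_var i x N)
  then obtain b where b: "\<forall>i. deg_le j (b i) N" "x = (\<Sum>i\<le>N. b i * var j ^ i)" by auto
  show ?case
  proof (cases "i = j")
    case False
    then have "i < j" using deg_le_var by simp
    then have "\<forall>l. deg_le j (var i * b l) (Suc N)" using b(1) deg_le.deg_le_var by blast
    moreover have "var i * x = (\<Sum>l\<le>Suc N. (if l \<le> N then var i * b l else 0) * var j ^ l)"
      by (simp add: b(2) sum_distrib_left mult.assoc)
    ultimately show ?thesis
      by (intro exI[of _ "\<lambda>l. if l \<le> N then var i * b l else 0"]) (auto intro: deg_le_0)
  next
    case True
    have "var i * x = (\<Sum>l\<le>Suc N. (case l of 0 \<Rightarrow> 0 | Suc l \<Rightarrow> b l) * var j ^ l)"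
      by (subst sum.atMost_Suc_shift) (simp add: b(2) True sum_distrib_left mult_ac)
    moreover have "deg_le j (case l of 0 \<Rightarrow> 0 | Suc l \<Rightarrow> b l) (Suc N)" for l
      using b(1) by (cases l) (auto intro: deg_le_0 deg_le_mono)
    ultimately show ?thesis by (intro exI[of _ "\<lambda>l. case l of 0 \<Rightarrow> 0 | Suc l \<Rightarrow> b l"]) simp
  qed
qed

lemma spans_I: "x - lin c T \<in> p \<Longrightarrow> x \<in> spans p T"
  by (auto simp: spans_def)

lemma spans_add: "is_ideal p \<Longrightarrow> x \<in> spans p T \<Longrightarrow> y \<in> spans p T \<Longrightarrow> x + y \<in> spans p T"
proof -
  assume p: "is_ideal p" and "x \<in> spans p T" "y \<in> spans p T"
  then obtain c d where c: "x - lin c T \<in> p" and d: "y - lin d T \<in> p" by (auto simp: spans_def)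
  have "x + y - lin (\<lambda>e. c e + d e) T = (x - lin c T) + (y - lin d T)" by (simp add: lin_add)
  then show ?thesis using is_ideal_add[OF p c d] by (intro spans_I[of _ "\<lambda>e. c e + d e"]) (simp only:)
qed

lemma spans_scale: "is_ideal p \<Longrightarrow> x \<in> spans p T \<Longrightarrow> cst k * x \<in> spans p T"
proof -
  assume p: "is_ideal p" and "x \<in> spans p T"
  then obtain c where c: "x - lin c T \<in> p" by (auto simp: spans_def)
  have "cst k * x - lin (\<lambda>e. k * c e) T = cst k * (x - lin c T)" by (simp add: lin_scale algebra_simps)
  then show ?thesis using is_ideal_mult[OF p c] by (intro spans_I[of _ "\<lambda>e. k * c e"]) simp
qed

lemma spans_ideal: "is_ideal p \<Longrightarrow> x \<in> p \<Longrightarrow> x \<in> spans p T"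
  by (rule spans_I[of _ "\<lambda>_. 0"]) (simp add: lin_def)

lemma spans_sum: "is_ideal p \<Longrightarrow> (\<And>i. i \<in> S \<Longrightarrow> f i \<in> spans p T) \<Longrightarrow> sum f S \<in> spans p T"
  by (induction S rule: infinite_finite_induct) (auto intro: spans_ideal is_ideal_0 spans_add)

lemma spans_cong: "is_ideal p \<Longrightarrow> x - y \<in> p \<Longrightarrow> y \<in> spans p T \<Longrightarrow> x \<in> spans p T"
  using spans_add[of p "x - y" T y] spans_ideal[of p "x - y" T] by simp

lemma spans_products:
  assumes p: "is_ideal p" and T: "finite T" "finite I"
    and b: "\<And>i. i \<in> I \<Longrightarrow> b i \<in> spans p T"
  shows "(\<Sum>i\<in>I. b i * z i) \<in> spans p ((\<lambda>(t, i). t * z i) ` (T \<times> I))"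
proof (intro spans_sum p)
  fix i assume i: "i \<in> I"
  let ?U = "(\<lambda>(t, i). t * z i) ` (T \<times> I)"
  obtain c where c: "b i - lin c T \<in> p" using b[OF i] by (auto simp: spans_def)
  have "(\<Sum>t\<in>T. cst (c t) * (t * z i)) \<in> spans p ?U"
    using T i by (intro spans_sum spans_scale p spans_self) auto
  moreover have "(\<Sum>t\<in>T. cst (c t) * (t * z i)) = lin c T * z i"
    by (simp add: lin_def sum_distrib_right mult.assoc)
  moreover have "b i * z i - lin c T * z i \<in> p"
    using is_ideal_mult2[OF p c, of "z i"] by (simp add: left_diff_distrib)
  ultimately show "b i * z i \<in> spans p ?U" using spans_cong[OF p] by metis
qed

lemma indep_bound_spanning:
  assumes p: "is_ideal p" and bound: "\<And>E. indep p E \<Longrightarrow> E \<subseteq> W \<Longrightarrow> card E \<le> k"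
  shows "\<exists>T\<subseteq>W. finite T \<and> card T \<le> k \<and> W \<subseteq> spans p T"
proof -
  define A where "A = {E. indep p E \<and> E \<subseteq> W}"
  have "{} \<in> A" by (auto simp: A_def indep_empty)
  moreover have "\<forall>E. E \<in> A \<longrightarrow> card E < Suc k" using bound by (auto simp: A_def less_Suc_eq_le)
  ultimately obtain E where E: "E \<in> A" "\<And>E'. E' \<in> A \<Longrightarrow> card E' \<le> card E"
    using ex_has_greatest_nat[of "\<lambda>E. E \<in> A" "{}" card "Suc k"] by blast
  have fin: "finite E" using E by (auto simp: A_def indep_def)
  have "x \<in> spans p E" if "x \<in> W" for x
  proof (rule ccontr)
    assume n: "x \<notin> spans p E"
    then have "indep p (insert x E)" using indep_insert[OF p] E by (auto simp: A_def)
    then have "card (insert x E) \<le> card E" using E that by (auto simp: A_def)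
    moreover have "x \<notin> E" using n spans_self[OF p fin] by auto
    ultimately show False using fin by simp
  qed
  then show ?thesis using E fin bound by (intro exI[of _ E]) (auto simp: A_def)
qed

lemma indep_scale:
  assumes p: "is_prime p" and E: "indep p E" and a: "a \<notin> p"
  shows "indep p ((*) a ` E)" "card ((*) a ` E) = card E"
proof -
  note I = prime_ideal[OF p]
  have inj: "inj_on ((*) a) E"
  proof (rule inj_onI, rule ccontr)
    fix x y assume xy: "x \<in> E" "y \<in> E" "a * x = a * y" "x \<noteq> y"
    then have "a * (x - y) \<in> p" using is_ideal_0[OF I] by (simp add: right_diff_distrib)
    then have d: "x - y \<in> p" using a p prime_mult_iff by blast
    define c where "c = (\<lambda>e. if e = x then 1 else if e = y then -1 else 0 :: complex)"
    have "lin c E = (\<Sum>e\<in>{x, y}. cst (c e) * e)" unfolding lin_def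
      using E xy by (intro sum.mono_neutral_right) (auto simp: indep_def c_def)
    also have "\<dots> = x - y" using xy by (simp add: c_def cst_uminus)
    finally have "c x = 0" using E d xy by (auto simp: indep_def)
    then show False by (simp add: c_def)
  qed
  then show "card ((*) a ` E) = card E" by (rule card_image)
  have "lin c ((*) a ` E) = a * lin (\<lambda>e. c (a * e)) E" for c
    unfolding lin_def sum.reindex[OF inj] sum_distrib_left comp_def
    by (simp only: mult.left_commute)
  then show "indep p ((*) a ` E)"
    using E a prime_mult_iff[OF p] by (auto simp: indep_def)
qed

text \<open>A free variable multiplies the count by the \<open>N + 1\<close> available powers. For
  an algebraic variable, multiplication by a power of the leading coefficient \<open>a s\<close>
  reduces every power of the variable below \<open>s\<close>, while coefficient degrees grow only
  linearly in \<open>N\<close>; the exponent is therefore unchanged.\<close>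

lemma growth_upper_bound:
  assumes p: "is_prime p"
  shows "\<exists>C. \<forall>N E. indep p E \<longrightarrow> (\<forall>x\<in>E. deg_le j x N) \<longrightarrow>
    card E \<le> C * (N + 1) ^ card {i. i < j \<and> \<not> (\<exists>s a. alg_relation p i s a)}"
proof (induction j)
  case 0
  note I = prime_ideal[OF p]
  have c: "x \<in> spans p {1}" if "deg_le 0 x N" for x N
    using that
  proof (induction rule: deg_le.induct)
    case (deg_le_cst c N)
    then show ?case using is_ideal_0[OF I] by (intro spans_I[of _ "\<lambda>_. c"]) (simp add: lin_def)
  qed (auto intro: spans_add[OF I])
  then have "card E \<le> 1" if "indep p E" "\<forall>x\<in>E. deg_le 0 x N" for E N
    using indep_card_le[OF I that(1), of "{1}"] that(2) by auto
  then show ?case by (intro exI[of _ 1]) auto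
next
  case (Suc j)
  note I = prime_ideal[OF p]
  let ?r = "\<lambda>j. card {i. i < j \<and> \<not> (\<exists>s a. alg_relation p i s a)}"
  obtain C where C: "\<And>N E. indep p E \<Longrightarrow> (\<forall>x\<in>E. deg_le j x N) \<Longrightarrow> card E \<le> C * (N + 1) ^ ?r j"
    using Suc by auto
  have span: "\<exists>T. finite T \<and> card T \<le> C * (N + 1) ^ ?r j \<and> {x. deg_le j x N} \<subseteq> spans p T" for N
  proof -
    have "card E \<le> C * (N + 1) ^ ?r j" if "indep p E" "E \<subseteq> {x. deg_le j x N}" for E
      using C[OF that(1), of N] that(2) by auto
    from indep_bound_spanning[OF I this] show ?thesis by blast
  qed
  show ?case
  proof (cases "\<exists>s a. alg_relation p j s a")
    case False
    then have "{i. i < Suc j \<and> \<not> (\<exists>s a. alg_relation p i s a)}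
        = insert j {i. i < j \<and> \<not> (\<exists>s a. alg_relation p i s a)}" by (auto simp: less_Suc_eq)
    then have r: "?r (Suc j) = Suc (?r j)" by simp
    have "card E \<le> C * (N + 1) ^ ?r (Suc j)" if E: "indep p E" "\<forall>x\<in>E. deg_le (Suc j) x N" for N E
    proof -
      obtain T where T: "finite T" "card T \<le> C * (N + 1) ^ ?r j" "{x. deg_le j x N} \<subseteq> spans p T"
        using span by blast
      let ?U = "(\<lambda>(t, i). t * var j ^ i) ` (T \<times> {..N})"
      have "E \<subseteq> spans p ?U"
      proof
        fix x assume "x \<in> E"
        then obtain b where b: "\<forall>i. deg_le j (b i) N" "x = (\<Sum>i\<le>N. b i * var j ^ i)"
          using E deg_le_Suc_expansion by blast
        show "x \<in> spans p ?U" unfolding b(2)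
          using T b(1) by (intro spans_products I) auto
      qed
      then have "card E \<le> card ?U" using T by (intro indep_card_le[OF I E(1)]) auto
      also have "\<dots> \<le> card (T \<times> {..N})" using T by (intro card_image_le) auto
      also have "\<dots> \<le> C * (N + 1) ^ ?r j * (N + 1)"
        unfolding card_cartesian_product using T(2) by (intro mult_le_mono) auto
      finally show ?thesis unfolding r power_Suc by (simp only: mult_ac)
    qed
    then show ?thesis by blast
  next
    case True
    then obtain s a where a: "alg_relation p j s a" by auto
    then have s: "s > 0" "a s \<notin> p" and aS: "\<And>i. a i \<in> subalg j" and rel: "(\<Sum>i\<le>s. a i * var j ^ i) \<in> p"
      by (auto simp: alg_relation_def)
    have "{i. i < Suc j \<and> \<not> (\<exists>s a. alg_relation p i s a)}
        = {i. i < j \<and> \<not> (\<exists>s a. alg_relation p i s a)}" using True by (auto simp: less_Suc_eq)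
    then have r: "?r (Suc j) = ?r j" by simp
    obtain d where d: "\<And>i. deg_le j (a i) (d i)" using subalg_deg_le[OF aS] by metis
    define c where "c = (\<Sum>i\<le>s. d i)"
    have ac: "deg_le j (a i) c" if "i \<le> s" for i
      using d by (rule deg_le_mono) (use that in \<open>auto simp: c_def intro: member_le_sum\<close>)
    let ?y = "var j"
    have red: "\<exists>b. (\<forall>i. deg_le j (b i) (m * c)) \<and> a s ^ m * ?y ^ m - (\<Sum>i<s. b i * ?y ^ i) \<in> p" for m
    proof (induction m)
      case 0
      have "(\<Sum>i<s. (if i = 0 then 1 else 0) * ?y ^ i) = (\<Sum>i<s. if i = 0 then 1 else 0)"
        by (intro sum.cong) auto
      then show ?case using s is_ideal_0[OF I]
        by (intro exI[of _ "\<lambda>i. if i = 0 then 1 else 0"]) (auto intro: deg_le_0 deg_le_1)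
    next
      case (Suc m)
      then obtain b where b: "\<And>i. deg_le j (b i) (m * c)"
        "a s ^ m * ?y ^ m - (\<Sum>i<s. b i * ?y ^ i) \<in> p" by auto
      obtain t where t: "s = Suc t" using s by (cases s) auto
      \<comment> \<open>Multiplication by \<open>a s * ?y\<close> shifts the coefficients and
        creates the term \<open>b t * a s * ?y ^ s\<close>, which the relation rewrites in lower
        powers.\<close>
      define b' where "b' i = (case i of 0 \<Rightarrow> 0 | Suc l \<Rightarrow> a s * b l) - b t * (if i < s then a i else 0)" for i
      have "deg_le j (b' i) (Suc m * c)" for i
      proof -
        have "deg_le j (case i of 0 \<Rightarrow> 0 | Suc l \<Rightarrow> a s * b l) (c + m * c)"
          by (cases i) (auto intro!: deg_le_0 deg_le_mult ac b)
        moreover have "deg_le j (b t * (if i < s then a i else 0)) (m * c + c)"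
          by (intro deg_le_mult b) (auto intro: ac deg_le_0)
        ultimately show ?thesis unfolding b'_def by (intro deg_le_diff) (auto simp: add.commute)
      qed
      moreover have "a s ^ Suc m * ?y ^ Suc m - (\<Sum>i<s. b' i * ?y ^ i) \<in> p"
      proof -
        have "(\<Sum>i<s. (case i of 0 \<Rightarrow> 0 | Suc l \<Rightarrow> a s * b l) * ?y ^ i)
            = a s * ?y * (\<Sum>i<t. b i * ?y ^ i)"
          unfolding t by (subst sum.lessThan_Suc_shift) (simp add: sum_distrib_left mult_ac)
        moreover have "(\<Sum>i<s. b t * (if i < s then a i else 0) * ?y ^ i) = b t * (\<Sum>i<s. a i * ?y ^ i)"
          by (simp add: sum_distrib_left mult.assoc)
        ultimately have "(\<Sum>i<s. b' i * ?y ^ i)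
            = a s * ?y * (\<Sum>i<t. b i * ?y ^ i) - b t * (\<Sum>i<s. a i * ?y ^ i)"
          by (simp add: b'_def left_diff_distrib sum_subtractf)
        then have "a s ^ Suc m * ?y ^ Suc m - (\<Sum>i<s. b' i * ?y ^ i)
          = a s * ?y * (a s ^ m * ?y ^ m - (\<Sum>i<s. b i * ?y ^ i)) + b t * (\<Sum>i\<le>s. a i * ?y ^ i)"
          by (simp add: t lessThan_Suc_atMost[symmetric] algebra_simps)
        also have "\<dots> \<in> p" by (intro is_ideal_add[OF I] is_ideal_mult[OF I] b rel)
        finally show ?thesis .
      qed
      ultimately show ?case by blast
    qed
    have "card E \<le> (s * C * (c + 1) ^ ?r j) * (N + 1) ^ ?r (Suc j)"
      if E: "indep p E" "\<forall>x\<in>E. deg_le (Suc j) x N" for N E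
    proof -
      \<comment> \<open>The coefficients of \<open>x\<close> contribute \<open>N\<close>; the
        remaining \<open>N * c\<close> comes from \<open>N - i\<close> factors \<open>a s\<close>
        together with \<open>i\<close> reductions, each of degree at most \<open>c\<close>.\<close>
      let ?M = "N * c + N"
      obtain T where T: "finite T" "card T \<le> C * (?M + 1) ^ ?r j" "{x. deg_le j x ?M} \<subseteq> spans p T"
        using span by blast
      let ?U = "(\<lambda>(t, i). t * ?y ^ i) ` (T \<times> {..<s})"
      have "(*) (a s ^ N) ` E \<subseteq> spans p ?U"
      proof
        fix w assume "w \<in> (*) (a s ^ N) ` E"
        then obtain x where x: "x \<in> E" "w = a s ^ N * x" by auto
        then obtain b where b: "\<forall>i. deg_le j (b i) N" "x = (\<Sum>i\<le>N. b i * ?y ^ i)"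
          using E deg_le_Suc_expansion by blast
        obtain e where e: "\<And>m i. deg_le j (e m i) (m * c)"
            "\<And>m. a s ^ m * ?y ^ m - (\<Sum>i<s. e m i * ?y ^ i) \<in> p" using red by metis
        define f where "f l = (\<Sum>i\<le>N. b i * a s ^ (N - i) * e i l)" for l
        have "deg_le j (f l) ?M" for l unfolding f_def
        proof (rule deg_le_sum)
          fix i assume i: "i \<in> {..N}"
          have "deg_le j (b i * a s ^ (N - i) * e i l) (N + (N - i) * c + i * c)"
            using b(1) by (intro deg_le_mult deg_le_power e ac) auto
          moreover have "N + (N - i) * c + i * c = ?M"
            using i by (simp add: add_mult_distrib[symmetric])
          ultimately show "deg_le j (b i * a s ^ (N - i) * e i l) ?M" by simp
        qed
        then have "(\<Sum>l<s. f l * ?y ^ l) \<in> spans p ?U" using T by (intro spans_products I) auto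
        moreover have "w - (\<Sum>l<s. f l * ?y ^ l) \<in> p"
        proof -
          have "w = (\<Sum>i\<le>N. b i * a s ^ (N - i) * (a s ^ i * ?y ^ i))"
            unfolding x(2) b(2) sum_distrib_left
          proof (intro sum.cong refl)
            fix i assume "i \<in> {..N}"
            then have "a s ^ N = a s ^ (N - i) * a s ^ i" by (simp add: power_add[symmetric])
            then show "a s ^ N * (b i * ?y ^ i) = b i * a s ^ (N - i) * (a s ^ i * ?y ^ i)"
              by (simp add: mult_ac)
          qed
          moreover have "(\<Sum>l<s. f l * ?y ^ l) = (\<Sum>i\<le>N. b i * a s ^ (N - i) * (\<Sum>l<s. e i l * ?y ^ l))"
            unfolding f_def sum_distrib_left sum_distrib_right
            by (subst sum.swap) (simp add: mult_ac)
          ultimately have "w - (\<Sum>l<s. f l * ?y ^ l)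
            = (\<Sum>i\<le>N. b i * a s ^ (N - i) * (a s ^ i * ?y ^ i - (\<Sum>l<s. e i l * ?y ^ l)))"
            by (simp add: sum_subtractf right_diff_distrib)
          also have "\<dots> \<in> p" by (intro is_ideal_sum[OF I] is_ideal_mult[OF I] e)
          finally show ?thesis .
        qed
        ultimately show "w \<in> spans p ?U" by (rule spans_cong[OF I, rotated])
      qed
      moreover have aN: "a s ^ N \<notin> p" using s prime_power[OF p] by blast
      ultimately have "card ((*) (a s ^ N) ` E) \<le> card ?U"
        using T by (intro indep_card_le[OF I indep_scale(1)[OF p E(1)]]) auto
      then have "card E \<le> card ?U" using indep_scale(2)[OF p E(1) aN] by simp
      also have "\<dots> \<le> card (T \<times> {..<s})" using T by (intro card_image_le) auto
      also have "\<dots> \<le> C * (?M + 1) ^ ?r j * s" using T by (simp add: card_cartesian_product)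
      also have "\<dots> \<le> C * ((c + 1) * (N + 1)) ^ ?r j * s"
        by (intro mult_le_mono power_mono) auto
      finally show ?thesis unfolding r power_mult_distrib by (simp only: mult_ac)
    qed
    then show ?thesis by blast
  qed
qed

text \<open>A lower bound for growth with exponent \<open>s\<close>. The slope \<open>k\<close> is
  left open so that it can absorb the degree of the multiplier in
  \<open>growth_at_least_Suc\<close>.\<close>

definition growth_at_least :: "nat \<Rightarrow> falg set \<Rightarrow> nat \<Rightarrow> bool" where
  "growth_at_least n p s \<longleftrightarrow>
    (\<exists>k. \<forall>L. \<exists>E. indep p E \<and> (\<forall>x\<in>E. deg_le n x (k * L)) \<and> L ^ s \<le> card E)"

lemma growth_at_least_0: "is_prime p \<Longrightarrow> growth_at_least n p 0"
  unfolding growth_at_least_def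
  by (intro exI[of _ 1] allI exI[of _ "{1}"])
    (auto simp: indep_def lin_def prime_cst intro: deg_le_1)

text \<open>Modulo \<open>p'\<close> the multiples of \<open>f\<close> vanish, so a relation first
  loses its coefficients on \<open>E\<close>. What remains is \<open>f\<close> times a combination
  of \<open>U\<close>, and \<open>f\<close> can be cancelled modulo \<open>p\<close>.\<close>

lemma indep_union_multiple:
  assumes p: "is_prime p" and p': "is_prime p'" "p \<subseteq> p'" and f: "f \<in> p'" "f \<notin> p"
    and E: "indep p' E" and U: "indep p U"
  shows "indep p (E \<union> (*) f ` U)" "card (E \<union> (*) f ` U) = card E + card U"
proof -
  note I' = prime_ideal[OF p'(1)]
  have fin: "finite E" "finite U" using E U by (auto simp: indep_def)
  have disj: "E \<inter> (*) f ` U = {}"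
  proof (rule ccontr)
    assume "\<not> ?thesis"
    then obtain e where e: "e \<in> E" "e \<in> p'" using is_ideal_mult2[OF I' f(1)] by auto
    let ?c = "\<lambda>x. if x = e then 1 else 0 :: complex"
    have "lin ?c E = (\<Sum>x\<in>E. if x = e then e else 0)" unfolding lin_def by (intro sum.cong) auto
    then have "lin ?c E \<in> p'" using fin e by simp
    then have "?c e = 0" using E e unfolding indep_def by blast
    then show False by simp
  qed
  note fU = indep_scale[OF p U f(2)]
  show "card (E \<union> (*) f ` U) = card E + card U"
    using disj fin fU(2) by (simp add: card_Un_disjoint)
  have "\<forall>e\<in>E \<union> (*) f ` U. c e = 0" if c: "lin c (E \<union> (*) f ` U) \<in> p" for c
  proof -
    have eq: "lin c (E \<union> (*) f ` U) = lin c E + lin c ((*) f ` U)"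
      using disj fin by (simp add: lin_def sum.union_disjoint)
    have "lin c ((*) f ` U) \<in> p'" unfolding lin_def
      using is_ideal_mult2[OF I' f(1)] by (intro is_ideal_sum[OF I'] is_ideal_mult[OF I']) auto
    then have "lin c E \<in> p'" using c eq p'(2) is_ideal_add_iff[OF I'] by auto
    then have cE: "\<forall>e\<in>E. c e = 0" using E by (auto simp: indep_def)
    then have "lin c E = 0" by (simp add: lin_def)
    then have "lin c ((*) f ` U) \<in> p" using c eq by simp
    then show ?thesis using cE fU(1) by (auto simp: indep_def)
  qed
  then show "indep p (E \<union> (*) f ` U)" using fin by (auto simp: indep_def)
qed

text \<open>With \<open>f\<close> in \<open>p'\<close> but not in \<open>p\<close>, the copies of
  \<open>E\<close> multiplied by 1, \<open>f\<close>, ..., \<open>f ^ (L - 1)\<close> are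
  independent together modulo \<open>p\<close>: a set of size \<open>L ^ s\<close> becomes one of
  size \<open>L ^ Suc s\<close>. Taking \<open>f\<close> in \<open>subalg n\<close> bounds its
  degree.\<close>

lemma growth_at_least_Suc:
  assumes p: "is_prime p" and n: "vars_in n p" and p': "is_prime p'" "p \<subset> p'"
    and g: "growth_at_least n p' s"
  shows "growth_at_least n p (Suc s)"
proof -
  obtain f0 where f0: "f0 \<in> p'" "f0 \<notin> p" using p'(2) by auto
  obtain f where f: "f \<in> subalg n" "f0 - f \<in> p"
    using subalg_mod[OF prime_ideal[OF p] n, of "\<lambda>_. 0" f0] is_ideal_0[OF prime_ideal[OF p]] by auto
  have fp': "f \<in> p'" using f f0 p' is_ideal_cong[OF prime_ideal[OF p'(1)], of f0 f] by auto
  have fp: "f \<notin> p" using f f0 is_ideal_cong[OF prime_ideal[OF p], of f0 f] by auto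
  obtain l where l: "deg_le n f l" using subalg_deg_le[OF f(1)] by auto
  obtain k where k: "\<And>L. \<exists>E. indep p' E \<and> (\<forall>x\<in>E. deg_le n x (k * L)) \<and> L ^ s \<le> card E"
    using g by (auto simp: growth_at_least_def)
  have "\<exists>E. indep p E \<and> (\<forall>x\<in>E. deg_le n x ((k + l) * L)) \<and> L ^ Suc s \<le> card E" for L
  proof -
    obtain E where E: "indep p' E" "\<forall>x\<in>E. deg_le n x (k * L)" "L ^ s \<le> card E" using k by blast
    have "\<exists>U. indep p U \<and> (\<forall>x\<in>U. deg_le n x (k * L + m * l)) \<and> card U = m * card E" for m
    proof (induction m)
      case 0
      then show ?case by (intro exI[of _ "{}"]) (simp add: indep_empty)
    next
      case (Suc m)
      then obtain U where U: "indep p U" "\<forall>x\<in>U. deg_le n x (k * L + m * l)" "card U = m * card E" by auto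
      note iu = indep_union_multiple[OF p p'(1) _ fp' fp E(1) U(1)]
      have "deg_le n x (k * L + Suc m * l)" if "x \<in> E \<union> (*) f ` U" for x
      proof (cases "x \<in> E")
        case True
        then show ?thesis using E(2) by (auto intro: deg_le_mono)
      next
        case False
        then obtain u where u: "u \<in> U" "x = f * u" using \<open>x \<in> E \<union> (*) f ` U\<close> by auto
        then have "deg_le n x (l + (k * L + m * l))" using deg_le_mult[OF l] U(2) by auto
        then show ?thesis by (simp add: algebra_simps)
      qed
      then show ?case using iu U(3) p'(2) by (intro exI[of _ "E \<union> (*) f ` U"]) auto
    qed
    from this[of L] obtain U where U: "indep p U" "\<forall>x\<in>U. deg_le n x (k * L + L * l)" "card U = L * card E"
      by auto
    then show ?thesis using E(3) by (intro exI[of _ U]) (auto simp: algebra_simps)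
  qed
  then show ?thesis unfolding growth_at_least_def by blast
qed

lemma growth_le_trdeg:
  assumes p: "is_prime p" and g: "growth_at_least n p s"
  shows "s \<le> trdeg n p"
proof (rule ccontr)
  assume "\<not> ?thesis"
  obtain C where C: "\<And>N E. indep p E \<Longrightarrow> (\<forall>x\<in>E. deg_le n x N) \<Longrightarrow> card E \<le> C * (N + 1) ^ trdeg n p"
    using growth_upper_bound[OF p, of n] by (auto simp: trdeg_def free_vars_def)
  obtain k where k: "\<And>L. \<exists>E. indep p E \<and> (\<forall>x\<in>E. deg_le n x (k * L)) \<and> L ^ s \<le> card E"
    using g by (auto simp: growth_at_least_def)
  \<comment> \<open>One above the value to which the two growth bounds limit \<open>L\<close>; since
    \<open>s\<close> exceeds \<open>trdeg n p\<close>, one factor \<open>L\<close> survives the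
    cancellation.\<close>
  define L where "L = C * (k + 1) ^ trdeg n p + 1"
  obtain E where E: "indep p E" "\<forall>x\<in>E. deg_le n x (k * L)" "L ^ s \<le> card E" using k by blast
  have "L ^ Suc (trdeg n p) \<le> L ^ s" using \<open>\<not> _\<close> by (intro power_increasing) (auto simp: L_def)
  also have "\<dots> \<le> C * (k * L + 1) ^ trdeg n p" using E C by (meson le_trans)
  also have "\<dots> \<le> C * ((k + 1) * L) ^ trdeg n p" by (intro mult_le_mono power_mono) (auto simp: L_def)
  also have "\<dots> = C * (k + 1) ^ trdeg n p * L ^ trdeg n p"
    unfolding power_mult_distrib by (simp only: mult.assoc)
  finally have "L * L ^ trdeg n p \<le> C * (k + 1) ^ trdeg n p * L ^ trdeg n p" by simp
  moreover have "L > 0" by (simp add: L_def)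
  ultimately have "L \<le> C * (k + 1) ^ trdeg n p" by simp
  then show False by (simp add: L_def)
qed

text \<open>Every strict inclusion adds one to the growth exponent, starting with 0 at the top of
  the chain, and this exponent is at most the transcendence degree.\<close>

lemma chain_length_le_trdeg:
  assumes P: "\<And>i. i \<le> m \<Longrightarrow> is_prime (P i)" "\<And>i. i < m \<Longrightarrow> P i \<subset> P (Suc i)" and n: "vars_in n (P 0)"
  shows "m \<le> trdeg n (P 0)"
proof -
  have "growth_at_least n (P 0) m"
    using P n
  proof (induction m arbitrary: P)
    case 0
    then show ?case by (simp add: growth_at_least_0)
  next
    case (Suc m)
    have s: "P 0 \<subset> P 1" using Suc.prems(2)[of 0] by simp
    have "growth_at_least n (P (Suc 0)) m"
      using Suc.IH[of "\<lambda>i. P (Suc i)"] Suc.prems s vars_in_mono[of n "P 0" "P 1"] by auto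
    then show ?case using growth_at_least_Suc[of "P 0" n "P 1" m] Suc.prems s by auto
  qed
  then show ?thesis using growth_le_trdeg P(1)[of 0] by simp
qed

section \<open>Regular points\<close>

definition partial :: "nat \<Rightarrow> falg \<Rightarrow> falg" where
  "partial i = der (\<lambda>j. if j = i then 1 else 0)"

lemma partial_derivation: "is_derivation (partial i)"
  unfolding partial_def by (rule der_derivation)

lemma partial_simps [simp]: "partial i (cst c) = 0" "partial i (var j) = (if j = i then 1 else 0)"
  by (auto simp: partial_def)

lemma sum_product_rule:
  fixes a b :: "'r::comm_ring_1"
  shows "(\<Sum>i\<in>S. (a * p i + q i * b) * w i) = a * (\<Sum>i\<in>S. p i * w i) + (\<Sum>i\<in>S. q i * w i) * b"
  unfolding sum_distrib_left sum_distrib_right sum.distrib[symmetric]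
  by (intro sum.cong refl) (simp add: algebra_simps)

lemma der_chain_rule:
  assumes "\<And>i. i \<ge> n \<Longrightarrow> v i = 0"
  shows "der v x = (\<Sum>i<n. partial i x * v i)"
proof (induction x rule: falg_induct)
  case (var j)
  have "(\<Sum>i<n. partial i (var j) * v i) = (\<Sum>i<n. if i = j then v j else 0)"
    by (intro sum.cong) auto
  then show ?case using assms[of j] by (cases "j < n") auto
next
  case (add a b)
  then show ?case
    by (simp add: derivation_add[OF der_derivation] derivation_add[OF partial_derivation]
        distrib_right sum.distrib)
next
  case (mult a b)
  then show ?case
    unfolding derivation_mult[OF der_derivation] derivation_mult[OF partial_derivation]
      sum_product_rule by simp
qed simp

section \<open>Tangent vectors and cotangent spaces\<close>

definition point_derivation :: "(falg \<Rightarrow> complex) \<Rightarrow> (falg \<Rightarrow> complex) \<Rightarrow> bool" where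
  "point_derivation f v \<longleftrightarrow> (\<forall>a b. v (a + b) = v a + v b) \<and>
    (\<forall>a b. v (a * b) = f a * v b + v a * f b) \<and> (\<forall>c. v (cst c) = 0)"

lemma pd_add: "point_derivation f v \<Longrightarrow> v (a + b) = v a + v b"
  and pd_mult: "point_derivation f v \<Longrightarrow> v (a * b) = f a * v b + v a * f b"
  and pd_cst: "point_derivation f v \<Longrightarrow> v (cst c) = 0"
  by (auto simp: point_derivation_def)

lemma pd_0: "point_derivation f v \<Longrightarrow> v 0 = 0"
  using pd_cst[of f v 0] by simp

lemma pd_cst_mult: "is_point f \<Longrightarrow> point_derivation f v \<Longrightarrow> v (cst c * x) = c * v x"
  by (simp add: pd_mult pd_cst point_cst)

lemma pd_diff: "is_point f \<Longrightarrow> point_derivation f v \<Longrightarrow> v (a - b) = v a - v b"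
  using pd_add[of f v a "cst (-1) * b"] pd_cst_mult[of f v "-1" b] by (simp add: cst_uminus)

lemma pd_sum: "point_derivation f v \<Longrightarrow> v (sum g S) = (\<Sum>i\<in>S. v (g i))"
  by (induction S rule: infinite_finite_induct) (auto simp: pd_0 pd_add)

lemma pd_power:
  "is_point f \<Longrightarrow> point_derivation f v \<Longrightarrow> v (a ^ k) = of_nat k * f a ^ (k - 1) * v a"
proof (induction k)
  case 0
  then show ?case using pd_cst[of f v 1] by simp
next
  case (Suc k)
  then show ?case by (cases k) (auto simp: pd_mult point_simps algebra_simps)
qed

lemma pd_lin: "is_point f \<Longrightarrow> point_derivation f v \<Longrightarrow> v (lin c E) = (\<Sum>e\<in>E. c e * v e)"
  by (simp add: lin_def pd_sum pd_cst_mult)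

lemma pd_comb:
  assumes "\<And>k. k \<in> K \<Longrightarrow> point_derivation f (vs k)"
  shows "point_derivation f (\<lambda>x. \<Sum>k\<in>K. c k * vs k x)"
  unfolding point_derivation_def
proof (intro conjI allI)
  note v = assms
  fix a b
  show "(\<Sum>k\<in>K. c k * vs k (a + b)) = (\<Sum>k\<in>K. c k * vs k a) + (\<Sum>k\<in>K. c k * vs k b)"
    unfolding sum.distrib[symmetric] by (intro sum.cong refl) (simp add: pd_add[OF v] distrib_left)
  show "(\<Sum>k\<in>K. c k * vs k (a * b)) = f a * (\<Sum>k\<in>K. c k * vs k b) + (\<Sum>k\<in>K. c k * vs k a) * f b"
    unfolding sum_distrib_left sum_distrib_right sum.distrib[symmetric]
    by (intro sum.cong refl) (simp add: pd_mult[OF v] algebra_simps)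
next
  fix d
  show "(\<Sum>k\<in>K. c k * vs k (cst d)) = 0" by (intro sum.neutral) (simp add: pd_cst[OF assms])
qed

lemma pd_chain_rule:
  assumes f: "is_point f" and v: "point_derivation f v" and "\<And>i. i \<ge> n \<Longrightarrow> v (var i) = 0"
  shows "v x = (\<Sum>i<n. f (partial i x) * v (var i))"
proof (induction x rule: falg_induct)
  case (cst c)
  then show ?case using f v by (simp add: pd_cst point_0)
next
  case (var j)
  have "(\<Sum>i<n. f (partial i (var j)) * v (var i)) = (\<Sum>i<n. if i = j then v (var j) else 0)"
    using f by (intro sum.cong) (auto simp: point_simps)
  then show ?case using assms(3)[of j] by (cases "j < n") auto
next
  case (add a b)
  then show ?case using f v
    by (simp add: pd_add derivation_add[OF partial_derivation] point_simps distrib_right sum.distrib)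
next
  case (mult a b)
  then show ?case
    unfolding pd_mult[OF v] derivation_mult[OF partial_derivation] point_add[OF f] point_mult[OF f]
      sum_product_rule by simp
qed

lemma pd_of_vector:
  assumes f: "is_point f"
  shows "point_derivation f (\<lambda>x. \<Sum>i<n. f (partial i x) * w i)"
  unfolding point_derivation_def derivation_add[OF partial_derivation]
    derivation_mult[OF partial_derivation] point_add[OF f] point_mult[OF f] sum_product_rule
  by (simp add: distrib_right sum.distrib point_0[OF f])

text \<open>For a point \<open>f\<close> with maximal ideal \<open>m\<close> this is the ideal
  \<open>m^2 + I\<close>; the cotangent space of \<open>I\<close> at \<open>f\<close> is
  \<open>m\<close> modulo it.\<close>

inductive_set cotangent_kernel :: "(falg \<Rightarrow> complex) \<Rightarrow> falg set \<Rightarrow> falg set" for f I where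
  ck_I: "x \<in> I \<Longrightarrow> x \<in> cotangent_kernel f I"
| ck_prod: "f a = 0 \<Longrightarrow> f b = 0 \<Longrightarrow> a * b \<in> cotangent_kernel f I"
| ck_add: "x \<in> cotangent_kernel f I \<Longrightarrow> y \<in> cotangent_kernel f I \<Longrightarrow> x + y \<in> cotangent_kernel f I"

lemma cotangent_kernel_ideal:
  assumes f: "is_point f" and I: "is_ideal I"
  shows "is_ideal (cotangent_kernel f I)"
proof -
  have "r * x \<in> cotangent_kernel f I" if "x \<in> cotangent_kernel f I" for r x
    using that
  proof (induction rule: cotangent_kernel.induct)
    case (ck_prod a b)
    then show ?case using cotangent_kernel.ck_prod[of f "r * a" b] f
      by (simp add: point_simps mult.assoc)
  qed (auto simp: distrib_left intro: cotangent_kernel.intros is_ideal_mult[OF I])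
  then show ?thesis unfolding is_ideal_def
    using is_ideal_0[OF I] by (auto intro: cotangent_kernel.intros)
qed

lemma pd_cotangent_kernel:
  assumes v: "point_derivation f v" "\<And>x. x \<in> I \<Longrightarrow> v x = 0"
  shows "x \<in> cotangent_kernel f I \<Longrightarrow> v x = 0"
  by (induction rule: cotangent_kernel.induct) (auto simp: v(2) pd_mult[OF v(1)] pd_add[OF v(1)])

definition embdim :: "(falg \<Rightarrow> complex) \<Rightarrow> falg set \<Rightarrow> nat \<Rightarrow> bool" where
  "embdim f I d \<longleftrightarrow> (\<exists>E\<subseteq>point_ideal f. indep (cotangent_kernel f I) E \<and>
    point_ideal f \<subseteq> spans (cotangent_kernel f I) E \<and> card E = d)"

lemma embdim_unique:
  assumes "is_point f" "is_ideal I" "embdim f I d" "embdim f I d'"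
  shows "d = d'"
proof -
  have "d \<le> d'" if "embdim f I d" "embdim f I d'" for d d'
    using that indep_card_le[OF cotangent_kernel_ideal[OF assms(1,2)]]
    unfolding embdim_def indep_def by (smt (verit, best) subset_trans)
  then show ?thesis using assms le_antisym by blast
qed

definition indep_tangents ::
  "(falg \<Rightarrow> complex) \<Rightarrow> falg set \<Rightarrow> nat set \<Rightarrow> (nat \<Rightarrow> falg \<Rightarrow> complex) \<Rightarrow> bool" where
  "indep_tangents f I K vs \<longleftrightarrow> finite K \<and>
    (\<forall>k\<in>K. point_derivation f (vs k) \<and> (\<forall>x\<in>I. vs k x = 0)) \<and>
    (\<forall>c. (\<forall>x. (\<Sum>k\<in>K. c k * vs k x) = 0) \<longrightarrow> (\<forall>k\<in>K. c k = 0))"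

text \<open>More than \<open>d\<close> tangent vectors have a nontrivial combination that kills a
  basis of the cotangent space. It then kills the maximal ideal and the constants, hence
  everything.\<close>

lemma indep_tangents_card_le:
  assumes f: "is_point f" and I: "is_ideal I" and e: "embdim f I d" and t: "indep_tangents f I K vs"
  shows "card K \<le> d"
proof (rule ccontr)
  assume "\<not> ?thesis"
  obtain E where E: "E \<subseteq> point_ideal f" "indep (cotangent_kernel f I) E"
    "point_ideal f \<subseteq> spans (cotangent_kernel f I) E" "card E = d" using e by (auto simp: embdim_def)
  obtain c where c: "\<exists>k\<in>K. c k \<noteq> 0" "\<forall>e\<in>E. (\<Sum>k\<in>K. c k * vs k e) = 0"
    using homogeneous_system_complex[of E K vs] E t \<open>\<not> _\<close> by (auto simp: indep_def indep_tangents_def)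
  let ?V = "\<lambda>x. \<Sum>k\<in>K. c k * vs k x"
  have V: "point_derivation f ?V" using t by (intro pd_comb) (auto simp: indep_tangents_def)
  have VI: "?V x = 0" if "x \<in> I" for x using t that by (auto simp: indep_tangents_def)
  have Vm: "?V x = 0" if x: "x \<in> point_ideal f" for x
  proof -
    obtain a where a: "x - lin a E \<in> cotangent_kernel f I" using E(3) x by (auto simp: spans_def)
    have "?V (x - lin a E) = 0" by (rule pd_cotangent_kernel[OF V VI a])
    moreover have "?V (lin a E) = 0" unfolding pd_lin[OF f V] using c(2) by simp
    ultimately show ?thesis using pd_diff[OF f V, of x "lin a E"] by simp
  qed
  have "?V x = 0" for x
  proof -
    have "?V (x - cst (f x)) = 0" using f by (intro Vm) (simp add: point_ideal_def point_simps)
    then show ?thesis using pd_diff[OF f V, of x "cst (f x)"] pd_cst[OF V] by simp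
  qed
  then show False using t c(1) by (auto simp: indep_tangents_def)
qed

section \<open>Jacobian pivots and embedding dimension\<close>

text \<open>The first-order Taylor formula: for a product, the remainder is a product of two
  elements that vanish at \<open>f\<close>.\<close>

lemma taylor_mod_cotangent_kernel:
  assumes f: "is_point f" and I: "is_ideal I" "I \<subseteq> point_ideal f" "vars_in n I"
  shows "x - cst (f x) - (\<Sum>i<n. cst (f (partial i x)) * (var i - cst (f (var i)))) \<in> cotangent_kernel f I"
proof (induction x rule: falg_induct)
  note C = cotangent_kernel_ideal[OF f I(1)]
  {
    case (cst c)
    then show ?case using f is_ideal_0[OF C] by (simp add: point_simps)
  next
    case (var j)
    have s: "(\<Sum>i<n. cst (f (partial i (var j))) * (var i - cst (f (var i))))
        = (\<Sum>i<n. if i = j then var j - cst (f (var j)) else 0)"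
      using f by (intro sum.cong) (auto simp: point_simps)
    show ?case
    proof (cases "j < n")
      case True
      then show ?thesis unfolding s using is_ideal_0[OF C] by simp
    next
      case False
      then have "var j \<in> I" using I(3) by (auto simp: vars_in_def)
      moreover from this have "f (var j) = 0" using I(2) by (auto simp: point_ideal_def)
      ultimately show ?thesis unfolding s using False by (simp add: ck_I)
    qed
  next
    case (add a b)
    have eq: "a + b - cst (f (a + b)) - (\<Sum>i<n. cst (f (partial i (a + b))) * (var i - cst (f (var i))))
      = (a - cst (f a) - (\<Sum>i<n. cst (f (partial i a)) * (var i - cst (f (var i)))))
      + (b - cst (f b) - (\<Sum>i<n. cst (f (partial i b)) * (var i - cst (f (var i)))))"
      using f by (simp add: derivation_add[OF partial_derivation] point_simps cst_add
          distrib_right sum.distrib)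
    show ?case unfolding eq by (rule ck_add[OF add])
  next
    case (mult a b)
    let ?T = "\<lambda>x. \<Sum>i<n. cst (f (partial i x)) * (var i - cst (f (var i)))"
    have T: "?T (a * b) = cst (f a) * ?T b + cst (f b) * ?T a"
      unfolding derivation_mult[OF partial_derivation] point_add[OF f] point_mult[OF f] cst_add cst_mult
        sum_product_rule by (simp add: mult.commute)
    have "a * b - cst (f (a * b)) - ?T (a * b)
      = (a - cst (f a)) * (b - cst (f b)) + cst (f a) * (b - cst (f b) - ?T b)
        + cst (f b) * (a - cst (f a) - ?T a)"
      unfolding T using f by (simp add: point_simps cst_mult algebra_simps)
    moreover have "(a - cst (f a)) * (b - cst (f b)) \<in> cotangent_kernel f I"
      using f by (intro ck_prod) (simp_all add: point_simps)
    ultimately show ?case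
      using ck_add[OF ck_add[OF _ is_ideal_mult[OF C mult(2)]] is_ideal_mult[OF C mult(1)]] by simp
  }
qed

text \<open>The pivots of the Jacobian matrix of \<open>I\<close> at \<open>f\<close>: the variables in \<open>F\<close> are local
  parameters, and the differentials of the remaining ones are eliminated by the \<open>G j\<close>.\<close>

definition pivots ::
  "nat \<Rightarrow> (falg \<Rightarrow> complex) \<Rightarrow> falg set \<Rightarrow> nat set \<Rightarrow> falg \<Rightarrow> (nat \<Rightarrow> falg) \<Rightarrow> bool" where
  "pivots n f I F u G \<longleftrightarrow> F \<subseteq> {..<n} \<and> f u \<noteq> 0 \<and>
    (\<forall>j\<in>{..<n} - F. G j \<in> I \<and> partial j (G j) - u \<in> I \<and>
      (\<forall>i\<in>{..<n} - F - {j}. partial i (G j) \<in> I)) \<and>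
    (\<forall>x\<in>I. (\<forall>i\<in>{..<n} - F. f (partial i x) = 0) \<longrightarrow> (\<forall>k\<in>F. f (partial k x) = 0))"

text \<open>Elimination is applied to the gradients of elements of \<open>I\<close>, with the ideal
  of \<open>f\<close> as the larger prime. The pivot equations then hold modulo \<open>I\<close> and
  not only at the point, so they can be differentiated along \<open>I\<close> later.\<close>

lemma pivots_exist:
  assumes f: "is_point f" and I: "is_ideal I" "I \<subseteq> point_ideal f"
  shows "\<exists>F u G. pivots n f I F u G"
proof -
  define M where "M = (\<lambda>x i. partial i x) ` I"
  have "rows_closed I {..<n} M" unfolding rows_closed_def
  proof (intro conjI ballI allI)
    show "M \<noteq> {}" using is_ideal_0[OF I(1)] by (auto simp: M_def)
    fix g h r s assume "g \<in> M" "h \<in> M"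
    then obtain x y where xy: "x \<in> I" "g = (\<lambda>i. partial i x)" "y \<in> I" "h = (\<lambda>i. partial i y)"
      by (auto simp: M_def)
    have "partial i (r * x + s * y) - (r * partial i x + s * partial i y) \<in> I" for i
    proof -
      have "partial i (r * x + s * y) - (r * partial i x + s * partial i y)
          = partial i r * x + partial i s * y"
        by (simp add: derivation_add[OF partial_derivation] derivation_mult[OF partial_derivation])
      also have "\<dots> \<in> I" using xy by (intro is_ideal_add[OF I(1)] is_ideal_mult[OF I(1)])
      finally show ?thesis .
    qed
    moreover have "r * x + s * y \<in> I" using xy by (intro is_ideal_add[OF I(1)] is_ideal_mult[OF I(1)])
    ultimately show "\<exists>k\<in>M. \<forall>i\<in>{..<n}. k i - (r * g i + s * h i) \<in> I"
      unfolding M_def xy by (intro bexI[of _ "\<lambda>i. partial i (r * x + s * y)"]) auto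
  qed
  from elimination[OF I(1) point_ideal_prime[OF f] I(2) _ this]
  obtain F u piv where F: "F \<subseteq> {..<n}" "u \<notin> point_ideal f"
    and piv: "\<forall>j\<in>{..<n} - F. piv j \<in> M \<and> piv j j - u \<in> I \<and> (\<forall>i\<in>{..<n} - F - {j}. piv j i \<in> I)"
    and rest: "\<forall>g\<in>M. (\<forall>i\<in>{..<n} - F. g i \<in> point_ideal f) \<longrightarrow> (\<forall>k\<in>F. g k \<in> point_ideal f)"
    by auto
  have "\<forall>j. \<exists>x. j \<in> {..<n} - F \<longrightarrow> x \<in> I \<and> piv j = (\<lambda>i. partial i x)"
    using piv by (fastforce simp: M_def)
  then obtain G where G: "\<And>j. j \<in> {..<n} - F \<Longrightarrow> G j \<in> I" "\<And>j. j \<in> {..<n} - F \<Longrightarrow> piv j = (\<lambda>i. partial i (G j))"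
    by metis
  have "pivots n f I F u G"
    unfolding pivots_def
  proof (intro conjI)
    show "\<forall>j\<in>{..<n} - F. G j \<in> I \<and> partial j (G j) - u \<in> I \<and> (\<forall>i\<in>{..<n} - F - {j}. partial i (G j) \<in> I)"
    proof
      fix j assume j: "j \<in> {..<n} - F"
      show "G j \<in> I \<and> partial j (G j) - u \<in> I \<and> (\<forall>i\<in>{..<n} - F - {j}. partial i (G j) \<in> I)"
      proof -
        have e: "partial i (G j) = piv j i" for i using G(2)[OF j] by simp
        show ?thesis unfolding e using piv j G(1)[OF j] by blast
      qed
    qed
    show "\<forall>x\<in>I. (\<forall>i\<in>{..<n} - F. f (partial i x) = 0) \<longrightarrow> (\<forall>k\<in>F. f (partial k x) = 0)"
      using rest by (auto simp: M_def point_ideal_def)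
  qed (use F in \<open>auto simp: point_ideal_def\<close>)
  then show ?thesis by blast
qed

text \<open>Subtracting suitable multiples of the \<open>G j\<close> from \<open>u * x\<close> makes
  the gradient vanish at \<open>f\<close> in all pivot columns, and by the last clause of
  \<open>pivots\<close> also in the columns of \<open>F\<close>.\<close>

lemma pivots_tangent:
  assumes f: "is_point f" and I: "is_ideal I" "I \<subseteq> point_ideal f" and P: "pivots n f I F u G"
    and k: "k \<in> F" and x: "x \<in> I"
  shows "f u * f (partial k x) = (\<Sum>j\<in>{..<n} - F. f (partial k (G j)) * f (partial j x))"
proof -
  define y where "y = u * x - (\<Sum>j\<in>{..<n} - F. partial j x * G j)"
  have G: "G j \<in> I" "partial j (G j) - u \<in> I" "\<And>i. i \<in> {..<n} - F - {j} \<Longrightarrow> partial i (G j) \<in> I"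
    if "j \<in> {..<n} - F" for j using P that by (auto simp: pivots_def)
  have f0: "f z = 0" if "z \<in> I" for z using I(2) that by (auto simp: point_ideal_def)
  have "y \<in> I" unfolding y_def
    by (intro is_ideal_diff[OF I(1)] is_ideal_mult[OF I(1)] is_ideal_sum[OF I(1)] x G(1))
  have fy: "f (partial i y) = f u * f (partial i x) - (\<Sum>j\<in>{..<n} - F. f (partial j x) * f (partial i (G j)))" for i
    using f by (simp add: y_def derivation_diff[OF partial_derivation] derivation_mult[OF partial_derivation]
        derivation_sum[OF partial_derivation] point_simps f0 x G(1))
  have "f (partial i y) = 0" if i: "i \<in> {..<n} - F" for i
  proof -
    have "(\<Sum>j\<in>{..<n} - F. f (partial j x) * f (partial i (G j)))
        = (\<Sum>j\<in>{..<n} - F. if j = i then f (partial i x) * f u else 0)"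
    proof (intro sum.cong refl)
      fix j assume j: "j \<in> {..<n} - F"
      show "f (partial j x) * f (partial i (G j)) = (if j = i then f (partial i x) * f u else 0)"
      proof (cases "j = i")
        case True
        have "f (partial j (G j)) = f u" using f0[OF G(2)[OF j]] f by (simp add: point_simps)
        then show ?thesis using True by simp
      next
        case False
        then have "f (partial i (G j)) = 0" using i j by (intro f0 G(3)) auto
        then show ?thesis using False by simp
      qed
    qed
    then show ?thesis unfolding fy using i by simp
  qed
  then have "f (partial k y) = 0" using P \<open>y \<in> I\<close> k by (auto simp: pivots_def)
  then show ?thesis unfolding fy by (simp add: mult.commute)
qed

text \<open>The solution of the linearised equations in which parameter \<open>k\<close> moves with
  speed \<open>f u\<close> and the other parameters rest; the \<open>G i\<close> then force the
  entries at the eliminated variables.\<close>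

definition tangent_vec ::
  "nat \<Rightarrow> (falg \<Rightarrow> complex) \<Rightarrow> nat set \<Rightarrow> falg \<Rightarrow> (nat \<Rightarrow> falg) \<Rightarrow> nat \<Rightarrow> falg \<Rightarrow> complex" where
  "tangent_vec n f F u G k x = (\<Sum>i<n. f (partial i x) *
    (if i = k then f u else if i \<in> F then 0 else - f (partial k (G i))))"

lemma tangent_vec_props:
  assumes f: "is_point f" and I: "is_ideal I" "I \<subseteq> point_ideal f" and P: "pivots n f I F u G"
    and k: "k \<in> F"
  shows "point_derivation f (tangent_vec n f F u G k)"
    and "x \<in> I \<Longrightarrow> tangent_vec n f F u G k x = 0"
    and "l \<in> F \<Longrightarrow> tangent_vec n f F u G k (var l - cst c) = (if l = k then f u else 0)"
proof -
  have FS: "F \<subseteq> {..<n}" using P by (simp add: pivots_def)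
  show "point_derivation f (tangent_vec n f F u G k)"
    using pd_of_vector[OF f] by (simp add: tangent_vec_def[abs_def])
  let ?w = "\<lambda>i. if i = k then f u else if i \<in> F then 0 else - f (partial k (G i))"
  {
    assume x: "x \<in> I"
    have "tangent_vec n f F u G k x = (\<Sum>i\<in>{..<n} - F. f (partial i x) * ?w i) + (\<Sum>i\<in>F. f (partial i x) * ?w i)"
      unfolding tangent_vec_def using FS by (subst sum.subset_diff[of F]) auto
    also have "(\<Sum>i\<in>F. f (partial i x) * ?w i) = (\<Sum>i\<in>F. if i = k then f (partial k x) * f u else 0)"
      by (intro sum.cong) auto
    also have "\<dots> = f u * f (partial k x)" using k finite_subset[OF FS] by simp
    also have "(\<Sum>i\<in>{..<n} - F. f (partial i x) * ?w i) = - (\<Sum>j\<in>{..<n} - F. f (partial k (G j)) * f (partial j x))"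
      unfolding sum_negf[symmetric] using k by (intro sum.cong) auto
    finally show "tangent_vec n f F u G k x = 0"
      using pivots_tangent[OF f I P k x] by simp
  }
  assume l: "l \<in> F"
  have "tangent_vec n f F u G k (var l - cst c) = (\<Sum>i<n. if i = l then (if l = k then f u else 0) else 0)"
    unfolding tangent_vec_def using f l
    by (intro sum.cong) (auto simp: derivation_diff[OF partial_derivation] point_simps)
  also have "\<dots> = (if l = k then f u else 0)" using l FS by auto
  finally show "tangent_vec n f F u G k (var l - cst c) = (if l = k then f u else 0)" .
qed

lemma pivots_tangents:
  assumes f: "is_point f" and I: "is_ideal I" "I \<subseteq> point_ideal f" and P: "pivots n f I F u G"
  shows "indep_tangents f I F (tangent_vec n f F u G)"
proof -
  have FS: "F \<subseteq> {..<n}" "f u \<noteq> 0" using P by (auto simp: pivots_def)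
  note fin = finite_subset[OF FS(1) finite_lessThan]
  note tv = tangent_vec_props[OF f I P]
  have "c k = 0" if c: "\<forall>x. (\<Sum>k\<in>F. c k * tangent_vec n f F u G k x) = 0" and k: "k \<in> F" for c k
  proof -
    have "(\<Sum>l\<in>F. c l * tangent_vec n f F u G l (var k - cst 0)) = (\<Sum>l\<in>F. if l = k then c k * f u else 0)"
      using tv(3)[OF _ k, of _ 0] by (intro sum.cong) simp_all
    also have "\<dots> = c k * f u" using fin k by simp
    finally show ?thesis using c FS(2) by simp
  qed
  then show ?thesis unfolding indep_tangents_def using fin tv(1,2) by blast
qed

text \<open>The coordinates in \<open>F\<close>, centred at \<open>f\<close>, form a basis of the
  cotangent space: the vectors \<open>tangent_vec\<close> are dual to them, and the Taylor expansion
  of \<open>G j\<close> expresses each eliminated coordinate through them.\<close>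

lemma pivots_embdim:
  assumes f: "is_point f" and I: "is_ideal I" "I \<subseteq> point_ideal f" "vars_in n I"
    and P: "pivots n f I F u G"
  shows "embdim f I (card F)"
proof -
  have FS: "F \<subseteq> {..<n}" "f u \<noteq> 0" using P by (auto simp: pivots_def)
  note fin = finite_subset[OF FS(1) finite_lessThan]
  note tv = tangent_vec_props[OF f I(1,2) P]
  note C = cotangent_kernel_ideal[OF f I(1)]
  define t where "t k = var k - cst (f (var k))" for k
  have tvt: "tangent_vec n f F u G k (t l) = (if l = k then f u else 0)" if "k \<in> F" "l \<in> F" for k l
    unfolding t_def using tv(3) that by blast
  have inj: "inj_on t F"
  proof (rule inj_onI)
    fix k l assume kl: "k \<in> F" "l \<in> F" "t k = t l"
    have "f u = tangent_vec n f F u G k (t l)" using tvt[OF kl(1,1)] kl(3) by simp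
    then show "k = l" using tvt[OF kl(1,2)] FS(2) by metis
  qed
  have tm: "t k \<in> point_ideal f" for k using f by (simp add: t_def point_ideal_def point_simps)
  have "indep (cotangent_kernel f I) (t ` F)"
    unfolding indep_def
  proof (intro conjI allI impI ballI)
    fix c e assume c: "lin c (t ` F) \<in> cotangent_kernel f I" and "e \<in> t ` F"
    then obtain k where k: "k \<in> F" "e = t k" by auto
    have "0 = tangent_vec n f F u G k (lin c (t ` F))"
      using pd_cotangent_kernel[OF tv(1,2) c] k(1) by simp
    also have "\<dots> = (\<Sum>l\<in>F. c (t l) * tangent_vec n f F u G k (t l))"
      by (simp add: pd_lin[OF f tv(1)[OF k(1)]] sum.reindex[OF inj])
    also have "\<dots> = (\<Sum>l\<in>F. if l = k then c (t k) * f u else 0)"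
      using tvt k by (intro sum.cong) auto
    also have "\<dots> = c (t k) * f u" using fin k by simp
    finally show "c e = 0" using k FS(2) by simp
  qed (use fin in auto)
  moreover have "point_ideal f \<subseteq> spans (cotangent_kernel f I) (t ` F)"
  proof
    have span_t: "t j \<in> spans (cotangent_kernel f I) (t ` F)" if j: "j < n" for j
    proof (cases "j \<in> F")
      case True
      then show ?thesis using spans_self[OF C, of "t ` F" "t j"] fin by auto
    next
      case False
      then have jF: "j \<in> {..<n} - F" using j by auto
      have f0: "f z = 0" if "z \<in> I" for z using I(2) that by (auto simp: point_ideal_def)
      have G: "G j \<in> I" "partial j (G j) - u \<in> I" "\<And>i. i \<in> {..<n} - F - {j} \<Longrightarrow> partial i (G j) \<in> I"
        using P jF by (auto simp: pivots_def)
      let ?s = "\<Sum>i<n. cst (f (partial i (G j))) * t i"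
      have "G j - cst (f (G j)) - ?s \<in> cotangent_kernel f I"
        unfolding t_def by (rule taylor_mod_cotangent_kernel[OF f I])
      then have "G j - (G j - cst (f (G j)) - ?s) \<in> cotangent_kernel f I"
        by (rule is_ideal_diff[OF C ck_I[OF G(1)]])
      then have s: "?s \<in> cotangent_kernel f I" using f0[OF G(1)] by simp
      have "?s = (\<Sum>i\<in>{..<n} - F. cst (f (partial i (G j))) * t i) + (\<Sum>i\<in>F. cst (f (partial i (G j))) * t i)"
        using FS by (subst sum.subset_diff[of F]) auto
      also have "(\<Sum>i\<in>{..<n} - F. cst (f (partial i (G j))) * t i) = (\<Sum>i\<in>{..<n} - F. if i = j then cst (f u) * t j else 0)"
      proof (intro sum.cong refl)
        fix i assume i: "i \<in> {..<n} - F"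
        have "f (partial j (G j)) = f u" using f0[OF G(2)] f by (simp add: point_simps)
        moreover have "f (partial i (G j)) = 0" if "i \<noteq> j" using i that by (intro f0 G(3)) auto
        ultimately show "cst (f (partial i (G j))) * t i = (if i = j then cst (f u) * t j else 0)" by auto
      qed
      also have "\<dots> = cst (f u) * t j" using jF by simp
      finally have eq: "cst (f u) * t j = ?s - (\<Sum>i\<in>F. cst (f (partial i (G j))) * t i)" by simp
      have "(\<Sum>i\<in>F. cst (- f (partial i (G j))) * t i) \<in> spans (cotangent_kernel f I) (t ` F)"
        using fin by (intro spans_sum spans_scale spans_self C) auto
      from spans_add[OF C spans_ideal[OF C s] this]
      have "cst (f u) * t j \<in> spans (cotangent_kernel f I) (t ` F)"
        by (simp add: eq cst_uminus sum_negf)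
      then have "cst (inverse (f u)) * (cst (f u) * t j) \<in> spans (cotangent_kernel f I) (t ` F)"
        by (rule spans_scale[OF C])
      then show ?thesis using cst_inverse[OF FS(2)] by (simp add: mult.assoc[symmetric])
    qed
    fix x assume "x \<in> point_ideal f"
    then have fx: "f x = 0" by (simp add: point_ideal_def)
    have "x - cst (f x) - (\<Sum>i<n. cst (f (partial i x)) * t i) \<in> cotangent_kernel f I"
      unfolding t_def by (rule taylor_mod_cotangent_kernel[OF f I])
    then have "x - (\<Sum>i<n. cst (f (partial i x)) * t i) \<in> cotangent_kernel f I" using fx by simp
    then show "x \<in> spans (cotangent_kernel f I) (t ` F)"
      by (rule spans_cong[OF C]) (intro spans_sum spans_scale C span_t, simp)
  qed
  ultimately show ?thesis unfolding embdim_def using tm card_image[OF inj]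
    by (intro exI[of _ "t ` F"]) auto
qed

lemma embdim_pivots:
  assumes f: "is_point f" and I: "is_ideal I" "I \<subseteq> point_ideal f" "vars_in n I" and e: "embdim f I d"
  obtains F u G where "pivots n f I F u G" "card F = d"
  using pivots_exist[OF f I(1,2), of n] pivots_embdim[OF f I] embdim_unique[OF f I(1) e] by metis

lemma embdim_exists:
  assumes "is_point f" "is_ideal I" "I \<subseteq> point_ideal f" "vars_in n I"
  shows "\<exists>d. embdim f I d"
  using pivots_exist[OF assms(1-3), of n] pivots_embdim[OF assms] by blast

lemma embdim_tangents:
  assumes "is_point f" "is_ideal I" "I \<subseteq> point_ideal f" "vars_in n I" "embdim f I d"
  shows "\<exists>K vs. indep_tangents f I K vs \<and> card K = d"
  using embdim_pivots[OF assms] pivots_tangents[OF assms(1-3)] by metis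

lemma embdim_antimono:
  assumes f: "is_point f" and I: "is_ideal I" "vars_in n I" and p: "is_ideal p" "I \<subseteq> p" "p \<subseteq> point_ideal f"
    and e: "embdim f I d" "embdim f p d'"
  shows "d' \<le> d"
proof -
  obtain K vs where K: "indep_tangents f p K vs" "card K = d'"
    using embdim_tangents[OF f p(1,3) vars_in_mono[OF I(2) p(2)] e(2)] by auto
  then have "indep_tangents f I K vs" using p(2) by (auto simp: indep_tangents_def)
  then show ?thesis using indep_tangents_card_le[OF f I(1) e(1)] K by auto
qed

section \<open>Embedding dimension against transcendence degree\<close>

text \<open>Where the derivatives \<open>u j\<close> of the shortest relations do not vanish, a
  tangent vector is determined by its values at the free variables, so there are at most
  \<open>trdeg n p\<close> independent ones.\<close>

lemma generic_embdim_le_trdeg: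
  assumes p: "is_prime p" and n: "vars_in n p"
  shows "\<exists>g. g \<notin> p \<and> (\<forall>f d. is_point f \<and> p \<subseteq> point_ideal f \<and> f g \<noteq> 0 \<and> embdim f p d \<longrightarrow> d \<le> trdeg n p)"
proof -
  let ?N = "{..<n} - free_vars n p"
  have "\<forall>j. \<exists>s a. j \<in> ?N \<longrightarrow> alg_relation p j s a \<and> (\<forall>s' a'. alg_relation p j s' a' \<longrightarrow> s \<le> s')"
  proof
    fix j
    show "\<exists>s a. j \<in> ?N \<longrightarrow> alg_relation p j s a \<and> (\<forall>s' a'. alg_relation p j s' a' \<longrightarrow> s \<le> s')"
    proof (cases "j \<in> ?N")
      case True
      then obtain s a where "alg_relation p j s a" by (auto simp: free_vars_def)
      then show ?thesis using minimal_relation by blast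
    qed blast
  qed
  then obtain s a where rel: "\<And>j. j \<in> ?N \<Longrightarrow> alg_relation p j (s j) (a j)"
    and min: "\<And>j s' a'. j \<in> ?N \<Longrightarrow> alg_relation p j s' a' \<Longrightarrow> s j \<le> s'" by metis
  define u where "u j = (\<Sum>i\<le>s j. of_nat i * a j i * var j ^ (i - 1))" for j
  have u: "u j \<notin> p" if "j \<in> ?N" for j
    unfolding u_def using minimal_relation_separable[OF p rel[OF that]] min[OF that] by blast
  have "(\<Prod>j\<in>?N. u j) \<notin> p" using u prime_prod[OF _ p, of ?N u] by auto
  moreover have "d \<le> trdeg n p"
    if f: "is_point f" and pf: "p \<subseteq> point_ideal f" and g: "f (\<Prod>j\<in>?N. u j) \<noteq> 0" and e: "embdim f p d" for f d
  proof (rule ccontr)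
    assume less: "\<not> ?thesis"
    note I = prime_ideal[OF p]
    have fu: "f (u j) \<noteq> 0" if j: "j \<in> ?N" for j
    proof
      assume "f (u j) = 0"
      then have "f (u j * (\<Prod>j\<in>?N - {j}. u j)) = 0" using f by (simp add: point_simps)
      then show False using g j by (simp add: prod.remove[of ?N j])
    qed
    obtain K vs where K: "indep_tangents f p K vs" "card K = d"
      using embdim_tangents[OF f I pf n e] by auto
    \<comment> \<open>With more tangent vectors than free variables, some nontrivial combination
      vanishes at all free variables; the relations then make it vanish at the algebraic ones, in
      the order in which they are adjoined.\<close>
    obtain c where c: "\<exists>k\<in>K. c k \<noteq> 0" "\<forall>l\<in>free_vars n p. (\<Sum>k\<in>K. c k * vs k (var l)) = 0"
      using homogeneous_system_complex[of "free_vars n p" K "\<lambda>k l. vs k (var l)"] K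
        less finite_free_vars by (auto simp: indep_tangents_def trdeg_def)
    define V where "V x = (\<Sum>k\<in>K. c k * vs k x)" for x
    have V: "point_derivation f V"
      using K unfolding V_def by (intro pd_comb) (auto simp: indep_tangents_def)
    have Vp: "V x = 0" if "x \<in> p" for x using K that by (auto simp: indep_tangents_def V_def)
    have Vvar: "V (var j) = 0" for j
    proof (induction j rule: less_induct)
      case (less j)
      have VS: "V x = 0" if "x \<in> subalg j" for x
        using that
        by (induction rule: subalg.induct) (auto simp: pd_cst[OF V] pd_add[OF V] pd_mult[OF V] less)
      show ?case
      proof (cases "j \<in> ?N")
        case True
        note r = rel[OF True, unfolded alg_relation_def]
        have "V (a j i * var j ^ i) = f (of_nat i * a j i * var j ^ (i - 1)) * V (var j)" for i
          using f r VS by (simp add: pd_mult[OF V] pd_power[OF f V] point_simps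
              cst_of_nat[symmetric] mult_ac)
        then have "V (\<Sum>i\<le>s j. a j i * var j ^ i) = f (u j) * V (var j)"
          using f by (simp add: pd_sum[OF V] u_def point_sum sum_distrib_right)
        then show ?thesis using Vp r fu[OF True] by simp
      next
        case False
        then show ?thesis using c(2) Vp n by (cases "j < n") (auto simp: V_def vars_in_def)
      qed
    qed
    have "V x = 0" for x
      using pd_chain_rule[OF f V, of n x] Vvar by simp
    then show False using c(1) K(1) by (auto simp: indep_tangents_def V_def)
  qed
  ultimately show ?thesis by blast
qed

lemma der_comb:
  assumes "finite L" "\<And>l i. l \<in> L \<Longrightarrow> i \<ge> n \<Longrightarrow> v l i = 0"
  shows "der (\<lambda>i. \<Sum>l\<in>L. c l * v l i) x = (\<Sum>l\<in>L. c l * der (v l) x)"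
proof -
  have "der (\<lambda>i. \<Sum>l\<in>L. c l * v l i) x = (\<Sum>i<n. partial i x * (\<Sum>l\<in>L. c l * v l i))"
    using assms(2) by (intro der_chain_rule) auto
  also have "\<dots> = (\<Sum>l\<in>L. c l * (\<Sum>i<n. partial i x * v l i))"
    unfolding sum_distrib_left by (subst sum.swap) (simp add: mult_ac)
  also have "\<dots> = (\<Sum>l\<in>L. c l * der (v l) x)"
    using assms(2) by (intro sum.cong refl) (simp add: der_chain_rule[symmetric])
  finally show ?thesis .
qed

text \<open>Differentiating \<open>G j\<close> leaves one linear equation modulo \<open>p\<close>:
  up to the factor \<open>u\<close>, the values at the parameters in \<open>F\<close> determine
  those at the other variables.\<close>

lemma pivots_derivation:
  assumes p: "is_ideal p" and P: "pivots n f p F u G" and v: "stable {der v} p" "\<And>i. i \<ge> n \<Longrightarrow> v i = 0"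
    and j: "j \<in> {..<n} - F"
  shows "u * v j + (\<Sum>k\<in>F. partial k (G j) * v k) \<in> p"
proof -
  have FS: "F \<subseteq> {..<n}" using P by (simp add: pivots_def)
  have G: "G j \<in> p" "partial j (G j) - u \<in> p" "\<And>i. i \<in> {..<n} - F - {j} \<Longrightarrow> partial i (G j) \<in> p"
    using P j by (auto simp: pivots_def)
  have "der v (G j) = (\<Sum>i<n. partial i (G j) * v i)" using v(2) by (rule der_chain_rule)
  also have "\<dots> = (\<Sum>i\<in>{..<n} - F. partial i (G j) * v i) + (\<Sum>k\<in>F. partial k (G j) * v k)"
    by (rule sum.subset_diff[OF FS finite_lessThan])
  also have "(\<Sum>i\<in>{..<n} - F. partial i (G j) * v i)
      = partial j (G j) * v j + (\<Sum>i\<in>{..<n} - F - {j}. partial i (G j) * v i)"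
    using j by (subst sum.remove[of _ j]) auto
  finally have eq: "u * v j + (\<Sum>k\<in>F. partial k (G j) * v k)
    = der v (G j) - (partial j (G j) - u) * v j - (\<Sum>i\<in>{..<n} - F - {j}. partial i (G j) * v i)"
    by (simp add: algebra_simps)
  have "der v (G j) \<in> p" using v(1) G(1) by (simp add: stable_def)
  moreover have "(partial j (G j) - u) * v j \<in> p" by (rule is_ideal_mult2[OF p G(2)])
  moreover have "(\<Sum>i\<in>{..<n} - F - {j}. partial i (G j) * v i) \<in> p"
    using G(3) by (intro is_ideal_sum[OF p] is_ideal_mult2[OF p])
  ultimately show ?thesis unfolding eq using is_ideal_diff[OF p] by blast
qed

text \<open>The derivations dual to the free variables are independent modulo \<open>p\<close>, yet
  a derivation preserving \<open>p\<close> is determined modulo \<open>p\<close> by its values on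
  \<open>F\<close>. In the case of equality they can be recombined into derivations dual to the
  local parameters, with factor \<open>u\<close> not vanishing at \<open>f\<close>.\<close>

lemma trdeg_le_embdim:
  assumes p: "is_prime p" and n: "vars_in n p" and f: "is_point f" "p \<subseteq> point_ideal f" and e: "embdim f p d"
  shows "trdeg n p \<le> d"
    and "trdeg n p = d \<Longrightarrow> \<exists>F u w. card F = d \<and> finite F \<and> f u \<noteq> 0 \<and>
      (\<forall>k\<in>F. stable {der (w k)} p \<and> w k k = u \<and> (\<forall>l\<in>F - {k}. w k l = 0))"
proof -
  note I = prime_ideal[OF p]
  obtain F u G where P: "pivots n f p F u G" and F: "card F = d"
    using embdim_pivots[OF f(1) I f(2) n e] by blast
  have FS: "F \<subseteq> {..<n}" "f u \<noteq> 0" using P by (auto simp: pivots_def)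
  note fin = finite_subset[OF FS(1) finite_lessThan]
  have up: "u \<notin> p" using f(2) FS(2) by (auto simp: point_ideal_def)
  let ?L = "free_vars n p"
  have "\<forall>l\<in>?L. \<exists>v. stable {der v} p \<and> v l \<notin> p \<and> (\<forall>l'\<in>?L. l' \<noteq> l \<longrightarrow> v l' = 0) \<and> (\<forall>i\<ge>n. v i = 0)"
    using free_var_derivation[OF p n] by blast
  from bchoice[OF this] obtain v where v': "\<forall>l\<in>?L. stable {der (v l)} p \<and> v l l \<notin> p \<and>
      (\<forall>l'\<in>?L. l' \<noteq> l \<longrightarrow> v l l' = 0) \<and> (\<forall>i\<ge>n. v l i = 0)" by (rule exE)
  have v: "\<And>l. l \<in> ?L \<Longrightarrow> stable {der (v l)} p" "\<And>l. l \<in> ?L \<Longrightarrow> v l l \<notin> p"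
    "\<And>l l'. l \<in> ?L \<Longrightarrow> l' \<in> ?L \<Longrightarrow> l' \<noteq> l \<Longrightarrow> v l l' = 0" "\<And>l i. l \<in> ?L \<Longrightarrow> i \<ge> n \<Longrightarrow> v l i = 0"
    using v' by simp_all
  define comb where "comb c i = (\<Sum>l\<in>?L. c l * v l i)" for c i
  have comb_stable: "stable {der (comb c)} p" for c
  proof -
    have "der (comb c) x = (\<Sum>l\<in>?L. c l * der (v l) x)" for x
      unfolding comb_def by (rule der_comb[OF finite_free_vars]) (rule v(4))
    moreover have "der (v l) x \<in> p" if "l \<in> ?L" "x \<in> p" for l x using v(1)[OF that(1)] that by (simp add: stable_def)
    ultimately show ?thesis unfolding stable_def
      by (auto intro!: is_ideal_sum[OF I] is_ideal_mult[OF I])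
  qed
  have comb0: "comb c i = 0" if "i \<ge> n" for c i using v(4) that by (simp add: comb_def)
  have comb_l: "comb c l = c l * v l l" if l: "l \<in> ?L" for c l
  proof -
    have "comb c l = (\<Sum>l'\<in>?L. if l' = l then c l * v l l else 0)"
      unfolding comb_def using v(3) l by (intro sum.cong) auto
    then show ?thesis using l finite_free_vars by simp
  qed
  \<comment> \<open>If all values on \<open>F\<close> were in \<open>p\<close>, the pivot equations
    would put the value \<open>c l * v l l\<close> at the free variable \<open>l\<close> into
    \<open>p\<close> as well.\<close>
  have nonzero: "\<exists>k\<in>F. comb c k \<notin> p" if c: "\<exists>l\<in>?L. c l \<notin> p" for c
  proof (rule ccontr)
    assume n: "\<not> ?thesis"
    obtain l where l: "l \<in> ?L" "c l \<notin> p" using c by auto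
    have "comb c l \<notin> p" using l v(2) comb_l prime_mult_iff[OF p] by auto
    moreover have "l < n" using l free_vars_less by blast
    ultimately have "l \<in> {..<n} - F" using n by auto
    from pivots_derivation[OF I P comb_stable comb0 this]
    have "u * comb c l + (\<Sum>k\<in>F. partial k (G l) * comb c k) \<in> p" .
    moreover have "(\<Sum>k\<in>F. partial k (G l) * comb c k) \<in> p"
      using n by (intro is_ideal_sum[OF I] is_ideal_mult[OF I]) auto
    ultimately have "u * comb c l \<in> p" using is_ideal_add_iff[OF I] by blast
    then show False using up \<open>comb c l \<notin> p\<close> prime_mult_iff[OF p] by blast
  qed
  have dep: "\<exists>c. (\<exists>l\<in>?L. c l \<notin> p) \<and> (\<forall>k\<in>T. comb c k \<in> p)" if "finite T" "card T < trdeg n p" for T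
    unfolding comb_def
    using homogeneous_system_mod_prime[OF p that(1) finite_free_vars, of n p v] that(2)
    by (simp add: trdeg_def)
  show "trdeg n p \<le> d"
  proof (rule ccontr)
    assume "\<not> ?thesis"
    then show False using dep[OF fin] nonzero F by fastforce
  qed
  assume eq: "trdeg n p = d"
  \<comment> \<open>Speed \<open>u\<close> at parameter \<open>k\<close>, zero at the other
    parameters, and at the eliminated variables the values dictated by the \<open>G i\<close>. All
    coefficients are ring elements.\<close>
  define w where "w k i = (if i = k then u else if i \<in> {..<n} - F then - partial k (G i) else 0)" for k i
  have "stable {der (w k)} p" if k: "k \<in> F" for k
  proof -
    \<comment> \<open>There is one equation fewer than there are unknowns, so a nontrivial
      combination vanishes modulo \<open>p\<close> at every parameter except \<open>k\<close>. Up to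
      the factors \<open>c0\<close> and \<open>u\<close> it agrees with \<open>w k\<close> modulo
      \<open>p\<close>, which shows that \<open>w k\<close> preserves \<open>p\<close>.\<close>
    have "card (F - {k}) < trdeg n p" using k fin F eq by (metis card_Diff1_less)
    then obtain c where c: "\<exists>l\<in>?L. c l \<notin> p" "\<forall>k'\<in>F - {k}. comb c k' \<in> p"
      using dep[of "F - {k}"] fin by auto
    define c0 where "c0 = comb c k"
    have c0: "c0 \<notin> p" using nonzero[OF c(1)] c(2) by (auto simp: c0_def)
    have wi: "c0 * w k i - u * comb c i \<in> p" if i: "i < n" for i
    proof (cases "i \<in> F")
      case True
      show ?thesis
      proof (cases "i = k")
        case True
        then show ?thesis using is_ideal_0[OF I] by (simp add: w_def c0_def mult.commute)
      next
        case False
        then show ?thesis using True c(2) by (simp add: w_def is_ideal_uminus[OF I] is_ideal_mult[OF I])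
      qed
    next
      case False
      then have iF: "i \<in> {..<n} - F" using i by auto
      have s: "(\<Sum>k'\<in>F. partial k' (G i) * comb c k')
          = partial k (G i) * c0 + (\<Sum>k'\<in>F - {k}. partial k' (G i) * comb c k')"
        using k fin by (simp add: sum.remove[of F k] c0_def)
      have "c0 * w k i - u * comb c i = (\<Sum>k'\<in>F - {k}. partial k' (G i) * comb c k')
          - (u * comb c i + (\<Sum>k'\<in>F. partial k' (G i) * comb c k'))"
      proof -
        have "i \<noteq> k" using iF k by auto
        then have "w k i = - partial k (G i)" using iF by (simp add: w_def)
        then show ?thesis unfolding s by (simp add: algebra_simps)
      qed
      moreover have "(\<Sum>k'\<in>F - {k}. partial k' (G i) * comb c k') \<in> p"
        using c(2) by (intro is_ideal_sum[OF I] is_ideal_mult[OF I]) auto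
      ultimately show ?thesis
        using is_ideal_diff[OF I _ pivots_derivation[OF I P comb_stable comb0 iF]] by (simp only:)
    qed
    have w0: "w k i = 0" if "i \<ge> n" for i using that k FS by (auto simp: w_def)
    have "der (w k) x \<in> p" if x: "x \<in> p" for x
    proof -
      have "c0 * der (w k) x - u * der (comb c) x = (\<Sum>i<n. partial i x * (c0 * w k i - u * comb c i))"
      proof -
        have "der (w k) x = (\<Sum>i<n. partial i x * w k i)" using w0 by (rule der_chain_rule)
        moreover have "der (comb c) x = (\<Sum>i<n. partial i x * comb c i)" using comb0 by (rule der_chain_rule)
        ultimately show ?thesis
          by (simp add: sum_distrib_left right_diff_distrib sum_subtractf mult.left_commute)
      qed
      also have "\<dots> \<in> p" using wi by (intro is_ideal_sum[OF I] is_ideal_mult[OF I]) auto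
      finally have "c0 * der (w k) x - u * der (comb c) x \<in> p" .
      moreover have "u * der (comb c) x \<in> p"
        using comb_stable[of c] x by (auto simp: stable_def intro: is_ideal_mult[OF I])
      ultimately have "c0 * der (w k) x \<in> p" using is_ideal_cong[OF I] by blast
      then show ?thesis using c0 prime_mult_iff[OF p] by blast
    qed
    then show ?thesis by (simp add: stable_def)
  qed
  moreover have "w k k = u" for k by (simp add: w_def)
  moreover have "w k l = 0" if "k \<in> F" "l \<in> F - {k}" for k l using that by (simp add: w_def)
  ultimately show "\<exists>F u w. card F = d \<and> finite F \<and> f u \<noteq> 0 \<and>
      (\<forall>k\<in>F. stable {der (w k)} p \<and> w k k = u \<and> (\<forall>l\<in>F - {k}. w k l = 0))"
    using F fin FS(2) by (intro exI[of _ F] exI[of _ u] exI[of _ w]) auto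
qed

section \<open>Prime chains and regularity\<close>

definition prime_chain :: "falg set \<Rightarrow> (falg \<Rightarrow> complex) \<Rightarrow> nat \<Rightarrow> bool" where
  "prime_chain I f m \<longleftrightarrow> (\<exists>P. (\<forall>i\<le>m. is_prime (P i) \<and> I \<subseteq> P i) \<and> (\<forall>i<m. P i \<subset> P (Suc i)) \<and>
    P m = point_ideal f)"

text \<open>At a smooth point, the chain consists of the cores of the maximal ideal with respect to
  fewer and fewer of the derivations dual to the local parameters.\<close>

lemma smooth_prime_chain:
  assumes p: "is_prime p" and n: "vars_in n p" and f: "is_point f" "p \<subseteq> point_ideal f"
    and e: "embdim f p (trdeg n p)"
  shows "prime_chain p f (trdeg n p)"
proof -
  let ?d = "trdeg n p" and ?m = "point_ideal f"
  obtain F u w where F: "card F = ?d" "finite F" "f u \<noteq> 0"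
    and w: "\<And>k. k \<in> F \<Longrightarrow> stable {der (w k)} p" "\<And>k. k \<in> F \<Longrightarrow> w k k = u"
      "\<And>k l. k \<in> F \<Longrightarrow> l \<in> F - {k} \<Longrightarrow> w k l = 0"
    using trdeg_le_embdim(2)[OF p n f e] by blast
  obtain h where h: "bij_betw h {..<?d} F" using F ex_bij_betw_nat_finite[of F] by (auto simp: atLeast0LessThan)
  have hF: "h i \<in> F" if "i < ?d" for i using h that by (auto simp: bij_betw_def)
  have hinj: "h i \<noteq> h j" if "i < ?d" "j < ?d" "i \<noteq> j" for i j
    using h that by (auto simp: bij_betw_def inj_on_def)
  define D where "D i = (\<lambda>j. der (w (h j))) ` {i..<?d}" for i
  define P where "P i = core (D i) ?m" for i
  note m = point_ideal_prime[OF f(1)]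
  have "is_prime (P i)" for i unfolding P_def
    by (rule falg_core_prime[OF _ m m]) (auto simp: D_def der_derivation)
  moreover have "p \<subseteq> P i" for i unfolding P_def
  proof (rule core_greatest[OF _ f(2)])
    show "stable (D i) p" using w(1) hF by (fastforce simp: stable_def D_def)
  qed
  moreover have "P i \<subset> P (Suc i)" if i: "i < ?d" for i
  proof -
    have "P i \<subseteq> P (Suc i)" unfolding P_def by (rule core_antimono) (auto simp: D_def)
    \<comment> \<open>\<open>t\<close> is killed by the derivations remaining in
      \<open>D (Suc i)\<close>, whereas \<open>der (w (h i))\<close> maps it to \<open>u\<close>,
      which does not vanish at \<open>f\<close>.\<close>
    moreover define t where "t = var (h i) - cst (f (var (h i)))"
    have "t \<in> P (Suc i)" unfolding P_def core_def
    proof (intro CollectI allI impI)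
      fix ds assume ds: "set ds \<subseteq> D (Suc i)"
      show "fold (\<lambda>d. d) ds t \<in> ?m"
      proof (cases ds)
        case Nil
        then show ?thesis using f(1) by (simp add: t_def point_ideal_def point_simps)
      next
        case (Cons d ds')
        then obtain j where j: "d = der (w (h j))" "Suc i \<le> j" "j < ?d" using ds by (auto simp: D_def)
        have "w (h j) (h i) = 0" using w(3)[of "h j" "h i"] hF hinj[of i j] i j by auto
        then have "d t = 0" by (simp add: j t_def derivation_diff[OF der_derivation])
        moreover have "fold (\<lambda>d. d) ds' 0 = (0::falg)"
        proof -
          have "set ds' \<subseteq> D (Suc i)" using ds Cons by simp
          then show ?thesis
            by (induction ds') (auto simp: D_def derivation_0[OF der_derivation])
        qed
        ultimately show ?thesis using Cons is_ideal_0[OF prime_ideal[OF m]] by simp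
      qed
    qed
    moreover have "t \<notin> P i"
    proof
      assume "t \<in> P i"
      moreover have "der (w (h i)) \<in> D i" using i by (auto simp: D_def)
      ultimately have "der (w (h i)) t \<in> ?m"
        using core_stable[of "D i" ?m] core_subset[of "D i" ?m] unfolding P_def stable_def by blast
      then have "u \<in> ?m" using w(2)[OF hF[OF i]] by (simp add: t_def derivation_diff[OF der_derivation])
      then show False using F(3) by (simp add: point_ideal_def)
    qed
    ultimately show ?thesis by blast
  qed
  moreover have "P ?d = ?m" by (simp add: P_def D_def core_empty)
  ultimately show ?thesis unfolding prime_chain_def by blast
qed

text \<open>The bottom member is replaced by \<open>p\<close> itself, so that the bound for chains
  starting at \<open>p\<close> applies.\<close>

lemma prime_chain_le_trdeg:
  assumes p: "is_prime p" "vars_in n p" and c: "prime_chain p f m"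
  shows "m \<le> trdeg n p"
proof (cases m)
  case (Suc m')
  obtain P where P: "\<forall>i\<le>m. is_prime (P i) \<and> p \<subseteq> P i" "\<forall>i<m. P i \<subset> P (Suc i)"
    using c unfolding prime_chain_def by blast
  have "m \<le> trdeg n ((P(0 := p)) 0)"
  proof (rule chain_length_le_trdeg[of m "P(0 := p)" n])
    show "is_prime ((P(0 := p)) i)" if "i \<le> m" for i using P(1) p that by simp
    show "(P(0 := p)) i \<subset> (P(0 := p)) (Suc i)" if "i < m" for i
      using P that by (cases i) auto
    show "vars_in n ((P(0 := p)) 0)" using p by simp
  qed
  then show ?thesis by simp
qed simp

text \<open>At a smooth point of \<open>p\<close> there is a chain of length
  \<open>trdeg n p\<close> above \<open>p\<close>. It is also a chain above \<open>q\<close>, where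
  \<open>trdeg n q\<close> bounds all lengths.\<close>

lemma trdeg_antimono:
  assumes p: "is_prime p" and q: "is_prime q" "q \<subseteq> p" "vars_in n q"
  shows "trdeg n p \<le> trdeg n q"
proof -
  note n = vars_in_mono[OF q(3,2)]
  obtain g where g0: "g \<notin> p \<and>
    (\<forall>f d. is_point f \<and> p \<subseteq> point_ideal f \<and> f g \<noteq> 0 \<and> embdim f p d \<longrightarrow> d \<le> trdeg n p)"
    using generic_embdim_le_trdeg[OF p n] by (rule exE)
  then have g: "g \<notin> p"
    "\<And>f d. is_point f \<Longrightarrow> p \<subseteq> point_ideal f \<Longrightarrow> f g \<noteq> 0 \<Longrightarrow> embdim f p d \<Longrightarrow> d \<le> trdeg n p"
    by simp_all
  obtain f where f: "is_point f" "p \<subseteq> point_ideal f" "f g \<noteq> 0" using nullstellensatz[OF p g(1)] by auto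
  obtain d where d: "embdim f p d" using embdim_exists[OF f(1) prime_ideal[OF p] f(2) n] by auto
  have "d = trdeg n p" using g(2)[OF f d] trdeg_le_embdim(1)[OF p n f(1,2) d] by simp
  then have "prime_chain p f (trdeg n p)" using smooth_prime_chain[OF p n f(1,2)] d by simp
  then have "prime_chain q f (trdeg n p)" using q(2) unfolding prime_chain_def by (meson subset_trans)
  then show ?thesis by (rule prime_chain_le_trdeg[OF q(1,3)])
qed

text \<open>An upper bound for the lengths of prime chains that is attained at regular points.
  Unlike a chain, it involves one prime at a time, which makes it comparable along a flow.\<close>

definition local_trdeg :: "nat \<Rightarrow> falg set \<Rightarrow> (falg \<Rightarrow> complex) \<Rightarrow> nat" where
  "local_trdeg n I f = Max {trdeg n p | p. is_prime p \<and> I \<subseteq> p \<and> p \<subseteq> point_ideal f}"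

lemma finite_trdegs: "finite {trdeg n p | p. Q p}"
  by (rule finite_subset[of _ "{..n}"]) (auto simp: trdeg_le)

lemma trdeg_le_local_trdeg:
  "is_prime p \<Longrightarrow> I \<subseteq> p \<Longrightarrow> p \<subseteq> point_ideal f \<Longrightarrow> trdeg n p \<le> local_trdeg n I f"
  unfolding local_trdeg_def by (rule Max_ge[OF finite_trdegs]) blast

lemma local_trdeg_attained:
  assumes "is_point f" "I \<subseteq> point_ideal f"
  obtains p where "is_prime p" "I \<subseteq> p" "p \<subseteq> point_ideal f" "trdeg n p = local_trdeg n I f"
proof -
  have "local_trdeg n I f \<in> {trdeg n p | p. is_prime p \<and> I \<subseteq> p \<and> p \<subseteq> point_ideal f}"
    unfolding local_trdeg_def using point_ideal_prime[OF assms(1)] assms(2)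
    by (intro Max_in finite_trdegs) blast
  then show thesis using that by auto
qed

lemma prime_chain_le_local_trdeg:
  assumes "vars_in n I" "prime_chain I f m"
  shows "m \<le> local_trdeg n I f"
proof -
  obtain P where P: "\<forall>i\<le>m. is_prime (P i) \<and> I \<subseteq> P i" "\<forall>i<m. P i \<subset> P (Suc i)" "P m = point_ideal f"
    using assms(2) unfolding prime_chain_def by blast
  have mono: "P 0 \<subseteq> P i" if "i \<le> m" for i using that
  proof (induction i)
    case (Suc i)
    then show ?case using P(2) by (metis Suc_leD Suc_le_lessD psubset_imp_subset subset_trans)
  qed simp
  have "prime_chain (P 0) f m" unfolding prime_chain_def using P mono by (intro exI[of _ P]) auto
  then have "m \<le> trdeg n (P 0)" using P assms(1) by (intro prime_chain_le_trdeg) (auto elim: vars_in_mono)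
  also have "\<dots> \<le> local_trdeg n I f" using P mono[of m] by (intro trdeg_le_local_trdeg) auto
  finally show ?thesis .
qed

definition regular :: "falg set \<Rightarrow> (falg \<Rightarrow> complex) \<Rightarrow> bool" where
  "regular I f \<longleftrightarrow> (\<exists>d. embdim f I d \<and> prime_chain I f d \<and> (\<forall>m. prime_chain I f m \<longrightarrow> m \<le> d))"

lemma local_trdeg_le_embdim:
  assumes f: "is_point f" and I: "is_ideal I" "I \<subseteq> point_ideal f" "vars_in n I" and e: "embdim f I d"
  shows "local_trdeg n I f \<le> d"
proof -
  obtain p where p: "is_prime p" "I \<subseteq> p" "p \<subseteq> point_ideal f" "trdeg n p = local_trdeg n I f"
    using local_trdeg_attained[OF f I(2)] by blast
  note n = vars_in_mono[OF I(3) p(2)]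
  obtain d' where d': "embdim f p d'" using embdim_exists[OF f prime_ideal[OF p(1)] p(3) n] by auto
  have "trdeg n p \<le> d'" by (rule trdeg_le_embdim(1)[OF p(1) n f p(3) d'])
  also have "d' \<le> d" by (rule embdim_antimono[OF f I(1,3) prime_ideal[OF p(1)] p(2,3) e d'])
  finally show ?thesis using p by simp
qed

text \<open>Chain lengths are at most \<open>local_trdeg\<close>, which is at most the embedding
  dimension. If the last two agree, a prime attaining \<open>local_trdeg\<close> has the same
  embedding dimension, so \<open>f\<close> is a smooth point of it and the missing chain
  exists.\<close>

lemma regular_iff:
  assumes f: "is_point f" and I: "is_ideal I" "I \<subseteq> point_ideal f" "vars_in n I"
  shows "regular I f \<longleftrightarrow> embdim f I (local_trdeg n I f)"
proof
  assume "regular I f"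
  then obtain d where d: "embdim f I d" "prime_chain I f d" by (auto simp: regular_def)
  have "d = local_trdeg n I f"
    using prime_chain_le_local_trdeg[OF I(3) d(2)] local_trdeg_le_embdim[OF f I d(1)] by simp
  then show "embdim f I (local_trdeg n I f)" using d by simp
next
  assume e: "embdim f I (local_trdeg n I f)"
  obtain p where p: "is_prime p" "I \<subseteq> p" "p \<subseteq> point_ideal f" "trdeg n p = local_trdeg n I f"
    using local_trdeg_attained[OF f I(2)] by blast
  note n = vars_in_mono[OF I(3) p(2)]
  obtain d' where d': "embdim f p d'" using embdim_exists[OF f prime_ideal[OF p(1)] p(3) n] by auto
  have "trdeg n p \<le> d'" by (rule trdeg_le_embdim(1)[OF p(1) n f p(3) d'])
  moreover have "d' \<le> trdeg n p"
    using embdim_antimono[OF f I(1,3) prime_ideal[OF p(1)] p(2,3) e d'] p(4) by simp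
  ultimately have "prime_chain p f (trdeg n p)" using smooth_prime_chain[OF p(1) n f p(3)] d' by simp
  then have "prime_chain I f (local_trdeg n I f)"
    using p(2,4) unfolding prime_chain_def by (metis subset_trans)
  then show "regular I f" using e prime_chain_le_local_trdeg[OF I(3)] unfolding regular_def by blast
qed

text \<open>Where \<open>h\<close> does not vanish, \<open>I\<close> and \<open>p\<close> have the
  same tangent vectors; where \<open>g\<close> does not vanish, at most \<open>trdeg n p\<close> of
  them are independent. Hence \<open>h * g\<close> works.\<close>

lemma generic_regular:
  assumes I: "is_ideal I" "vars_in n I" and p: "is_prime p" "I \<subseteq> p" and h: "h \<notin> p" "\<And>x. x \<in> p \<Longrightarrow> h * x \<in> I"
  shows "\<exists>g. g \<notin> p \<and> (\<forall>f. is_point f \<and> I \<subseteq> point_ideal f \<and> f g \<noteq> 0 \<longrightarrow> regular I f)"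
proof -
  note n = vars_in_mono[OF I(2) p(2)]
  obtain g where g0: "g \<notin> p \<and>
    (\<forall>f d. is_point f \<and> p \<subseteq> point_ideal f \<and> f g \<noteq> 0 \<and> embdim f p d \<longrightarrow> d \<le> trdeg n p)"
    using generic_embdim_le_trdeg[OF p(1) n] by (rule exE)
  then have g: "g \<notin> p"
    "\<And>f d. is_point f \<Longrightarrow> p \<subseteq> point_ideal f \<Longrightarrow> f g \<noteq> 0 \<Longrightarrow> embdim f p d \<Longrightarrow> d \<le> trdeg n p"
    by simp_all
  have "regular I f" if f: "is_point f" and If: "I \<subseteq> point_ideal f" and fg: "f (h * g) \<noteq> 0" for f
  proof -
    have fh: "f h \<noteq> 0" "f g \<noteq> 0" using fg f by (auto simp: point_simps)
    have pf: "p \<subseteq> point_ideal f"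
    proof
      fix x assume "x \<in> p"
      then have "f (h * x) = 0" using h(2) If by (auto simp: point_ideal_def)
      then show "x \<in> point_ideal f" using fh f by (simp add: point_ideal_def point_simps)
    qed
    obtain d where d: "embdim f I d" using embdim_exists[OF f I(1) If I(2)] by auto
    obtain d' where d': "embdim f p d'" using embdim_exists[OF f prime_ideal[OF p(1)] pf n] by auto
    obtain K vs where K: "indep_tangents f I K vs" "card K = d"
      using embdim_tangents[OF f I(1) If I(2) d] by auto
    have "vs k x = 0" if k: "k \<in> K" and x: "x \<in> p" for k x
    proof -
      have v: "point_derivation f (vs k)" "vs k (h * x) = 0"
        using K k h(2)[OF x] by (auto simp: indep_tangents_def)
      have "f x = 0" using x pf by (auto simp: point_ideal_def)
      then show ?thesis using v(2) fh(1) by (simp add: pd_mult[OF v(1)])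
    qed
    then have "indep_tangents f p K vs" using K by (auto simp: indep_tangents_def)
    then have "d \<le> d'" using indep_tangents_card_le[OF f prime_ideal[OF p(1)] d'] K by auto
    also have "d' \<le> trdeg n p" by (rule g(2)[OF f pf fh(2) d'])
    also have "\<dots> \<le> local_trdeg n I f" by (rule trdeg_le_local_trdeg[OF p pf])
    finally have "d = local_trdeg n I f" using local_trdeg_le_embdim[OF f I(1) If I(2) d] by simp
    then show ?thesis using d regular_iff[OF f I(1) If I(2)] by simp
  qed
  moreover have "h * g \<notin> p" using h(1) g(1) prime_mult_iff[OF p(1)] by blast
  ultimately show ?thesis by blast
qed

text \<open>A maximal annihilator of an element modulo \<open>I\<close> is prime, as for associated
  primes, and radicality keeps \<open>h\<close> out of it. Where \<open>h\<close> does not vanish,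
  \<open>I\<close> and this prime have the same points.\<close>

lemma radical_ideal_annihilator_prime:
  assumes J: "is_ideal J" "vars_in n J" and I: "is_ideal I" "J \<subseteq> I" "1 \<notin> I"
    and rad: "\<And>x. x * x \<in> I \<Longrightarrow> x \<in> I"
  shows "\<exists>p h. is_prime p \<and> I \<subseteq> p \<and> h \<notin> p \<and> (\<forall>x\<in>p. h * x \<in> I)"
proof -
  define ann where "ann h = {x. h * x \<in> I}" for h
  have id: "is_ideal (ann h)" for h
    unfolding is_ideal_def ann_def
    using is_ideal_0[OF I(1)] is_ideal_add[OF I(1)] is_ideal_mult[OF I(1)]
    by (auto simp: distrib_left mult.left_commute)
  have Ia: "I \<subseteq> ann h" for h using is_ideal_mult[OF I(1)] by (auto simp: ann_def)
  have "\<exists>p\<in>ann ` (- I). \<forall>q\<in>ann ` (- I). p \<subseteq> q \<longrightarrow> q = p"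
  proof (rule exists_maximal_ideal_in_family[OF J])
    show "ann ` (- I) \<noteq> {}" using I(3) by auto
    fix q assume "q \<in> ann ` (- I)"
    then show "is_ideal q \<and> J \<subseteq> q" using id Ia I(2) by blast
  qed
  then obtain h where h: "h \<notin> I" "\<And>k. k \<notin> I \<Longrightarrow> ann h \<subseteq> ann k \<Longrightarrow> ann k = ann h" by blast
  have "is_prime (ann h)" unfolding is_prime_def
  proof (intro conjI allI impI id)
    show "1 \<notin> ann h" using h(1) by (simp add: ann_def)
    fix a b assume ab: "a * b \<in> ann h"
    show "a \<in> ann h \<or> b \<in> ann h"
    proof (rule ccontr)
      assume n: "\<not> ?thesis"
      then have "h * a \<notin> I" by (simp add: ann_def)
      moreover have "ann h \<subseteq> ann (h * a)"
        using is_ideal_mult[OF I(1), of "h * _" a] by (auto simp: ann_def mult_ac)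
      ultimately have "ann (h * a) = ann h" by (rule h(2))
      moreover have "b \<in> ann (h * a)" using ab by (simp add: ann_def mult.assoc)
      ultimately show False using n by simp
    qed
  qed
  moreover have "h \<notin> ann h"
  proof
    assume "h \<in> ann h"
    then have "h * h \<in> I" by (simp add: ann_def)
    then show False using rad[of h] h(1) by blast
  qed
  moreover have "\<forall>x\<in>ann h. h * x \<in> I" by (simp add: ann_def)
  ultimately show ?thesis using Ia by (intro exI[of _ "ann h"] exI[of _ h]) simp
qed

text \<open>Replacing a prime by its core makes it smaller, so the transcendence degree does not
  drop. The maximum is therefore attained at a stable prime, and by hypothesis such primes pass from
  \<open>f\<close> to \<open>g\<close>.\<close>

lemma local_trdeg_le_if_same_stable_primes:
  assumes D: "\<And>d. d \<in> D \<Longrightarrow> is_derivation d" and I: "stable D I" "vars_in n I"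
    and f: "is_point f" "I \<subseteq> point_ideal f"
    and same: "\<And>p. is_prime p \<Longrightarrow> stable D p \<Longrightarrow> I \<subseteq> p \<Longrightarrow> p \<subseteq> point_ideal f \<Longrightarrow> p \<subseteq> point_ideal g"
  shows "local_trdeg n I f \<le> local_trdeg n I g"
proof -
  obtain p where p: "is_prime p" "I \<subseteq> p" "p \<subseteq> point_ideal f" "trdeg n p = local_trdeg n I f"
    using local_trdeg_attained[OF f] by blast
  let ?q = "core D p"
  have q: "is_prime ?q" "stable D ?q" "I \<subseteq> ?q" "?q \<subseteq> p"
    using falg_core_prime[OF D p(1) p(1)] core_stable[of D p] core_greatest[OF I(1) p(2)] core_subset[of D p]
    by auto
  have "trdeg n p \<le> trdeg n ?q" by (rule trdeg_antimono[OF p(1) q(1,4) vars_in_mono[OF I(2) q(3)]])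
  also have "\<dots> \<le> local_trdeg n I g"
    using same[OF q(1,2,3)] q p(3) by (intro trdeg_le_local_trdeg) auto
  finally show ?thesis using p(4) by simp
qed

section \<open>Flows of derivations\<close>

text \<open>\<open>norm_le \<rho> x d c\<close>: \<open>x\<close> has an expression of degree at most \<open>d\<close> in the variables in which
  the absolute values of the terms at radius \<open>\<rho>\<close> add up to at most \<open>c\<close>.\<close>

inductive norm_le :: "real \<Rightarrow> falg \<Rightarrow> nat \<Rightarrow> real \<Rightarrow> bool" for \<rho> where
  norm_le_cst: "norm z \<le> c \<Longrightarrow> norm_le \<rho> (cst z) d c"
| norm_le_add: "norm_le \<rho> x d c \<Longrightarrow> norm_le \<rho> y d c' \<Longrightarrow> norm_le \<rho> (x + y) d (c + c')"
| norm_le_var: "norm_le \<rho> x d c \<Longrightarrow> norm_le \<rho> (var i * x) (Suc d) (\<rho> * c)"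

lemma norm_le_nonneg: "norm_le \<rho> x d c \<Longrightarrow> \<rho> \<ge> 1 \<Longrightarrow> c \<ge> 0"
proof (induction rule: norm_le.induct)
  case (norm_le_cst z c d)
  then show ?case using norm_ge_zero order_trans by blast
qed auto

lemma norm_le_mono: "norm_le \<rho> x d c \<Longrightarrow> c \<le> c' \<Longrightarrow> norm_le \<rho> x d c'"
  using norm_le_add[of \<rho> x d c "cst 0" "c' - c"] norm_le_cst[of 0 "c' - c" \<rho> d] by simp

lemma norm_le_deg_mono: "norm_le \<rho> x d c \<Longrightarrow> d \<le> d' \<Longrightarrow> norm_le \<rho> x d' c"
proof (induction arbitrary: d' rule: norm_le.induct)
  case (norm_le_var x d c i)
  then show ?case by (cases d') (auto intro: norm_le.norm_le_var)
qed (auto intro: norm_le.intros)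

lemma norm_le_0: "c \<ge> 0 \<Longrightarrow> norm_le \<rho> 0 d c"
  using norm_le_cst[of 0 c \<rho> d] by simp

lemma norm_le_cst_mult: "norm_le \<rho> x d c \<Longrightarrow> norm_le \<rho> (cst z * x) d (norm z * c)"
proof (induction rule: norm_le.induct)
  case (norm_le_cst w c d)
  then have "norm_le \<rho> (cst (z * w)) d (norm z * c)"
    by (intro norm_le.norm_le_cst) (simp add: norm_mult mult_left_mono)
  then show ?case by (simp add: cst_mult)
next
  case (norm_le_add x d c y c')
  then show ?case using norm_le.norm_le_add[OF norm_le_add.IH] by (simp add: distrib_left)
next
  case (norm_le_var x d c i)
  then have "norm_le \<rho> (var i * (cst z * x)) (Suc d) (\<rho> * (norm z * c))" by (intro norm_le.norm_le_var)
  then show ?case by (simp add: mult_ac)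
qed

lemma norm_le_mult:
  assumes y: "norm_le \<rho> y e c'" and \<rho>: "\<rho> \<ge> 1"
  shows "norm_le \<rho> x d c \<Longrightarrow> norm_le \<rho> (x * y) (d + e) (c * c')"
proof (induction rule: norm_le.induct)
  case (norm_le_cst z c d)
  have "norm_le \<rho> (cst z * y) e (norm z * c')" by (rule norm_le_cst_mult[OF y])
  then have "norm_le \<rho> (cst z * y) e (c * c')"
    by (rule norm_le_mono) (intro mult_right_mono norm_le_cst norm_le_nonneg[OF y \<rho>])
  then show ?case by (rule norm_le_deg_mono) simp
next
  case (norm_le_add x d c y' c'')
  then show ?case using norm_le.norm_le_add[OF norm_le_add.IH] by (simp add: distrib_right)
next
  case (norm_le_var x d c i)
  then show ?case using norm_le.norm_le_var[of \<rho> "x * y" "d + e" "c * c'" i] by (simp add: mult.assoc)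
qed

lemma norm_le_exists: "\<rho> \<ge> 1 \<Longrightarrow> \<exists>d c. norm_le \<rho> x d c"
proof (induction x rule: falg_induct)
  case (cst z)
  then show ?case using norm_le_cst by blast
next
  case (var i)
  then show ?case using norm_le_var[OF norm_le_cst[of 1 1 \<rho> 0], of i] by auto
next
  case (add a b)
  then obtain d c e c' where "norm_le \<rho> a d c" "norm_le \<rho> b e c'" by blast
  then have "norm_le \<rho> a (max d e) c" "norm_le \<rho> b (max d e) c'" by (auto elim: norm_le_deg_mono)
  then show ?case using norm_le_add by blast
next
  case (mult a b)
  then show ?case using norm_le_mult by blast
qed

lemma norm_le_point:
  assumes f: "is_point f" and \<rho>: "\<And>i. norm (f (var i)) \<le> \<rho>"
  shows "norm_le \<rho> x d c \<Longrightarrow> norm (f x) \<le> c"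
proof (induction rule: norm_le.induct)
  case (norm_le_add x d c y c')
  then show ?case using norm_triangle_ineq[of "f x" "f y"] f by (simp add: point_simps)
next
  case (norm_le_var x d c i)
  then show ?case using f \<rho>[of i] by (auto simp: point_simps norm_mult intro!: mult_mono)
      (meson \<rho> norm_ge_zero order_trans)
qed (use f in \<open>simp add: point_simps\<close>)

text \<open>A term has at most \<open>d\<close> variables and the product rule differentiates them
  one at a time. Each summand lacks a factor \<rho>, which can be restored because \<rho> \<ge>
  1.\<close>

lemma norm_le_point_derivation:
  assumes f: "is_point f" "\<And>i. norm (f (var i)) \<le> \<rho>" and \<rho>: "\<rho> \<ge> 1"
    and v: "point_derivation f v" "\<And>i. norm (v (var i)) \<le> V"
  shows "norm_le \<rho> x d c \<Longrightarrow> norm (v x) \<le> V * d * c"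
proof (induction rule: norm_le.induct)
  have V: "V \<ge> 0" using v(2)[of 0] norm_ge_zero order_trans by blast
  {
    case (norm_le_cst z c d)
    then have "c \<ge> 0" using norm_ge_zero order_trans by blast
    then show ?case using V by (simp add: pd_cst[OF v(1)])
  next
    case (norm_le_add x d c y c')
    then show ?case using norm_triangle_ineq[of "v x" "v y"] by (simp add: pd_add[OF v(1)] distrib_left)
  next
    case (norm_le_var x d c i)
    have c: "c \<ge> 0" "norm (f x) \<le> c"
      using norm_le_nonneg[OF norm_le_var(1) \<rho>] norm_le_point[OF f norm_le_var(1)] by auto
    have "norm (v (var i * x)) \<le> norm (f (var i) * v x) + norm (v (var i) * f x)"
      unfolding pd_mult[OF v(1)] by (rule norm_triangle_ineq)
    also have "\<dots> = norm (f (var i)) * norm (v x) + norm (v (var i)) * norm (f x)"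
      by (simp only: norm_mult)
    finally have 1: "norm (v (var i * x)) \<le> norm (f (var i)) * norm (v x) + norm (v (var i)) * norm (f x)" .
    have 2: "norm (f (var i)) * norm (v x) \<le> \<rho> * (V * d * c)"
      using \<rho> by (intro mult_mono f(2) norm_le_var.IH) auto
    have 3: "norm (v (var i)) * norm (f x) \<le> V * c"
      by (intro mult_mono v(2) c V norm_ge_zero)
    have 4: "V * c \<le> \<rho> * (V * c)"
      using mult_right_mono[OF \<rho>, of "V * c"] V c by simp
    have "norm (v (var i * x)) \<le> \<rho> * (V * d * c) + \<rho> * (V * c)" using 1 2 3 4 by linarith
    also have "\<dots> = V * real (Suc d) * (\<rho> * c)" by (simp add: algebra_simps)
    finally show ?case .
  }
qed

text \<open>The factor \<open>d\<close> again counts the variables of a term; the one that is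
  differentiated is replaced by an element of degree \<open>D\<close> and bound
  \<open>M\<close>.\<close>

lemma norm_le_der:
  assumes a: "\<And>i. norm_le \<rho> (a i) D M" and \<rho>: "\<rho> \<ge> 1"
  shows "norm_le \<rho> x d c \<Longrightarrow> norm_le \<rho> (der a x) (d + D) (d * M * c)"
proof (induction rule: norm_le.induct)
  have M: "M \<ge> 0" by (rule norm_le_nonneg[OF a \<rho>])
  {
    case (norm_le_cst z c d)
    then have "c \<ge> 0" using norm_ge_zero order_trans by blast
    then show ?case using M by (simp add: norm_le_0)
  next
    case (norm_le_add x d c y c')
    then show ?case using norm_le.norm_le_add[OF norm_le_add.IH]
      by (simp add: derivation_add[OF der_derivation] distrib_left)
  next
    case (norm_le_var x d c i)
    have c: "c \<ge> 0" using norm_le_nonneg[OF norm_le_var(1) \<rho>] .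
    have "norm_le \<rho> (var i * der a x) (Suc (d + D)) (\<rho> * (d * M * c))"
      by (rule norm_le.norm_le_var[OF norm_le_var.IH])
    moreover have "norm_le \<rho> (a i * x) (Suc (d + D)) (M * c)"
      by (rule norm_le_deg_mono[OF norm_le_mult[OF norm_le_var(1) \<rho> a]]) simp
    ultimately have "norm_le \<rho> (var i * der a x + a i * x) (Suc (d + D)) (\<rho> * (d * M * c) + M * c)"
      by (rule norm_le_add)
    then have "norm_le \<rho> (var i * der a x + a i * x) (Suc (d + D)) (real (Suc d) * M * (\<rho> * c))"
    proof (rule norm_le_mono)
      have "M * c \<le> \<rho> * (M * c)" using mult_right_mono[OF \<rho>, of "M * c"] M c by simp
      then show "\<rho> * (d * M * c) + M * c \<le> real (Suc d) * M * (\<rho> * c)" by (simp add: algebra_simps)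
    qed
    then show ?case by (simp add: derivation_mult[OF der_derivation])
  }
qed

text \<open>Step \<open>k\<close> multiplies the bound by the current degree
  \<open>d + k * D\<close> and by \<open>M\<close>, hence by at most
  \<open>M * (D + 1) * (d + k + 1)\<close>. The product of the numbers from \<open>d + 1\<close> to
  \<open>d + k\<close> is \<open>fact k * ((d + k) choose k)\<close>.\<close>

lemma norm_le_der_power:
  assumes a: "\<And>i. norm_le \<rho> (a i) D M" and \<rho>: "\<rho> \<ge> 1" and x: "norm_le \<rho> x d c"
  shows "norm_le \<rho> ((der a ^^ k) x) (d + k * D) (c * (M * (D + 1)) ^ k * (fact k * ((d + k) choose k)))"
proof (induction k)
  case 0
  then show ?case using x by simp
next
  case (Suc k)
  have M: "M \<ge> 0" by (rule norm_le_nonneg[OF a \<rho>])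
  have c: "c \<ge> 0" by (rule norm_le_nonneg[OF x \<rho>])
  let ?B = "c * (M * (D + 1)) ^ k * (fact k * ((d + k) choose k)) :: real"
  have B: "?B \<ge> 0" using M c by simp
  have "norm_le \<rho> ((der a ^^ Suc k) x) (d + k * D + D) (real (d + k * D) * M * ?B)"
    using norm_le_der[OF a \<rho> Suc] by simp
  then have 1: "norm_le \<rho> ((der a ^^ Suc k) x) (d + Suc k * D) (real (d + k * D) * M * ?B)"
    by (simp add: algebra_simps)
  have 2: "real (d + k * D) * M * ?B \<le> real ((D + 1) * (d + k + 1)) * M * ?B"
  proof (intro mult_right_mono B M)
    have "d + k * D \<le> (D + 1) * (d + k + 1)" by (simp add: algebra_simps)
    then show "real (d + k * D) \<le> real ((D + 1) * (d + k + 1))" by (simp only: of_nat_le_iff)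
  qed
  have 3: "real ((D + 1) * (d + k + 1)) * M * ?B
      = c * (M * (D + 1)) ^ Suc k * (fact (Suc k) * ((d + Suc k) choose Suc k))"
  proof -
    have "Suc k * ((d + Suc k) choose Suc k) = (d + k + 1) * ((d + k) choose k)"
      using Suc_times_binomial_eq[of "d + k" k] by (simp add: mult.commute)
    then have e: "fact (Suc k) * ((d + Suc k) choose Suc k) = fact k * ((d + k + 1) * ((d + k) choose k))"
      unfolding fact_Suc by (simp only: of_nat_id mult.assoc mult.left_commute)
    show ?thesis unfolding e power_Suc of_nat_mult of_nat_add of_nat_1 by (simp only: mult_ac)
  qed
  show ?case by (rule norm_le_mono[OF 1 2[unfolded 3]])
qed

section \<open>Exponential series of a derivation\<close>

text \<open>Ensures that the exponential series of \<open>d\<close>, evaluated by \<open>g\<close>,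
  converges for times of norm below \<open>1 / r\<close>. Here \<open>g\<close> may be a point or a
  tangent vector.\<close>

definition admissible :: "(falg \<Rightarrow> falg) \<Rightarrow> real \<Rightarrow> (falg \<Rightarrow> complex) \<Rightarrow> bool" where
  "admissible d r g \<longleftrightarrow> (\<forall>x. \<exists>C\<ge>0. \<forall>k. norm (g ((d ^^ k) x)) \<le> C * r ^ k * fact k)"

text \<open>One radius serves all points with coordinates bounded by \<rho> and all tangent vectors
  there. This uniformity makes it possible to run the flow backwards from a later point of the
  curve.\<close>

lemma flow_radius:
  assumes n: "\<And>i. i \<ge> n \<Longrightarrow> a i = 0" and \<rho>: "\<rho> \<ge> 1"
  shows "\<exists>r>0. \<forall>f. is_point f \<and> (\<forall>i. norm (f (var i)) \<le> \<rho>) \<longrightarrow> admissible (der a) r f \<and>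
    (\<forall>v. point_derivation f v \<and> (\<forall>i\<ge>n. v (var i) = 0) \<longrightarrow> admissible (der a) r v)"
proof -
  have "\<forall>i. \<exists>d c. norm_le \<rho> (a i) d c" using norm_le_exists[OF \<rho>] by blast
  then obtain d0 c0 where dc: "\<And>i. norm_le \<rho> (a i) (d0 i) (c0 i)" by metis
  define D where "D = (\<Sum>i<n. d0 i)"
  define M where "M = (\<Sum>i<n. \<bar>c0 i\<bar>) + 1"
  have M: "M > 0" by (simp add: M_def add_nonneg_pos sum_nonneg)
  have a: "norm_le \<rho> (a i) D M" for i
  proof (cases "i < n")
    case True
    have "c0 i \<le> \<bar>c0 i\<bar>" by simp
    also have "\<dots> \<le> (\<Sum>i<n. \<bar>c0 i\<bar>)" by (rule member_le_sum) (use True in auto)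
    finally have "c0 i \<le> M" by (simp add: M_def)
    moreover have "d0 i \<le> D" unfolding D_def by (rule member_le_sum) (use True in auto)
    ultimately show ?thesis using norm_le_deg_mono[OF norm_le_mono[OF dc]] by blast
  next
    case False
    then show ?thesis using n M by (simp add: norm_le_0)
  qed
  \<comment> \<open>The factor 2 pays for the binomial coefficient, which is at most
    \<open>2 ^ (d + k)\<close>; the part \<open>2 ^ d\<close> joins the constant.\<close>
  define r0 where "r0 = 2 * (M * (D + 1))"
  have r0: "r0 > 0" using M by (simp add: r0_def add_nonneg_pos)
  have bound: "norm_le \<rho> ((der a ^^ k) x) (d + k * D) (c * 2 ^ d * r0 ^ k * fact k)"
    if x: "norm_le \<rho> x d c" for x d c k
  proof (rule norm_le_mono[OF norm_le_der_power[OF a \<rho> x]])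
    have c: "c \<ge> 0" by (rule norm_le_nonneg[OF x \<rho>])
    have "real ((d + k) choose k) \<le> 2 ^ (d + k)"
      using binomial_le_pow2[of "d + k" k] by (metis of_nat_le_iff of_nat_numeral of_nat_power)
    then have "c * (M * (D + 1)) ^ k * (fact k * real ((d + k) choose k)) \<le>
        c * (M * (D + 1)) ^ k * (fact k * 2 ^ (d + k))"
      using c M by (intro mult_left_mono) auto
    also have "\<dots> = c * 2 ^ d * r0 ^ k * fact k"
    proof -
      have "r0 ^ k = 2 ^ k * (M * (D + 1)) ^ k" by (simp only: r0_def power_mult_distrib)
      then show ?thesis by (simp only: power_add mult_ac)
    qed
    finally show "c * (M * (D + 1)) ^ k * real (fact k * ((d + k) choose k)) \<le> c * 2 ^ d * r0 ^ k * fact k"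
      by simp
  qed
  \<comment> \<open>Doubling \<open>r0\<close> absorbs the degree \<open>d + k * D\<close>, which
    enters for tangent vectors and is at most \<open>(d + D) * 2 ^ k\<close>.\<close>
  have key: "admissible (der a) (2 * r0) f \<and>
      (\<forall>v. point_derivation f v \<and> (\<forall>i\<ge>n. v (var i) = 0) \<longrightarrow> admissible (der a) (2 * r0) v)"
    if f: "is_point f" "\<forall>i. norm (f (var i)) \<le> \<rho>" for f
  proof (intro conjI allI impI)
    show "admissible (der a) (2 * r0) f"
      unfolding admissible_def
    proof
      fix x
      obtain d c where x: "norm_le \<rho> x d c" using norm_le_exists[OF \<rho>] by blast
      have c: "c \<ge> 0" by (rule norm_le_nonneg[OF x \<rho>])
      have "norm (f ((der a ^^ k) x)) \<le> c * 2 ^ d * (2 * r0) ^ k * fact k" for k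
      proof -
        have "norm (f ((der a ^^ k) x)) \<le> c * 2 ^ d * r0 ^ k * fact k"
          using norm_le_point[OF f(1) _ bound[OF x]] f(2) by blast
        also have "\<dots> \<le> c * 2 ^ d * (2 * r0) ^ k * fact k"
          using c r0 by (intro mult_right_mono mult_left_mono power_mono) auto
        finally show ?thesis .
      qed
      then show "\<exists>C\<ge>0. \<forall>k. norm (f ((der a ^^ k) x)) \<le> C * (2 * r0) ^ k * fact k"
        using c by (intro exI[of _ "c * 2 ^ d"]) auto
    qed
    fix v assume v: "point_derivation f v \<and> (\<forall>i\<ge>n. v (var i) = 0)"
    then have vd: "point_derivation f v" by blast
    have fr: "norm (f (var i)) \<le> \<rho>" for i using f(2) by blast
    define V where "V = (\<Sum>i<n. norm (v (var i)))"
    have V: "norm (v (var i)) \<le> V" for i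
    proof (cases "i < n")
      case True
      then show ?thesis unfolding V_def by (intro member_le_sum) auto
    next
      case False
      then show ?thesis using v by (auto simp: V_def sum_nonneg)
    qed
    have V0: "V \<ge> 0" by (simp add: V_def sum_nonneg)
    show "admissible (der a) (2 * r0) v"
      unfolding admissible_def
    proof
      fix x
      obtain d c where x: "norm_le \<rho> x d c" using norm_le_exists[OF \<rho>] by blast
      have c: "c \<ge> 0" by (rule norm_le_nonneg[OF x \<rho>])
      have "norm (v ((der a ^^ k) x)) \<le> (V * (d + D) * c * 2 ^ d) * (2 * r0) ^ k * fact k" for k
      proof -
        have "norm (v ((der a ^^ k) x)) \<le> V * real (d + k * D) * (c * 2 ^ d * r0 ^ k * fact k)"
          by (rule norm_le_point_derivation[OF f(1) fr \<rho> vd V bound[OF x]])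
        also have "\<dots> \<le> V * (real (d + D) * 2 ^ k) * (c * 2 ^ d * r0 ^ k * fact k)"
        proof (intro mult_right_mono mult_left_mono V0)
          have "k + 1 \<le> 2 ^ k" by (induction k) auto
          then have "(d + D) * (k + 1) \<le> (d + D) * 2 ^ k" by (rule mult_le_mono2)
          then have "d + k * D \<le> (d + D) * 2 ^ k" by (simp add: algebra_simps)
          then have "real (d + k * D) \<le> real ((d + D) * 2 ^ k)" by (simp only: of_nat_le_iff)
          then show "real (d + k * D) \<le> real (d + D) * 2 ^ k" by simp
        qed (use c r0 in auto)
        finally show ?thesis by (simp add: power_mult_distrib mult_ac)
      qed
      moreover have "V * (d + D) * c * 2 ^ d \<ge> 0" using V0 c by simp
      ultimately show "\<exists>C\<ge>0. \<forall>k. norm (v ((der a ^^ k) x)) \<le> C * (2 * r0) ^ k * fact k" by blast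
    qed
  qed
  have pos: "2 * r0 > 0" using r0 by simp
  show ?thesis
    by (rule exI[of _ "2 * r0"], rule conjI[OF pos], intro allI impI, elim conjE, rule key)
qed

text \<open>The functional \<open>g\<close> composed with the exponential of \<open>t * d\<close>:
  for a point this is the point reached at time \<open>t\<close>, for a tangent vector its transport
  along the flow.\<close>

definition flow :: "(falg \<Rightarrow> falg) \<Rightarrow> (falg \<Rightarrow> complex) \<Rightarrow> complex \<Rightarrow> falg \<Rightarrow> complex" where
  "flow d g t x = (\<Sum>k. g ((d ^^ k) x) / fact k * t ^ k)"

lemma flow_0: "flow d g 0 x = g x"
proof -
  have "(\<lambda>k. g ((d ^^ k) x) / fact k * 0 ^ k) sums (g ((d ^^ 0) x) / fact 0)"
    using powser_sums_zero[of "\<lambda>k. g ((d ^^ k) x) / fact k"] by simp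
  then show ?thesis by (simp add: flow_def sums_iff)
qed

lemma admissible_power: "admissible d r g \<Longrightarrow> r > 0 \<Longrightarrow> norm t * r < 1 \<Longrightarrow>
  summable (\<lambda>k. norm (g ((d ^^ k) x) / fact k * t ^ k))"
proof -
  assume g: "admissible d r g" and r: "r > 0" "norm t * r < 1"
  obtain C where C: "C \<ge> 0" "\<And>k. norm (g ((d ^^ k) x)) \<le> C * r ^ k * fact k"
    using g by (auto simp: admissible_def)
  have "summable (\<lambda>k. C * (norm t * r) ^ k)"
    using r by (intro summable_mult summable_geometric) auto
  then show ?thesis
  proof (rule summable_comparison_test')
    fix k :: nat assume "0 \<le> k"
    have "norm (norm (g ((d ^^ k) x) / fact k * t ^ k)) = norm (g ((d ^^ k) x)) / fact k * norm t ^ k"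
      by (simp add: norm_mult norm_divide norm_power)
    also have "\<dots> \<le> (C * r ^ k * fact k) / fact k * norm t ^ k"
      by (intro mult_right_mono divide_right_mono C) auto
    also have "\<dots> = C * (norm t * r) ^ k" by (simp add: power_mult_distrib)
    finally show "norm (norm (g ((d ^^ k) x) / fact k * t ^ k)) \<le> C * (norm t * r) ^ k" .
  qed
qed

lemma flow_sums:
  assumes "admissible d r g" "r > 0" "norm t * r < 1"
  shows "(\<lambda>k. g ((d ^^ k) x) / fact k * t ^ k) sums flow d g t x"
  unfolding flow_def by (rule summable_sums[OF summable_norm_cancel[OF admissible_power[OF assms]]])

lemma flow_add:
  assumes g: "admissible d r g" "r > 0" "norm t * r < 1"
    and d: "is_derivation d" and lin: "\<And>x y. g (x + y) = g x + g y"
  shows "flow d g t (x + y) = flow d g t x + flow d g t y"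
proof -
  have "(\<lambda>k. g ((d ^^ k) x) / fact k * t ^ k + g ((d ^^ k) y) / fact k * t ^ k) sums
      (flow d g t x + flow d g t y)"
    by (intro sums_add flow_sums[OF g])
  then show ?thesis
    using sums_unique2[OF flow_sums[OF g, of "x + y"]]
    by (simp add: derivation_funpow_add[OF d] lin add_divide_distrib distrib_right)
qed

lemma flow_cst:
  assumes "\<And>c. d (cst c) = 0" "d 0 = 0" "g 0 = 0"
  shows "flow d g t (cst c) = g (cst c)"
proof -
  have "(d ^^ k) (cst c) = 0" if "k > 0" for k
    using that
  proof (induction k)
    case (Suc k)
    then show ?case using assms by (cases k) auto
  qed simp
  then have "(\<lambda>k. g ((d ^^ k) (cst c)) / fact k * t ^ k) = (\<lambda>k. if k = 0 then g (cst c) else 0)"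
    using assms by auto
  then show ?thesis unfolding flow_def by (simp add: sums_unique[OF sums_single, symmetric])
qed

text \<open>The Cauchy product of two exponential series reproduces the Leibniz rule. Two
  functionals are allowed so that the product rule of a transported tangent vector is covered
  too.\<close>

lemma flow_product:
  assumes g: "admissible d r g" and h: "admissible d r h" and r: "r > 0" "norm t * r < 1"
  shows "(\<lambda>k. (\<Sum>i\<le>k. of_nat (k choose i) * (g ((d ^^ i) x) * h ((d ^^ (k - i)) y))) / fact k * t ^ k) sums
    (flow d g t x * flow d h t y)"
proof -
  have "(\<lambda>k. \<Sum>i\<le>k. (g ((d ^^ i) x) / fact i * t ^ i) * (h ((d ^^ (k - i)) y) / fact (k - i) * t ^ (k - i))) sums
    (flow d g t x * flow d h t y)"
    unfolding flow_def by (intro Cauchy_product_sums admissible_power[OF g r] admissible_power[OF h r])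
  moreover have "(\<Sum>i\<le>k. (g ((d ^^ i) x) / fact i * t ^ i) * (h ((d ^^ (k - i)) y) / fact (k - i) * t ^ (k - i)))
    = (\<Sum>i\<le>k. of_nat (k choose i) * (g ((d ^^ i) x) * h ((d ^^ (k - i)) y))) / fact k * t ^ k" for k
    unfolding sum_divide_distrib sum_distrib_right
  proof (intro sum.cong refl)
    fix i assume i: "i \<in> {..k}"
    have "t ^ k = t ^ i * t ^ (k - i)" using i by (simp add: power_add[symmetric])
    moreover have "of_nat (k choose i) = (fact k / (fact i * fact (k - i)) :: complex)"
      using i binomial_fact[of i k] by simp
    ultimately show "(g ((d ^^ i) x) / fact i * t ^ i) * (h ((d ^^ (k - i)) y) / fact (k - i) * t ^ (k - i))
      = of_nat (k choose i) * (g ((d ^^ i) x) * h ((d ^^ (k - i)) y)) / fact k * t ^ k"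
      by (simp add: field_simps)
  qed
  ultimately show ?thesis by simp
qed

lemma flow_point:
  assumes f: "is_point f" "admissible (der a) r f" and r: "r > 0" "norm t * r < 1"
  shows "is_point (flow (der a) f t)"
  unfolding is_point_def
proof (intro conjI allI)
  fix x y c
  show "flow (der a) f t (x + y) = flow (der a) f t x + flow (der a) f t y"
    by (rule flow_add[OF f(2) r der_derivation]) (simp add: point_add[OF f(1)])
  have "f ((der a ^^ k) (x * y)) = (\<Sum>i\<le>k. of_nat (k choose i) * (f ((der a ^^ i) x) * f ((der a ^^ (k - i)) y)))" for k
    unfolding derivation_leibniz[OF der_derivation]
    using f(1) by (simp add: point_sum point_mult cst_of_nat[symmetric] point_cst)
  then show "flow (der a) f t (x * y) = flow (der a) f t x * flow (der a) f t y"
    using sums_unique2[OF flow_sums[OF f(2) r, of "x * y"]] flow_product[OF f(2,2) r, of x y] by simp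
  show "flow (der a) f t (cst c) = c"
    using flow_cst[of "der a" f] f(1) derivation_0[OF der_derivation] by (simp add: point_cst point_0)
qed

lemma flow_point_derivation:
  assumes f: "is_point f" "admissible (der a) r f" and v: "point_derivation f v" "admissible (der a) r v"
    and r: "r > 0" "norm t * r < 1"
  shows "point_derivation (flow (der a) f t) (flow (der a) v t)"
  unfolding point_derivation_def
proof (intro conjI allI)
  fix x y c
  show "flow (der a) v t (x + y) = flow (der a) v t x + flow (der a) v t y"
    by (rule flow_add[OF v(2) r der_derivation]) (simp add: pd_add[OF v(1)])
  have "v ((der a ^^ k) (x * y)) = (\<Sum>i\<le>k. of_nat (k choose i) * (f ((der a ^^ i) x) * v ((der a ^^ (k - i)) y)))
      + (\<Sum>i\<le>k. of_nat (k choose i) * (v ((der a ^^ i) x) * f ((der a ^^ (k - i)) y)))" for k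
  proof -
    have e: "v (of_nat m * z) = of_nat m * v z" for m z
      using pd_cst_mult[OF f(1) v(1), of "of_nat m" z] by (simp add: cst_of_nat)
    show ?thesis
      unfolding derivation_leibniz[OF der_derivation] sum.distrib[symmetric] pd_sum[OF v(1)] e
      unfolding pd_mult[OF v(1)] distrib_left by (rule refl)
  qed
  then have "(\<lambda>k. v ((der a ^^ k) (x * y)) / fact k * t ^ k) sums
      (flow (der a) f t x * flow (der a) v t y + flow (der a) v t x * flow (der a) f t y)"
    using sums_add[OF flow_product[OF f(2) v(2) r, of x y] flow_product[OF v(2) f(2) r, of x y]]
    by (simp add: add_divide_distrib distrib_right)
  then show "flow (der a) v t (x * y) = flow (der a) f t x * flow (der a) v t y + flow (der a) v t x * flow (der a) f t y"
    using sums_unique2[OF flow_sums[OF v(2) r, of "x * y"]] by simp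
  show "flow (der a) v t (cst c) = 0"
    using flow_cst[of "der a" v] derivation_0[OF der_derivation] by (simp add: pd_cst[OF v(1)] pd_0[OF v(1)])
qed

lemma flow_deriv:
  assumes g: "admissible d r g" "r > 0" "norm t * r < 1"
  shows "((\<lambda>t. flow d g t x) has_field_derivative flow d g t (d x)) (at t)"
proof -
  define c where "c k = g ((d ^^ k) x) / fact k" for k
  obtain s where s: "norm t < s" "s < 1 / r" using g dense[of "norm t" "1 / r"] by (auto simp: field_simps)
  have "s > 0" using s norm_ge_zero[of t] by linarith
  then have "norm (complex_of_real s) * r < 1" using s g(2) by (simp add: field_simps)
  then have "summable (\<lambda>k. c k * complex_of_real s ^ k)"
    using flow_sums[OF g(1,2), of "complex_of_real s" x] by (simp add: c_def sums_iff)
  then have "DERIV (\<lambda>t. \<Sum>k. c k * t ^ k) t :> (\<Sum>k. diffs c k * t ^ k)"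
    using s \<open>s > 0\<close> by (intro termdiffs_strong) auto
  moreover have "diffs c k = g ((d ^^ k) (d x)) / fact k" for k
    by (simp add: diffs_def c_def funpow_swap1 field_simps del: of_nat_Suc)
  ultimately show ?thesis by (simp add: flow_def[abs_def] c_def)
qed

text \<open>The series is the Taylor expansion of \<open>flow d g s x\<close> in \<open>s\<close>
  around \<open>t\<close>, evaluated at 0. The factor 2 in the hypothesis places 0 inside a disc
  around \<open>t\<close> on which the function is holomorphic.\<close>

lemma flow_back_sums:
  assumes g: "admissible d r g" "r > 0" "norm t * (2 * r) < 1"
  shows "(\<lambda>k. flow d g t ((d ^^ k) x) / fact k * (- t) ^ k) sums g x"
proof -
  let ?G = "\<lambda>t. flow d g t x"
  have hol: "?G holomorphic_on ball 0 (1 / r)"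
    unfolding holomorphic_on_def
  proof
    fix s assume "s \<in> ball (0::complex) (1 / r)"
    then have "norm s * r < 1" using g(2) by (simp add: field_simps)
    from flow_deriv[OF g(1,2) this] show "?G field_differentiable at s within ball 0 (1 / r)"
      using field_differentiable_at_within field_differentiable_def by blast
  qed
  have hd: "\<forall>s\<in>ball 0 (1 / r). (deriv ^^ k) ?G s = flow d g s ((d ^^ k) x)" for k
  proof (induction k)
    case (Suc k)
    show ?case
    proof
      fix s assume s: "s \<in> ball (0::complex) (1 / r)"
      then have sr: "norm s * r < 1" using g(2) by (simp add: field_simps)
      have "eventually (\<lambda>s. s \<in> ball 0 (1 / r)) (nhds s)" using s by (intro eventually_nhds_in_open) auto
      then have "eventually (\<lambda>s. (deriv ^^ k) ?G s = flow d g s ((d ^^ k) x)) (nhds s)"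
        by eventually_elim (use Suc in auto)
      then have "deriv ((deriv ^^ k) ?G) s = deriv (\<lambda>s. flow d g s ((d ^^ k) x)) s"
        by (intro deriv_cong_ev) auto
      also have "\<dots> = flow d g s (d ((d ^^ k) x))"
        by (rule DERIV_imp_deriv[OF flow_deriv[OF g(1,2) sr]])
      finally show "(deriv ^^ Suc k) ?G s = flow d g s ((d ^^ Suc k) x)" by simp
    qed
  qed simp
  have tr: "norm t < 1 / (2 * r)" using g by (simp add: field_simps)
  have "1 / (2 * r) + 1 / (2 * r) = 1 / r" using g(2) by (simp add: field_simps)
  then have t: "norm t < 1 / r - norm t" using tr by linarith
  have "ball t (1 / r - norm t) \<subseteq> ball 0 (1 / r)"
  proof
    fix s assume s: "s \<in> ball t (1 / r - norm t)"
    have "norm s \<le> norm t + dist t s" by (metis dist_commute dist_norm norm_triangle_sub)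
    then show "s \<in> ball 0 (1 / r)" using s by simp
  qed
  then have "?G holomorphic_on ball t (1 / r - norm t)" using hol holomorphic_on_subset by blast
  then have "(\<lambda>k. (deriv ^^ k) ?G t / fact k * (0 - t) ^ k) sums ?G 0"
    by (rule holomorphic_power_series) (use t in simp)
  moreover have "(deriv ^^ k) ?G t = flow d g t ((d ^^ k) x)" for k
  proof -
    have "norm t < 1 / r" using t norm_ge_zero[of t] by linarith
    then show ?thesis using hd[of k] by simp
  qed
  ultimately show ?thesis by (simp add: flow_0)
qed

lemma flow_back:
  assumes "admissible d r g" "r > 0" "norm t * (2 * r) < 1"
  shows "flow d (flow d g t) (- t) x = g x"
  using flow_back_sums[OF assms, of x] by (simp add: flow_def[of d "flow d g t"] sums_iff)

lemma stable_funpow: "stable {d} I \<Longrightarrow> x \<in> I \<Longrightarrow> (d ^^ k) x \<in> I"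
  by (induction k) (auto simp: stable_def)

lemma flow_kills_stable:
  assumes "stable {d} I" "\<And>x. x \<in> I \<Longrightarrow> g x = 0" "x \<in> I"
  shows "flow d g t x = 0"
  using stable_funpow[OF assms(1,3)] assms(2) by (simp add: flow_def)

text \<open>Independent tangent vectors at the start are transported to independent tangent vectors
  at time \<open>t\<close>; they still kill \<open>I\<close> because \<open>I\<close> is
  stable.\<close>

lemma flow_embdim_le:
  assumes f: "is_point f" "\<And>i. norm (f (var i)) \<le> \<rho>" and r: "r > 0" "norm t * (2 * r) < 1"
    and adm: "admissible (der a) r f"
      "\<And>v. point_derivation f v \<Longrightarrow> (\<forall>i\<ge>n. v (var i) = 0) \<Longrightarrow> admissible (der a) r v"
    and I: "is_ideal I" "vars_in n I" "stable {der a} I" "I \<subseteq> point_ideal f"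
    and e: "embdim f I d" "embdim (flow (der a) f t) I d'"
  shows "d \<le> d'"
proof -
  have t: "norm t * r < 1" using r norm_ge_zero[of t] mult_nonneg_nonneg[of "norm t" r] by linarith
  obtain K vs where K: "indep_tangents f I K vs" "card K = d"
    using embdim_tangents[OF f(1) I(1,4,2) e(1)] by auto
  have vs: "point_derivation f (vs k)" "\<And>x. x \<in> I \<Longrightarrow> vs k x = 0" if "k \<in> K" for k
    using K that by (auto simp: indep_tangents_def)
  have adv: "admissible (der a) r (vs k)" if "k \<in> K" for k
    by (rule adm(2)[OF vs(1)[OF that]]) (use vs(2)[OF that] I(2) in \<open>auto simp: vars_in_def\<close>)
  let ?vs = "\<lambda>k. flow (der a) (vs k) t"
  have fin: "finite K" using K by (simp add: indep_tangents_def)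
  have "indep_tangents (flow (der a) f t) I K ?vs"
    unfolding indep_tangents_def
  proof (intro conjI ballI allI impI fin)
    fix k assume k: "k \<in> K"
    show "point_derivation (flow (der a) f t) (?vs k)"
      by (rule flow_point_derivation[OF f(1) adm(1) vs(1)[OF k] adv[OF k] r(1) t])
    show "?vs k x = 0" if "x \<in> I" for x
      using flow_kills_stable[OF I(3) vs(2)[OF k] that] .
  next
    fix c k assume c: "\<forall>x. (\<Sum>k\<in>K. c k * ?vs k x) = 0" and k: "k \<in> K"
    \<comment> \<open>The backward series recovers \<open>vs k\<close> from its transport, so a
      linear relation among the transported vectors holds among the original ones.\<close>
    have "(\<Sum>k\<in>K. c k * vs k x) = 0" for x
    proof -
      have "(\<lambda>j. \<Sum>k\<in>K. c k * (?vs k ((der a ^^ j) x) / fact j * (- t) ^ j)) sums (\<Sum>k\<in>K. c k * vs k x)"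
        by (intro sums_sum sums_mult flow_back_sums[OF adv r])
      moreover have "(\<Sum>k\<in>K. c k * (?vs k ((der a ^^ j) x) / fact j * (- t) ^ j)) = 0" for j
      proof -
        have "(\<Sum>k\<in>K. c k * (?vs k ((der a ^^ j) x) / fact j * (- t) ^ j))
            = (\<Sum>k\<in>K. c k * ?vs k ((der a ^^ j) x)) / fact j * (- t) ^ j"
          by (simp add: sum_divide_distrib sum_distrib_right mult.assoc)
        then show ?thesis using c by simp
      qed
      ultimately show ?thesis using sums_unique2[OF sums_zero] by force
    qed
    then show "c k = 0" using K k by (auto simp: indep_tangents_def)
  qed
  then show ?thesis
    using indep_tangents_card_le[OF flow_point[OF f(1) adm(1) r(1) t] I(1) e(2)] K by auto
qed

text \<open>Each invariance is an equivalence, so its second half runs the flow back from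
  \<open>\<gamma> t\<close>. For this the curve has to stay in the polydisc on which the radius
  \<open>r\<close> is valid.\<close>

theorem local_flow:
  assumes a: "\<And>i. i \<ge> n \<Longrightarrow> a i = 0" and f: "is_point f" "\<And>i. i \<ge> n \<Longrightarrow> f (var i) = 0"
  shows "\<exists>T>0. \<exists>\<gamma>. \<gamma> 0 = f \<and> (\<forall>t\<in>{0..T::real}. is_point (\<gamma> t) \<and>
    (\<forall>x. ((\<lambda>s. \<gamma> s x) has_vector_derivative \<gamma> t (der a x)) (at t within {0..T})) \<and>
    (\<forall>I. stable {der a} I \<longrightarrow> (I \<subseteq> point_ideal f \<longleftrightarrow> I \<subseteq> point_ideal (\<gamma> t))) \<and>
    (\<forall>I d. is_ideal I \<and> vars_in n I \<and> stable {der a} I \<and> I \<subseteq> point_ideal f \<longrightarrow>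
      (embdim f I d \<longleftrightarrow> embdim (\<gamma> t) I d)))"
proof -
  \<comment> \<open>The summand 1 makes \<rho> strictly larger than all coordinates of
    \<open>f\<close>, which leaves room for the curve.\<close>
  define \<rho> where "\<rho> = 1 + (\<Sum>i<n. norm (f (var i)))"
  have \<rho>1: "\<rho> \<ge> 1" by (simp add: \<rho>_def sum_nonneg)
  have fl: "norm (f (var i)) < \<rho>" for i
  proof (cases "i < n")
    case True
    have "norm (f (var i)) \<le> (\<Sum>i<n. norm (f (var i)))" by (rule member_le_sum) (use True in auto)
    then show ?thesis by (simp add: \<rho>_def)
  next
    case False
    then show ?thesis using f(2) \<rho>1 by simp
  qed
  then have fr: "\<And>i. norm (f (var i)) \<le> \<rho>" using less_imp_le by blast
  obtain r where r: "r > 0" and adm: "\<And>f. is_point f \<Longrightarrow> \<forall>i. norm (f (var i)) \<le> \<rho> \<Longrightarrow> admissible (der a) r f"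
    and adv: "\<And>f v. is_point f \<Longrightarrow> \<forall>i. norm (f (var i)) \<le> \<rho> \<Longrightarrow> point_derivation f v \<Longrightarrow>
      \<forall>i\<ge>n. v (var i) = 0 \<Longrightarrow> admissible (der a) r v"
    using flow_radius[of n a \<rho>, OF a \<rho>1] by blast
  have fadm: "admissible (der a) r f" using adm[OF f(1)] fr by blast
  have small: "\<forall>\<^sub>F t in at 0. norm (flow (der a) f t (var i)) < \<rho>" for i
  proof -
    have "isCont (\<lambda>t. flow (der a) f t (var i)) 0"
      using DERIV_isCont[OF flow_deriv[OF fadm r, of 0]] by simp
    then have "((\<lambda>t. norm (flow (der a) f t (var i))) \<longlongrightarrow> norm (f (var i))) (at 0)"
      using isCont_def flow_0 tendsto_norm by metis
    then show ?thesis using fl[of i] by (rule order_tendstoD(2))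
  qed
  have "\<forall>\<^sub>F t in at 0. \<forall>i\<in>{..<n}. norm (flow (der a) f t (var i)) < \<rho>"
    using small by (intro eventually_ball_finite) auto
  then obtain \<epsilon> where \<epsilon>: "\<epsilon> > 0" "\<And>t. t \<noteq> 0 \<Longrightarrow> norm t < \<epsilon> \<Longrightarrow> \<forall>i\<in>{..<n}. norm (flow (der a) f t (var i)) < \<rho>"
    unfolding eventually_at by auto
  \<comment> \<open>The first bound keeps the coordinates below \<rho>; the second gives
    \<open>T * (2 * r) < 1\<close>, as backward flow requires.\<close>
  define T where "T = min (\<epsilon> / 2) (1 / (4 * r))"
  have T: "T > 0" "T < \<epsilon>" "T * (2 * r) < 1" using \<epsilon>(1) r by (auto simp: T_def min_def field_simps)
  define \<gamma> where "\<gamma> t = flow (der a) f (complex_of_real t)" for t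
  have start: "\<gamma> 0 = f" by (auto simp: \<gamma>_def flow_0)
  have key: "is_point (\<gamma> t) \<and>
    (\<forall>x. ((\<lambda>s. \<gamma> s x) has_vector_derivative \<gamma> t (der a x)) (at t within {0..T})) \<and>
    (\<forall>I. stable {der a} I \<longrightarrow> (I \<subseteq> point_ideal f \<longleftrightarrow> I \<subseteq> point_ideal (\<gamma> t))) \<and>
    (\<forall>I d. is_ideal I \<and> vars_in n I \<and> stable {der a} I \<and> I \<subseteq> point_ideal f \<longrightarrow>
      (embdim f I d \<longleftrightarrow> embdim (\<gamma> t) I d))" if t: "t \<in> {0..T}" for t
  proof -
    let ?t = "complex_of_real t"
    have t2: "norm ?t * (2 * r) < 1" 
    proof -
      have "t * (2 * r) \<le> T * (2 * r)" using t r by (intro mult_right_mono) auto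
      then show ?thesis using t T(3) by simp
    qed
    have t1: "norm ?t * r < 1" using t2 r t mult_nonneg_nonneg[of t r] by simp
    have p: "is_point (\<gamma> t)" unfolding \<gamma>_def by (rule flow_point[OF f(1) fadm r t1])
    have bk: "flow (der a) (\<gamma> t) (- ?t) = f"
      unfolding \<gamma>_def using flow_back[OF fadm r t2] by blast
    have gz: "\<gamma> t (var i) = 0" if "i \<ge> n" for i
    proof -
      have "(der a ^^ k) (var i) = (if k = 0 then var i else 0)" for k
        using a[OF that] by (induction k) (auto simp: derivation_0[OF der_derivation])
      then have "f ((der a ^^ k) (var i)) = 0" for k using f(2)[OF that] point_0[OF f(1)] by simp
      then show ?thesis by (simp add: \<gamma>_def flow_def)
    qed
    have gr: "norm (\<gamma> t (var i)) \<le> \<rho>" for i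
    proof (cases "i < n")
      case True
      then show ?thesis using \<epsilon>(2)[of ?t] t T fr[of i]
        by (cases "t = 0") (auto simp: \<gamma>_def flow_0 intro: less_imp_le)
    next
      case False
      then show ?thesis using gz \<rho>1 by simp
    qed
    have I: "I \<subseteq> point_ideal f \<longleftrightarrow> I \<subseteq> point_ideal (\<gamma> t)" if "stable {der a} I" for I
    proof
      assume "I \<subseteq> point_ideal f"
      then show "I \<subseteq> point_ideal (\<gamma> t)"
        using flow_kills_stable[OF that, of f] by (auto simp: point_ideal_def \<gamma>_def)
    next
      assume "I \<subseteq> point_ideal (\<gamma> t)"
      then have "\<And>x. x \<in> I \<Longrightarrow> flow (der a) (\<gamma> t) (- ?t) x = 0"
        using flow_kills_stable[OF that, of "\<gamma> t"] by (auto simp: point_ideal_def)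
      then show "I \<subseteq> point_ideal f" unfolding bk by (auto simp: point_ideal_def)
    qed
    have dv: "((\<lambda>s. \<gamma> s x) has_vector_derivative \<gamma> t (der a x)) (at t within {0..T})" for x
    proof -
      have "((\<lambda>s. flow (der a) f s x) has_field_derivative \<gamma> t (der a x)) (at ?t)"
        unfolding \<gamma>_def by (rule flow_deriv[OF fadm r t1])
      from has_vector_derivative_real_field[OF this]
      have "((\<lambda>s. \<gamma> s x) has_vector_derivative \<gamma> t (der a x)) (at t)" by (simp add: \<gamma>_def)
      then show ?thesis by (rule has_vector_derivative_at_within)
    qed
    have ed: "embdim f I d \<longleftrightarrow> embdim (\<gamma> t) I d"
      if II: "is_ideal I" "vars_in n I" "stable {der a} I" "I \<subseteq> point_ideal f" for I d
    proof -
      have Ig: "I \<subseteq> point_ideal (\<gamma> t)" using I[OF II(3)] II(4) by blast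
      obtain d1 where d1: "embdim f I d1" using embdim_exists[OF f(1) II(1,4,2)] by blast
      obtain d2 where d2: "embdim (\<gamma> t) I d2" using embdim_exists[OF p II(1) Ig II(2)] by blast
      have "d1 \<le> d2"
      proof (rule flow_embdim_le[OF f(1) fr r t2 fadm _ II d1 d2[unfolded \<gamma>_def]])
        fix v assume "point_derivation f v" "\<forall>i\<ge>n. v (var i) = 0"
        then show "admissible (der a) r v" using adv[OF f(1), of v] fr by blast
      qed
      moreover have "d2 \<le> d1"
      proof -
        have t2': "norm (- ?t) * (2 * r) < 1" using t2 by simp
        have g: "admissible (der a) r (\<gamma> t)" using adm[OF p] gr by blast
        have d1': "embdim (flow (der a) (\<gamma> t) (- ?t)) I d1" using d1 unfolding bk .
        show ?thesis
        proof (rule flow_embdim_le[OF p gr r t2' g _ II(1-3) Ig d2 d1'])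
          fix v assume "point_derivation (\<gamma> t) v" "\<forall>i\<ge>n. v (var i) = 0"
          then show "admissible (der a) r v" using adv[OF p, of v] gr by blast
        qed
      qed
      ultimately show ?thesis
        using d1 d2 embdim_unique[OF f(1) II(1)] embdim_unique[OF p II(1)] by (metis le_antisym)
    qed
    show ?thesis using p dv I ed by blast
  qed
  show ?thesis
    by (rule exI[of _ T], rule conjI[OF T(1)], rule exI[of _ \<gamma>], rule conjI[OF start], rule ballI, rule key)
qed

section \<open>Primitive and rational ideals for a set of derivations\<close>

definition constant_derivations :: "(falg \<Rightarrow> falg) set \<Rightarrow> bool" where
  "constant_derivations D \<longleftrightarrow> (\<forall>d\<in>D. is_derivation d \<and> (\<forall>c. d (cst c) = 0))"

text \<open>By the quotient rule, \<open>s * d a - a * d s \<in> p\<close> says that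
  \<open>d\<close> kills the fraction \<open>a / s\<close>; the conclusion says that this fraction
  is a scalar.\<close>

definition no_new_constants :: "(falg \<Rightarrow> falg) set \<Rightarrow> falg set \<Rightarrow> bool" where
  "no_new_constants D p \<longleftrightarrow>
    (\<forall>a s. s \<notin> p \<and> (\<forall>d\<in>D. s * d a - a * d s \<in> p) \<longrightarrow> (\<exists>c. a - cst c * s \<in> p))"

text \<open>At a point of \<open>p\<close> where \<open>g\<close> does not vanish, the core is a
  stable prime that contains \<open>p\<close> but not \<open>g\<close>, so it equals
  \<open>p\<close>.\<close>

lemma locally_closed_imp_core:
  assumes D: "constant_derivations D" and p: "is_prime p" "stable D p"
    and g: "g \<notin> p" "\<And>q. is_prime q \<Longrightarrow> stable D q \<Longrightarrow> p \<subset> q \<Longrightarrow> g \<in> q"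
  shows "\<exists>f. is_point f \<and> core D (point_ideal f) = p"
proof -
  obtain f where f: "is_point f" "p \<subseteq> point_ideal f" "f g \<noteq> 0" using nullstellensatz[OF p(1) g(1)] by auto
  let ?q = "core D (point_ideal f)"
  note m = point_ideal_prime[OF f(1)]
  have q: "is_prime ?q" using falg_core_prime[OF _ m m] D by (auto simp: constant_derivations_def)
  have "p \<subseteq> ?q" by (rule core_greatest[OF p(2) f(2)])
  moreover have "g \<notin> ?q" using core_subset[of D "point_ideal f"] f(3) by (auto simp: point_ideal_def)
  ultimately have "?q = p" using g(2)[OF q core_stable] by blast
  then show ?thesis using f by blast
qed

text \<open>For a central fraction \<open>a / s\<close>, the denominators form a stable ideal, which cannot lie
  inside the maximal ideal, so the fraction has a value at the point. After subtracting this
  value, the multiples of the fraction in the coordinate ring form a stable ideal inside the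
  maximal ideal, so the fraction is zero.\<close>

lemma core_imp_no_new_constants:
  assumes D: "constant_derivations D" and f: "is_point f" and p: "is_prime p" "core D (point_ideal f) = p"
  shows "no_new_constants D p"
  unfolding no_new_constants_def
proof (intro allI impI, elim conjE)
  fix a s assume s: "s \<notin> p" and central: "\<forall>d\<in>D. s * d a - a * d s \<in> p"
  note I = prime_ideal[OF p(1)]
  have stp: "stable D p" using core_stable[of D "point_ideal f"] p(2) by simp
  have pm: "p \<subseteq> point_ideal f" using core_subset[of D "point_ideal f"] p(2) by simp
  have dd: "is_derivation d" if "d \<in> D" for d using D that by (simp add: constant_derivations_def)
  have inp: "K \<subseteq> p" if "stable D K" "K \<subseteq> point_ideal f" for K
    using core_greatest[OF that] p(2) by simp
  define L where "L = {b. \<exists>a'. b * a - a' * s \<in> p}"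
  have "stable D L" unfolding stable_def
  proof (intro ballI)
    fix d b assume d: "d \<in> D" and "b \<in> L"
    then obtain a' where a': "b * a - a' * s \<in> p" by (auto simp: L_def)
    have "d (b * a - a' * s) \<in> p" using stp d a' by (simp add: stable_def)
    moreover have "d (b * a - a' * s) = b * d a + d b * a - (a' * d s + d a' * s)"
      by (simp add: derivation_diff[OF dd[OF d]] derivation_mult[OF dd[OF d]])
    ultimately have 1: "b * d a + d b * a - (a' * d s + d a' * s) \<in> p" by simp
    have 2: "s * d a - a * d s \<in> p" using central d by blast
    have "s * (b * d a + d b * a - (a' * d s + d a' * s)) - b * (s * d a - a * d s)
        - (b * a - a' * s) * d s \<in> p"
      by (rule is_ideal_diff[OF I is_ideal_diff[OF I is_ideal_mult[OF I 1] is_ideal_mult[OF I 2]]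
            is_ideal_mult2[OF I a']])
    moreover have "s * (b * d a + d b * a - (a' * d s + d a' * s)) - b * (s * d a - a * d s)
        - (b * a - a' * s) * d s = s * (d b * a - d a' * s)"
      by (simp add: algebra_simps)
    ultimately have "s * (d b * a - d a' * s) \<in> p" by simp
    then have "d b * a - d a' * s \<in> p" using s prime_mult_iff[OF p(1)] by blast
    then show "d b \<in> L" by (auto simp: L_def)
  qed
  moreover have "s \<in> L" unfolding L_def using is_ideal_0[OF I] by (auto intro!: exI[of _ a] simp: mult.commute)
  ultimately have "\<not> L \<subseteq> point_ideal f" using inp s by blast
  then obtain b a' where b: "f b \<noteq> 0" and ba: "b * a - a' * s \<in> p" by (auto simp: L_def point_ideal_def)
  define c where "c = f a' / f b"
  define z where "z = a - cst c * s"
  \<comment> \<open>Modulo \<open>p\<close> the fraction \<open>z / s\<close> equals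
    \<open>(a' - cst c * b) / b\<close>, whose numerator vanishes at \<open>f\<close> while its
    denominator does not.\<close>
  have az: "b * z - (a' - cst c * b) * s \<in> p"
    using ba by (simp add: z_def algebra_simps)
  have fz: "f (a' - cst c * b) = 0" using f b by (simp add: point_simps c_def)
  have zc: "s * d z - z * d s \<in> p" if d: "d \<in> D" for d
  proof -
    have "d (cst c * s) = cst c * d s"
      using derivation_cst_mult[OF dd[OF d]] D d by (simp add: constant_derivations_def)
    then have "s * d z - z * d s = s * d a - a * d s"
      by (simp add: z_def derivation_diff[OF dd[OF d]] algebra_simps)
    then show ?thesis using central d by simp
  qed
  define K where "K = {x. \<exists>w. x * s - w * z \<in> p}"
  have "K \<subseteq> point_ideal f"
  proof
    fix x assume "x \<in> K"
    then obtain w where w: "x * s - w * z \<in> p" by (auto simp: K_def)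
    have "b * (x * s - w * z) + w * (b * z - (a' - cst c * b) * s) \<in> p"
      by (rule is_ideal_add[OF I is_ideal_mult[OF I w] is_ideal_mult[OF I az]])
    moreover have "b * (x * s - w * z) + w * (b * z - (a' - cst c * b) * s)
        = s * (b * x - w * (a' - cst c * b))" by (simp add: algebra_simps)
    ultimately have "b * x - w * (a' - cst c * b) \<in> p" using s prime_mult_iff[OF p(1)] by metis
    then have "f (b * x - w * (a' - cst c * b)) = 0" using pm by (auto simp: point_ideal_def)
    then have "f b * f x = 0" using fz f by (simp add: point_diff[OF f] point_mult[OF f])
    then show "x \<in> point_ideal f" using b by (simp add: point_ideal_def)
  qed
  moreover have "stable D K" unfolding stable_def
  proof (intro ballI)
    fix d x assume d: "d \<in> D" and "x \<in> K"
    then obtain w where w: "x * s - w * z \<in> p" by (auto simp: K_def)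
    have "d (x * s - w * z) \<in> p" using stp d w by (simp add: stable_def)
    then have 1: "x * d s + d x * s - (w * d z + d w * z) \<in> p"
      by (simp add: derivation_diff[OF dd[OF d]] derivation_mult[OF dd[OF d]])
    have "s * (x * d s + d x * s - (w * d z + d w * z)) + w * (s * d z - z * d s)
        - (x * s - w * z) * d s \<in> p"
      by (rule is_ideal_diff[OF I is_ideal_add[OF I is_ideal_mult[OF I 1] is_ideal_mult[OF I zc[OF d]]]
            is_ideal_mult2[OF I w]])
    moreover have "s * (x * d s + d x * s - (w * d z + d w * z)) + w * (s * d z - z * d s)
        - (x * s - w * z) * d s = s * (d x * s - d w * z)" by (simp add: algebra_simps)
    ultimately have "d x * s - d w * z \<in> p" using s prime_mult_iff[OF p(1)] by metis
    then show "d x \<in> K" by (auto simp: K_def)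
  qed
  ultimately have "K \<subseteq> p" using inp by blast
  moreover have "a' - cst c * b \<in> K"
    unfolding K_def using is_ideal_uminus[OF I az] by (auto intro!: exI[of _ b])
  ultimately have "a' - cst c * b \<in> p" by blast
  then have "(b * z - (a' - cst c * b) * s) + (a' - cst c * b) * s \<in> p"
    by (intro is_ideal_add[OF I az] is_ideal_mult2[OF I])
  then have "b * z \<in> p" by simp
  moreover have "b \<notin> p" using b pm by (auto simp: point_ideal_def)
  ultimately have "z \<in> p" using prime_mult_iff[OF p(1)] by blast
  then show "\<exists>c. a - cst c * s \<in> p" by (auto simp: z_def)
qed

section \<open>Generalised Wronskians\<close>

text \<open>The row space of the Wronskian matrix: its rows are the iterated derivations, its
  columns are indexed by the elements to which they are applied.\<close>

inductive_set word_rows :: "(falg \<Rightarrow> falg) set \<Rightarrow> (falg \<Rightarrow> falg) set" for D where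
  wr_word: "set ds \<subseteq> D \<Longrightarrow> fold (\<lambda>d. d) ds \<in> word_rows D"
| wr_comb: "m \<in> word_rows D \<Longrightarrow> m' \<in> word_rows D \<Longrightarrow> (\<lambda>e. r * m e + s * m' e) \<in> word_rows D"

lemma word_rows_closed: "is_ideal I \<Longrightarrow> rows_closed I S (word_rows D)"
  unfolding rows_closed_def
proof (intro conjI ballI allI)
  show "word_rows D \<noteq> {}" using wr_word[of "[]" D] by auto
  fix m m' r s assume "is_ideal I" "m \<in> word_rows D" "m' \<in> word_rows D"
  then show "\<exists>h\<in>word_rows D. \<forall>i\<in>S. h i - (r * m i + s * m' i) \<in> I"
    using is_ideal_0 by (intro bexI[of _ "\<lambda>e. r * m e + s * m' e"] wr_comb) auto
qed

lemma word_lin: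
  assumes D: "constant_derivations D" and ds: "set ds \<subseteq> D"
  shows "fold (\<lambda>d. d) ds (lin c E) = (\<Sum>e\<in>E. cst (c e) * fold (\<lambda>d. d) ds e)"
proof -
  have "fold (\<lambda>d. d) ds (\<Sum>e\<in>E. cst (c e) * g e) = (\<Sum>e\<in>E. cst (c e) * fold (\<lambda>d. d) ds (g e))" for g
    using ds
  proof (induction ds arbitrary: g)
    case (Cons d ds)
    then have d: "is_derivation d" "\<And>c. d (cst c) = 0" using D by (auto simp: constant_derivations_def)
    have "d (\<Sum>e\<in>E. cst (c e) * g e) = (\<Sum>e\<in>E. cst (c e) * d (g e))"
      by (simp add: derivation_sum[OF d(1)] derivation_cst_mult[OF d])
    then show ?case using Cons.IH[of "\<lambda>e. d (g e)"] Cons.prems by simp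
  qed simp
  then show ?thesis unfolding lin_def .
qed

lemma word_rows_kill:
  assumes D: "constant_derivations D" and Q: "is_ideal Q" "stable D Q" "lin c E \<in> Q"
    and m: "m \<in> word_rows D"
  shows "(\<Sum>e\<in>E. cst (c e) * m e) \<in> Q"
  using m
proof (induction rule: word_rows.induct)
  case (wr_word ds)
  have "fold (\<lambda>d. d) ds x \<in> Q" if "x \<in> Q" for x
    using wr_word that Q(2) by (induction ds arbitrary: x) (auto simp: stable_def)
  then show ?case using word_lin[OF D wr_word, of c E] Q(3) by metis
next
  case (wr_comb m m' r s)
  have "(\<Sum>e\<in>E. cst (c e) * (r * m e + s * m' e))
      = r * (\<Sum>e\<in>E. cst (c e) * m e) + s * (\<Sum>e\<in>E. cst (c e) * m' e)"
    by (simp add: sum_distrib_left sum.distrib distrib_left mult.left_commute)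
  then show ?case using wr_comb by (simp add: is_ideal_add[OF Q(1)] is_ideal_mult[OF Q(1)])
qed

text \<open>Differentiating the relation and eliminating its entry at \<open>e1\<close> gives a
  relation with fewer entries outside \<open>p\<close>, which by induction has none. All quotients
  \<open>v e / v e1\<close> are then constants, hence scalars, so the relation becomes a linear
  dependence of \<open>E\<close>.\<close>

lemma word_relation_imp_dependent:
  assumes D: "constant_derivations D" and p: "is_prime p" "stable D p" "no_new_constants D p"
    and E: "indep p E" and v: "\<exists>e\<in>E. v e \<notin> p"
    and rel: "\<And>ds. set ds \<subseteq> D \<Longrightarrow> (\<Sum>e\<in>E. v e * fold (\<lambda>d. d) ds e) \<in> p"
  shows False
  using v rel
proof (induction "card {e\<in>E. v e \<notin> p}" arbitrary: v rule: less_induct)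
  case less
  note I = prime_ideal[OF p(1)]
  have fin: "finite E" using E by (simp add: indep_def)
  obtain e1 where e1: "e1 \<in> E" "v e1 \<notin> p" using less.prems(1) by auto
  have dd: "is_derivation d" if "d \<in> D" for d using D that by (simp add: constant_derivations_def)
  have const: "v e1 * d (v e) - v e * d (v e1) \<in> p" if d: "d \<in> D" and e: "e \<in> E" for d e
  proof (rule ccontr)
    assume n: "\<not> ?thesis"
    \<comment> \<open>The numerator of the derivative of \<open>v e / v e1\<close>.\<close>
    define w where "w e = v e1 * d (v e) - v e * d (v e1)" for e
    have sub: "{e\<in>E. w e \<notin> p} \<subseteq> {e\<in>E. v e \<notin> p} - {e1}"
    proof
      fix e assume e: "e \<in> {e\<in>E. w e \<notin> p}"
      have "w e \<in> p" if "v e \<in> p"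
      proof -
        have "d (v e) \<in> p" using p(2) d that by (simp add: stable_def)
        then show ?thesis unfolding w_def
          by (rule is_ideal_diff[OF I is_ideal_mult[OF I] is_ideal_mult2[OF I that]])
      qed
      moreover have "w e1 = 0" by (simp add: w_def mult.commute)
      ultimately show "e \<in> {e\<in>E. v e \<notin> p} - {e1}" using e is_ideal_0[OF I] by auto
    qed
    have "card {e\<in>E. w e \<notin> p} < card {e\<in>E. v e \<notin> p}"
      using sub e1 fin by (intro psubset_card_mono) auto
    moreover have "\<exists>e\<in>E. w e \<notin> p" using n e by (auto simp: w_def)
    moreover have "(\<Sum>e\<in>E. w e * fold (\<lambda>d. d) ds e) \<in> p" if ds: "set ds \<subseteq> D" for ds
    proof -
      let ?S = "\<Sum>e\<in>E. v e * fold (\<lambda>d. d) ds e"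
      let ?S' = "\<Sum>e\<in>E. v e * fold (\<lambda>d. d) (ds @ [d]) e"
      have "d ?S = ?S' + (\<Sum>e\<in>E. d (v e) * fold (\<lambda>d. d) ds e)"
        by (simp add: derivation_sum[OF dd[OF d]] derivation_mult[OF dd[OF d]] sum.distrib)
      have "(\<Sum>e\<in>E. w e * fold (\<lambda>d. d) ds e) = v e1 * (d ?S - ?S') - d (v e1) * ?S"
      proof -
        have "(\<Sum>e\<in>E. w e * fold (\<lambda>d. d) ds e) =
            (\<Sum>e\<in>E. v e1 * (d (v e) * fold (\<lambda>d. d) ds e) - d (v e1) * (v e * fold (\<lambda>d. d) ds e))"
          by (intro sum.cong refl) (simp add: w_def algebra_simps)
        also have "\<dots> = v e1 * (\<Sum>e\<in>E. d (v e) * fold (\<lambda>d. d) ds e) - d (v e1) * ?S"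
          by (simp only: sum_subtractf sum_distrib_left)
        finally show ?thesis using \<open>d ?S = _\<close> by simp
      qed
      moreover have s: "?S \<in> p" using less.prems(2)[OF ds] .
      moreover have s': "?S' \<in> p" using less.prems(2)[of "ds @ [d]"] ds d by simp
      moreover have dS: "d ?S \<in> p" using p(2) d s by (simp add: stable_def)
      moreover have "v e1 * (d ?S - ?S') - d (v e1) * ?S \<in> p"
        by (rule is_ideal_diff[OF I is_ideal_mult[OF I is_ideal_diff[OF I dS s']] is_ideal_mult[OF I s]])
      ultimately show ?thesis by (simp only:)
    qed
    ultimately show False by (rule less.hyps)
  qed
  have "\<exists>c. v e - cst c * v e1 \<in> p" if "e \<in> E" for e
    using p(3) e1(2) const that unfolding no_new_constants_def by blast
  then obtain c where c: "\<And>e. e \<in> E \<Longrightarrow> v e - cst (c e) * v e1 \<in> p" by metis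
  have "(\<Sum>e\<in>E. v e * e) \<in> p" using less.prems(2)[of "[]"] by simp
  moreover have "(\<Sum>e\<in>E. (v e - cst (c e) * v e1) * e) \<in> p"
    using c by (intro is_ideal_sum[OF I] is_ideal_mult2[OF I])
  ultimately have "(\<Sum>e\<in>E. v e * e) - (\<Sum>e\<in>E. (v e - cst (c e) * v e1) * e) \<in> p"
    by (rule is_ideal_diff[OF I])
  moreover have "(\<Sum>e\<in>E. v e * e) - (\<Sum>e\<in>E. (v e - cst (c e) * v e1) * e) = v e1 * lin c E"
    by (simp add: lin_def left_diff_distrib sum_subtractf sum_distrib_left mult.left_commute mult.assoc)
  ultimately have "lin c E \<in> p" using e1(2) prime_mult_iff[OF p(1)] by metis
  then have "c e1 = 0" using E e1(1) by (auto simp: indep_def)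
  then show False using c[OF e1(1)] e1(2) by simp
qed

text \<open>The element \<open>W\<close> plays the role of a nonvanishing generalised Wronskian of \<open>E\<close>.\<close>

lemma wronskian:
  assumes D: "constant_derivations D" and p: "is_prime p" "stable D p" "no_new_constants D p"
    and E: "indep p E"
  shows "\<exists>W. W \<notin> p \<and> (\<forall>Q c. is_ideal Q \<and> stable D Q \<and> p \<subseteq> Q \<and> lin c E \<in> Q \<and> (\<exists>e\<in>E. c e \<noteq> 0) \<longrightarrow> W \<in> Q)"
proof -
  note I = prime_ideal[OF p(1)]
  have fin: "finite E" using E by (simp add: indep_def)
  from elimination[OF I p(1) subset_refl fin word_rows_closed[OF I, of E D]]
  obtain F u piv where F: "F \<subseteq> E" "u \<notin> p"
    and piv: "\<forall>j\<in>E - F. piv j \<in> word_rows D \<and> piv j j - u \<in> p \<and> (\<forall>i\<in>E - F - {j}. piv j i \<in> p)"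
    and rest: "\<forall>f\<in>word_rows D. (\<forall>i\<in>E - F. f i \<in> p) \<longrightarrow> (\<forall>k\<in>F. f k \<in> p)"
    by (elim exE conjE)
  \<comment> \<open>A column \<open>k\<close> without pivot would yield a vector annihilated by all
    rows: \<open>u\<close> at \<open>k\<close>, the negated entries of the pivot rows in the pivot
    columns, zero elsewhere.\<close>
  have "F = {}"
  proof (rule ccontr)
    assume "F \<noteq> {}"
    then obtain k where k: "k \<in> F" by auto
    define v where "v e = (if e = k then u else if e \<in> F then 0 else - piv e k)" for e
    have "(\<Sum>e\<in>E. v e * f e) \<in> p" if f: "f \<in> word_rows D" for f
    proof -
      obtain h where h: "h \<in> word_rows D" "\<forall>i\<in>E. h i - (u * f i - (\<Sum>j\<in>E - F. f j * piv j i)) \<in> p"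
        using rows_closed_comb[OF word_rows_closed[OF I, of E D] I, of "E - F" f piv u f] fin f piv by auto
      have "h i \<in> p" if i: "i \<in> E - F" for i
      proof -
        have s: "(\<Sum>j\<in>E - F. f j * piv j i) = f i * piv i i + (\<Sum>j\<in>E - F - {i}. f j * piv j i)"
          using fin i by (subst sum.remove[of _ i]) auto
        have 1: "(\<Sum>j\<in>E - F - {i}. f j * piv j i) \<in> p"
          using piv i by (intro is_ideal_sum[OF I] is_ideal_mult[OF I]) auto
        have 2: "f i * (piv i i - u) \<in> p" using piv i by (intro is_ideal_mult[OF I]) auto
        have 3: "h i - (u * f i - (\<Sum>j\<in>E - F. f j * piv j i)) \<in> p" using h(2) i by auto
        have "(h i - (u * f i - (\<Sum>j\<in>E - F. f j * piv j i))) - f i * (piv i i - u)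
            - (\<Sum>j\<in>E - F - {i}. f j * piv j i) \<in> p"
          by (rule is_ideal_diff[OF I is_ideal_diff[OF I 3 2] 1])
        then show ?thesis unfolding s by (simp add: algebra_simps)
      qed
      then have hk: "h k \<in> p" using rest h(1) k by blast
      have "h k - (u * f k - (\<Sum>j\<in>E - F. f j * piv j k)) \<in> p" using h(2) k F by auto
      from is_ideal_diff[OF I hk this] have "u * f k - (\<Sum>j\<in>E - F. f j * piv j k) \<in> p" by simp
      moreover have "(\<Sum>e\<in>E. v e * f e) = u * f k - (\<Sum>j\<in>E - F. f j * piv j k)"
      proof -
        have "(\<Sum>e\<in>E. v e * f e) = (\<Sum>e\<in>E - F. v e * f e) + (\<Sum>e\<in>F. v e * f e)"
          by (rule sum.subset_diff[OF F(1) fin])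
        also have "(\<Sum>e\<in>F. v e * f e) = (\<Sum>e\<in>F. if e = k then u * f k else 0)"
          by (intro sum.cong) (auto simp: v_def)
        also have "\<dots> = u * f k" using k finite_subset[OF F(1) fin] by simp
        also have "(\<Sum>e\<in>E - F. v e * f e) = - (\<Sum>j\<in>E - F. f j * piv j k)"
          unfolding sum_negf[symmetric] using k by (intro sum.cong) (auto simp: v_def)
        finally show ?thesis by simp
      qed
      ultimately show ?thesis by simp
    qed
    then have "(\<Sum>e\<in>E. v e * fold (\<lambda>d. d) ds e) \<in> p" if "set ds \<subseteq> D" for ds
      using wr_word[OF that] by blast
    moreover have "\<exists>e\<in>E. v e \<notin> p" using k F by (auto simp: v_def)
    ultimately show False using word_relation_imp_dependent[OF D p E, of v] by blast
  qed
  have "u \<in> Q" if Q: "is_ideal Q" "stable D Q" "p \<subseteq> Q" "lin c E \<in> Q" and e: "e \<in> E" "c e \<noteq> 0" for Q c e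
  proof -
    \<comment> \<open>Modulo \<open>p\<close> the row \<open>piv e\<close> is \<open>u\<close> at
      \<open>e\<close> and zero elsewhere, so applying it to the combination isolates
      \<open>c e * u\<close>.\<close>
    have pe: "piv e \<in> word_rows D" "piv e e - u \<in> p" "\<forall>i\<in>E - {e}. piv e i \<in> p"
      using piv e(1) \<open>F = {}\<close> by auto
    have 1: "(\<Sum>i\<in>E. cst (c i) * piv e i) \<in> Q" by (rule word_rows_kill[OF D Q(1,2,4) pe(1)])
    have 2: "(\<Sum>i\<in>E - {e}. cst (c i) * piv e i) \<in> Q"
      using pe(3) Q(3) by (intro is_ideal_sum[OF Q(1)] is_ideal_mult[OF Q(1)]) auto
    have "(\<Sum>i\<in>E. cst (c i) * piv e i) = cst (c e) * piv e e + (\<Sum>i\<in>E - {e}. cst (c i) * piv e i)"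
      using fin e(1) by (rule sum.remove)
    then have "cst (c e) * piv e e \<in> Q" using is_ideal_diff[OF Q(1) 1 2] by simp
    then have "cst (inverse (c e)) * (cst (c e) * piv e e) \<in> Q" by (rule is_ideal_mult[OF Q(1)])
    then have "piv e e \<in> Q" using cst_inverse[OF e(2)] by (simp add: mult.assoc[symmetric])
    moreover have "piv e e - u \<in> Q" using pe(2) Q(3) by blast
    ultimately show ?thesis using is_ideal_diff[OF Q(1), of "piv e e" "piv e e - u"] by simp
  qed
  then show ?thesis using F(2) by (intro exI[of _ u]) blast
qed

lemma no_new_constants_imp_core:
  assumes D: "constant_derivations D" and p: "is_prime p" "stable D p" "no_new_constants D p"
  shows "\<exists>f. is_point f \<and> core D (point_ideal f) = p"
proof -
  note I = prime_ideal[OF p(1)]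
  define \<E> where "\<E> = {E. finite E \<and> E \<subseteq> range monomial \<and> indep p E}"
  have "countable {E. finite E \<and> E \<subseteq> range monomial}"
    by (intro countable_Collect_finite_subset) auto
  then have c\<E>: "countable \<E>" by (rule countable_subset[rotated]) (auto simp: \<E>_def)
  have "\<forall>E\<in>\<E>. \<exists>W. W \<notin> p \<and>
    (\<forall>Q c. is_ideal Q \<and> stable D Q \<and> p \<subseteq> Q \<and> lin c E \<in> Q \<and> (\<exists>e\<in>E. c e \<noteq> 0) \<longrightarrow> W \<in> Q)"
    using wronskian[OF D p] by (simp add: \<E>_def)
  from bchoice[OF this] obtain W where W: "\<forall>E\<in>\<E>. W E \<notin> p \<and>
    (\<forall>Q c. is_ideal Q \<and> stable D Q \<and> p \<subseteq> Q \<and> lin c E \<in> Q \<and> (\<exists>e\<in>E. c e \<noteq> 0) \<longrightarrow> W E \<in> Q)"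
    by (rule exE)
  obtain f where f: "is_point f" "p \<subseteq> point_ideal f" "\<forall>w\<in>W ` \<E>. f w \<noteq> 0"
    using point_avoiding_countable[OF p(1), of "W ` \<E>"] c\<E> W by auto
  let ?Q = "core D (point_ideal f)"
  have pQ: "p \<subseteq> ?Q" by (rule core_greatest[OF p(2) f(2)])
  have QI: "is_ideal ?Q"
    using core_ideal[OF _ prime_ideal[OF point_ideal_prime[OF f(1)]], of D] D
    by (auto simp: constant_derivations_def)
  have "x \<in> p" if x: "x \<in> ?Q" for x
  proof (rule ccontr)
    assume xp: "x \<notin> p"
    \<comment> \<open>Modulo \<open>p\<close>, \<open>x\<close> is a nontrivial combination of an
      independent set of monomials. The element \<open>W\<close> of this set then lies in the core,
      although it does not vanish at \<open>f\<close>.\<close>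
    obtain N c where c: "x = (\<Sum>i<N. cst (c i) * monomial i)" using falg_monomial_expansion by blast
    let ?T = "monomial ` {..<N}"
    obtain E where E: "E \<subseteq> ?T" "indep p E" "?T \<subseteq> spans p E"
      using exists_indep_spanning[OF I, of ?T] by auto
    have "x \<in> spans p E" unfolding c
    proof (intro spans_sum[OF I] spans_scale[OF I])
      fix i assume "i \<in> {..<N}"
      then show "monomial i \<in> spans p E" using E(3) by blast
    qed
    then obtain a where a: "x - lin a E \<in> p" by (auto simp: spans_def)
    then have "x - (x - lin a E) \<in> ?Q" using is_ideal_diff[OF QI x, of "x - lin a E"] pQ by blast
    then have laQ: "lin a E \<in> ?Q" by simp
    have "\<exists>e\<in>E. a e \<noteq> 0"
    proof (rule ccontr)
      assume "\<not> ?thesis"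
      then have "lin a E = 0" by (simp add: lin_def)
      then show False using a xp by simp
    qed
    moreover have "E \<in> \<E>" using E finite_subset[of E ?T] by (auto simp: \<E>_def)
    ultimately have "W E \<in> ?Q" using W QI core_stable[of D "point_ideal f"] pQ laQ by blast
    then have "f (W E) = 0" using core_subset[of D "point_ideal f"] by (auto simp: point_ideal_def)
    then show False using f(3) \<open>E \<in> \<E>\<close> by blast
  qed
  then have "?Q = p" using pQ by blast
  then show ?thesis using f by blast
qed

section \<open>Presentations of affine Poisson algebras\<close>

lemma complex_field_simps:
  "carrier complex_field = UNIV" "mult complex_field a b = a * b" "one complex_field = 1"
  "zero complex_field = 0" "add complex_field a b = a + b"
  by (simp_all add: ring_of_type_algebra_def)

text \<open>The generators are padded with zeros to a sequence because \<open>falg\<close> has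
  countably many variables; the padding puts all variables from \<open>n\<close> on among the
  relations.\<close>

locale presentation =
  fixes A :: "(complex, 'a) module" (structure) and br :: "'a \<Rightarrow> 'a \<Rightarrow> 'a"
    and n :: nat and y :: "nat \<Rightarrow> 'a"
  assumes poisson: "complex_poisson_algebra A br"
    and y_closed: "y i \<in> carrier A" and y_zero: "i \<ge> n \<Longrightarrow> y i = \<zero>"
    and generated: "generate_ring A (range y \<union> range (scalar A)) = carrier A"
begin

sublocale cring A
  using poisson by (simp add: complex_poisson_algebra_def Module.algebra_def)

sublocale pois: complex_poisson_algebra A br by (rule poisson)

lemma smult_simps:
  assumes "a \<in> carrier A"
  shows "c \<odot>\<^bsub>A\<^esub> a \<in> carrier A" "(c + d) \<odot>\<^bsub>A\<^esub> a = c \<odot>\<^bsub>A\<^esub> a \<oplus> d \<odot>\<^bsub>A\<^esub> a"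
    "(c * d) \<odot>\<^bsub>A\<^esub> a = c \<odot>\<^bsub>A\<^esub> (d \<odot>\<^bsub>A\<^esub> a)" "1 \<odot>\<^bsub>A\<^esub> a = a" "0 \<odot>\<^bsub>A\<^esub> a = \<zero>"
  using pois.smult_closed[of c a] pois.smult_l_distr[of c d a] pois.smult_assoc1[of c d a]
    pois.smult_one[of a] pois.smult_l_null[of a] assms
  by (simp_all add: complex_field_simps)

lemma smult_mult: "a \<in> carrier A \<Longrightarrow> b \<in> carrier A \<Longrightarrow> (c \<odot>\<^bsub>A\<^esub> a) \<otimes> b = c \<odot>\<^bsub>A\<^esub> (a \<otimes> b)"
  using pois.smult_assoc2[of c a b] by (simp add: complex_field_simps)

lemma scalar_closed: "scalar A c \<in> carrier A"
  by (simp add: smult_simps)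

lemma smult_scalar: "a \<in> carrier A \<Longrightarrow> c \<odot>\<^bsub>A\<^esub> a = scalar A c \<otimes> a"
  by (simp add: smult_mult)

lemma scalar_add: "scalar A (c + d) = scalar A c \<oplus> scalar A d"
  and scalar_mult: "scalar A (c * d) = scalar A c \<otimes> scalar A d"
  and scalar_1: "scalar A 1 = \<one>" and scalar_0: "scalar A 0 = \<zero>"
  by (simp_all add: smult_simps smult_mult)

section \<open>The surjection onto the algebra and the correspondence of ideals\<close>

primrec ev :: "fexpr \<Rightarrow> 'a" where
  "ev (FCst c) = scalar A c"
| "ev (FVar i) = y i"
| "ev (FAdd a b) = ev a \<oplus> ev b"
| "ev (FMul a b) = ev a \<otimes> ev b"

lemma ev_closed: "ev e \<in> carrier A"
  by (induction e) (simp_all add: scalar_closed y_closed)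

lemma scalar_neg: "a \<in> carrier A \<Longrightarrow> scalar A (- 1) \<otimes> a \<oplus> a = \<zero>"
  using smult_simps(2)[of a "-1" 1] smult_simps(4,5)[of a] smult_scalar[of a "-1"] by simp

lemma scalar_neg': "a \<in> carrier A \<Longrightarrow> a \<oplus> a \<otimes> scalar A (- 1) = \<zero>"
  using scalar_neg[of a] by (simp add: m_comm a_comm scalar_closed)

lemma ev_feq: "feq a b \<Longrightarrow> ev a = ev b"
  by (induction rule: feq.induct)
    (simp_all add: ev_closed scalar_closed a_ac m_ac l_distr r_distr scalar_add scalar_mult
      scalar_1 scalar_0 scalar_neg' del: One_nat_def)

definition \<pi> :: "falg \<Rightarrow> 'a" where "\<pi> x = ev (rep_falg x)"

lemma \<pi>_abs: "\<pi> (abs_falg e) = ev e"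
  unfolding \<pi>_def by (intro ev_feq) (metis Quotient3_falg Quotient3_rep_abs feq_refl)

lemma \<pi>_closed: "\<pi> x \<in> carrier A"
  by (simp add: \<pi>_def ev_closed)

lemma \<pi>_add: "\<pi> (a + b) = \<pi> a \<oplus> \<pi> b" and \<pi>_mult: "\<pi> (a * b) = \<pi> a \<otimes> \<pi> b"
proof -
  obtain e f where "a = abs_falg e" "b = abs_falg f" by (metis falg_cases)
  then show "\<pi> (a + b) = \<pi> a \<oplus> \<pi> b" "\<pi> (a * b) = \<pi> a \<otimes> \<pi> b"
    by (simp_all add: plus_falg.abs_eq times_falg.abs_eq \<pi>_abs)
qed

lemma \<pi>_cst: "\<pi> (cst c) = scalar A c" and \<pi>_var: "\<pi> (var i) = y i"
  by (simp_all add: cst.abs_eq var.abs_eq \<pi>_abs)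

lemma \<pi>_0: "\<pi> 0 = \<zero>" and \<pi>_1: "\<pi> 1 = \<one>"
  using \<pi>_cst[of 0] \<pi>_cst[of 1] by (simp_all add: scalar_0 scalar_1)

lemma \<pi>_uminus: "\<pi> (- a) = \<ominus> \<pi> a"
  using \<pi>_add[of "-a" a] minus_equality[of "\<pi> (- a)" "\<pi> a"] by (simp add: \<pi>_0 \<pi>_closed)

lemma \<pi>_diff: "\<pi> (a - b) = \<pi> a \<ominus> \<pi> b"
  using \<pi>_add[of a "-b"] by (simp add: \<pi>_uminus a_minus_def)

lemmas \<pi>_simps = \<pi>_add \<pi>_mult \<pi>_cst \<pi>_var \<pi>_0 \<pi>_1 \<pi>_uminus \<pi>_diff

lemma \<pi>_surj: "a \<in> carrier A \<Longrightarrow> \<exists>x. \<pi> x = a"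
proof -
  assume "a \<in> carrier A"
  then have "a \<in> generate_ring A (range y \<union> range (scalar A))" using generated by simp
  then show ?thesis
  proof (induction rule: generate_ring.induct)
    case one
    then show ?case using \<pi>_1 by blast
  next
    case (incl h)
    then show ?case using \<pi>_var \<pi>_cst by blast
  next
    case (a_inv h)
    then show ?case using \<pi>_uminus by blast
  next
    case (eng_add h1 h2)
    then show ?case using \<pi>_add by blast
  next
    case (eng_mult h1 h2)
    then show ?case using \<pi>_mult by blast
  qed
qed

lemma carrier_eq: "carrier A = range \<pi>"
  using \<pi>_surj \<pi>_closed by blast

definition lift :: "'a set \<Rightarrow> falg set" where "lift I = {x. \<pi> x \<in> I}"

definition relations :: "falg set" where "relations = {x. \<pi> x = \<zero>}"

lemma lift_iff: "x \<in> lift I \<longleftrightarrow> \<pi> x \<in> I"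
  by (simp add: lift_def)

lemma lift_mono_iff:
  assumes "I \<subseteq> carrier A"
  shows "lift I \<subseteq> lift I' \<longleftrightarrow> I \<subseteq> I'"
proof
  assume l: "lift I \<subseteq> lift I'"
  show "I \<subseteq> I'"
  proof
    fix a assume "a \<in> I"
    moreover obtain x where "\<pi> x = a" using assms \<open>a \<in> I\<close> \<pi>_surj by blast
    ultimately show "a \<in> I'" using l by (auto simp: lift_def)
  qed
qed (auto simp: lift_def)

lemma lift_inj: "I \<subseteq> carrier A \<Longrightarrow> I' \<subseteq> carrier A \<Longrightarrow> lift I = lift I' \<Longrightarrow> I = I'"
  using lift_mono_iff[of I I'] lift_mono_iff[of I' I] by blast

lemma lift_image: "is_ideal Q \<Longrightarrow> relations \<subseteq> Q \<Longrightarrow> lift (\<pi> ` Q) = Q"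
proof
  assume Q: "is_ideal Q" "relations \<subseteq> Q"
  show "lift (\<pi> ` Q) \<subseteq> Q"
  proof
    fix x assume "x \<in> lift (\<pi> ` Q)"
    then obtain z where z: "z \<in> Q" "\<pi> x = \<pi> z" by (auto simp: lift_def)
    then have "x - z \<in> relations" by (simp add: relations_def \<pi>_diff \<pi>_closed r_neg a_minus_def)
    then have "(x - z) + z \<in> Q" using Q z by (intro is_ideal_add) auto
    then show "x \<in> Q" by simp
  qed
qed (auto simp: lift_def)

lemma ideal_subset: "ideal I A \<Longrightarrow> I \<subseteq> carrier A"
  by (simp add: additive_subgroup.a_subset ideal.axioms(1))

lemma lift_ideal: "ideal I A \<Longrightarrow> is_ideal (lift I)"
proof -
  assume "ideal I A"
  then interpret I: ideal I A .
  show ?thesis unfolding is_ideal_def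
    by (auto simp: lift_def \<pi>_simps \<pi>_closed intro: I.I_l_closed)
qed

lemma relations_subset_lift: "ideal I A \<Longrightarrow> relations \<subseteq> lift I"
proof -
  assume "ideal I A"
  then interpret I: ideal I A .
  show ?thesis by (auto simp: lift_def relations_def)
qed

lemma relations_ideal: "is_ideal relations"
  unfolding is_ideal_def by (auto simp: relations_def \<pi>_simps \<pi>_closed)

lemma relations_vars: "vars_in n relations"
  by (simp add: vars_in_def relations_def \<pi>_var y_zero)

lemma image_ideal: "is_ideal Q \<Longrightarrow> ideal (\<pi> ` Q) A"
proof (rule idealI)
  assume Q: "is_ideal Q"
  show "ring A" by (rule ring_axioms)
  show "subgroup (\<pi> ` Q) (add_monoid A)"
  proof (rule add.subgroupI)
    show "\<pi> ` Q \<subseteq> carrier A" by (auto simp: \<pi>_closed)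
    show "\<pi> ` Q \<noteq> {}" using is_ideal_0[OF Q] by auto
    show "\<ominus> a \<in> \<pi> ` Q" if "a \<in> \<pi> ` Q" for a
      using that is_ideal_uminus[OF Q] by (auto simp: \<pi>_uminus[symmetric])
    show "a \<oplus> b \<in> \<pi> ` Q" if "a \<in> \<pi> ` Q" "b \<in> \<pi> ` Q" for a b
      using that is_ideal_add[OF Q] by (auto simp: \<pi>_add[symmetric])
  qed
  fix a x assume "a \<in> \<pi> ` Q" "x \<in> carrier A"
  then obtain q r where q: "q \<in> Q" "a = \<pi> q" "x = \<pi> r" using \<pi>_surj by blast
  show "x \<otimes> a \<in> \<pi> ` Q" using is_ideal_mult[OF Q q(1), of r] q by (metis \<pi>_mult imageI)
  show "a \<otimes> x \<in> \<pi> ` Q" using is_ideal_mult2[OF Q q(1), of r] q by (metis \<pi>_mult imageI)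
qed

lemma lift_prime: "primeideal P A \<Longrightarrow> is_prime (lift P)"
proof -
  assume "primeideal P A"
  then interpret P: primeideal P A .
  have "\<one> \<notin> P" using P.one_imp_carrier P.I_notcarr by blast
  then show ?thesis unfolding is_prime_def
    using lift_ideal[OF P.is_ideal] P.I_prime by (auto simp: lift_iff \<pi>_simps \<pi>_closed)
qed

lemma prime_of_lift: "ideal P A \<Longrightarrow> is_prime (lift P) \<Longrightarrow> primeideal P A"
proof (rule primeidealI)
  assume P: "ideal P A" "is_prime (lift P)"
  show "ideal P A" by (rule P(1))
  show "cring A" by (rule cring_axioms)
  show "carrier A \<noteq> P" using prime_one[OF P(2)] by (auto simp: lift_iff \<pi>_1)
  fix a b assume ab: "a \<in> carrier A" "b \<in> carrier A" "a \<otimes> b \<in> P"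
  obtain x z where "\<pi> x = a" "\<pi> z = b" using ab \<pi>_surj by metis
  then show "a \<in> P \<or> b \<in> P" using ab(3) prime_mult[OF P(2), of x z] by (auto simp: lift_iff \<pi>_mult)
qed

lemma image_prime: "is_prime Q \<Longrightarrow> relations \<subseteq> Q \<Longrightarrow> primeideal (\<pi> ` Q) A"
  using prime_of_lift[OF image_ideal] lift_image prime_ideal by metis

section \<open>Maximal ideals as points\<close>

definition is_pt :: "(falg \<Rightarrow> complex) \<Rightarrow> bool" where
  "is_pt f \<longleftrightarrow> is_point f \<and> relations \<subseteq> point_ideal f"

definition mx :: "(falg \<Rightarrow> complex) \<Rightarrow> 'a set" where "mx f = \<pi> ` point_ideal f"

lemma is_ptD: "is_pt f \<Longrightarrow> is_point f" "is_pt f \<Longrightarrow> relations \<subseteq> point_ideal f"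
  by (auto simp: is_pt_def)

lemma lift_mx: "is_pt f \<Longrightarrow> lift (mx f) = point_ideal f"
  unfolding mx_def using lift_image prime_ideal[OF point_ideal_prime] by (simp add: is_pt_def)

lemma mx_ideal: "is_pt f \<Longrightarrow> ideal (mx f) A"
  unfolding mx_def by (intro image_ideal prime_ideal point_ideal_prime is_ptD)

lemma mx_subset: "mx f \<subseteq> carrier A"
  by (auto simp: mx_def \<pi>_closed)

lemma mx_iff: "is_pt f \<Longrightarrow> \<pi> x \<in> mx f \<longleftrightarrow> f x = 0"
  using lift_mx[of f] by (auto simp: lift_def point_ideal_def)

lemma mx_maximal:
  assumes f: "is_pt f"
  shows "maximalideal (mx f) A"
proof (rule maximalidealI)
  show "ideal (mx f) A" by (rule mx_ideal[OF f])
  have "\<one> \<notin> mx f" using mx_iff[OF f, of 1] point_1[OF is_ptD(1)[OF f]] by (simp add: \<pi>_1)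
  then show "carrier A \<noteq> mx f" by auto
  fix I assume I: "ideal I A" "mx f \<subseteq> I" "I \<subseteq> carrier A"
  interpret I: ideal I A by (rule I(1))
  show "I = mx f \<or> I = carrier A"
  proof (cases "I \<subseteq> mx f")
    case False
    then obtain a where a: "a \<in> I" "a \<notin> mx f" by auto
    then obtain x where x: "\<pi> x = a" using \<pi>_surj I(3) by blast
    have fx: "f x \<noteq> 0" using a x mx_iff[OF f, of x] by simp
    note pt = is_ptD(1)[OF f]
    have "f (1 - cst (inverse (f x)) * x) = 0" using fx by (simp add: point_simps[OF pt])
    then have "\<pi> (1 - cst (inverse (f x)) * x) \<in> I" using mx_iff[OF f] I(2) by blast
    moreover have "\<pi> (cst (inverse (f x)) * x) \<in> I"
      using a x by (simp add: \<pi>_mult \<pi>_closed I.I_l_closed)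
    ultimately have "\<pi> (1 - cst (inverse (f x)) * x) \<oplus> \<pi> (cst (inverse (f x)) * x) \<in> I"
      by (rule I.a_closed)
    then have "\<one> \<in> I" unfolding \<pi>_add[symmetric] by (simp add: \<pi>_1)
    then show ?thesis using I.one_imp_carrier by blast
  qed (use I in auto)
qed

text \<open>The Nullstellensatz gives a point above the prime \<open>lift m\<close>, and maximality
  of \<open>m\<close> turns the inclusion into an equality.\<close>

lemma maximal_point:
  assumes "maximalideal m A"
  shows "\<exists>f. is_pt f \<and> m = mx f"
proof -
  interpret m: maximalideal m A by (rule assms)
  have "primeideal m A" by (rule maximalideal_prime[OF assms])
  then have p: "is_prime (lift m)" by (rule lift_prime)
  obtain f where f: "is_point f" "lift m \<subseteq> point_ideal f"
    using nullstellensatz[OF p prime_one[OF p]] by auto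
  have pt: "is_pt f" using f relations_subset_lift[OF m.is_ideal] by (auto simp: is_pt_def)
  have "lift m \<subseteq> lift (mx f)" using f(2) lift_mx[OF pt] by simp
  then have sub: "m \<subseteq> mx f" using lift_mono_iff[OF ideal_subset[OF m.is_ideal]] by blast
  have "\<one> \<notin> mx f" using mx_iff[OF pt, of 1] point_1[OF f(1)] by (simp add: \<pi>_1)
  then have "mx f \<noteq> carrier A" by auto
  then have "m = mx f" using m.I_maximal[OF mx_ideal[OF pt] sub mx_subset] by blast
  then show ?thesis using pt by blast
qed

lemma max_spectrum_eq: "max_spectrum A = mx ` {f. is_pt f}"
  unfolding max_spectrum_def using mx_maximal maximal_point by blast

lemma mx_inj: "is_pt f \<Longrightarrow> is_pt g \<Longrightarrow> mx f = mx g \<Longrightarrow> f = g"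
  by (rule point_eqI) (use lift_mx is_ptD in \<open>auto dest: arg_cong[where f = lift]\<close>)

lemma point_value_eq:
  assumes f: "is_pt f"
  shows "point_value A (mx f) (\<pi> x) = f x"
proof -
  have "\<pi> x \<ominus> scalar A c \<in> mx f \<longleftrightarrow> f x = c" for c
    using mx_iff[OF f, of "x - cst c"] is_ptD(1)[OF f] by (simp add: \<pi>_simps point_simps)
  then show ?thesis unfolding point_value_def by simp
qed

section \<open>Hamiltonian derivations and Poisson ideals\<close>

definition sec :: "'a \<Rightarrow> falg" where "sec a = (SOME x. \<pi> x = a)"

lemma \<pi>_sec: "a \<in> carrier A \<Longrightarrow> \<pi> (sec a) = a"
  unfolding sec_def using \<pi>_surj[of a] by (rule someI_ex)

text \<open>\<open>sec\<close> makes arbitrary choices, so the resulting derivation represents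
  \<open>br a\<close> only after applying \<pi>. Zero coefficients from \<open>n\<close> on give the
  finite support required by \<open>local_flow\<close>.\<close>

definition ham_coeff :: "'a \<Rightarrow> nat \<Rightarrow> falg" where
  "ham_coeff a i = (if i < n then sec (br a (y i)) else 0)"

definition ham :: "'a \<Rightarrow> falg \<Rightarrow> falg" where "ham a = der (ham_coeff a)"

definition hams :: "(falg \<Rightarrow> falg) set" where "hams = ham ` carrier A"

lemma br_closed: "a \<in> carrier A \<Longrightarrow> b \<in> carrier A \<Longrightarrow> br a b \<in> carrier A"
  by (rule pois.br_closed)

lemma br_0_right: "a \<in> carrier A \<Longrightarrow> br a \<zero> = \<zero>"
  using pois.br_smult_right[of a \<zero> 0] by (simp add: smult_simps br_closed)

lemma br_scalar:
  assumes a: "a \<in> carrier A"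
  shows "br a (scalar A c) = \<zero>"
proof -
  have "br a \<one> = br a \<one> \<oplus> br a \<one>"
    using pois.br_derivation_right[OF a one_closed one_closed] a by (simp add: br_closed)
  then have "br a \<one> = \<zero>" using a by (metis br_closed add.l_cancel_one' one_closed)
  then show ?thesis using pois.br_smult_right[OF a one_closed, of c] smult_scalar[OF zero_closed]
    by (simp add: scalar_closed)
qed

lemma br_anti:
  assumes a: "a \<in> carrier A" and b: "b \<in> carrier A"
  shows "br a b = \<ominus> br b a"
proof -
  have "br (a \<oplus> b) (a \<oplus> b) = \<zero>" using a b by (intro pois.br_alternating) simp
  moreover have "br (a \<oplus> b) (a \<oplus> b) = (br a a \<oplus> br a b) \<oplus> (br b a \<oplus> br b b)"
    using a b by (simp add: pois.br_add_left pois.br_add_right br_closed a_ac)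
  ultimately have "br a b \<oplus> br b a = \<zero>" using a b by (simp add: pois.br_alternating br_closed)
  then show ?thesis using a b by (metis br_closed minus_equality)
qed

lemma \<pi>_ham: "a \<in> carrier A \<Longrightarrow> \<pi> (ham a x) = br a (\<pi> x)"
proof (induction x rule: falg_induct)
  case (cst c)
  then show ?case by (simp add: ham_def \<pi>_0 \<pi>_cst br_scalar)
next
  case (var i)
  then show ?case by (simp add: ham_def ham_coeff_def \<pi>_simps \<pi>_sec br_closed y_closed y_zero br_0_right)
next
  case (add x z)
  then show ?case
    by (simp add: ham_def derivation_add[OF der_derivation] \<pi>_simps pois.br_add_right \<pi>_closed)
next
  case (mult x z)
  then show ?case
    by (simp add: ham_def derivation_mult[OF der_derivation] \<pi>_simps pois.br_derivation_right \<pi>_closed)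
qed

lemma ham_derivation: "is_derivation (ham a)"
  unfolding ham_def by (rule der_derivation)

lemma hams_constant: "constant_derivations hams"
  by (auto simp: constant_derivations_def hams_def ham_derivation) (simp add: ham_def)

lemma hams_derivation: "d \<in> hams \<Longrightarrow> is_derivation d"
  by (auto simp: hams_def ham_derivation)

lemma relations_stable: "stable hams relations"
  by (auto simp: stable_def hams_def relations_def \<pi>_ham br_0_right)

lemma poisson_ideal_iff: "poisson_ideal A br I \<longleftrightarrow> ideal I A \<and> stable hams (lift I)"
proof (cases "ideal I A")
  case True
  interpret I: ideal I A by (rule True)
  have "(\<forall>x\<in>I. \<forall>a\<in>carrier A. br x a \<in> I) \<longleftrightarrow> (\<forall>x\<in>lift I. \<forall>a\<in>carrier A. br a (\<pi> x) \<in> I)"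
  proof
    assume h: "\<forall>x\<in>I. \<forall>a\<in>carrier A. br x a \<in> I"
    show "\<forall>x\<in>lift I. \<forall>a\<in>carrier A. br a (\<pi> x) \<in> I"
    proof (intro ballI)
      fix x a assume xa: "x \<in> lift I" "a \<in> carrier A"
      then have "br (\<pi> x) a \<in> I" using h by (auto simp: lift_def)
      then show "br a (\<pi> x) \<in> I" using br_anti[OF xa(2) \<pi>_closed] I.a_inv_closed by simp
    qed
  next
    assume h: "\<forall>x\<in>lift I. \<forall>a\<in>carrier A. br a (\<pi> x) \<in> I"
    show "\<forall>x\<in>I. \<forall>a\<in>carrier A. br x a \<in> I"
    proof (intro ballI)
      fix z a assume za: "z \<in> I" "a \<in> carrier A"
      then obtain x where x: "\<pi> x = z" using \<pi>_surj I.Icarr by blast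
      then have "br a z \<in> I" using h za by (auto simp: lift_def)
      then show "br z a \<in> I" using br_anti[OF I.Icarr[OF za(1)] za(2)] I.a_inv_closed by simp
    qed
  qed
  then show ?thesis using True by (auto simp: poisson_ideal_def stable_def hams_def lift_iff \<pi>_ham)
qed (simp add: poisson_ideal_def)

lemma poisson_spectrum_iff:
  "P \<in> poisson_spectrum A br \<longleftrightarrow> ideal P A \<and> is_prime (lift P) \<and> stable hams (lift P)"
  unfolding poisson_spectrum_def prime_spectrum_def
  using lift_prime prime_of_lift primeideal.axioms(1) by (auto simp: poisson_ideal_iff)

lemma core_ge_relations: "is_pt f \<Longrightarrow> relations \<subseteq> core hams (point_ideal f)"
  by (intro core_greatest relations_stable is_ptD)

lemma core_props:
  assumes f: "is_pt f"
  shows "is_prime (core hams (point_ideal f))" "stable hams (core hams (point_ideal f))"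
    "lift (\<pi> ` core hams (point_ideal f)) = core hams (point_ideal f)"
proof -
  note m = point_ideal_prime[OF is_ptD(1)[OF f]]
  show p: "is_prime (core hams (point_ideal f))" by (rule falg_core_prime[OF hams_derivation m m])
  show "stable hams (core hams (point_ideal f))" by (rule core_stable)
  show "lift (\<pi> ` core hams (point_ideal f)) = core hams (point_ideal f)"
    by (rule lift_image[OF prime_ideal[OF p] core_ge_relations[OF f]])
qed

lemma poisson_core_iff:
  assumes f: "is_pt f"
  shows "is_poisson_core A br (mx f) P \<longleftrightarrow> ideal P A \<and> lift P = core hams (point_ideal f)"
proof
  assume "is_poisson_core A br (mx f) P"
  then have P: "ideal P A" "stable hams (lift P)" "P \<subseteq> mx f"
    and max: "\<And>K. ideal K A \<Longrightarrow> stable hams (lift K) \<Longrightarrow> K \<subseteq> mx f \<Longrightarrow> K \<subseteq> P"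
    by (auto simp: is_poisson_core_def poisson_ideal_iff)
  have "lift P \<subseteq> point_ideal f" using P(3) lift_mx[OF f] by (auto simp: lift_def)
  then have "lift P \<subseteq> core hams (point_ideal f)" by (rule core_greatest[OF P(2)])
  moreover have "\<pi> ` core hams (point_ideal f) \<subseteq> P"
  proof (rule max)
    show "ideal (\<pi> ` core hams (point_ideal f)) A" by (intro image_ideal prime_ideal core_props f)
    show "stable hams (lift (\<pi> ` core hams (point_ideal f)))" unfolding core_props(3)[OF f] by (rule core_stable)
    show "\<pi> ` core hams (point_ideal f) \<subseteq> mx f" unfolding mx_def by (intro image_mono core_subset)
  qed
  then have "core hams (point_ideal f) \<subseteq> lift P" by (auto simp: lift_def)
  ultimately show "ideal P A \<and> lift P = core hams (point_ideal f)" using P by blast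
next
  assume P: "ideal P A \<and> lift P = core hams (point_ideal f)"
  have "P \<subseteq> mx f"
    using P core_subset[of hams "point_ideal f"] lift_mx[OF f] lift_mono_iff[OF ideal_subset] by metis
  moreover have "K \<subseteq> P" if K: "ideal K A" "stable hams (lift K)" "K \<subseteq> mx f" for K
  proof -
    have "lift K \<subseteq> point_ideal f" using K(3) lift_mx[OF f] by (auto simp: lift_def)
    then have "lift K \<subseteq> lift P" using core_greatest[OF K(2)] P by blast
    then show ?thesis using lift_mono_iff[OF ideal_subset[OF K(1)]] by blast
  qed
  ultimately show "is_poisson_core A br (mx f) P"
    using P core_stable[of hams "point_ideal f"] by (auto simp: is_poisson_core_def poisson_ideal_iff)
qed

lemma poisson_primitive_iff:
  "poisson_primitive A br P \<longleftrightarrow> ideal P A \<and> (\<exists>f. is_pt f \<and> core hams (point_ideal f) = lift P)"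
  unfolding poisson_primitive_def using maximal_point mx_maximal poisson_core_iff by metis

section \<open>The Zariski topology and locally closed primes\<close>

lemma topspace_zariski: "topspace (zariski_topology A) = prime_spectrum A"
proof
  show "topspace (zariski_topology A) \<subseteq> prime_spectrum A"
    using openin_topspace[of "zariski_topology A"] unfolding openin_zariski by blast
  have "openin (zariski_topology A) (prime_spectrum A)" unfolding openin_zariski
    by (intro exI[of _ "carrier A"]) (auto simp: prime_spectrum_def primeideal_def primeideal_axioms_def
        dest: ideal_subset)
  then show "prime_spectrum A \<subseteq> topspace (zariski_topology A)" by (rule openin_subset)
qed

lemma closedin_zariski:
  "closedin (zariski_topology A) V \<longleftrightarrow> (\<exists>T\<subseteq>carrier A. V = {P \<in> prime_spectrum A. T \<subseteq> P})"
proof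
  assume "closedin (zariski_topology A) V"
  then obtain T where T: "V \<subseteq> prime_spectrum A" "T \<subseteq> carrier A"
    "prime_spectrum A - V = {P \<in> prime_spectrum A. \<not> T \<subseteq> P}"
    unfolding closedin_def openin_zariski topspace_zariski by blast
  then have "V = {P \<in> prime_spectrum A. T \<subseteq> P}" by blast
  then show "\<exists>T\<subseteq>carrier A. V = {P \<in> prime_spectrum A. T \<subseteq> P}" using T(2) by blast
next
  assume "\<exists>T\<subseteq>carrier A. V = {P \<in> prime_spectrum A. T \<subseteq> P}"
  then obtain T where T: "T \<subseteq> carrier A" "V = {P \<in> prime_spectrum A. T \<subseteq> P}" by blast
  then have "prime_spectrum A - V = {P \<in> prime_spectrum A. \<not> T \<subseteq> P}" by blast
  then show "closedin (zariski_topology A) V"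
    unfolding closedin_def openin_zariski topspace_zariski using T by blast
qed

text \<open>The closed part may be shrunk to the primes containing \<open>P\<close>, and the open
  part to the primes avoiding one function \<open>g\<close> that does not lie in
  \<open>P\<close>.\<close>

lemma poisson_locally_closed_iff:
  "poisson_locally_closed A br P \<longleftrightarrow> P \<in> poisson_spectrum A br \<and>
    (\<exists>g. g \<notin> lift P \<and> (\<forall>q. is_prime q \<and> stable hams q \<and> lift P \<subset> q \<longrightarrow> g \<in> q))"
proof (cases "P \<in> poisson_spectrum A br")
  case True
  then have P: "ideal P A" "is_prime (lift P)" "stable hams (lift P)" by (simp_all add: poisson_spectrum_iff)
  have PP: "P \<in> prime_spectrum A" using True by (simp add: poisson_spectrum_def)
  let ?Sp = "poisson_spectrum A br" and ?Z = "zariski_topology A"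
  have Sps: "?Sp \<subseteq> prime_spectrum A" by (auto simp: poisson_spectrum_def)
  show ?thesis
  proof
    assume "poisson_locally_closed A br P"
    then obtain U V where UV: "openin (subtopology ?Z ?Sp) U" "closedin (subtopology ?Z ?Sp) V" "{P} = U \<inter> V"
      by (auto simp: poisson_locally_closed_def locally_closedin_def)
    obtain U' where U': "openin ?Z U'" "U = U' \<inter> ?Sp" using UV(1) by (auto simp: openin_subtopology)
    obtain S where S: "S \<subseteq> carrier A" "U' = {P \<in> prime_spectrum A. \<not> S \<subseteq> P}"
      using U'(1) by (auto simp: openin_zariski)
    obtain V' where V': "closedin ?Z V'" "V = V' \<inter> ?Sp" using UV(2) by (auto simp: closedin_subtopology)
    obtain T where T: "T \<subseteq> carrier A" "V' = {P \<in> prime_spectrum A. T \<subseteq> P}"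
      using V'(1) by (auto simp: closedin_zariski)
    have "P \<in> U" "P \<in> V" using UV(3) by auto
    then obtain s where s: "s \<in> S" "s \<notin> P" using U' S by auto
    have TP: "T \<subseteq> P" using \<open>P \<in> V\<close> V' T PP by blast
    obtain g where g: "\<pi> g = s" using s S \<pi>_surj by blast
    have "g \<in> q" if q: "is_prime q" "stable hams q" "lift P \<subset> q" for q
    proof -
      let ?Q = "\<pi> ` q"
      have rq: "relations \<subseteq> q" using relations_subset_lift[OF P(1)] q(3) by blast
      have lq: "lift ?Q = q" by (rule lift_image[OF prime_ideal[OF q(1)] rq])
      have QS: "?Q \<in> ?Sp" unfolding poisson_spectrum_iff lq using q image_ideal prime_ideal by blast
      have "P \<subseteq> ?Q" using q(3) lq lift_mono_iff[OF ideal_subset[OF P(1)]] by blast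
      then have "T \<subseteq> ?Q" using TP by blast
      then have "?Q \<in> V'" using T QS Sps by blast
      then have "?Q \<in> V" using V' QS by blast
      moreover have "?Q \<noteq> P" using q(3) lq by auto
      then have "?Q \<notin> U \<inter> V" unfolding UV(3)[symmetric] by simp
      ultimately have "?Q \<notin> U" by simp
      then have "?Q \<notin> U'" using U'(2) QS by simp
      then have "S \<subseteq> ?Q" using S(2) QS Sps by auto
      then have "\<pi> g \<in> ?Q" using s g by auto
      then show "g \<in> q" using lq by (auto simp: lift_def)
    qed
    moreover have "g \<notin> lift P" using s g by (simp add: lift_iff)
    ultimately show "P \<in> ?Sp \<and> (\<exists>g. g \<notin> lift P \<and> (\<forall>q. is_prime q \<and> stable hams q \<and> lift P \<subset> q \<longrightarrow> g \<in> q))"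
      using True by blast
  next
    assume "P \<in> ?Sp \<and> (\<exists>g. g \<notin> lift P \<and> (\<forall>q. is_prime q \<and> stable hams q \<and> lift P \<subset> q \<longrightarrow> g \<in> q))"
    then obtain g where g: "g \<notin> lift P" "\<And>q. is_prime q \<Longrightarrow> stable hams q \<Longrightarrow> lift P \<subset> q \<Longrightarrow> g \<in> q" by blast
    define U' where "U' = {Q \<in> prime_spectrum A. \<not> {\<pi> g} \<subseteq> Q}"
    define V' where "V' = {Q \<in> prime_spectrum A. P \<subseteq> Q}"
    have U'o: "openin ?Z U'" unfolding openin_zariski U'_def by (intro exI[of _ "{\<pi> g}"]) (simp add: \<pi>_closed)
    have V'c: "closedin ?Z V'" unfolding closedin_zariski V'_def using ideal_subset[OF P(1)] by blast
    have "{P} = (U' \<inter> ?Sp) \<inter> (V' \<inter> ?Sp)"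
    proof
      show "{P} \<subseteq> (U' \<inter> ?Sp) \<inter> (V' \<inter> ?Sp)" using True PP g(1) by (auto simp: U'_def V'_def lift_iff)
      show "(U' \<inter> ?Sp) \<inter> (V' \<inter> ?Sp) \<subseteq> {P}"
      proof
        fix Q assume "Q \<in> (U' \<inter> ?Sp) \<inter> (V' \<inter> ?Sp)"
        then have Q: "\<pi> g \<notin> Q" "P \<subseteq> Q" "ideal Q A" "is_prime (lift Q)" "stable hams (lift Q)"
          by (auto simp: U'_def V'_def poisson_spectrum_iff)
        have "\<not> lift P \<subset> lift Q" using g(2)[OF Q(4,5)] Q(1) by (auto simp: lift_iff)
        moreover have "lift P \<subseteq> lift Q" using Q(2) by (auto simp: lift_def)
        ultimately have "lift P = lift Q" by blast
        then show "Q \<in> {P}" using lift_inj ideal_subset P(1) Q(3) by blast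
      qed
    qed
    then show "poisson_locally_closed A br P"
      unfolding poisson_locally_closed_def locally_closedin_def using True U'o V'c
      by (intro conjI exI[of _ "U' \<inter> ?Sp"] exI[of _ "V' \<inter> ?Sp"])
        (auto simp: openin_subtopology closedin_subtopology)
  qed
qed (simp add: poisson_locally_closed_def)

end

section \<open>Quotients, fraction fields and dimensions in a presentation\<close>

lemma subset_spans:
  assumes L: "is_ideal L" and E: "finite E" and e: "e \<in> E"
  shows "e \<in> spans L E"
proof -
  have "lin (\<lambda>x. if x = e then 1 else 0) E = (\<Sum>x\<in>E. if x = e then e else 0)"
    unfolding lin_def by (intro sum.cong) (auto simp: cst_0 cst_1)
  also have "\<dots> = e" using e E by simp
  finally show ?thesis unfolding spans_def using is_ideal_0[OF L]
    by (intro CollectI exI[of _ "\<lambda>x. if x = e then 1 else 0"]) simp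
qed

context presentation
begin

section \<open>Quotients, fraction fields and Poisson centers\<close>

definition qt :: "'a set \<Rightarrow> falg \<Rightarrow> 'a set" where "qt I x = I +> \<pi> x"

lemma qt_eq_iff: "ideal I A \<Longrightarrow> qt I x = qt I z \<longleftrightarrow> x - z \<in> lift I"
  unfolding qt_def lift_iff \<pi>_diff using quotient_eq_iff_same_a_r_cos[of I "\<pi> x" "\<pi> z"] \<pi>_closed by simp

lemma qt_ring:
  assumes "ideal I A"
  shows "qt I x \<oplus>\<^bsub>A Quot I\<^esub> qt I z = qt I (x + z)" "qt I x \<otimes>\<^bsub>A Quot I\<^esub> qt I z = qt I (x * z)"
    "\<zero>\<^bsub>A Quot I\<^esub> = qt I 0" "\<one>\<^bsub>A Quot I\<^esub> = qt I 1" "qt I x \<ominus>\<^bsub>A Quot I\<^esub> qt I z = qt I (x - z)"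
    "carrier (A Quot I) = range (qt I)"
proof -
  interpret I: ideal I A by (rule assms)
  interpret h: ring_hom_ring A "A Quot I" "(+>) I" by (rule I.rcos_ring_hom_ring)
  show "qt I x \<oplus>\<^bsub>A Quot I\<^esub> qt I z = qt I (x + z)" "qt I x \<otimes>\<^bsub>A Quot I\<^esub> qt I z = qt I (x * z)"
    "\<zero>\<^bsub>A Quot I\<^esub> = qt I 0" "\<one>\<^bsub>A Quot I\<^esub> = qt I 1" "qt I x \<ominus>\<^bsub>A Quot I\<^esub> qt I z = qt I (x - z)"
    by (simp_all add: qt_def \<pi>_simps \<pi>_closed a_minus_def)
  show "carrier (A Quot I) = range (qt I)"
    unfolding qt_def FactRing_simps by (auto simp: carrier_eq)
qed

text \<open>A lift of the bracket that is a derivation in its second argument; in the first it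
  depends on the choices in \<open>sec\<close> and behaves well only modulo the relations.\<close>

definition pb :: "falg \<Rightarrow> falg \<Rightarrow> falg" where "pb x z = ham (\<pi> x) z"

lemma \<pi>_pb: "\<pi> (pb x z) = br (\<pi> x) (\<pi> z)"
  by (simp add: pb_def \<pi>_ham \<pi>_closed)

lemma pb_anti: "pb x z + pb z x \<in> relations"
  using br_anti[of "\<pi> x" "\<pi> z"] \<pi>_closed
  by (simp add: relations_def \<pi>_simps \<pi>_pb br_closed l_neg)

lemma pb_diff_right: "pb x (z - w) = pb x z - pb x w"
  unfolding pb_def by (rule derivation_diff[OF ham_derivation])

lemma pb_stable: "stable hams L \<Longrightarrow> z \<in> L \<Longrightarrow> pb x z \<in> L"
  by (auto simp: stable_def hams_def pb_def \<pi>_closed)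

lemma qt_bracket:
  assumes I: "ideal I A" "stable hams (lift I)"
  shows "quotient_bracket A br I (qt I x) (qt I z) = qt I (pb x z)"
proof -
  note L = lift_ideal[OF I(1)] and r = relations_subset_lift[OF I(1)]
  have mem: "a \<in> qt I x \<longleftrightarrow> (\<exists>w. a = \<pi> w \<and> w - x \<in> lift I)" for a x
  proof
    assume "a \<in> qt I x"
    then obtain i where i: "i \<in> I" "a = i \<oplus> \<pi> x" by (auto simp: qt_def a_r_coset_def')
    then obtain u where u: "\<pi> u = i" using ideal_subset[OF I(1)] \<pi>_surj by blast
    show "\<exists>w. a = \<pi> w \<and> w - x \<in> lift I"
      by (rule exI[of _ "u + x"]) (simp add: i u \<pi>_add lift_iff)
  next
    assume "\<exists>w. a = \<pi> w \<and> w - x \<in> lift I"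
    then obtain w where w: "a = \<pi> w" "w - x \<in> lift I" by blast
    then have "a = \<pi> (w - x) \<oplus> \<pi> x" by (simp add: \<pi>_add[symmetric])
    then show "a \<in> qt I x" using w(2) by (auto simp: qt_def a_r_coset_def' lift_iff)
  qed
  have eq: "I +> br a b = qt I (pb x z)" if ab: "a \<in> qt I x" "b \<in> qt I z" for a b
  proof -
    obtain w v where w: "a = \<pi> w" "w - x \<in> lift I" "b = \<pi> v" "v - z \<in> lift I"
      using ab mem by blast
    have 1: "pb w (v - z) \<in> lift I" by (rule pb_stable[OF I(2) w(4)])
    have 2: "pb z (w - x) \<in> lift I" by (rule pb_stable[OF I(2) w(2)])
    have 3: "pb w z + pb z w \<in> lift I" "pb x z + pb z x \<in> lift I" using pb_anti r by blast+
    \<comment> \<open>Differences can be taken only in the second argument, so a change of the first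
      argument is moved there by antisymmetry modulo the relations.\<close>
    have "pb w v - pb x z = pb w (v - z) - pb z (w - x) + (pb w z + pb z w) - (pb x z + pb z x)"
      by (simp add: pb_diff_right)
    also have "\<dots> \<in> lift I" by (intro is_ideal_diff[OF L] is_ideal_add[OF L] 1 2 3)
    finally have "qt I (pb w v) = qt I (pb x z)" by (simp add: qt_eq_iff[OF I(1)])
    then show ?thesis by (simp add: qt_def w \<pi>_pb)
  qed
  have "\<pi> x \<in> qt I x" "\<pi> z \<in> qt I z"
    unfolding mem using is_ideal_0[OF L] by (auto intro!: exI)
  then show ?thesis unfolding quotient_bracket_def using eq by blast
qed

definition fr :: "'a set \<Rightarrow> falg \<Rightarrow> falg \<Rightarrow> ('a set \<times> 'a set) set" where
  "fr P a s = fraction (A Quot P) (qt P a) (qt P s)"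

text \<open>The relation demands nonzero denominators on both sides, so a class with denominator
  \<open>s\<close> in \<open>lift P\<close> is empty.\<close>

lemma fraction_rel_qt:
  assumes P: "ideal P A"
  shows "((qt P a, qt P s), u) \<in> fraction_rel (A Quot P) \<longleftrightarrow>
    (\<exists>b t. u = (qt P b, qt P t) \<and> s \<notin> lift P \<and> t \<notin> lift P \<and> a * t - b * s \<in> lift P)"
proof -
  have "(\<exists>b t. u = (qt P b, qt P t) \<and> s \<notin> lift P \<and> t \<notin> lift P \<and> a * t - b * s \<in> lift P) \<longleftrightarrow>
    (\<exists>v w. u = (v, w) \<and> v \<in> range (qt P) \<and> w \<in> range (qt P) \<and> qt P s \<noteq> qt P 0 \<and> w \<noteq> qt P 0 \<and>
      qt P a \<otimes>\<^bsub>A Quot P\<^esub> w = v \<otimes>\<^bsub>A Quot P\<^esub> qt P s)"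
    (is "?l \<longleftrightarrow> ?r")
  proof
    assume ?l
    then obtain b t where b: "u = (qt P b, qt P t)" "s \<notin> lift P" "t \<notin> lift P" "a * t - b * s \<in> lift P"
      by blast
    then show ?r
      by - (rule exI[of _ "qt P b"], rule exI[of _ "qt P t"],
        simp add: qt_ring[OF P] qt_eq_iff[OF P] del: image_iff, simp)
  next
    assume ?r
    then obtain b t where b: "u = (qt P b, qt P t)" "qt P s \<noteq> qt P 0" "qt P t \<noteq> qt P 0"
      "qt P a \<otimes>\<^bsub>A Quot P\<^esub> qt P t = qt P b \<otimes>\<^bsub>A Quot P\<^esub> qt P s"
      by blast
    then show ?l
      by (intro exI[of _ b] exI[of _ t]) (simp add: qt_ring[OF P] qt_eq_iff[OF P])
  qed
  also have "\<dots> \<longleftrightarrow> ((qt P a, qt P s), u) \<in> fraction_rel (A Quot P)"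
    by (auto simp: fraction_rel_def qt_ring[OF P])
  finally show ?thesis by simp
qed

lemma mem_fr:
  assumes P: "ideal P A"
  shows "u \<in> fr P a s \<longleftrightarrow>
    (\<exists>b t. u = (qt P b, qt P t) \<and> s \<notin> lift P \<and> t \<notin> lift P \<and> a * t - b * s \<in> lift P)"
  unfolding fr_def fraction_def Image_singleton_iff by (rule fraction_rel_qt[OF P])

lemma fr_eq_iff:
  assumes P: "ideal P A" "is_prime (lift P)" and s: "s \<notin> lift P" "t \<notin> lift P"
  shows "fr P a s = fr P b t \<longleftrightarrow> a * t - b * s \<in> lift P"
proof
  note L = prime_ideal[OF P(2)]
  assume "fr P a s = fr P b t"
  moreover have "(qt P b, qt P t) \<in> fr P b t" unfolding mem_fr[OF P(1)]
    using s is_ideal_0[OF L] by (intro exI[of _ b] exI[of _ t]) auto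
  ultimately have "(qt P b, qt P t) \<in> fr P a s" by simp
  then obtain b' t' where b: "qt P b = qt P b'" "qt P t = qt P t'" "a * t' - b' * s \<in> lift P"
    unfolding mem_fr[OF P(1)] by auto
  have "b - b' \<in> lift P" "t - t' \<in> lift P" using b qt_eq_iff[OF P(1)] by auto
  then have "a * (t - t') - s * (b - b') + (a * t' - b' * s) \<in> lift P"
    using b(3) by (intro is_ideal_add[OF L _ b(3)] is_ideal_diff[OF L is_ideal_mult[OF L] is_ideal_mult[OF L]])
  then show "a * t - b * s \<in> lift P" by (simp add: algebra_simps)
next
  note L = prime_ideal[OF P(2)]
  have sub: "fr P a s \<subseteq> fr P b t" if st: "s \<notin> lift P" "t \<notin> lift P" and h: "a * t - b * s \<in> lift P"
    for a s b t
  proof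
    fix u assume "u \<in> fr P a s"
    then obtain c r where c: "u = (qt P c, qt P r)" "r \<notin> lift P" "a * r - c * s \<in> lift P"
      unfolding mem_fr[OF P(1)] by auto
    have "s * (b * r - c * t) = t * (a * r - c * s) - r * (a * t - b * s)" by (simp add: algebra_simps)
    also have "\<dots> \<in> lift P" by (intro is_ideal_diff[OF L] is_ideal_mult[OF L] c h)
    finally have "b * r - c * t \<in> lift P" using prime_mult[OF P(2)] st by blast
    then show "u \<in> fr P b t" unfolding mem_fr[OF P(1)] using c st by blast
  qed
  assume h: "a * t - b * s \<in> lift P"
  then have "b * s - a * t \<in> lift P" using is_ideal_uminus[OF L h] by simp
  then show "fr P a s = fr P b t" using sub[OF s h] sub[OF s(2,1)] by blast
qed

lemma fraction_field_qt:
  assumes P: "ideal P A"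
  shows "carrier (fraction_field (A Quot P)) = {fr P a s | a s. s \<notin> lift P}"
    "\<zero>\<^bsub>fraction_field (A Quot P)\<^esub> = fr P 0 1"
proof -
  have "carrier (fraction_field (A Quot P)) =
    {fraction (A Quot P) a s | a s. a \<in> range (qt P) \<and> s \<in> range (qt P) - {qt P 0}}"
    by (auto simp: fraction_field_def qt_ring[OF P] quotient_def fraction_def)
  also have "\<dots> = {fr P a s | a s. s \<notin> lift P}"
    unfolding fr_def using qt_eq_iff[OF P, of _ 0] by simp blast
  finally show "carrier (fraction_field (A Quot P)) = {fr P a s | a s. s \<notin> lift P}" .
  show "\<zero>\<^bsub>fraction_field (A Quot P)\<^esub> = fr P 0 1"
    by (simp add: fraction_field_def qt_ring[OF P] fr_def)
qed

definition pbnum :: "falg \<Rightarrow> falg \<Rightarrow> falg \<Rightarrow> falg \<Rightarrow> falg" where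
  "pbnum a s b t = s * t * pb a b - s * b * pb a t - a * t * pb s b + a * b * pb s t"

text \<open>The bracket of two fractions is a union over all representatives. Each pair contributes
  a subset, and if all pairs give the same class, the union is that class.\<close>

lemma fraction_bracket_qt:
  assumes P: "ideal P A" "stable hams (lift P)"
  shows "\<And>a s b t. (qt P a, qt P s) \<in> u \<Longrightarrow> (qt P b, qt P t) \<in> v \<Longrightarrow>
      fr P (pbnum a s b t) (s * s * (t * t)) \<subseteq> fraction_bracket (A Quot P) (quotient_bracket A br P) u v"
    and "u = fr P a0 s0 \<Longrightarrow> v = fr P b0 t0 \<Longrightarrow> u \<noteq> {} \<Longrightarrow> v \<noteq> {} \<Longrightarrow>
      (\<And>a s b t. (qt P a, qt P s) \<in> u \<Longrightarrow> (qt P b, qt P t) \<in> v \<Longrightarrow>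
         fr P (pbnum a s b t) (s * s * (t * t)) = w) \<Longrightarrow>
      fraction_bracket (A Quot P) (quotient_bracket A br P) u v = w"
proof -
  define F where "F = (\<lambda>a s b t. fraction (A Quot P)
       (s \<otimes>\<^bsub>A Quot P\<^esub> t \<otimes>\<^bsub>A Quot P\<^esub> quotient_bracket A br P a b \<ominus>\<^bsub>A Quot P\<^esub> s \<otimes>\<^bsub>A Quot P\<^esub> b \<otimes>\<^bsub>A Quot P\<^esub> quotient_bracket A br P a t
          \<ominus>\<^bsub>A Quot P\<^esub> a \<otimes>\<^bsub>A Quot P\<^esub> t \<otimes>\<^bsub>A Quot P\<^esub> quotient_bracket A br P s b \<oplus>\<^bsub>A Quot P\<^esub> a \<otimes>\<^bsub>A Quot P\<^esub> b \<otimes>\<^bsub>A Quot P\<^esub> quotient_bracket A br P s t)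
       (s \<otimes>\<^bsub>A Quot P\<^esub> s \<otimes>\<^bsub>A Quot P\<^esub> (t \<otimes>\<^bsub>A Quot P\<^esub> t)))"
  have F: "F (qt P a) (qt P s) (qt P b) (qt P t) = fr P (pbnum a s b t) (s * s * (t * t))" for a s b t
    by (simp add: F_def fr_def pbnum_def qt_ring[OF P(1)] qt_bracket[OF P])
  have B: "fraction_bracket (A Quot P) (quotient_bracket A br P) u v =
    (\<Union>x\<in>u. \<Union>z\<in>v. F (fst x) (snd x) (fst z) (snd z))" for u v
    by (simp add: fraction_bracket_def F_def case_prod_beta)
  show "fr P (pbnum a s b t) (s * s * (t * t)) \<subseteq> fraction_bracket (A Quot P) (quotient_bracket A br P) u v"
    if "(qt P a, qt P s) \<in> u" "(qt P b, qt P t) \<in> v" for a s b t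
  proof -
    have "F (fst (qt P a, qt P s)) (snd (qt P a, qt P s)) (fst (qt P b, qt P t)) (snd (qt P b, qt P t))
      \<subseteq> fraction_bracket (A Quot P) (quotient_bracket A br P) u v"
      unfolding B using that by blast
    then show ?thesis by (simp add: F)
  qed
  assume u: "u = fr P a0 s0" "v = fr P b0 t0" "u \<noteq> {}" "v \<noteq> {}"
    and w: "\<And>a s b t. (qt P a, qt P s) \<in> u \<Longrightarrow> (qt P b, qt P t) \<in> v \<Longrightarrow>
         fr P (pbnum a s b t) (s * s * (t * t)) = w"
  have "F (fst x) (snd x) (fst z) (snd z) = w" if xz: "x \<in> u" "z \<in> v" for x z
  proof -
    obtain a s where x: "x = (qt P a, qt P s)" using xz(1) unfolding u(1) mem_fr[OF P(1)] by blast
    obtain b t where z: "z = (qt P b, qt P t)" using xz(2) unfolding u(2) mem_fr[OF P(1)] by blast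
    show ?thesis using w[of a s b t] xz unfolding x z by (simp add: F)
  qed
  then show "fraction_bracket (A Quot P) (quotient_bracket A br P) u v = w"
    unfolding B using u(3,4) by simp
qed

text \<open>Whether the derivative of a fraction vanishes does not depend on the representative;
  multiplying by \<open>s * s\<close> turns this into an identity in the derivative of
  \<open>a * s' - a' * s\<close>.\<close>

lemma wronskian_fraction_cong:
  assumes p: "is_prime p" "is_derivation d" "stable {d} p" and s: "s \<notin> p" "a * s' - a' * s \<in> p"
    and w: "s * d a - a * d s \<in> p"
  shows "s' * d a' - a' * d s' \<in> p"
proof -
  note L = prime_ideal[OF p(1)]
  define e where "e = a * s' - a' * s"
  have e: "e \<in> p" "d e \<in> p" using s(2) p(3) by (auto simp: e_def stable_def)
  have de: "d e = a * d s' + d a * s' - (a' * d s + d a' * s)"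
    by (simp add: e_def derivation_diff[OF p(2)] derivation_mult[OF p(2)])
  have "s * (s * (s' * d a' - a' * d s')) =
    (s' * s') * (s * d a - a * d s) - (s * s') * d e + (s * d s' + s' * d s) * e"
    unfolding de unfolding e_def by (simp add: algebra_simps)
  also have "\<dots> \<in> p"
    by (intro is_ideal_add[OF L] is_ideal_diff[OF L] is_ideal_mult[OF L] e w)
  finally show ?thesis using s(1) by (simp add: prime_mult_iff[OF p(1)])
qed

text \<open>Testing against \<open>b / 1\<close> recovers the derivation attached to
  \<open>b\<close>. Conversely, the bracket with \<open>b / t\<close> is built by the quotient rule
  from the derivations attached to \<open>b\<close> and \<open>t\<close>.\<close>

lemma fr_central_iff:
  assumes P: "ideal P A" "is_prime (lift P)" "stable hams (lift P)" and s: "s \<notin> lift P"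
  shows "fr P a s \<in> poisson_center (fraction_field (A Quot P))
      (fraction_bracket (A Quot P) (quotient_bracket A br P)) \<longleftrightarrow>
    (\<forall>d\<in>hams. s * d a - a * d s \<in> lift P)"
    (is "?l \<longleftrightarrow> ?r")
proof
  note L = prime_ideal[OF P(2)] and rel = relations_subset_lift[OF P(1)]
  have self: "(qt P a, qt P s) \<in> fr P a s" if "s \<notin> lift P" for a s
    unfolding mem_fr[OF P(1)] using that is_ideal_0[OF L] by (intro exI[of _ a] exI[of _ s]) auto
  have prod: "s * s * (t * t) \<notin> lift P" if "s \<notin> lift P" "t \<notin> lift P" for s t
    using that by (simp add: prime_mult_iff[OF P(2)])
  have one: "1 \<notin> lift P" by (rule prime_one[OF P(2)])
  note ff = fraction_field_qt[OF P(1)]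
  have anti: "pb x z + pb z x \<in> lift P" for x z using pb_anti rel by blast
  {
    assume ?l
    then have br0: "fraction_bracket (A Quot P) (quotient_bracket A br P) (fr P a s) (fr P b 1) = fr P 0 1" for b
      using one unfolding poisson_center_def ff by blast
    show ?r
    proof
      fix d assume "d \<in> hams"
      then obtain h where h: "d = ham h" "h \<in> carrier A" by (auto simp: hams_def)
      obtain b where b: "\<pi> b = h" using \<pi>_surj[OF h(2)] by blast
      have d: "d x = pb b x" for x by (simp add: pb_def h b)
      have "fr P (pbnum a s b 1) (s * s * (1 * 1)) \<subseteq> fr P 0 1"
        unfolding br0[of b, symmetric]
        by (rule fraction_bracket_qt(1)[OF P(1,3) self[OF s] self[OF one]])
      then have "(qt P (pbnum a s b 1), qt P (s * s * (1 * 1))) \<in> fr P 0 1"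
        using self[OF prod[OF s one]] by blast
      then obtain c t where "qt P (pbnum a s b 1) = qt P c" "- c \<in> lift P"
        unfolding mem_fr[OF P(1)] by auto
      then have "pbnum a s b 1 - c \<in> lift P" "c \<in> lift P"
        using qt_eq_iff[OF P(1)] is_ideal_uminus[OF L, of "- c"] by auto
      then have N: "pbnum a s b 1 \<in> lift P" using is_ideal_add[OF L] by force
      have one0: "pb x 1 \<in> lift P" for x
        unfolding pb_def derivation_1[OF ham_derivation] by (rule is_ideal_0[OF L])
      \<comment> \<open>With denominator 1 the terms containing \<open>pb _ 1\<close> vanish, and
        antisymmetry exchanges the arguments of the other two.\<close>
      have "s * d a - a * d s = - pbnum a s b 1 - s * b * pb a 1 + a * b * pb s 1
          + s * (pb a b + pb b a) - a * (pb s b + pb b s)"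
        by (simp add: d pbnum_def algebra_simps)
      also have "\<dots> \<in> lift P"
        by (intro is_ideal_diff[OF L _ is_ideal_mult[OF L anti]] is_ideal_add[OF L _ is_ideal_mult[OF L anti]]
          is_ideal_add[OF L _ is_ideal_mult[OF L one0]] is_ideal_diff[OF L is_ideal_uminus[OF L N] is_ideal_mult[OF L one0]])
      finally show "s * d a - a * d s \<in> lift P" .
    qed
  next
    assume r: ?r
    have "fraction_bracket (A Quot P) (quotient_bracket A br P) (fr P a s) (fr P b t) = fr P 0 1"
      if t: "t \<notin> lift P" for b t
    proof (rule fraction_bracket_qt(2)[OF P(1,3) refl refl])
      show "fr P a s \<noteq> {}" "fr P b t \<noteq> {}" using self s t by blast+
      fix a' s' b' t' assume m: "(qt P a', qt P s') \<in> fr P a s" "(qt P b', qt P t') \<in> fr P b t"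
      have st: "s' \<notin> lift P \<and> a * s' - a' * s \<in> lift P" if mm: "(qt P a', qt P s') \<in> fr P a s" for a a' s s'
      proof -
        have "fraction_rel (A Quot P) `` {(qt P a, qt P s)} = fr P a s" by (simp add: fr_def fraction_def)
        then obtain c r where c: "qt P a' = qt P c" "qt P s' = qt P r" "r \<notin> lift P" "a * r - c * s \<in> lift P"
          using mm unfolding mem_fr[OF P(1)] by blast
        have ac: "a' - c \<in> lift P" "s' - r \<in> lift P" using c qt_eq_iff[OF P(1)] by auto
        have "a * (s' - r) - s * (a' - c) + (a * r - c * s) \<in> lift P"
          by (intro is_ideal_add[OF L] is_ideal_diff[OF L] is_ideal_mult[OF L] ac c)
        moreover have "s' \<notin> lift P" using c(3) ac(2) is_ideal_diff[OF L, of s' "s' - r"] by auto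
        ultimately show ?thesis by (simp add: algebra_simps)
      qed
      have a': "s' \<notin> lift P" "a * s' - a' * s \<in> lift P" using st[OF m(1)] by auto
      have t': "t' \<notin> lift P" using st[OF m(2)] by auto
      have w: "s' * pb b a' - a' * pb b s' \<in> lift P" for b
      proof -
        have h: "ham (\<pi> b) \<in> hams" by (simp add: hams_def \<pi>_closed)
        show ?thesis unfolding pb_def
          by (rule wronskian_fraction_cong[OF P(2) ham_derivation _ s a'(2)])
            (use h r P(3) in \<open>auto simp: stable_def\<close>)
      qed
      have "pbnum a' s' b' t' = t' * (s' * (pb a' b' + pb b' a') - a' * (pb s' b' + pb b' s')
          - (s' * pb b' a' - a' * pb b' s'))
        - b' * (s' * (pb a' t' + pb t' a') - a' * (pb s' t' + pb t' s') - (s' * pb t' a' - a' * pb t' s'))"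
        by (simp add: pbnum_def algebra_simps)
      also have "\<dots> \<in> lift P"
        by (intro is_ideal_diff[OF L] is_ideal_mult[OF L] w anti)
      finally show "fr P (pbnum a' s' b' t') (s' * s' * (t' * t')) = fr P 0 1"
        unfolding fr_eq_iff[OF P(1,2) prod[OF a'(1) t'] one] by simp
    qed
    then show ?l unfolding poisson_center_def ff using s by blast
  }
qed

lemma poisson_rational_iff:
  "poisson_rational A br P \<longleftrightarrow> P \<in> poisson_spectrum A br \<and> no_new_constants hams (lift P)"
proof (cases "P \<in> poisson_spectrum A br")
  case True
  then have P: "ideal P A" "is_prime (lift P)" "stable hams (lift P)" by (simp_all add: poisson_spectrum_iff)
  note L = prime_ideal[OF P(2)]
  let ?C = "poisson_center (fraction_field (A Quot P)) (fraction_bracket (A Quot P) (quotient_bracket A br P))"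
  have one: "1 \<notin> lift P" by (rule prime_one[OF P(2)])
  have d0: "d (cst c) = 0" "d 1 = 0" if "d \<in> hams" for d c
    using that hams_constant by (auto simp: constant_derivations_def derivation_1)
  have C: "?C = {fr P a s | a s. s \<notin> lift P \<and> (\<forall>d\<in>hams. s * d a - a * d s \<in> lift P)}"
  proof -
    have "?C = {u \<in> {fr P a s | a s. s \<notin> lift P}. u \<in> ?C}"
      unfolding fraction_field_qt(1)[OF P(1), symmetric] by (auto simp: poisson_center_def)
    also have "\<dots> = {fr P a s | a s. s \<notin> lift P \<and> fr P a s \<in> ?C}" by blast
    also have "\<dots> = {fr P a s | a s. s \<notin> lift P \<and> (\<forall>d\<in>hams. s * d a - a * d s \<in> lift P)}"
      by (intro Collect_cong ex_cong1 conj_cong refl fr_central_iff[OF P])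
    finally show ?thesis .
  qed
  have cr: "fr P (cst c) 1 \<in> ?C" for c
    unfolding fr_central_iff[OF P one] using is_ideal_0[OF L] by (simp add: d0)
  have R: "range (\<lambda>c. fraction (A Quot P) (P +> scalar A c) \<one>\<^bsub>A Quot P\<^esub>) = range (\<lambda>c. fr P (cst c) 1)"
    by (simp add: fr_def qt_ring[OF P(1)] qt_def \<pi>_cst)
  have "?C = range (\<lambda>c. fr P (cst c) 1) \<longleftrightarrow> ?C \<subseteq> range (\<lambda>c. fr P (cst c) 1)" using cr by blast
  also have "\<dots> \<longleftrightarrow> (\<forall>a s. s \<notin> lift P \<and> (\<forall>d\<in>hams. s * d a - a * d s \<in> lift P) \<longrightarrow>
      (\<exists>c. fr P a s = fr P (cst c) 1))"
    unfolding C by blast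
  also have "\<dots> \<longleftrightarrow> no_new_constants hams (lift P)"
    unfolding no_new_constants_def using fr_eq_iff[OF P(1,2) _ one] by simp
  finally show ?thesis using True unfolding poisson_rational_def R by blast
qed (simp add: poisson_rational_def)

section \<open>Cotangent dimension and Krull dimension\<close>

text \<open>The dimension is defined inductively by adjoining one vector at a time. Upstairs this
  amounts to inserting an element outside the span into an independent set.\<close>

lemma dimension_qt_iff:
  assumes J: "ideal J A"
  defines "K \<equiv> range (\<lambda>c. J +> scalar A c)"
  shows "ring.dimension (A Quot J) d K E \<longleftrightarrow>
    (\<exists>E0. indep (lift J) E0 \<and> card E0 = d \<and> E = qt J ` spans (lift J) E0)"
proof -
  note L = lift_ideal[OF J] and q = qt_ring[OF J] and eq = qt_eq_iff[OF J]
  interpret R: ring "A Quot J" by (rule ideal.quotient_is_ring[OF J])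
  have K: "K = range (\<lambda>c. qt J (cst c))" by (simp add: K_def qt_def \<pi>_cst)
  have lin_insert: "lin c (insert w E0) = cst (c w) * w + lin c E0" if "finite E0" "w \<notin> E0" for c w E0
    using that by (simp add: lin_def)
  have mem: "qt J x \<in> qt J ` spans (lift J) E0 \<longleftrightarrow> x \<in> spans (lift J) E0" for x E0
  proof
    assume "qt J x \<in> qt J ` spans (lift J) E0"
    then obtain z c where z: "x - z \<in> lift J" "z - lin c E0 \<in> lift J" by (auto simp: eq spans_def)
    then have "(x - z) + (z - lin c E0) \<in> lift J" by (rule is_ideal_add[OF L])
    then show "x \<in> spans (lift J) E0" by (auto simp: spans_def)
  qed simp
  have ext: "R.line_extension K (qt J w) (qt J ` spans (lift J) E0) = qt J ` spans (lift J) (insert w E0)"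
    if fin: "finite E0" and w: "w \<notin> E0" for w E0
  proof -
    have "R.line_extension K (qt J w) (qt J ` spans (lift J) E0) =
      {qt J (cst c * w + x) | c x. x \<in> spans (lift J) E0}"
      unfolding R.line_extension_def set_add_def' r_coset_def K by (auto simp: q)
    also have "\<dots> = qt J ` spans (lift J) (insert w E0)"
    proof (rule Set.set_eqI, rule iffI)
      fix u assume "u \<in> {qt J (cst c * w + x) | c x. x \<in> spans (lift J) E0}"
      then obtain c x b where u: "u = qt J (cst c * w + x)" "x - lin b E0 \<in> lift J" by (auto simp: spans_def)
      have "lin (b(w := c)) E0 = lin b E0" unfolding lin_def using w by (intro sum.cong) auto
      then have "lin (b(w := c)) (insert w E0) = cst c * w + lin b E0" by (simp add: lin_insert[OF fin w])
      then have "cst c * w + x - lin (b(w := c)) (insert w E0) \<in> lift J" using u(2) by simp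
      then show "u \<in> qt J ` spans (lift J) (insert w E0)" unfolding u(1) spans_def by blast
    next
      fix u assume "u \<in> qt J ` spans (lift J) (insert w E0)"
      then obtain z c where z: "u = qt J z" "z - lin c (insert w E0) \<in> lift J" by (auto simp: spans_def)
      then have "(z - cst (c w) * w) - lin c E0 \<in> lift J" by (simp add: lin_insert[OF fin w] algebra_simps)
      then have "z - cst (c w) * w \<in> spans (lift J) E0" by (auto simp: spans_def)
      moreover have "u = qt J (cst (c w) * w + (z - cst (c w) * w))" using z by simp
      ultimately show "u \<in> {qt J (cst c * w + x) | c x. x \<in> spans (lift J) E0}" by blast
    qed
    finally show ?thesis .
  qed
  have indep_insert: "indep (lift J) (insert w E0) \<longleftrightarrow> indep (lift J) E0 \<and> w \<notin> spans (lift J) E0"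
    if fin: "finite E0" and w: "w \<notin> E0" for w E0
  proof
    assume i: "indep (lift J) (insert w E0)"
    have "c e = 0" if c: "lin c E0 \<in> lift J" "e \<in> E0" for c e
    proof -
      have "lin (c(w := 0)) E0 = lin c E0" unfolding lin_def using w by (intro sum.cong) auto
      then have "lin (c(w := 0)) (insert w E0) \<in> lift J" using c by (simp add: lin_insert[OF fin w])
      then have "\<forall>e\<in>insert w E0. (c(w := 0)) e = 0" using i unfolding indep_def by blast
      then have "(c(w := 0)) e = 0" using c(2) by blast
      then show ?thesis using c(2) w by (auto split: if_splits)
    qed
    moreover have "w \<notin> spans (lift J) E0"
    proof
      assume "w \<in> spans (lift J) E0"
      then obtain c where c: "w - lin c E0 \<in> lift J" by (auto simp: spans_def)
      define b where "b = (\<lambda>e. if e = w then 1 else - c e)"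
      have "lin b E0 = - lin c E0"
        unfolding lin_def b_def sum_negf[symmetric] using w by (intro sum.cong) (auto simp: cst_uminus)
      then have "lin b (insert w E0) \<in> lift J" using c by (simp add: lin_insert[OF fin w] b_def)
      then have "b w = 0" using i unfolding indep_def by blast
      then show False by (simp add: b_def)
    qed
    ultimately show "indep (lift J) E0 \<and> w \<notin> spans (lift J) E0" using fin by (auto simp: indep_def)
  next
    assume i: "indep (lift J) E0 \<and> w \<notin> spans (lift J) E0"
    have "\<forall>e\<in>insert w E0. c e = 0" if c: "lin c (insert w E0) \<in> lift J" for c
    proof -
      have cw: "c w = 0"
      proof (rule ccontr)
        assume n: "c w \<noteq> 0"
        define b where "b = (\<lambda>e. - (c e / c w))"
        have "lin b E0 = - (cst (1 / c w) * lin c E0)"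
          unfolding lin_def b_def sum_distrib_left sum_negf[symmetric]
          by (intro sum.cong) (simp_all add: cst_uminus mult.assoc[symmetric] cst_mult[symmetric])
        moreover have "cst (1 / c w) * lin c (insert w E0) = w + cst (1 / c w) * lin c E0"
          using n by (simp add: lin_insert[OF fin w] distrib_left mult.assoc[symmetric] cst_mult[symmetric])
        ultimately have "w - lin b E0 \<in> lift J" using is_ideal_mult[OF L c, of "cst (1 / c w)"] by simp
        then show False using i by (auto simp: spans_def)
      qed
      then have "lin c E0 \<in> lift J" using c by (simp add: lin_insert[OF fin w])
      then show ?thesis using i cw by (auto simp: indep_def)
    qed
    then show "indep (lift J) (insert w E0)" using fin by (simp add: indep_def)
  qed
  have zero: "qt J ` spans (lift J) {} = {\<zero>\<^bsub>A Quot J\<^esub>}"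
  proof -
    have "qt J x = qt J 0 \<longleftrightarrow> x \<in> lift J" for x by (simp add: eq)
    then show ?thesis using is_ideal_0[OF L] unfolding spans_def lin_def q(3) by simp blast
  qed
  show ?thesis
  proof
    have "R.dimension d K' E \<Longrightarrow> K' = K \<Longrightarrow>
      \<exists>E0. indep (lift J) E0 \<and> card E0 = d \<and> E = qt J ` spans (lift J) E0" for K'
    proof (induction rule: R.dimension.induct)
      case (zero_dim K)
      show ?case by (rule exI[of _ "{}"]) (simp add: zero indep_def)
    next
      case (Suc_dim v E n K')
      then obtain E0 where E0: "indep (lift J) E0" "card E0 = n" "E = qt J ` spans (lift J) E0" by blast
      obtain w where w: "v = qt J w" using Suc_dim(1) q(6) by blast
      have fin: "finite E0" using E0(1) by (simp add: indep_def)
      have ws: "w \<notin> spans (lift J) E0" using Suc_dim(2) w E0(3) by blast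
      have "e \<in> spans (lift J) E0" if e: "e \<in> E0" for e
      proof -
        show ?thesis by (rule subset_spans[OF L fin e])
      qed
      then have we: "w \<notin> E0" using ws by blast
      show ?case
        by (rule exI[of _ "insert w E0"])
          (use E0 ws we fin in \<open>simp add: indep_insert[OF fin we] ext[OF fin we] w Suc_dim(5)\<close>)
    qed
    then show "R.dimension d K E \<Longrightarrow> \<exists>E0. indep (lift J) E0 \<and> card E0 = d \<and> E = qt J ` spans (lift J) E0" by blast
  next
    assume "\<exists>E0. indep (lift J) E0 \<and> card E0 = d \<and> E = qt J ` spans (lift J) E0"
    then obtain E0 where E0: "indep (lift J) E0" "card E0 = d" "E = qt J ` spans (lift J) E0" by blast
    have "finite E0" using E0(1) by (simp add: indep_def)
    then have "indep (lift J) E0 \<Longrightarrow> R.dimension (card E0) K (qt J ` spans (lift J) E0)"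
    proof (induction E0)
      case empty
      show ?case by (simp add: zero)
    next
      case (insert w E0)
      have i: "indep (lift J) E0" "w \<notin> spans (lift J) E0"
        using insert indep_insert[OF insert(1,2)] by auto
      have "R.dimension (Suc (card E0)) K (R.line_extension K (qt J w) (qt J ` spans (lift J) E0))"
        by (rule R.Suc_dim) (use i insert.IH in \<open>auto simp: q mem simp del: image_iff\<close>)
      then show ?case using insert(1,2) by (simp add: ext)
    qed
    then show "R.dimension d K E" using E0 by simp
  qed
qed

lemma lift_cotangent:
  assumes f: "is_pt f" and I: "ideal I A" "I \<subseteq> mx f"
  shows "ideal ((mx f \<cdot> mx f) <+>\<^bsub>A\<^esub> I) A" "lift ((mx f \<cdot> mx f) <+>\<^bsub>A\<^esub> I) = cotangent_kernel f (lift I)"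
proof -
  note m = mx_ideal[OF f]
  let ?J = "(mx f \<cdot> mx f) <+>\<^bsub>A\<^esub> I"
  show J: "ideal ?J A" by (intro add_ideals ideal_prod_is_ideal m I)
  note L = lift_ideal[OF J]
  have CK: "is_ideal (cotangent_kernel f (lift I))"
    by (rule cotangent_kernel_ideal[OF is_ptD(1)[OF f] lift_ideal[OF I(1)]])
  have rel: "relations \<subseteq> cotangent_kernel f (lift I)"
    using relations_subset_lift[OF I(1)] by (auto intro: cotangent_kernel.ck_I)
  have zm: "\<zero> \<in> mx f \<cdot> mx f"
    using ideal_prod_is_ideal[OF m m] by (meson additive_subgroup.zero_closed ideal.axioms(1))
  have z: "\<zero> \<in> I" using I(1) by (meson additive_subgroup.zero_closed ideal.axioms(1))
  show "lift ?J = cotangent_kernel f (lift I)"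
  proof
    have p: "a \<in> \<pi> ` cotangent_kernel f (lift I)" if "a \<in> mx f \<cdot> mx f" for a
      using that
    proof (induction rule: ideal_prod.induct)
      case (prod i j)
      then obtain x z where "i = \<pi> x" "j = \<pi> z" "f x = 0" "f z = 0"
        by (auto simp: mx_def point_ideal_def)
      then show ?case using cotangent_kernel.ck_prod[of f x z] by (auto simp: \<pi>_mult[symmetric])
    next
      case (sum s1 s2)
      then show ?case using cotangent_kernel.ck_add by (fastforce simp: \<pi>_add[symmetric])
    qed
    have "?J \<subseteq> \<pi> ` cotangent_kernel f (lift I)"
    proof
      fix a assume "a \<in> ?J"
      then obtain b c where b: "a = b \<oplus> c" "b \<in> mx f \<cdot> mx f" "c \<in> I" by (auto simp: set_add_def')
      obtain x where x: "x \<in> cotangent_kernel f (lift I)" "b = \<pi> x" using p[OF b(2)] by blast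
      obtain z where z: "c = \<pi> z" using b(3) ideal_subset[OF I(1)] \<pi>_surj by blast
      have "z \<in> cotangent_kernel f (lift I)" using b(3) z by (auto simp: lift_iff intro: cotangent_kernel.ck_I)
      then have "x + z \<in> cotangent_kernel f (lift I)" by (rule cotangent_kernel.ck_add[OF x(1)])
      then show "a \<in> \<pi> ` cotangent_kernel f (lift I)" using b x z by (simp add: \<pi>_add[symmetric])
    qed
    then have "lift ?J \<subseteq> lift (\<pi> ` cotangent_kernel f (lift I))" by (auto simp: lift_def)
    then show "lift ?J \<subseteq> cotangent_kernel f (lift I)" by (simp add: lift_image[OF CK rel])
  next
    show "cotangent_kernel f (lift I) \<subseteq> lift ?J"
    proof
      fix x assume "x \<in> cotangent_kernel f (lift I)"
      then show "x \<in> lift ?J"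
      proof (induction rule: cotangent_kernel.induct)
        case (ck_I x)
        have "\<zero> \<oplus> \<pi> x \<in> ?J" using ck_I zm unfolding set_add_def' lift_iff by blast
        then show ?case by (simp add: lift_iff \<pi>_closed)
      next
        case (ck_prod a b)
        have "\<pi> a \<otimes> \<pi> b \<in> mx f \<cdot> mx f" by (rule ideal_prod.prod) (simp_all add: mx_iff[OF f] ck_prod)
        then have "\<pi> a \<otimes> \<pi> b \<oplus> \<zero> \<in> ?J" using z unfolding set_add_def' by blast
        then show ?case by (simp add: lift_iff \<pi>_closed \<pi>_mult)
      next
        case (ck_add x z)
        then show ?case by (intro is_ideal_add[OF L])
      qed
    qed
  qed
qed

lemma cotangent_dimension_iff:
  assumes f: "is_pt f" and I: "ideal (\<Inter>V) A" "\<Inter>V \<subseteq> mx f"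
  shows "cotangent_dimension A V (mx f) d \<longleftrightarrow> embdim f (lift (\<Inter>V)) d"
proof -
  note J = lift_cotangent[OF f I]
  let ?J = "(mx f \<cdot> mx f) <+>\<^bsub>A\<^esub> \<Inter>V" and ?C = "cotangent_kernel f (lift (\<Inter>V))"
  note C = lift_ideal[OF J(1), unfolded J(2)] and m = prime_ideal[OF point_ideal_prime[OF is_ptD(1)[OF f]]]
  have Cm: "?C \<subseteq> point_ideal f"
  proof
    fix x assume "x \<in> ?C"
    then show "x \<in> point_ideal f"
    proof (induction rule: cotangent_kernel.induct)
      case (ck_I x)
      then show ?case using I(2) mx_iff[OF f, of x] by (auto simp: point_ideal_def lift_iff)
    qed (simp_all add: point_ideal_def point_simps[OF is_ptD(1)[OF f]])
  qed
  have "(+>) ?J ` mx f = qt ?J ` point_ideal f"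
    by (auto simp: qt_def mx_def)
  then have "cotangent_dimension A V (mx f) d \<longleftrightarrow>
    (\<exists>E0. indep ?C E0 \<and> card E0 = d \<and> qt ?J ` point_ideal f = qt ?J ` spans ?C E0)"
    unfolding cotangent_dimension_def Let_def using dimension_qt_iff[OF J(1), unfolded J(2)] by simp
  also have "\<dots> \<longleftrightarrow> embdim f (lift (\<Inter>V)) d"
  proof -
    have "qt ?J ` point_ideal f = qt ?J ` spans ?C E0 \<longleftrightarrow> E0 \<subseteq> point_ideal f \<and> point_ideal f \<subseteq> spans ?C E0"
      if E0: "finite E0" for E0
    proof
      note eq = qt_eq_iff[OF J(1), unfolded J(2)]
      assume h: "qt ?J ` point_ideal f = qt ?J ` spans ?C E0"
      have "e \<in> point_ideal f" if e: "e \<in> E0" for e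
      proof -
        have "e \<in> spans ?C E0" by (rule subset_spans[OF C E0 e])
        then have "qt ?J e \<in> qt ?J ` point_ideal f" unfolding h by blast
        then obtain z where z: "e - z \<in> ?C" "z \<in> point_ideal f" by (auto simp: eq)
        then have "(e - z) + z \<in> point_ideal f" using Cm by (intro is_ideal_add[OF m]) auto
        then show ?thesis by simp
      qed
      moreover have "x \<in> spans ?C E0" if x: "x \<in> point_ideal f" for x
      proof -
        have "qt ?J x \<in> qt ?J ` spans ?C E0" using h x by blast
        then obtain z c where z: "x - z \<in> ?C" "z - lin c E0 \<in> ?C" by (auto simp: eq spans_def)
        then have "(x - z) + (z - lin c E0) \<in> ?C" by (rule is_ideal_add[OF C])
        then show ?thesis by (auto simp: spans_def)
      qed
      ultimately show "E0 \<subseteq> point_ideal f \<and> point_ideal f \<subseteq> spans ?C E0" by blast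
    next
      assume h: "E0 \<subseteq> point_ideal f \<and> point_ideal f \<subseteq> spans ?C E0"
      have "spans ?C E0 \<subseteq> point_ideal f"
      proof
        fix x assume "x \<in> spans ?C E0"
        then obtain c where c: "x - lin c E0 \<in> ?C" by (auto simp: spans_def)
        have "lin c E0 \<in> point_ideal f"
          unfolding lin_def by (rule is_ideal_sum[OF m], rule is_ideal_mult[OF m]) (use h in auto)
        then have "(x - lin c E0) + lin c E0 \<in> point_ideal f" using c Cm by (intro is_ideal_add[OF m]) auto
        then show "x \<in> point_ideal f" by simp
      qed
      then show "qt ?J ` point_ideal f = qt ?J ` spans ?C E0" using h by (simp add: subset_antisym)
    qed
    note key = this
    have "indep ?C E0 \<and> card E0 = d \<and> qt ?J ` point_ideal f = qt ?J ` spans ?C E0 \<longleftrightarrow>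
      E0 \<subseteq> point_ideal f \<and> indep ?C E0 \<and> point_ideal f \<subseteq> spans ?C E0 \<and> card E0 = d" for E0
    proof (cases "finite E0")
      case True
      show ?thesis unfolding key[OF True] by argo
    qed (simp add: indep_def)
    then show ?thesis unfolding embdim_def by (intro ex_cong1)
  qed
  finally show ?thesis .
qed

lemma local_dimension_iff:
  assumes f: "is_pt f" and I: "ideal (\<Inter>V) A" "\<Inter>V \<subseteq> mx f"
  shows "local_dimension A V (mx f) = enat d \<longleftrightarrow>
    prime_chain (lift (\<Inter>V)) f d \<and> (\<forall>m. prime_chain (lift (\<Inter>V)) f m \<longrightarrow> m \<le> d)"
proof -
  let ?c = "prime_chain (lift (\<Inter>V)) f"
  have "(\<exists>P. (\<forall>i\<le>m. primeideal (P i) A \<and> \<Inter>V \<subseteq> P i) \<and> (\<forall>i<m. P i \<subset> P (Suc i)) \<and> P m = mx f) \<longleftrightarrow> ?c m" for m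
  proof
    assume "\<exists>P. (\<forall>i\<le>m. primeideal (P i) A \<and> \<Inter>V \<subseteq> P i) \<and> (\<forall>i<m. P i \<subset> P (Suc i)) \<and> P m = mx f"
    then obtain P where P: "\<And>i. i \<le> m \<Longrightarrow> primeideal (P i) A \<and> \<Inter>V \<subseteq> P i" "\<And>i. i < m \<Longrightarrow> P i \<subset> P (Suc i)" "P m = mx f"
      by blast
    have sub: "P i \<subseteq> carrier A" if "i \<le> m" for i
      using P(1)[OF that] by (simp add: ideal_subset primeideal.axioms(1))
    show "?c m" unfolding prime_chain_def
    proof (intro exI[of _ "\<lambda>i. lift (P i)"] conjI allI impI)
      fix i assume i: "i < m"
      show "lift (P i) \<subset> lift (P (Suc i))"
        using P(2)[OF i] lift_mono_iff[OF sub, of i "P (Suc i)"] lift_mono_iff[OF sub, of "Suc i" "P i"] i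
        by (simp add: less_le_not_le)
    next
      fix i assume i: "i \<le> m"
      show "is_prime (lift (P i))" using P(1)[OF i] lift_prime by blast
      show "lift (\<Inter>V) \<subseteq> lift (P i)" using P(1)[OF i] unfolding lift_def by blast
    qed (simp add: P(3) lift_mx[OF f])
  next
    assume "?c m"
    then obtain P where P: "\<And>i. i \<le> m \<Longrightarrow> is_prime (P i) \<and> lift (\<Inter>V) \<subseteq> P i" "\<And>i. i < m \<Longrightarrow> P i \<subset> P (Suc i)"
      "P m = point_ideal f"
      unfolding prime_chain_def by blast
    have rel: "relations \<subseteq> P i" if "i \<le> m" for i
      using P(1)[OF that] relations_subset_lift[OF I(1)] by blast
    have lP: "lift (\<pi> ` P i) = P i" if "i \<le> m" for i
      by (rule lift_image[OF prime_ideal rel[OF that]]) (use P(1)[OF that] in blast)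
    show "\<exists>P. (\<forall>i\<le>m. primeideal (P i) A \<and> \<Inter>V \<subseteq> P i) \<and> (\<forall>i<m. P i \<subset> P (Suc i)) \<and> P m = mx f"
    proof (rule exI[of _ "\<lambda>i. \<pi> ` P i"], intro conjI allI impI)
      fix i assume i: "i \<le> m"
      show "primeideal (\<pi> ` P i) A" by (rule image_prime[OF _ rel[OF i]]) (use P(1)[OF i] in blast)
      show "\<Inter>V \<subseteq> \<pi> ` P i" using P(1)[OF i] lP[OF i] lift_mono_iff[OF ideal_subset[OF I(1)]] by metis
    next
      fix i assume i: "i < m"
      have "P i \<noteq> P (Suc i)" using P(2)[OF i] by blast
      then have "lift (\<pi> ` P i) \<noteq> lift (\<pi> ` P (Suc i))" using lP[of i] lP[of "Suc i"] i by simp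
      then have "\<pi> ` P i \<noteq> \<pi> ` P (Suc i)" by metis
      moreover have "\<pi> ` P i \<subseteq> \<pi> ` P (Suc i)" using P(2)[OF i] by (intro image_mono) simp
      ultimately show "\<pi> ` P i \<subset> \<pi> ` P (Suc i)" by blast
    qed (simp add: P(3) mx_def)
  qed
  then have ld: "local_dimension A V (mx f) = Sup {enat m | m. ?c m}"
    unfolding local_dimension_def by simp
  have c0: "?c 0"
  proof -
    have "lift (\<Inter>V) \<subseteq> point_ideal f" using I(2) lift_mx[OF f] by (auto simp: lift_def)
    then show ?thesis unfolding prime_chain_def
      using point_ideal_prime[OF is_ptD(1)[OF f]] by (intro exI[of _ "\<lambda>_. point_ideal f"]) simp
  qed
  show ?thesis
  proof
    assume e: "local_dimension A V (mx f) = enat d"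
    have le: "m \<le> d" if "?c m" for m
    proof -
      have "enat m \<le> Sup {enat m | m. ?c m}" by (rule Sup_upper) (use that in blast)
      then show ?thesis using e ld by simp
    qed
    \<comment> \<open>The lengths are bounded and include 0, so there is a greatest one, and it is
      the supremum.\<close>
    obtain k where k: "?c k" "\<And>m. ?c m \<Longrightarrow> m \<le> k"
      using ex_has_greatest_nat[of ?c 0 "\<lambda>x. x" "Suc d"] c0 le by (auto simp: less_Suc_eq_le)
    have "Sup {enat m | m. ?c m} \<le> enat k" by (rule Sup_least) (use k(2) in auto)
    then have "d \<le> k" using e ld by simp
    then have "d = k" using le[OF k(1)] by simp
    then show "?c d \<and> (\<forall>m. ?c m \<longrightarrow> m \<le> d)" using k by blast
  next
    assume h: "?c d \<and> (\<forall>m. ?c m \<longrightarrow> m \<le> d)"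
    have "Sup {enat m | m. ?c m} = enat d"
    proof (rule antisym)
      show "Sup {enat m | m. ?c m} \<le> enat d" by (rule Sup_least) (use h in auto)
      show "enat d \<le> Sup {enat m | m. ?c m}" by (rule Sup_upper) (use h in blast)
    qed
    then show "local_dimension A V (mx f) = enat d" using ld by simp
  qed
qed

lemma regular_point_iff:
  assumes f: "is_pt f" and I: "ideal (\<Inter>V) A" "\<Inter>V \<subseteq> mx f"
  shows "regular_point A V (mx f) \<longleftrightarrow> regular (lift (\<Inter>V)) f"
  unfolding regular_point_def regular_def cotangent_dimension_iff[OF assms] local_dimension_iff[OF assms] by simp

end

section \<open>Invariance of Poisson ideals along Hamiltonian flows\<close>

text \<open>This is the regularity that Cauchy's inequality provides for the partial derivatives of
  a Hamiltonian along a curve.\<close>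

definition locally_bounded_on :: "real set \<Rightarrow> (real \<Rightarrow> complex) \<Rightarrow> bool" where
  "locally_bounded_on S v \<longleftrightarrow> (\<forall>t\<in>S. \<exists>\<delta>>0. \<exists>K. \<forall>s\<in>S. dist s t < \<delta> \<longrightarrow> norm (v s) \<le> K)"

lemma locally_bounded_on_combine:
  assumes "locally_bounded_on S v" "locally_bounded_on S w"
    and c: "\<And>t K L. norm (v t) \<le> K \<Longrightarrow> norm (w t) \<le> L \<Longrightarrow> norm (u t) \<le> c K L"
  shows "locally_bounded_on S u"
  unfolding locally_bounded_on_def
proof
  fix t assume t: "t \<in> S"
  obtain d K where d: "d > 0" "\<And>s. s \<in> S \<Longrightarrow> dist s t < d \<Longrightarrow> norm (v s) \<le> K"
    using assms(1) t unfolding locally_bounded_on_def by meson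
  obtain e L where e: "e > 0" "\<And>s. s \<in> S \<Longrightarrow> dist s t < e \<Longrightarrow> norm (w s) \<le> L"
    using assms(2) t unfolding locally_bounded_on_def by meson
  show "\<exists>\<delta>>0. \<exists>K. \<forall>s\<in>S. dist s t < \<delta> \<longrightarrow> norm (u s) \<le> K"
    by (rule exI[of _ "min d e"], rule conjI, simp add: d e, rule exI[of _ "c K L"])
      (use c d(2) e(2) in simp)
qed

lemma locally_bounded_on_mult:
  "locally_bounded_on S v \<Longrightarrow> locally_bounded_on S w \<Longrightarrow> locally_bounded_on S (\<lambda>t. v t * w t)"
  by (erule locally_bounded_on_combine[where c = "\<lambda>K L. K * L"])
    (auto simp: norm_mult intro: mult_mono order_trans[OF norm_ge_zero])

lemma locally_bounded_on_sum:
  "(\<And>i. i \<in> B \<Longrightarrow> locally_bounded_on S (v i)) \<Longrightarrow> locally_bounded_on S (\<lambda>t. \<Sum>i\<in>B. v i t)"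
proof (induction B rule: infinite_finite_induct)
  case (insert i B)
  have "locally_bounded_on S (\<lambda>t. v i t + (\<Sum>i\<in>B. v i t))"
    by (rule locally_bounded_on_combine[where c = "(+)", of S "v i" "\<lambda>t. \<Sum>i\<in>B. v i t"])
      (use insert in \<open>auto intro: norm_triangle_le add_mono\<close>)
  then show ?case using insert by simp
qed (auto simp: locally_bounded_on_def intro: exI[of _ 1] exI[of _ 0])

lemma continuous_imp_locally_bounded_on:
  assumes "continuous_on S v"
  shows "locally_bounded_on S v"
  unfolding locally_bounded_on_def
proof
  fix t assume t: "t \<in> S"
  then obtain d where d: "d > 0" "\<And>s. s \<in> S \<Longrightarrow> dist s t < d \<Longrightarrow> dist (v s) (v t) < 1"
    using assms unfolding continuous_on_iff by (meson zero_less_one)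
  have "norm (v s) \<le> norm (v t) + 1" if "s \<in> S" "dist s t < d" for s
    using d(2)[OF that] norm_triangle_ineq2[of "v s" "v t"] by (simp add: dist_norm)
  then show "\<exists>\<delta>>0. \<exists>K. \<forall>s\<in>S. dist s t < \<delta> \<longrightarrow> norm (v s) \<le> K" using d(1) by blast
qed

text \<open>On an interval of radius \<epsilon> around a zero, the maximum of the sum of the norms
  is at most \<open>card J * K * \<epsilon>\<close> times itself. That factor is at most 1/2, so the
  maximum is 0.\<close>

lemma linear_ode_locally_zero:
  fixes u :: "'j \<Rightarrow> real \<Rightarrow> complex"
  assumes J: "finite J" and K: "K \<ge> 0" and \<epsilon>: "\<epsilon> > 0" "2 * real (card J) * K * \<epsilon> \<le> 1"
    and N: "N = {0..T} \<inter> cball t \<epsilon>"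
    and t: "t \<in> {0..T}" "\<And>j. j \<in> J \<Longrightarrow> u j t = 0"
    and u: "\<And>j s. j \<in> J \<Longrightarrow> s \<in> {0..T} \<Longrightarrow> (u j has_vector_derivative u' j s) (at s within {0..T})"
    and bd: "\<And>j s. j \<in> J \<Longrightarrow> s \<in> N \<Longrightarrow> norm (u' j s) \<le> K * (\<Sum>k\<in>J. norm (u k s))"
    and s: "s \<in> N" and j: "j \<in> J"
  shows "u j s = 0"
proof -
  let ?n = "\<lambda>s. \<Sum>k\<in>J. norm (u k s)"
  have cN: "compact N" "convex N" "t \<in> N"
    using \<epsilon> t unfolding N by (auto intro!: compact_Int convex_Int)
  have du: "(u j has_vector_derivative u' j s) (at s within N)" if "j \<in> J" "s \<in> N" for j s
    using u[of j s] that N by (intro has_vector_derivative_within_subset[of "u j" _ s "{0..T}" N]) auto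
  have "continuous_on N ?n"
    using du by (intro continuous_on_sum continuous_on_norm)
      (meson continuous_on_eq_continuous_within has_vector_derivative_continuous)
  then obtain r where r: "r \<in> N" "\<And>s. s \<in> N \<Longrightarrow> ?n s \<le> ?n r"
    using continuous_attains_sup[OF cN(1), of ?n] cN(3) by blast
  have n0: "0 \<le> ?n s" for s by (simp add: sum_nonneg)
  have bound: "norm (u j s) \<le> K * ?n r * \<epsilon>" if js: "j \<in> J" "s \<in> N" for j s
  proof -
    have "norm (u j s - u j t) \<le> (K * ?n r) * norm (s - t)"
    proof (rule differentiable_bound[OF cN(2)])
      show "(u j has_derivative (\<lambda>h. h *\<^sub>R u' j x)) (at x within N)" if "x \<in> N" for x
        using du[OF js(1) that] by (simp add: has_vector_derivative_def)
      show "onorm (\<lambda>h. h *\<^sub>R u' j x) \<le> K * ?n r" if x: "x \<in> N" for x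
      proof (rule onorm_le)
        fix h :: real
        have "norm (u' j x) \<le> K * ?n x" by (rule bd[OF js(1) x])
        also have "\<dots> \<le> K * ?n r" by (rule mult_left_mono[OF r(2)[OF x] K])
        finally show "norm (h *\<^sub>R u' j x) \<le> K * ?n r * norm h"
          by (simp add: mult.commute[of "\<bar>h\<bar>"] mult_right_mono)
      qed
    qed (use js cN in auto)
    also have "\<dots> \<le> K * ?n r * \<epsilon>"
      using js(2) K n0 unfolding N by (intro mult_left_mono) (auto simp: dist_norm norm_minus_commute)
    finally show ?thesis using t(2)[OF js(1)] by simp
  qed
  have "?n r \<le> (\<Sum>k\<in>J. K * ?n r * \<epsilon>)" by (rule sum_mono) (rule bound[OF _ r(1)])
  then have "2 * ?n r \<le> (2 * real (card J) * K * \<epsilon>) * ?n r" by (simp add: algebra_simps)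
  also have "\<dots> \<le> 1 * ?n r" by (rule mult_right_mono[OF \<epsilon>(2) n0])
  finally have "?n r = 0" using n0[of r] by simp
  then have "norm (u j s) \<le> 0" using bound[OF j s] by simp
  then show ?thesis by simp
qed

text \<open>The common zero set is closed by continuity and open by the local lemma, hence the whole
  interval. Openness on both sides of a zero allows \<open>b\<close> to lie before
  \<open>a\<close>.\<close>

lemma linear_ode_zero:
  fixes u :: "'j \<Rightarrow> real \<Rightarrow> complex"
  assumes J: "finite J"
    and u: "\<And>j s. j \<in> J \<Longrightarrow> s \<in> {0..T} \<Longrightarrow> (u j has_vector_derivative u' j s) (at s within {0..T})"
    and u': "\<And>j s. j \<in> J \<Longrightarrow> s \<in> {0..T} \<Longrightarrow> u' j s = (\<Sum>k\<in>J. M j k s * u k s)"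
    and M: "\<And>j k. j \<in> J \<Longrightarrow> k \<in> J \<Longrightarrow> locally_bounded_on {0..T} (M j k)"
    and a: "a \<in> {0..T}" "\<And>j. j \<in> J \<Longrightarrow> u j a = 0" and b: "b \<in> {0..T}" "j \<in> J"
  shows "u j b = 0"
proof -
  let ?n = "\<lambda>s. \<Sum>k\<in>J. norm (u k s)"
  define Z' where "Z' = {s \<in> {0..T}. ?n s = 0}"
  have zero: "?n s = 0 \<longleftrightarrow> (\<forall>k\<in>J. u k s = 0)" for s
    using J by (simp add: sum_nonneg_eq_0_iff)
  have "continuous_on {0..T} ?n"
    using u by (intro continuous_on_sum continuous_on_norm)
      (meson continuous_on_eq_continuous_within has_vector_derivative_continuous)
  then have cl: "closedin (top_of_set {0..T}) Z'"
    unfolding Z'_def by (rule continuous_closedin_preimage_constant)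
  have op: "openin (top_of_set {0..T}) Z'"
    unfolding openin_euclidean_subtopology_iff
  proof (intro conjI ballI)
    show "Z' \<subseteq> {0..T}" by (auto simp: Z'_def)
    fix t assume "t \<in> Z'"
    then have t: "t \<in> {0..T}" "\<And>k. k \<in> J \<Longrightarrow> u k t = 0" using zero by (auto simp: Z'_def)
    define V where "V = (\<lambda>s. \<Sum>j\<in>J. \<Sum>k\<in>J. complex_of_real (norm (M j k s)))"
    have "locally_bounded_on {0..T} V" unfolding V_def
    proof (intro locally_bounded_on_sum)
      fix i k assume "i \<in> J" "k \<in> J"
      then show "locally_bounded_on {0..T} (\<lambda>t. complex_of_real (norm (M i k t)))"
        using M unfolding locally_bounded_on_def by simp
    qed
    then obtain d K where d: "d > 0" "\<And>s. s \<in> {0..T} \<Longrightarrow> dist s t < d \<Longrightarrow> norm (V s) \<le> K"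
      using t(1) unfolding locally_bounded_on_def by meson
    define K' where "K' = max K 0"
    \<comment> \<open>The first bound stays where the coefficients are controlled by
      \<open>K'\<close>; the second makes the contraction factor small, its summand 1 keeping the
      denominator positive.\<close>
    define \<epsilon> where "\<epsilon> = min (d / 2) (1 / (2 * real (card J) * K' + 1))"
    have pos: "0 \<le> 2 * real (card J) * K'" by (simp add: K'_def)
    have \<epsilon>: "\<epsilon> > 0" using d(1) pos unfolding \<epsilon>_def by (simp add: add_nonneg_pos)
    have "2 * real (card J) * K' * \<epsilon> \<le> 2 * real (card J) * K' * (1 / (2 * real (card J) * K' + 1))"
      by (rule mult_left_mono[OF _ pos]) (simp add: \<epsilon>_def)
    also have "\<dots> \<le> 1"
    proof -
      have "x * (1 / (x + 1)) \<le> 1" if "0 \<le> x" for x :: real using that by (simp add: divide_simps)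
      then show ?thesis using pos by blast
    qed
    finally have \<epsilon>1: "2 * real (card J) * K' * \<epsilon> \<le> 1" .
    have bd: "norm (u' j s) \<le> K' * ?n s" if j: "j \<in> J" and s: "s \<in> {0..T} \<inter> cball t \<epsilon>" for j s
    proof -
      have dd: "dist s t < d" using s d(1) by (auto simp: \<epsilon>_def dist_commute)
      have s0: "s \<in> {0..T}" using s by simp
      have Mj: "norm (M j k s) \<le> K'" if k: "k \<in> J" for k
      proof -
        have "norm (M j k s) \<le> (\<Sum>k\<in>J. norm (M j k s))" by (rule member_le_sum[OF k]) (use J in auto)
        also have "\<dots> \<le> (\<Sum>j\<in>J. \<Sum>k\<in>J. norm (M j k s))"
          by (rule member_le_sum[OF j]) (use J in \<open>auto intro: sum_nonneg\<close>)
        also have "\<dots> = norm (V s)"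
          unfolding V_def of_real_sum[symmetric] norm_of_real by (simp add: sum_nonneg)
        also have "\<dots> \<le> K'" using d(2)[OF s0 dd] by (simp add: K'_def)
        finally show ?thesis .
      qed
      have "norm (u' j s) \<le> (\<Sum>k\<in>J. norm (M j k s * u k s))" unfolding u'[OF j s0] by (rule norm_sum)
      also have "\<dots> \<le> (\<Sum>k\<in>J. K' * norm (u k s))"
        unfolding norm_mult by (intro sum_mono mult_right_mono Mj) auto
      finally show ?thesis by (simp add: sum_distrib_left)
    qed
    have "s \<in> Z'" if s: "s \<in> {0..T}" "dist s t < \<epsilon>" for s
    proof -
      have "u k s = 0" if k: "k \<in> J" for k
        by (rule linear_ode_locally_zero[OF J _ \<epsilon> \<epsilon>1 refl t u bd _ k])
          (use s in \<open>auto simp: K'_def dist_commute\<close>)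
      then show ?thesis using s(1) zero by (simp add: Z'_def)
    qed
    then show "\<exists>e>0. \<forall>x'\<in>{0..T}. dist x' t < e \<longrightarrow> x' \<in> Z'" using \<epsilon> by blast
  qed
  have "Z' = {} \<or> Z' = {0..T}"
    using connected_clopen[of "{0..T}"] op cl by (simp add: connected_iff_interval)
  moreover have "a \<in> Z'" using a zero by (simp add: Z'_def)
  ultimately have "b \<in> Z'" using b(1) by blast
  then show ?thesis using zero b(2) by (simp add: Z'_def)
qed

text \<open>Continuity bounds \<open>F\<close> near \<open>z0\<close>, and Cauchy's inequality in
  one variable bounds the derivative on smaller discs. Coordinates from \<open>n\<close> on stay
  fixed, as \<open>F\<close> is holomorphic only in the others.\<close>

lemma partial_deriv_locally_bounded:
  assumes F: "holomorphic_in_variables n U F" and z0: "z0 \<in> U" and i: "i < n"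
  shows "\<exists>r>0. \<exists>K. \<forall>z. (\<forall>j<n. dist (z j) (z0 j) < r) \<and> (\<forall>j\<ge>n. z j = z0 j) \<longrightarrow> norm (partial_deriv i F z) \<le> K"
proof -
  have U: "open U" "continuous_on U F" and hol: "\<And>z i. z \<in> U \<Longrightarrow> i < n \<Longrightarrow> (\<lambda>w. F (z(i := w))) field_differentiable at (z i)"
    using F by (auto simp: holomorphic_in_variables_def)
  define U' where "U' = U \<inter> F -` ball (F z0) 1"
  have "open U'" unfolding U'_def by (rule continuous_open_preimage[OF U(2,1) open_ball])
  have zU: "z0 \<in> U'" using z0 by (simp add: U'_def)
  have "openin (product_topology (\<lambda>i. euclidean) UNIV) U'" using \<open>open U'\<close> by (simp add: open_fun_def)
  then obtain W where W: "z0 \<in> (\<Pi>\<^sub>E i\<in>UNIV. W i)" "\<And>i. open (W i)" "(\<Pi>\<^sub>E i\<in>UNIV. W i) \<subseteq> U'"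
    using product_topology_open_contains_basis[OF _ zU] by (metis open_openin)
  have "\<exists>r>0. ball (z0 j) r \<subseteq> W j" for j
    using W(2)[of j] W(1) by (auto simp: open_contains_ball PiE_def)
  then obtain \<rho> where \<rho>: "\<And>j. \<rho> j > 0" "\<And>j. ball (z0 j) (\<rho> j) \<subseteq> W j" by metis
  \<comment> \<open>Half of the smallest radius: \<open>z\<close> may be within \<open>r\<close> of
    \<open>z0\<close>, its coordinate \<open>i\<close> may move by another \<open>r\<close>, and the
    point stays in the box.\<close>
  define r where "r = Min (\<rho> ` {..<n}) / 2"
  have ne: "\<rho> ` {..<n} \<noteq> {}" using i by auto
  have r: "r > 0" using \<rho>(1) ne by (simp add: r_def)
  have r2: "2 * r \<le> \<rho> j" if "j < n" for j
    using that Min_le[of "\<rho> ` {..<n}" "\<rho> j"] by (simp add: r_def)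
  have inU: "z \<in> U'" if z: "\<And>j. j < n \<Longrightarrow> dist (z j) (z0 j) < 2 * r" "\<And>j. j \<ge> n \<Longrightarrow> z j = z0 j" for z
  proof -
    have "z j \<in> W j" for j
    proof (cases "j < n")
      case True
      then have "z j \<in> ball (z0 j) (\<rho> j)" using z(1)[OF True] r2[OF True] by (simp add: dist_commute)
      then show ?thesis using \<rho>(2) by blast
    next
      case False
      then show ?thesis using z(2)[of j] \<rho>(1,2)[of j] by auto
    qed
    then show ?thesis using W(3) by (auto simp: PiE_def)
  qed
  have "norm (partial_deriv i F z) \<le> (norm (F z0) + 1) / (r / 2)"
    if z: "\<forall>j<n. dist (z j) (z0 j) < r" "\<forall>j\<ge>n. z j = z0 j" for z
  proof -
    have near: "z(i := w) \<in> U'" if w: "dist w (z i) < r" for w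
    proof (rule inU)
      fix j assume j: "j < n"
      show "dist ((z(i := w)) j) (z0 j) < 2 * r"
      proof (cases "j = i")
        case True
        have "dist w (z0 i) \<le> dist w (z i) + dist (z i) (z0 i)" by (rule dist_triangle)
        then show ?thesis using True w z(1) i by fastforce
      next
        case False
        then show ?thesis using z(1) j r by fastforce
      qed
    qed (use z i in auto)
    have d: "(\<lambda>w. F (z(i := w))) field_differentiable at w" if w: "dist w (z i) < r" for w
    proof -
      have "z(i := w) \<in> U" using near[OF w] by (simp add: U'_def)
      from hol[OF this i] show ?thesis by simp
    qed
    have "norm ((deriv ^^ 1) (\<lambda>w. F (z(i := w))) (z i)) \<le> fact 1 * (norm (F z0) + 1) / (r / 2) ^ 1"
    proof (rule Cauchy_inequality)
      show "(\<lambda>w. F (z(i := w))) holomorphic_on ball (z i) (r / 2)"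
        unfolding holomorphic_on_def
      proof
        fix w assume "w \<in> ball (z i) (r / 2)"
        then show "(\<lambda>w. F (z(i := w))) field_differentiable at w within ball (z i) (r / 2)"
          using r by - (rule field_differentiable_at_within, rule d, simp add: dist_commute)
      qed
      show "continuous_on (cball (z i) (r / 2)) (\<lambda>w. F (z(i := w)))"
        using r by - (rule continuous_at_imp_continuous_on, rule ballI,
          rule field_differentiable_imp_continuous_at, rule d, auto simp: dist_commute)
      show "0 < r / 2" using r by simp
      fix w assume "norm (z i - w) = r / 2"
      then have "dist w (z i) < r" using r by (simp add: dist_norm norm_minus_commute)
      then have "dist (F z0) (F (z(i := w))) < 1" using near by (auto simp: U'_def)
      then show "norm (F (z(i := w))) \<le> norm (F z0) + 1"
        using norm_triangle_ineq2[of "F (z(i := w))" "F z0"] by (simp add: dist_norm norm_minus_commute)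
    qed
    then show ?thesis by (simp add: partial_deriv_def)
  qed
  then show ?thesis using r by blast
qed

context presentation
begin

text \<open>Finite generation of \<open>Q\<close> modulo the relations makes the linear system
  finite. Its uniqueness statement favours neither end of the interval, which gives both
  directions.\<close>

lemma ham_flow_step:
  assumes step: "hamiltonian_flow_step A br S p q" and S: "S \<subseteq> max_spectrum A"
    and f: "is_pt f" "p = mx f" and g: "is_pt g" "q = mx g"
    and Q: "is_ideal Q" "relations \<subseteq> Q" "stable hams Q"
  shows "Q \<subseteq> point_ideal f \<longleftrightarrow> Q \<subseteq> point_ideal g"
proof -
  obtain k x U F T \<gamma> where h: "\<forall>i<k. x i \<in> carrier A" "holomorphic_in_variables k U F" "0 \<le> T" "\<gamma> 0 = p" "\<gamma> T = q"
    "\<forall>t\<in>{0..T::real}. \<gamma> t \<in> S \<and> coordinates A k x (\<gamma> t) \<in> U \<and>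
        (\<forall>g\<in>carrier A. ((\<lambda>s. point_value A (\<gamma> s) g)
           has_vector_derivative hamiltonian_vector_field A br k x F (\<gamma> t) g)
           (at t within {0..T}))"
    using step unfolding hamiltonian_flow_step_def by blast
  have "\<forall>t\<in>{0..T}. \<exists>f. is_pt f \<and> \<gamma> t = mx f" using h(6) S by (auto simp: max_spectrum_eq)
  then obtain \<phi> where \<phi>: "\<And>t. t \<in> {0..T} \<Longrightarrow> is_pt (\<phi> t)" "\<And>t. t \<in> {0..T} \<Longrightarrow> \<gamma> t = mx (\<phi> t)"
    by metis
  have ends: "\<phi> 0 = f" "\<phi> T = g"
    using mx_inj[of "\<phi> 0" f] mx_inj[of "\<phi> T" g] \<phi>[of 0] \<phi>[of T] h(3-5) f g by auto
  define \<xi> where "\<xi> i = sec (x i)" for i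
  have \<xi>: "\<pi> (\<xi> i) = x i" if "i < k" for i using that h(1) by (simp add: \<xi>_def \<pi>_sec)
  define z where "z t = coordinates A k x (\<gamma> t)" for t
  have z: "z t i = (if i < k then \<phi> t (\<xi> i) else 0)" if "t \<in> {0..T}" for t i
    using point_value_eq[OF \<phi>(1)[OF that], of "\<xi> i"] \<xi>[of i]
    by (cases "i < k") (simp_all add: z_def coordinates_def \<phi>(2)[OF that])
  have D: "((\<lambda>s. \<phi> s a) has_vector_derivative (\<Sum>i<k. partial_deriv i F (z t) * \<phi> t (ham (x i) a))) (at t within {0..T})"
    if t: "t \<in> {0..T}" for t a
  proof -
    have "((\<lambda>s. point_value A (\<gamma> s) (\<pi> a)) has_vector_derivative hamiltonian_vector_field A br k x F (\<gamma> t) (\<pi> a))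
        (at t within {0..T})" using h(6) t \<pi>_closed by blast
    moreover have "hamiltonian_vector_field A br k x F (\<gamma> t) (\<pi> a) = (\<Sum>i<k. partial_deriv i F (z t) * \<phi> t (ham (x i) a))"
      unfolding hamiltonian_vector_field_def z_def[symmetric]
    proof (intro sum.cong refl)
      fix i assume "i \<in> {..<k}"
      then have "br (x i) (\<pi> a) = \<pi> (ham (x i) a)" using h(1) by (simp add: \<pi>_ham)
      then show "partial_deriv i F (z t) * point_value A (\<gamma> t) (br (x i) (\<pi> a)) =
          partial_deriv i F (z t) * \<phi> t (ham (x i) a)"
        using point_value_eq[OF \<phi>(1)[OF t]] by (simp add: \<phi>(2)[OF t])
    qed
    ultimately have "((\<lambda>s. point_value A (\<gamma> s) (\<pi> a)) has_vector_derivative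
        (\<Sum>i<k. partial_deriv i F (z t) * \<phi> t (ham (x i) a))) (at t within {0..T})" by simp
    then show ?thesis
      by (rule has_vector_derivative_transform[OF t, rotated])
        (simp add: point_value_eq \<phi>)
  qed
  have cont: "continuous_on {0..T} (\<lambda>s. \<phi> s a)" for a
    using D has_vector_derivative_continuous unfolding continuous_on_eq_continuous_within by blast
  \<comment> \<open>The coordinates of the curve are continuous, so for a short time it stays in a
    box on which the partial derivative is bounded.\<close>
  have pF: "locally_bounded_on {0..T} (\<lambda>s. partial_deriv i F (z s))" if i: "i < k" for i
    unfolding locally_bounded_on_def
  proof
    fix t assume t: "t \<in> {0..T}"
    have "z t \<in> U" using h(6) t by (simp add: z_def)
    then obtain r K where r: "r > 0"
      "\<And>w. (\<forall>j<k. dist (w j) (z t j) < r) \<and> (\<forall>j\<ge>k. w j = z t j) \<Longrightarrow> norm (partial_deriv i F w) \<le> K"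
      using partial_deriv_locally_bounded[OF h(2) _ i] by blast
    have "\<forall>j. \<exists>d>0. \<forall>s\<in>{0..T}. dist s t < d \<longrightarrow> dist (\<phi> s (\<xi> j)) (\<phi> t (\<xi> j)) < r"
      using cont t r(1) unfolding continuous_on_iff by blast
    then obtain d where d: "\<And>j. d j > 0" "\<And>j s. s \<in> {0..T} \<Longrightarrow> dist s t < d j \<Longrightarrow> dist (\<phi> s (\<xi> j)) (\<phi> t (\<xi> j)) < r"
      by metis
    define \<delta> where "\<delta> = Min (d ` {..<k})"
    have "\<delta> > 0" unfolding \<delta>_def using i d(1) by (subst Min_gr_iff) auto
    moreover have "norm (partial_deriv i F (z s)) \<le> K" if s: "s \<in> {0..T}" "dist s t < \<delta>" for s
    proof (rule r(2), intro conjI allI impI)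
      fix j assume j: "j < k"
      then have "\<delta> \<le> d j" unfolding \<delta>_def by (intro Min_le) auto
      then have "dist s t < d j" using s(2) by simp
      then show "dist (z s j) (z t j) < r" using d(2)[OF s(1)] j by (simp add: z[OF s(1)] z[OF t])
    qed (simp add: z[OF s(1)] z[OF t])
    ultimately show "\<exists>\<delta>>0. \<exists>K. \<forall>s\<in>{0..T}. dist s t < \<delta> \<longrightarrow> norm (partial_deriv i F (z s)) \<le> K" by blast
  qed
  obtain G where G: "G \<subseteq> Q" "finite G" "\<And>a. a \<in> Q \<Longrightarrow> \<exists>c. a - (\<Sum>e\<in>G. c e * e) \<in> relations"
    using falg_noetherian[OF relations_ideal relations_vars Q(1,2)] by metis
  \<comment> \<open>Stability keeps \<open>ham (x i) e\<close> in \<open>Q\<close>, so it is a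
    combination of the generators modulo the relations; the coefficients enter the matrix of the
    system.\<close>
  have "\<exists>c. ham (x i) e - (\<Sum>e'\<in>G. c e' * e') \<in> relations" if "i < k" "e \<in> G" for i e
    using G that Q(3) h(1) by (auto simp: stable_def hams_def)
  then obtain c where c: "\<And>i e. i < k \<Longrightarrow> e \<in> G \<Longrightarrow> ham (x i) e - (\<Sum>e'\<in>G. c i e e' * e') \<in> relations"
    by metis
  have gen: "Q \<subseteq> point_ideal (\<phi> t) \<longleftrightarrow> (\<forall>e\<in>G. \<phi> t e = 0)" if t: "t \<in> {0..T}" for t
  proof
    note pt = is_ptD(1)[OF \<phi>(1)[OF t]]
    assume e: "\<forall>e\<in>G. \<phi> t e = 0"
    show "Q \<subseteq> point_ideal (\<phi> t)"
    proof
      fix a assume "a \<in> Q"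
      then obtain c where "a - (\<Sum>e\<in>G. c e * e) \<in> relations" using G(3) by blast
      then have "\<phi> t (a - (\<Sum>e\<in>G. c e * e)) = 0" using is_ptD(2)[OF \<phi>(1)[OF t]] by (auto simp: point_ideal_def)
      moreover have "\<phi> t (\<Sum>e\<in>G. c e * e) = (\<Sum>e\<in>G. \<phi> t (c e * e))" by (rule point_sum[OF pt])
      ultimately show "a \<in> point_ideal (\<phi> t)" using e by (simp add: point_ideal_def point_simps[OF pt])
    qed
  qed (use G(1) in \<open>auto simp: point_ideal_def\<close>)
  have zero: "\<forall>e\<in>G. \<phi> b e = 0" if a: "a \<in> {0..T}" "\<forall>e\<in>G. \<phi> a e = 0" and b: "b \<in> {0..T}" for a b
  proof
    fix e assume e: "e \<in> G"
    show "\<phi> b e = 0"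
    proof (rule linear_ode_zero[where u = "\<lambda>e s. \<phi> s e" and T = T and a = a and J = G
          and u' = "\<lambda>e t. \<Sum>i<k. partial_deriv i F (z t) * \<phi> t (ham (x i) e)"
          and M = "\<lambda>e e' t. \<Sum>i<k. partial_deriv i F (z t) * \<phi> t (c i e e')"])
      fix e t assume et: "e \<in> G" "t \<in> {0..T}"
      note pt = is_ptD(1)[OF \<phi>(1)[OF et(2)]]
      have "\<phi> t (ham (x i) e) = (\<Sum>e'\<in>G. \<phi> t (c i e e') * \<phi> t e')" if i: "i < k" for i
      proof -
        have "\<phi> t (ham (x i) e - (\<Sum>e'\<in>G. c i e e' * e')) = 0"
          using c[OF i et(1)] is_ptD(2)[OF \<phi>(1)[OF et(2)]] by (auto simp: point_ideal_def)
        then show ?thesis by (simp add: point_simps[OF pt] point_sum[OF pt])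
      qed
      then have "(\<Sum>i<k. partial_deriv i F (z t) * \<phi> t (ham (x i) e)) =
        (\<Sum>i<k. \<Sum>e'\<in>G. partial_deriv i F (z t) * \<phi> t (c i e e') * \<phi> t e')"
        by (intro sum.cong) (auto simp: sum_distrib_left mult.assoc)
      also have "\<dots> = (\<Sum>e'\<in>G. \<Sum>i<k. partial_deriv i F (z t) * \<phi> t (c i e e') * \<phi> t e')" by (rule sum.swap)
      finally show "(\<Sum>i<k. partial_deriv i F (z t) * \<phi> t (ham (x i) e)) =
        (\<Sum>e'\<in>G. (\<Sum>i<k. partial_deriv i F (z t) * \<phi> t (c i e e')) * \<phi> t e')"
        by (simp add: sum_distrib_right)
    next
      fix e e' show "locally_bounded_on {0..T} (\<lambda>t. \<Sum>i<k. partial_deriv i F (z t) * \<phi> t (c i e e'))"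
        by (rule locally_bounded_on_sum, rule locally_bounded_on_mult[OF pF continuous_imp_locally_bounded_on[OF cont]]) simp
    qed (use G(2) D a b e in auto)
  qed
  have "0 \<in> {0..T}" "T \<in> {0..T}" using h(3) by auto
  then show ?thesis using gen zero unfolding ends[symmetric] by metis
qed

section \<open>Iterated singular loci as sets of points\<close>

definition stratum_points :: "nat \<Rightarrow> (falg \<Rightarrow> complex) set" where
  "stratum_points i = {f. is_pt f \<and> mx f \<in> iterated_singular_locus A i}"

definition stratum_ideal :: "nat \<Rightarrow> falg set" where
  "stratum_ideal i = {x. \<forall>f\<in>stratum_points i. f x = 0}"

lemma iterated_subset: "iterated_singular_locus A i \<subseteq> max_spectrum A"
  by (induction i) (auto simp: singular_locus_def)

lemma iterated_eq: "iterated_singular_locus A i = mx ` stratum_points i"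
  using iterated_subset[of i] unfolding max_spectrum_eq stratum_points_def by blast

lemma stratum_ideal_ideal: "is_ideal (stratum_ideal i)"
  unfolding is_ideal_def stratum_ideal_def stratum_points_def
  by (auto simp: point_simps is_ptD)

lemma relations_subset_stratum_ideal: "relations \<subseteq> stratum_ideal i"
  by (auto simp: stratum_ideal_def stratum_points_def is_pt_def point_ideal_def)

lemma stratum_ideal_subset: "f \<in> stratum_points i \<Longrightarrow> stratum_ideal i \<subseteq> point_ideal f"
  by (auto simp: stratum_ideal_def point_ideal_def)

lemma stratum_points_pt: "f \<in> stratum_points i \<Longrightarrow> is_pt f"
  by (simp add: stratum_points_def)

lemma stratum_points_0: "stratum_points 0 = {f. is_pt f}"
  by (auto simp: stratum_points_def max_spectrum_eq)

text \<open>The intersection of the maximal ideals of a locus lifts to its stratum ideal, so the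
  recursion for singular loci can be read in \<open>falg\<close>.\<close>

lemma stratum_points_Suc: "stratum_points (Suc i) = {f \<in> stratum_points i. \<not> regular (stratum_ideal i) f}"
proof -
  let ?V = "iterated_singular_locus A i"
  have "regular_point A ?V (mx f) \<longleftrightarrow> regular (stratum_ideal i) f" if f: "f \<in> stratum_points i" for f
  proof -
    have V: "mx f \<in> ?V" using f by (simp add: stratum_points_def)
    have I: "ideal (\<Inter>?V) A"
      using V by (intro i_Intersect) (auto simp: iterated_eq intro: mx_ideal stratum_points_pt)
    have "\<pi> x \<in> \<Inter>?V \<longleftrightarrow> x \<in> stratum_ideal i" for x
      unfolding iterated_eq stratum_ideal_def using mx_iff stratum_points_pt by auto
    then have "lift (\<Inter>?V) = stratum_ideal i" by (auto simp: lift_def)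
    then show ?thesis using regular_point_iff[OF stratum_points_pt[OF f] I] V by auto
  qed
  then show ?thesis by (auto simp: stratum_points_def singular_locus_def)
qed

lemma smooth_stratum_iff:
  "is_pt f \<Longrightarrow> mx f \<in> smooth_stratum A i \<longleftrightarrow> f \<in> stratum_points i \<and> f \<notin> stratum_points (Suc i)"
  by (simp add: smooth_stratum_def stratum_points_def)

text \<open>The vanishing ideals of the iterated singular loci stabilise. If one of the loci \<open>V\<close> at
  that stage were nonempty, the points of \<open>V\<close> where a suitable function is nonzero would be regular,
  so this function would vanish on the singular locus and hence on \<open>V\<close>.\<close>

lemma smooth_stratum_exists:
  assumes f: "is_pt f"
  shows "\<exists>i. mx f \<in> smooth_stratum A i"
proof (rule ccontr)
  assume none: "\<nexists>i. mx f \<in> smooth_stratum A i"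
  have all: "f \<in> stratum_points i" for i
  proof (induction i)
    case 0
    then show ?case using f by (simp add: stratum_points_0)
  next
    case (Suc i)
    then show ?case using none smooth_stratum_iff[OF f] by blast
  qed
  have "stratum_ideal i \<subseteq> stratum_ideal (Suc i)" for i
    unfolding stratum_ideal_def stratum_points_Suc by blast
  then obtain k where k: "stratum_ideal (Suc k) = stratum_ideal k"
    using ascending_ideals_stabilise[OF relations_ideal relations_vars stratum_ideal_ideal relations_subset_stratum_ideal]
    by blast
  have one: "1 \<notin> stratum_ideal k"
    using all[of k] point_1[OF is_ptD(1)[OF f]] unfolding stratum_ideal_def by force
  have rad: "x \<in> stratum_ideal k" if "x * x \<in> stratum_ideal k" for x
    using that is_ptD(1)[OF stratum_points_pt, of _ k] by (auto simp: stratum_ideal_def point_mult)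
  have vars: "vars_in n (stratum_ideal k)" by (rule vars_in_mono[OF relations_vars relations_subset_stratum_ideal])
  obtain p h where p: "is_prime p" "stratum_ideal k \<subseteq> p" "h \<notin> p" "\<And>x. x \<in> p \<Longrightarrow> h * x \<in> stratum_ideal k"
    using radical_ideal_annihilator_prime[OF relations_ideal relations_vars stratum_ideal_ideal
        relations_subset_stratum_ideal one rad] by blast
  obtain g where g: "g \<notin> p" "\<And>f. is_point f \<Longrightarrow> stratum_ideal k \<subseteq> point_ideal f \<Longrightarrow> f g \<noteq> 0 \<Longrightarrow> regular (stratum_ideal k) f"
    using generic_regular[OF stratum_ideal_ideal vars p] by blast
  have "f' g = 0" if f': "f' \<in> stratum_points (Suc k)" for f'
  proof (rule ccontr)
    assume "f' g \<noteq> 0"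
    moreover have "f' \<in> stratum_points k" "\<not> regular (stratum_ideal k) f'" using f' by (auto simp: stratum_points_Suc)
    ultimately show False
      using g(2)[OF is_ptD(1)[OF stratum_points_pt] stratum_ideal_subset] by blast
  qed
  then have "g \<in> stratum_ideal (Suc k)" by (simp add: stratum_ideal_def)
  then show False using k p(2) g(1) by blast
qed

section \<open>Hamiltonian curves and invariance of the strata\<close>

definition ham_curve :: "'a \<Rightarrow> (falg \<Rightarrow> complex) \<Rightarrow> real \<Rightarrow> (real \<Rightarrow> falg \<Rightarrow> complex) \<Rightarrow> bool" where
  "ham_curve h f T \<gamma> \<longleftrightarrow> T > 0 \<and> \<gamma> 0 = f \<and> (\<forall>t\<in>{0..T}. is_point (\<gamma> t) \<and>
    (\<forall>x. ((\<lambda>s. \<gamma> s x) has_vector_derivative \<gamma> t (ham h x)) (at t within {0..T})) \<and>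
    (\<forall>I. stable {ham h} I \<longrightarrow> (I \<subseteq> point_ideal f \<longleftrightarrow> I \<subseteq> point_ideal (\<gamma> t))) \<and>
    (\<forall>I d. is_ideal I \<and> vars_in n I \<and> stable {ham h} I \<and> I \<subseteq> point_ideal f \<longrightarrow>
      (embdim f I d \<longleftrightarrow> embdim (\<gamma> t) I d)))"

lemma ham_curve_exists:
  assumes f: "is_pt f"
  shows "\<exists>T \<gamma>. ham_curve h f T \<gamma>"
proof -
  have "f (var i) = 0" if "i \<ge> n" for i
    using relations_vars is_ptD(2)[OF f] that by (auto simp: vars_in_def point_ideal_def)
  then show ?thesis
    using local_flow[of n "ham_coeff h" f] is_ptD(1)[OF f]
    unfolding ham_curve_def ham_def by (auto simp: ham_coeff_def)
qed

lemma ham_curveD: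
  assumes "ham_curve h f T \<gamma>"
  shows "T > 0" "\<gamma> 0 = f" "t \<in> {0..T} \<Longrightarrow> is_point (\<gamma> t)"
    "t \<in> {0..T} \<Longrightarrow> ((\<lambda>s. \<gamma> s x) has_vector_derivative \<gamma> t (ham h x)) (at t within {0..T})"
    "t \<in> {0..T} \<Longrightarrow> stable {ham h} I \<Longrightarrow> I \<subseteq> point_ideal f \<longleftrightarrow> I \<subseteq> point_ideal (\<gamma> t)"
    "t \<in> {0..T} \<Longrightarrow> is_ideal I \<Longrightarrow> vars_in n I \<Longrightarrow> stable {ham h} I \<Longrightarrow> I \<subseteq> point_ideal f \<Longrightarrow>
      embdim f I d \<longleftrightarrow> embdim (\<gamma> t) I d"
proof -
  note c = assms[unfolded ham_curve_def]
  note b = c[THEN conjunct2, THEN conjunct2, THEN bspec]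
  show "T > 0" "\<gamma> 0 = f" using c by simp_all
  show "t \<in> {0..T} \<Longrightarrow> is_point (\<gamma> t)" by (rule b[THEN conjunct1])
  show "t \<in> {0..T} \<Longrightarrow> ((\<lambda>s. \<gamma> s x) has_vector_derivative \<gamma> t (ham h x)) (at t within {0..T})"
    by (rule b[THEN conjunct2, THEN conjunct1, THEN spec])
  show "t \<in> {0..T} \<Longrightarrow> stable {ham h} I \<Longrightarrow> I \<subseteq> point_ideal f \<longleftrightarrow> I \<subseteq> point_ideal (\<gamma> t)"
    by (rule b[THEN conjunct2, THEN conjunct2, THEN conjunct1, THEN spec, THEN mp])
  show "t \<in> {0..T} \<Longrightarrow> is_ideal I \<Longrightarrow> vars_in n I \<Longrightarrow> stable {ham h} I \<Longrightarrow> I \<subseteq> point_ideal f \<Longrightarrow>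
      embdim f I d \<longleftrightarrow> embdim (\<gamma> t) I d"
    by (rule b[THEN conjunct2, THEN conjunct2, THEN conjunct2, THEN spec, THEN spec, THEN mp]) simp_all
qed

lemma stable_ham: "h \<in> carrier A \<Longrightarrow> stable hams I \<Longrightarrow> stable {ham h} I"
  by (auto simp: stable_def hams_def)

lemma ham_curve_pt:
  assumes c: "ham_curve h f T \<gamma>" "h \<in> carrier A" "is_pt f" "t \<in> {0..T}"
  shows "is_pt (\<gamma> t)"
  using ham_curveD(3,5)[OF c(1,4)] is_ptD(2)[OF c(3)] stable_ham[OF c(2) relations_stable]
  by (simp add: is_pt_def)

text \<open>If \<open>x\<close> vanishes on an invariant set, it is zero along every curve starting
  there; the derivative at time 0 is the value of \<open>ham h x\<close> at the starting
  point.\<close>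

lemma flow_invariant_vanishing_stable:
  assumes S: "\<And>f. f \<in> S \<Longrightarrow> is_pt f"
    and flow: "\<And>h f T \<gamma> t. h \<in> carrier A \<Longrightarrow> f \<in> S \<Longrightarrow> ham_curve h f T \<gamma> \<Longrightarrow> t \<in> {0..T} \<Longrightarrow> \<gamma> t \<in> S"
  shows "stable hams {x. \<forall>f\<in>S. f x = 0}"
  unfolding stable_def
proof (intro ballI CollectI)
  fix d x f assume d: "d \<in> hams" and x: "x \<in> {x. \<forall>f\<in>S. f x = 0}" and f: "f \<in> S"
  obtain h where h: "h \<in> carrier A" "d = ham h" using d by (auto simp: hams_def)
  obtain T \<gamma> where c: "ham_curve h f T \<gamma>" using ham_curve_exists[OF S[OF f]] by blast
  note T = ham_curveD(1)[OF c]
  have 0: "0 \<in> {0..T}" using T by simp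
  have d1: "((\<lambda>s. \<gamma> s x) has_vector_derivative f (ham h x)) (at 0 within {0..T})"
    using ham_curveD(4)[OF c 0, of x] by (simp add: ham_curveD(2)[OF c])
  have "((\<lambda>s. \<gamma> s x) has_vector_derivative 0) (at 0 within {0..T})"
  proof (rule has_vector_derivative_transform[OF 0])
    show "((\<lambda>s. 0) has_vector_derivative 0) (at 0 within {0..T})" by (rule has_vector_derivative_const)
    show "\<gamma> s x = 0" if "s \<in> {0..T}" for s using flow[OF h(1) f c that] x by blast
  qed
  moreover have "at 0 within {0..T} \<noteq> bot" using T by (simp add: at_within_Icc_at_right)
  ultimately have "f (ham h x) = 0" using vector_derivative_unique_within d1 by blast
  then show "f (d x) = 0" using h by simp
qed

text \<open>The flow changes neither the embedding dimension nor the stable primes contained in a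
  point. Stability of the stratum ideal is a hypothesis because it is obtained together with
  invariance of the strata, by induction.\<close>

lemma ham_curve_regular_iff:
  assumes c: "ham_curve h f T \<gamma>" "h \<in> carrier A" and f: "f \<in> stratum_points i" and t: "t \<in> {0..T}"
    and st: "stable hams (stratum_ideal i)"
  shows "regular (stratum_ideal i) (\<gamma> t) \<longleftrightarrow> regular (stratum_ideal i) f"
proof -
  let ?I = "stratum_ideal i"
  have vars: "vars_in n ?I" by (rule vars_in_mono[OF relations_vars relations_subset_stratum_ideal])
  note I = stratum_ideal_ideal[of i] and s = stable_ham[OF c(2) st]
  note pf = is_ptD(1)[OF stratum_points_pt[OF f]] and pg = ham_curveD(3)[OF c(1) t]
  have If: "?I \<subseteq> point_ideal f" by (rule stratum_ideal_subset[OF f])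
  then have Ig: "?I \<subseteq> point_ideal (\<gamma> t)" using ham_curveD(5)[OF c(1) t s] by blast
  have "local_trdeg n ?I f = local_trdeg n ?I (\<gamma> t)"
  proof (rule antisym)
    show "local_trdeg n ?I f \<le> local_trdeg n ?I (\<gamma> t)"
      by (rule local_trdeg_le_if_same_stable_primes[OF _ s vars pf If])
        (use ham_derivation ham_curveD(5)[OF c(1) t] in auto)
    show "local_trdeg n ?I (\<gamma> t) \<le> local_trdeg n ?I f"
      by (rule local_trdeg_le_if_same_stable_primes[OF _ s vars pg Ig])
        (use ham_derivation ham_curveD(5)[OF c(1) t] in auto)
  qed
  then show ?thesis
    unfolding regular_iff[OF pf I If vars] regular_iff[OF pg I Ig vars]
    using ham_curveD(6)[OF c(1) t I vars s If] by simp
qed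

text \<open>Invariance of one locus makes its vanishing ideal stable, stability makes regularity
  constant along curves, and so the singular part is invariant again.\<close>

lemma stratum_points_flow_invariant:
  "h \<in> carrier A \<Longrightarrow> f \<in> stratum_points i \<Longrightarrow> ham_curve h f T \<gamma> \<Longrightarrow> t \<in> {0..T} \<Longrightarrow> \<gamma> t \<in> stratum_points i"
proof (induction i arbitrary: h f T \<gamma> t)
  case 0
  then show ?case using ham_curve_pt by (simp add: stratum_points_0)
next
  case (Suc i)
  have st: "stable hams (stratum_ideal i)"
    unfolding stratum_ideal_def
  proof (rule flow_invariant_vanishing_stable)
    fix h f T \<gamma> t assume "h \<in> carrier A" "f \<in> stratum_points i" "ham_curve h f T \<gamma>" "t \<in> {0..T}"
    then show "\<gamma> t \<in> stratum_points i" by (rule Suc.IH)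
  qed (rule stratum_points_pt)
  have f: "f \<in> stratum_points i" "\<not> regular (stratum_ideal i) f" using Suc.prems(2) by (simp_all add: stratum_points_Suc)
  show ?case
    using Suc.IH[OF Suc.prems(1) f(1) Suc.prems(3,4)] ham_curve_regular_iff[OF Suc.prems(3,1) f(1) Suc.prems(4) st] f(2)
    by (simp add: stratum_points_Suc)
qed

lemma stratum_ideal_stable: "stable hams (stratum_ideal i)"
  unfolding stratum_ideal_def
proof (rule flow_invariant_vanishing_stable)
  fix h f T \<gamma> t assume "h \<in> carrier A" "f \<in> stratum_points i" "ham_curve h f T \<gamma>" "t \<in> {0..T}"
  then show "\<gamma> t \<in> stratum_points i" by (rule stratum_points_flow_invariant)
qed (rule stratum_points_pt)

lemma smooth_stratum_flow_invariant:
  assumes c: "h \<in> carrier A" "ham_curve h f T \<gamma>" "t \<in> {0..T}" and f: "is_pt f" "mx f \<in> smooth_stratum A i"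
  shows "mx (\<gamma> t) \<in> smooth_stratum A i"
proof -
  have fi: "f \<in> stratum_points i" "regular (stratum_ideal i) f"
    using f by (simp_all add: smooth_stratum_iff stratum_points_Suc)
  show ?thesis
    using stratum_points_flow_invariant[OF c(1) fi(1) c(2,3)] ham_curve_regular_iff[OF c(2,1) fi(1) c(3) stratum_ideal_stable]
      ham_curve_pt[OF c(2,1) f(1) c(3)] fi(2)
    by (simp add: smooth_stratum_iff stratum_points_Suc)
qed

lemma ham_curve_flow_step:
  assumes c: "h \<in> carrier A" "ham_curve h f T \<gamma>" "t \<in> {0..T}" and f: "is_pt f"
    and S: "\<And>s. s \<in> {0..T} \<Longrightarrow> mx (\<gamma> s) \<in> S"
  shows "hamiltonian_flow_step A br S (mx f) (mx (\<gamma> t))"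
  unfolding hamiltonian_flow_step_def
\<comment> \<open>The Hamiltonian \<open>h\<close> itself is written as \<open>F(h)\<close> with one
  variable and \<open>F\<close> the coordinate function, whose partial derivative is 1.\<close>
proof (rule exI[of _ "1 :: nat"], rule exI[of _ "\<lambda>_. h"], rule exI[of _ UNIV], rule exI[of _ "\<lambda>z. z 0"],
    rule exI[of _ t], rule exI[of _ "\<lambda>s. mx (\<gamma> s)"], intro conjI ballI allI impI)
  let ?F = "\<lambda>z :: nat \<Rightarrow> complex. z 0"
  show "holomorphic_in_variables 1 UNIV ?F"
    by (auto simp: holomorphic_in_variables_def continuous_on_product_coordinates)
  have F: "partial_deriv 0 ?F z = 1" for z
    by (simp add: partial_deriv_def)
  fix s assume s: "s \<in> {0..t}"
  then have sT: "s \<in> {0..T}" using c(3) by simp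
  show "mx (\<gamma> s) \<in> S" by (rule S[OF sT])
  show "coordinates A 1 (\<lambda>_. h) (mx (\<gamma> s)) \<in> UNIV" by simp
  note pt = ham_curve_pt[OF c(2,1) f]
  fix a assume "a \<in> carrier A"
  then obtain x where x: "a = \<pi> x" using \<pi>_surj by blast
  have "((\<lambda>s. \<gamma> s x) has_vector_derivative \<gamma> s (ham h x)) (at s within {0..t})"
    by (rule has_vector_derivative_within_subset[OF ham_curveD(4)[OF c(2) sT]]) (use c(3) in auto)
  moreover have "hamiltonian_vector_field A br 1 (\<lambda>_. h) ?F (mx (\<gamma> s)) a = \<gamma> s (ham h x)"
    using point_value_eq[OF pt[OF sT], of "ham h x"] c(1)
    by (simp add: hamiltonian_vector_field_def F x \<pi>_ham)
  ultimately have "((\<lambda>s. \<gamma> s x) has_vector_derivative hamiltonian_vector_field A br 1 (\<lambda>_. h) ?F (mx (\<gamma> s)) a)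
      (at s within {0..t})" by simp
  then show "((\<lambda>s. point_value A (mx (\<gamma> s)) a) has_vector_derivative
      hamiltonian_vector_field A br 1 (\<lambda>_. h) ?F (mx (\<gamma> s)) a) (at s within {0..t})"
  proof (rule has_vector_derivative_transform[OF s, rotated])
    fix r assume "r \<in> {0..t}"
    then have "r \<in> {0..T}" using c(3) by simp
    then show "point_value A (mx (\<gamma> r)) a = \<gamma> r x" using point_value_eq[OF pt] by (simp add: x)
  qed
qed (use c f ham_curveD(2)[OF c(2)] in auto)

section \<open>Symplectic leaves and the equivalence\<close>

lemma leaf_stable_ideal:
  assumes L: "mx g \<in> leaf_in A br (smooth_stratum A i) (mx f)" and f: "is_pt f" and g: "is_pt g"
    and Q: "is_ideal Q" "relations \<subseteq> Q" "stable hams Q"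
  shows "Q \<subseteq> point_ideal f \<longleftrightarrow> Q \<subseteq> point_ideal g"
proof -
  have S: "smooth_stratum A i \<subseteq> max_spectrum A" using iterated_subset by (auto simp: smooth_stratum_def)
  have "(hamiltonian_flow_step A br (smooth_stratum A i))\<^sup>*\<^sup>* (mx f) q \<Longrightarrow>
    \<exists>u. is_pt u \<and> q = mx u \<and> (Q \<subseteq> point_ideal f \<longleftrightarrow> Q \<subseteq> point_ideal u)" for q
  proof (induction rule: rtranclp_induct)
    case base
    then show ?case using f by blast
  next
    case (step p q)
    then obtain u where u: "is_pt u" "p = mx u" "Q \<subseteq> point_ideal f \<longleftrightarrow> Q \<subseteq> point_ideal u" by blast
    have "q \<in> smooth_stratum A i" using step(2) unfolding hamiltonian_flow_step_def by fastforce
    then obtain v where v: "is_pt v" "q = mx v" using S by (auto simp: max_spectrum_eq)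
    then show ?case using ham_flow_step[OF step(2) S u(1,2) v Q] u(3) by blast
  qed
  from this[OF L[unfolded leaf_in_def mem_Collect_eq]]
  obtain u where u: "is_pt u" "mx g = mx u" "Q \<subseteq> point_ideal f \<longleftrightarrow> Q \<subseteq> point_ideal u"
    by (elim exE conjE)
  then show ?thesis using mx_inj[OF g u(1,2)] by simp
qed

lemma leaf_vanishing_ideal:
  assumes f: "is_pt f" "mx f \<in> smooth_stratum A i"
  shows "{x. \<forall>g. is_pt g \<and> mx g \<in> leaf_in A br (smooth_stratum A i) (mx f) \<longrightarrow> g x = 0} =
    core hams (point_ideal f)"
proof
  let ?St = "smooth_stratum A i"
  let ?L = "leaf_in A br ?St (mx f)"
  let ?S = "{g. is_pt g \<and> mx g \<in> ?L}"
  have self: "mx f \<in> ?L" by (simp add: leaf_in_def)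
  have step: "q \<in> ?St" if "hamiltonian_flow_step A br ?St p q" for p q
    using that unfolding hamiltonian_flow_step_def by fastforce
  have LS: "q \<in> ?St" if "q \<in> ?L" for q
    using that f(2) step unfolding leaf_in_def by (auto elim: rtranclp.cases)
  have "stable hams {x. \<forall>g\<in>?S. g x = 0}"
  proof (rule flow_invariant_vanishing_stable)
    fix h g T \<gamma> t assume h: "h \<in> carrier A" "g \<in> ?S" "ham_curve h g T \<gamma>" "t \<in> {0..T}"
    have g: "is_pt g" "mx g \<in> ?L" "mx g \<in> ?St" using h(2) LS by auto
    have "hamiltonian_flow_step A br ?St (mx g) (mx (\<gamma> t))"
      by (rule ham_curve_flow_step[OF h(1,3,4) g(1) smooth_stratum_flow_invariant[OF h(1,3) _ g(1,3)]])
    then have "mx (\<gamma> t) \<in> ?L" using g(2) unfolding leaf_in_def by (auto intro: rtranclp.rtrancl_into_rtrancl)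
    then show "\<gamma> t \<in> ?S" using ham_curve_pt[OF h(3,1) g(1) h(4)] by simp
  qed simp
  then have st: "stable hams {x. \<forall>g. is_pt g \<and> mx g \<in> ?L \<longrightarrow> g x = 0}" by (simp add: Ball_def)
  show "{x. \<forall>g. is_pt g \<and> mx g \<in> ?L \<longrightarrow> g x = 0} \<subseteq> core hams (point_ideal f)"
    by (rule core_greatest[OF st]) (use f(1) self in \<open>auto simp: point_ideal_def\<close>)
  have "core hams (point_ideal f) \<subseteq> point_ideal g" if g: "is_pt g" "mx g \<in> ?L" for g
    using leaf_stable_ideal[OF g(2) f(1) g(1) prime_ideal[OF core_props(1)[OF f(1)]] core_ge_relations[OF f(1)] core_stable]
      core_subset by blast
  then show "core hams (point_ideal f) \<subseteq> {x. \<forall>g. is_pt g \<and> mx g \<in> ?L \<longrightarrow> g x = 0}"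
    by (auto simp: point_ideal_def)
qed

lemma primitive_imp_locally_closed:
  assumes alg: "algebraic_poisson_bracket A br" and P: "ideal P A" and f: "is_pt f"
    and core: "core hams (point_ideal f) = lift P"
  shows "poisson_locally_closed A br P"
proof -
  obtain i where i: "mx f \<in> smooth_stratum A i" using smooth_stratum_exists[OF f] by blast
  let ?L = "leaf_in A br (smooth_stratum A i) (mx f)"
  have "?L \<in> symplectic_leaves A br" using i by (auto simp: symplectic_leaves_def)
  then have "locally_closedin (subtopology (zariski_topology A) (max_spectrum A)) ?L"
    using alg by (simp add: algebraic_poisson_bracket_def)
  then obtain U V where UV: "openin (subtopology (zariski_topology A) (max_spectrum A)) U"
    "closedin (subtopology (zariski_topology A) (max_spectrum A)) V" "?L = U \<inter> V"
    by (auto simp: locally_closedin_def)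
  have mp: "max_spectrum A \<subseteq> prime_spectrum A"
    unfolding max_spectrum_def prime_spectrum_def using maximalideal_prime by blast
  obtain U' V' where UV': "openin (zariski_topology A) U'" "U = U' \<inter> max_spectrum A"
    "closedin (zariski_topology A) V'" "V = V' \<inter> max_spectrum A"
    using UV(1,2) unfolding openin_subtopology closedin_subtopology by blast
  obtain S where "S \<subseteq> carrier A" "U' = {P \<in> prime_spectrum A. \<not> S \<subseteq> P}"
    using UV'(1) unfolding openin_zariski by blast
  then have S: "S \<subseteq> carrier A" "U = {m \<in> max_spectrum A. \<not> S \<subseteq> m}" using UV'(2) mp by auto
  obtain T where "T \<subseteq> carrier A" "V' = {P \<in> prime_spectrum A. T \<subseteq> P}"
    using UV'(3) unfolding closedin_zariski by blast
  then have T: "T \<subseteq> carrier A" "V = {m \<in> max_spectrum A. T \<subseteq> m}" using UV'(4) mp by auto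
  have self: "mx f \<in> ?L" by (simp add: leaf_in_def)
  then obtain s where s: "s \<in> S" "s \<notin> mx f" using UV(3) S(2) by blast
  obtain g where g: "\<pi> g = s" using s(1) S(1) \<pi>_surj by blast
  have gf: "f g \<noteq> 0" using s(2) mx_iff[OF f, of g] g by simp
  have gP: "g \<notin> lift P" using gf core_subset[of hams "point_ideal f"] core by (auto simp: point_ideal_def)
  have TP: "T \<subseteq> P"
  proof
    fix a assume a: "a \<in> T"
    obtain x where x: "\<pi> x = a" using a T(1) \<pi>_surj by blast
    have "u x = 0" if u: "is_pt u" "mx u \<in> ?L" for u
    proof -
      have "a \<in> mx u" using u(2) a UV(3) T(2) by auto
      then show ?thesis using mx_iff[OF u(1), of x] x by simp
    qed
    then have "x \<in> lift P" using leaf_vanishing_ideal[OF f i] core by blast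
    then show "a \<in> P" by (simp add: lift_iff x)
  qed
  have "g \<in> q" if q: "is_prime q" "stable hams q" "lift P \<subset> q" for q
  proof (rule ccontr)
    assume "g \<notin> q"
    \<comment> \<open>This point lies in \<open>V\<close> because \<open>T \<subseteq> P\<close> and
      in \<open>U\<close> because of \<open>s\<close>, hence on the leaf. So \<open>q\<close> is
      contained in the ideal of \<open>f\<close>, and by stability in its core
      \<open>lift P\<close>.\<close>
    then obtain u where u: "is_point u" "q \<subseteq> point_ideal u" "u g \<noteq> 0" using nullstellensatz[OF q(1)] by blast
    have rq: "relations \<subseteq> q" using relations_subset_lift[OF P] q(3) by blast
    then have pt: "is_pt u" using u by (auto simp: is_pt_def)
    have "lift P \<subseteq> lift (mx u)" unfolding lift_mx[OF pt] using q(3) u(2) by blast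
    then have "P \<subseteq> mx u" using lift_mono_iff[OF ideal_subset[OF P]] by blast
    then have "mx u \<in> V" using TP T(2) pt by (auto simp: max_spectrum_eq)
    moreover have "s \<notin> mx u" using u(3) mx_iff[OF pt, of g] g by simp
    then have "mx u \<in> U" using s(1) S(2) pt by (auto simp: max_spectrum_eq)
    ultimately have "mx u \<in> ?L" using UV(3) by blast
    then have "q \<subseteq> point_ideal f"
      using leaf_stable_ideal[OF _ f pt prime_ideal[OF q(1)] rq q(2)] u(2) by blast
    then have "q \<subseteq> lift P" unfolding core[symmetric] by (rule core_greatest[OF q(2)])
    then show False using q(3) by blast
  qed
  moreover have "P \<in> poisson_spectrum A br"
    unfolding poisson_spectrum_iff core[symmetric] using P core_props(1,2)[OF f] by blast
  ultimately show ?thesis unfolding poisson_locally_closed_iff using gP by blast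
qed

theorem algebraic_imp_dixmier_moeglin:
  assumes alg: "algebraic_poisson_bracket A br"
  shows "poisson_dixmier_moeglin A br"
proof -
  have pt: "is_pt f" if P: "ideal P A" and f: "is_point f" "core hams (point_ideal f) = lift P" for P f
    using relations_subset_lift[OF P] f core_subset[of hams "point_ideal f"] by (auto simp: is_pt_def)
  have prim: "poisson_primitive A br P" if "ideal P A" "\<exists>f. is_point f \<and> core hams (point_ideal f) = lift P" for P
    unfolding poisson_primitive_iff using that pt by blast
  have spec: "P \<in> poisson_spectrum A br" if "poisson_primitive A br P" for P
    using that core_props(1,2) unfolding poisson_primitive_iff poisson_spectrum_iff by metis
  have "poisson_locally_closed A br P \<longleftrightarrow> poisson_primitive A br P" for P
  proof
    assume "poisson_locally_closed A br P"
    then obtain g where P: "ideal P A" "is_prime (lift P)" "stable hams (lift P)" and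
      g: "g \<notin> lift P" "\<And>q. is_prime q \<Longrightarrow> stable hams q \<Longrightarrow> lift P \<subset> q \<Longrightarrow> g \<in> q"
      unfolding poisson_locally_closed_iff poisson_spectrum_iff by blast
    show "poisson_primitive A br P" by (rule prim[OF P(1) locally_closed_imp_core[OF hams_constant P(2,3) g]])
  qed (use primitive_imp_locally_closed[OF alg] poisson_primitive_iff in blast)
  moreover have "poisson_primitive A br P \<longleftrightarrow> poisson_rational A br P" for P
  proof
    assume p: "poisson_primitive A br P"
    then obtain f where f: "is_pt f" "core hams (point_ideal f) = lift P" by (auto simp: poisson_primitive_iff)
    have "is_prime (lift P)" using spec[OF p] by (simp add: poisson_spectrum_iff)
    then show "poisson_rational A br P" unfolding poisson_rational_iff
      using spec[OF p] core_imp_no_new_constants[OF hams_constant is_ptD(1)[OF f(1)] _ f(2)] by blast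
  next
    assume "poisson_rational A br P"
    then have P: "ideal P A" "is_prime (lift P)" "stable hams (lift P)" "no_new_constants hams (lift P)"
      by (auto simp: poisson_rational_iff poisson_spectrum_iff)
    show "poisson_primitive A br P" by (rule prim[OF P(1) no_new_constants_imp_core[OF hams_constant P(2-4)]])
  qed
  ultimately show ?thesis by (simp add: poisson_dixmier_moeglin_def)
qed

end

theorem corollary6p8:
  fixes A :: "(complex, 'a) module" and br :: "'a \<Rightarrow> 'a \<Rightarrow> 'a"
  assumes "complex_affine_poisson_algebra A br"
    and "algebraic_poisson_bracket A br"
  shows "poisson_dixmier_moeglin A br"
proof -
  interpret complex_affine_poisson_algebra A br by (rule assms(1))
  have ring: "ring A" using M_cring by (rule cring.axioms(1))
  obtain S where S: "finite S" "S \<subseteq> carrier A" "generate_ring A (S \<union> range (scalar A)) = carrier A"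
    using finitely_generated by (auto simp: finitely_generated_algebra_def)
  obtain k and z :: "nat \<Rightarrow> 'a" where z: "S = z ` {i. i < k}" using finite_imp_nat_seg_image_inj_on[OF S(1)] by blast
  \<comment> \<open>Zeros beyond \<open>k\<close> turn the finite generating set into a sequence as
    required by \<open>presentation\<close>.\<close>
  define y where "y i = (if i < k then z i else \<zero>\<^bsub>A\<^esub>)" for i
  have y: "y i \<in> carrier A" for i using S(2) z by (auto simp: y_def)
  have "generate_ring A (range y \<union> range (scalar A)) = carrier A"
  proof
    have sub: "range y \<union> range (scalar A) \<subseteq> carrier A"
      using y smult_closed by (auto simp: ring_of_type_algebra_def)
    show "generate_ring A (range y \<union> range (scalar A)) \<subseteq> carrier A" by (rule ring.generate_ring_incl[OF ring sub])
    have "S \<subseteq> range y"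
    proof
      fix a assume "a \<in> S"
      then obtain i where "i < k" "a = z i" using z by blast
      then have "a = y i" by (simp add: y_def)
      then show "a \<in> range y" by blast
    qed
    then show "carrier A \<subseteq> generate_ring A (range y \<union> range (scalar A))"
      unfolding S(3)[symmetric] by - (rule ring.mono_generate_ring[OF ring _ sub], blast)
  qed
  then interpret presentation A br k y
    by (intro presentation.intro complex_poisson_algebra_axioms y) (simp_all add: y_def)
  show ?thesis by (rule algebraic_imp_dixmier_moeglin[OF assms(2)])
qed

end
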